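(* Consider a fixed collection of $p$ predictors partitioned into $k$ blocks, with an $n\times p$ design $X$ whose columns are centered and such that columns in different blocks are orthogonal (block orthogonality), and with $\lim_{n\to\infty}\frac1nX^TX=D$ for some positive definite $p\times p$ matrix $D$. Each model $\mathcal M_\gamma$ (a subset of predictors) is equipped with the block hyper-$g$ prior (hyperparameter $2<a\le4$) whose blocks are the nonempty intersections of $\mathcal M_\gamma$ with the $k$ blocks. Suppose the data are generated by a true model $\mathcal M_T:y=\alpha_T\mathbf 1+\sum_{i\in B_T}X_{i,T}\beta_{i,T}+\epsilon$, $\epsilon\sim N(0,\sigma^2I_n)$, where $B_T$ is the set of blocks containing at least one nonzero coefficient, and assume that for every model $\mathcal M_\gamma\not\supseteq\mathcal M_T$, $\lim_{n\to\infty}\frac1n\beta_T^TX_T^T(I-P_{X_\gamma})X_T\beta_T>0$. Then, as $n\to\infty$: (i) for any model $\mathcal M_\gamma\supset\mathcal M_T$ such that all predictors in $\mathcal M_\gamma$ that are not in $\mathcal M_T$ lie in blocks not in $B_T$, $BF(\mathcal M_\gamma:\mathcal M_T)$ converges in distribution to some non-degenerate random variable $W_\gamma$; (ii) for every other model $\mathcal M_\gamma\ne\mathcal M_T$, $BF(\mathcal M_\gamma:\mathcal M_T)\to0$ in probability.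
   Context: Block hyper-$g$ prior on blocks $X_1,\dots,X_m$: $\pi(\alpha,\sigma^2)\propto1/\sigma^2$; $\beta\mid g,\sigma^2\sim N(0,A\sigma^2)$ with $A$ block diagonal with blocks $g_i(X_i^TX_i)^{-1}$; $g_i$ independent with densities $\frac{a-2}{2}(1+g_i)^{-a/2}$, $g_i>0$. The response is centered. $X_T$, $\beta_T$ are the design and coefficient vector of the true model, $X_\gamma$ the design of $\mathcal M_\gamma$, and $P_{X_\gamma}$ the projection onto its column space. $BF(\mathcal M_\gamma:\mathcal M_T)=p(y\mid\mathcal M_\gamma)/p(y\mid\mathcal M_T)$. The number of predictors $p$ is fixed while $n\to\infty$. *)

theory Defs
  imports "HOL-Probability.Probability"
begin

text \<open>Predictors are indexed by naturals j < p; observations by r < n.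
  A design sequence is X :: nat => nat => nat => real, X n r j = entry (r,j) of the n x p design.
  Blocks: blk j is the block label of predictor j.  Models are sets of predictor indices.\<close>

definition hyperg_density :: "real \<Rightarrow> real \<Rightarrow> real" where
  "hyperg_density a t = (if 0 < t then (a - 2) / 2 * (1 + t) powr (-(a / 2)) else 0)"

definition det_on :: "'i set \<Rightarrow> ('i \<Rightarrow> 'i \<Rightarrow> real) \<Rightarrow> real" where
  "det_on S Q = (\<Sum>\<pi>\<in>{\<pi>. \<pi> permutes S}. of_int (sign \<pi>) * (\<Prod>j\<in>S. Q j (\<pi> j)))"

definition mvn_prec_density :: "'i set \<Rightarrow> ('i \<Rightarrow> 'i \<Rightarrow> real) \<Rightarrow> ('i \<Rightarrow> real) \<Rightarrow> real" where
  "mvn_prec_density S Q b =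
     (2 * pi) powr (- real (card S) / 2) * sqrt (det_on S Q)
       * exp (- (\<Sum>j\<in>S. \<Sum>j'\<in>S. b j * Q j j' * b j') / 2)"

definition gram :: "(nat \<Rightarrow> nat \<Rightarrow> nat \<Rightarrow> real) \<Rightarrow> nat \<Rightarrow> nat \<Rightarrow> nat \<Rightarrow> real" where
  "gram X n j j' = (\<Sum>r<n. X n r j * X n r j')"

definition block_set :: "(nat \<Rightarrow> nat) \<Rightarrow> nat set \<Rightarrow> nat \<Rightarrow> nat set" where
  "block_set blk \<gamma> i = {j \<in> \<gamma>. blk j = i}"

text \<open>Prior density of beta given g and sigma^2 = s: N(0, A s) with A block diagonal with blocks
  g_i (X_i^T X_i)^{-1}; its precision matrix is block diagonal with blocks X_i^T X_i / (g_i s).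
  The blocks are the nonempty intersections of gamma with the blocks, indexed by blk ` gamma.\<close>
definition prior_beta :: "(nat \<Rightarrow> nat \<Rightarrow> nat \<Rightarrow> real) \<Rightarrow> (nat \<Rightarrow> nat) \<Rightarrow> nat \<Rightarrow> nat set
    \<Rightarrow> (nat \<Rightarrow> real) \<Rightarrow> real \<Rightarrow> (nat \<Rightarrow> real) \<Rightarrow> real" where
  "prior_beta X blk n \<gamma> g s \<beta> =
     (\<Prod>i\<in>blk ` \<gamma>. mvn_prec_density (block_set blk \<gamma> i) (\<lambda>j j'. gram X n j j' / (g i * s)) \<beta>)"

definition lik :: "(nat \<Rightarrow> nat \<Rightarrow> nat \<Rightarrow> real) \<Rightarrow> nat \<Rightarrow> nat set \<Rightarrow> (nat \<Rightarrow> real)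
    \<Rightarrow> real \<Rightarrow> (nat \<Rightarrow> real) \<Rightarrow> real \<Rightarrow> real" where
  "lik X n \<gamma> y \<alpha> \<beta> s = (\<Prod>r<n. normal_density (\<alpha> + (\<Sum>j\<in>\<gamma>. X n r j * \<beta> j)) (sqrt s) (y r))"

text \<open>Marginal likelihood p(y | M_gamma) under the block hyper-g prior:
  pi(alpha, sigma^2) proportional to 1/sigma^2, beta | g, sigma^2 ~ N(0, A sigma^2),
  g_i iid hyper-g(a).\<close>
definition marg_lik :: "real \<Rightarrow> (nat \<Rightarrow> nat \<Rightarrow> nat \<Rightarrow> real) \<Rightarrow> (nat \<Rightarrow> nat) \<Rightarrow> nat
    \<Rightarrow> nat set \<Rightarrow> (nat \<Rightarrow> real) \<Rightarrow> ennreal" where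
  "marg_lik a X blk n \<gamma> y =
     (\<integral>\<^sup>+ s. (\<integral>\<^sup>+ \<alpha>. (\<integral>\<^sup>+ g. (\<integral>\<^sup>+ \<beta>.
        ennreal (indicator {0<..} s / s * lik X n \<gamma> y \<alpha> \<beta> s * prior_beta X blk n \<gamma> g s \<beta>
                 * (\<Prod>i\<in>blk ` \<gamma>. hyperg_density a (g i)))
      \<partial>(PiM \<gamma> (\<lambda>_. lborel))) \<partial>(PiM (blk ` \<gamma>) (\<lambda>_. lborel))) \<partial>lborel) \<partial>lborel)"

definition bayes_factor :: "real \<Rightarrow> (nat \<Rightarrow> nat \<Rightarrow> nat \<Rightarrow> real) \<Rightarrow> (nat \<Rightarrow> nat) \<Rightarrow> nat
    \<Rightarrow> nat set \<Rightarrow> nat set \<Rightarrow> (nat \<Rightarrow> real) \<Rightarrow> real" where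
  "bayes_factor a X blk n \<gamma> T y = enn2real (marg_lik a X blk n \<gamma> y) / enn2real (marg_lik a X blk n T y)"

text \<open>Orthogonal projection P_{X_gamma} v of v in R^n onto the column space of X_gamma
  (vectors are functions on nat, zero beyond n).\<close>
definition proj_col :: "(nat \<Rightarrow> nat \<Rightarrow> nat \<Rightarrow> real) \<Rightarrow> nat \<Rightarrow> nat set \<Rightarrow> (nat \<Rightarrow> real) \<Rightarrow> (nat \<Rightarrow> real)" where
  "proj_col X n \<gamma> v = (THE u. (\<exists>b. \<forall>r<n. u r = (\<Sum>j\<in>\<gamma>. X n r j * b j))
                             \<and> (\<forall>r. n \<le> r \<longrightarrow> u r = 0)
                             \<and> (\<forall>j\<in>\<gamma>. (\<Sum>r<n. (v r - u r) * X n r j) = 0))"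

definition resid_quad :: "(nat \<Rightarrow> nat \<Rightarrow> nat \<Rightarrow> real) \<Rightarrow> nat \<Rightarrow> nat set \<Rightarrow> nat set \<Rightarrow> (nat \<Rightarrow> real) \<Rightarrow> real" where
  "resid_quad X n \<gamma> T \<beta>T =
     (let \<mu> = (\<lambda>r. if r < n then (\<Sum>j\<in>T. X n r j * \<beta>T j) else 0)
      in (\<Sum>r<n. \<mu> r * (\<mu> r - proj_col X n \<gamma> \<mu> r)))"

definition response :: "(nat \<Rightarrow> nat \<Rightarrow> nat \<Rightarrow> real) \<Rightarrow> nat set \<Rightarrow> real \<Rightarrow> (nat \<Rightarrow> real)
    \<Rightarrow> (nat \<Rightarrow> 'w \<Rightarrow> nat \<Rightarrow> real) \<Rightarrow> nat \<Rightarrow> 'w \<Rightarrow> nat \<Rightarrow> real" where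
  "response X T \<alpha>T \<beta>T \<epsilon> n \<omega> r = \<alpha>T + (\<Sum>j\<in>T. X n r j * \<beta>T j) + \<epsilon> n \<omega> r"

definition conv_prob_zero :: "'w measure \<Rightarrow> (nat \<Rightarrow> 'w \<Rightarrow> real) \<Rightarrow> bool" where
  "conv_prob_zero M Z = (\<forall>e>0. (\<lambda>n. measure M {\<omega> \<in> space M. e < \<bar>Z n \<omega>\<bar>}) \<longlonglongrightarrow> 0)"

end

theory Submission
  imports Defs
begin

text \<open>Integrating out $\alpha$, $\beta$ and $\sigma^2$ turns the marginal likelihood into a factor depending
  on $n$ only, which cancels in the Bayes factor, times the hyper-$g$ expectation of
  $\prod_i (1+g_i)^{-p_i/2}\,(S - \sum_i \frac{g_i}{1+g_i} Q_i)^{-(n-1)/2}$, where $S$ is the total sum of squares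
  and $Q_i$ the explained sum of squares of block $i$. For a block carrying signal, $Q_i$ grows linearly in $n$
  and the expectation concentrates on large $g_i$. If $\gamma$ misses a true predictor, its residual sum of squares
  is larger by a constant factor and the Bayes factor decays exponentially. A superfluous predictor in a block
  with signal contributes a factor $(1+g_i)^{-1/2} \to 0$. If all superfluous predictors lie in blocks
  without signal, the Bayes factor differs by $o(1)$ from $\prod_j \Psi(Q_j/2\sigma^2)$, where by Gram--Schmidt
  $Q_j$ is a sum of squares of independent centred normals, so that its law does not depend on $n$.\<close>

section \<open>Gaussian elimination and Gaussian integrals\<close>

text \<open>Concentration rests on an imbalance of costs. Restricting every g_i to an interval of
  length one near n costs a power of n, and there the shrunk residual sum of squares exceeds the
  unshrunk one by a bounded amount; any region where it stays larger by a constant factor loses a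
  factor geometric in n. The limit factor \<Psi> stems from (h - t)^(-m) being close to h^(-m) exp(m
  t / h), with m = (n - 1)/2 and h close to n \<sigma>^2: the exponential splits over the null
  blocks, and m / h tends to 1 / (2 \<sigma>^2). The obstacle is that the explained sums of null
  blocks stay bounded along a data sequence but need not converge. The deterministic statement
  therefore compares the Bayes factor with a product evaluated at the same data, and the law of that
  product is brought in afterwards. Identifiability, applied to the true model with one predictor
  removed, makes the true coefficients nonzero; the gap between residual sums is then computed from
  \<open>D\<close>.\<close>

definition schur :: "('i \<Rightarrow> 'i \<Rightarrow> real) \<Rightarrow> 'i \<Rightarrow> 'i \<Rightarrow> 'i \<Rightarrow> real" where
  "schur Q x i j = Q i j - Q i x * Q x j / Q x x"

text \<open>For a symmetric matrix this is positive definiteness in the form that induction over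
  eliminated indices consumes: finitely many strict inequalities, each stable under small changes of
  the entries.\<close>

fun pivots_pos :: "'i list \<Rightarrow> ('i \<Rightarrow> 'i \<Rightarrow> real) \<Rightarrow> bool" where
  "pivots_pos [] Q = True"
| "pivots_pos (x # xs) Q = (0 < Q x x \<and> pivots_pos xs (schur Q x))"

text \<open>$b^T Q^{-1} b$ for a symmetric matrix with positive pivots, computed by eliminating the indices one by one:
  dimensions are sets of indices here, and every statement about this form reduces to one variable.\<close>
fun inv_quad_list :: "'i list \<Rightarrow> ('i \<Rightarrow> 'i \<Rightarrow> real) \<Rightarrow> ('i \<Rightarrow> real) \<Rightarrow> real" where
  "inv_quad_list [] Q b = 0"
| "inv_quad_list (x # xs) Q b = (b x)\<^sup>2 / Q x x + inv_quad_list xs (schur Q x) (\<lambda>i. b i - Q i x * b x / Q x x)"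

definition sym_on :: "'i set \<Rightarrow> ('i \<Rightarrow> 'i \<Rightarrow> real) \<Rightarrow> bool" where
  "sym_on S Q \<longleftrightarrow> (\<forall>i\<in>S. \<forall>j\<in>S. Q i j = Q j i)"

lemma sym_onD: "sym_on S Q \<Longrightarrow> i \<in> S \<Longrightarrow> j \<in> S \<Longrightarrow> Q i j = Q j i"
  unfolding sym_on_def by blast

lemma sym_on_schur: "sym_on (insert x S) Q \<Longrightarrow> sym_on S (schur Q x)"
proof -
  assume *: "sym_on (insert x S) Q"
  have "schur Q x i j = schur Q x j i" if "i \<in> S" "j \<in> S" for i j
    using sym_onD[OF *, of i j] sym_onD[OF *, of i x] sym_onD[OF *, of x j] that
    by (simp add: schur_def)
  then show ?thesis unfolding sym_on_def by blast
qed

lemma inv_quad_list_cong: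
  assumes "\<And>i j. i \<in> set xs \<Longrightarrow> j \<in> set xs \<Longrightarrow> Q i j = Q' i j" "\<And>i. i \<in> set xs \<Longrightarrow> b i = b' i"
  shows "inv_quad_list xs Q b = inv_quad_list xs Q' b'"
  using assms
proof (induction xs arbitrary: Q Q' b b')
  case (Cons x xs)
  have "inv_quad_list xs (schur Q x) (\<lambda>i. b i - Q i x * b x / Q x x)
      = inv_quad_list xs (schur Q' x) (\<lambda>i. b' i - Q' i x * b' x / Q' x x)"
    using Cons.prems by (intro Cons.IH) (auto simp: schur_def)
  then show ?case using Cons.prems by simp
qed simp

lemma pivots_pos_scale: "0 < c \<Longrightarrow> pivots_pos xs (\<lambda>i j. c * Q i j) = pivots_pos xs Q"
proof (induction xs arbitrary: Q)
  case (Cons x xs)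
  have "schur (\<lambda>i j. c * Q i j) x = (\<lambda>i j. c * schur Q x i j)"
    using Cons.prems by (auto simp: schur_def fun_eq_iff algebra_simps)
  then show ?case using Cons by (simp add: zero_less_mult_iff)
qed simp

lemma inv_quad_list_scale: "0 < c \<Longrightarrow> inv_quad_list xs (\<lambda>i j. c * Q i j) (\<lambda>i. d * b i) = d\<^sup>2 / c * inv_quad_list xs Q b"
proof (induction xs arbitrary: Q b)
  case (Cons x xs)
  have 1: "schur (\<lambda>i j. c * Q i j) x = (\<lambda>i j. c * schur Q x i j)"
    using Cons.prems by (auto simp: schur_def fun_eq_iff algebra_simps)
  have 2: "(\<lambda>i. d * b i - c * Q i x * (d * b x) / (c * Q x x)) = (\<lambda>i. d * (b i - Q i x * b x / Q x x))"
    using Cons.prems by (auto simp: fun_eq_iff algebra_simps)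
  show ?case
    unfolding inv_quad_list.simps 1 2 Cons.IH[OF Cons.prems] using Cons.prems
    by (simp add: field_simps power2_eq_square)
qed simp

lemma inv_quad_list_nonneg: "pivots_pos xs Q \<Longrightarrow> 0 \<le> inv_quad_list xs Q b"
  by (induction xs arbitrary: Q b) (simp_all add: add_nonneg_nonneg)

lemma quad_insert:
  fixes Q :: "'i \<Rightarrow> 'i \<Rightarrow> real"
  assumes "finite S" "x \<notin> S" "sym_on (insert x S) Q"
  shows "(\<Sum>i\<in>insert x S. \<Sum>j\<in>insert x S. v i * Q i j * v j)
    = Q x x * (v x)\<^sup>2 + 2 * v x * (\<Sum>j\<in>S. Q x j * v j) + (\<Sum>i\<in>S. \<Sum>j\<in>S. v i * Q i j * v j)"
proof -
  have "(\<Sum>i\<in>S. v i * Q i x * v x) = v x * (\<Sum>j\<in>S. Q x j * v j)"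
    unfolding sum_distrib_left
  proof (intro sum.cong refl)
    fix i assume "i \<in> S"
    then have "Q i x = Q x i" using assms(3) unfolding sym_on_def by blast
    then show "v i * Q i x * v x = v x * (Q x i * v i)" by simp
  qed
  moreover have "(\<Sum>j\<in>S. v x * Q x j * v j) = v x * (\<Sum>j\<in>S. Q x j * v j)"
    by (simp add: sum_distrib_left mult.assoc)
  ultimately show ?thesis using assms(1,2)
    by (simp add: sum.distrib power2_eq_square)
qed

text \<open>For a positive pivot, minimising the form on \<open>insert x S\<close> over the
  coordinate at \<open>x\<close> leaves exactly this form; positivity and Gaussian integrals
  therefore pass from \<open>Q\<close> to its Schur complement.\<close>

lemma quad_schur:
  fixes Q :: "'i \<Rightarrow> 'i \<Rightarrow> real"
  assumes "finite S" "sym_on (insert x S) Q"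
  shows "(\<Sum>i\<in>S. \<Sum>j\<in>S. v i * schur Q x i j * v j)
    = (\<Sum>i\<in>S. \<Sum>j\<in>S. v i * Q i j * v j) - (\<Sum>j\<in>S. Q x j * v j)\<^sup>2 / Q x x"
proof -
  have "(\<Sum>j\<in>S. Q x j * v j)\<^sup>2 / Q x x = (\<Sum>i\<in>S. \<Sum>j\<in>S. (Q x i * v i) * (Q x j * v j) / Q x x)"
    by (simp add: power2_eq_square sum_product sum_divide_distrib)
  also have "\<dots> = (\<Sum>i\<in>S. \<Sum>j\<in>S. v i * (Q i x * Q x j / Q x x) * v j)"
  proof (intro sum.cong refl)
    fix i j assume "i \<in> S" "j \<in> S"
    then have "Q i x = Q x i" using assms(2) unfolding sym_on_def by blast
    then show "Q x i * v i * (Q x j * v j) / Q x x = v i * (Q i x * Q x j / Q x x) * v j"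
      by simp
  qed
  finally show ?thesis
    by (simp add: schur_def left_diff_distrib right_diff_distrib sum_subtractf)
qed

text \<open>The Schur complement inherits positivity because its value at \<open>v\<close> is a
  value of the form of \<open>Q\<close> itself, at an extension of \<open>v\<close> to the
  eliminated index.\<close>

lemma pivots_pos_if_posdef:
  assumes "distinct xs" "sym_on (set xs) Q"
    and "\<And>v. (\<exists>i\<in>set xs. v i \<noteq> 0) \<Longrightarrow> 0 < (\<Sum>i\<in>set xs. \<Sum>j\<in>set xs. v i * Q i j * v j)"
  shows "pivots_pos xs Q"
  using assms
proof (induction xs arbitrary: Q)
  case (Cons x xs)
  note sym = Cons.prems(2)[simplified]
  have x: "x \<notin> set xs" using Cons.prems by simp
  have "0 < (\<Sum>i\<in>insert x (set xs). \<Sum>j\<in>insert x (set xs). indicator {x} i * Q i j * indicator {x} j)"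
    using Cons.prems(3)[of "indicator {x}"] by simp
  then have pos: "0 < Q x x"
    unfolding quad_insert[OF finite_set x sym] using x
    by (auto simp: indicator_def if_distrib if_distribR cong: if_cong split: if_splits)
  have "pivots_pos xs (schur Q x)"
  proof (intro Cons.IH)
    fix v :: "'a \<Rightarrow> real" assume v: "\<exists>i\<in>set xs. v i \<noteq> 0"
    define s where "s = (\<Sum>j\<in>set xs. Q x j * v j)"
    \<comment> \<open>The coordinate at \<open>x\<close> minimises Q x x t^2 + 2 t s over t.\<close>
    define v' where "v' = v(x := - s / Q x x)"
    have eq: "(\<Sum>j\<in>set xs. Q x j * v' j) = s"
      "(\<Sum>i\<in>set xs. \<Sum>j\<in>set xs. v' i * Q i j * v' j) = (\<Sum>i\<in>set xs. \<Sum>j\<in>set xs. v i * Q i j * v j)"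
      unfolding s_def v'_def using x by (auto intro!: sum.cong)
    have "0 < (\<Sum>i\<in>set (x#xs). \<Sum>j\<in>set (x#xs). v' i * Q i j * v' j)"
      using v x by (intro Cons.prems(3)) (auto simp: v'_def)
    also have "\<dots> = (\<Sum>i\<in>set xs. \<Sum>j\<in>set xs. v i * Q i j * v j) - s\<^sup>2 / Q x x"
      unfolding list.set quad_insert[OF finite_set x sym] eq using pos
      by (simp add: v'_def field_simps power2_eq_square)
    finally show "0 < (\<Sum>i\<in>set xs. \<Sum>j\<in>set xs. v i * schur Q x i j * v j)"
      unfolding quad_schur[OF finite_set sym] s_def .
  next
    show "distinct xs" using Cons.prems(1) by simp
    show "sym_on (set xs) (schur Q x)" by (rule sym_on_schur[OF sym])
  qed
  then show ?case using pos by simp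
qed simp

lemma schur_tendsto:
  assumes "0 < D x x" "\<And>i j. i \<in> insert x S \<Longrightarrow> j \<in> insert x S \<Longrightarrow> ((\<lambda>n. Q n i j) \<longlongrightarrow> D i j) F"
    "i \<in> S" "j \<in> S"
  shows "((\<lambda>n. schur (Q n) x i j) \<longlongrightarrow> schur D x i j) F"
  unfolding schur_def using assms by (intro tendsto_intros) auto

text \<open>Each pivot is a rational function of the entries whose denominators are earlier pivots,
  so positivity at the limit is inherited by nearby matrices.\<close>

lemma pivots_pos_eventually:
  assumes "pivots_pos xs D" "\<And>i j. i \<in> set xs \<Longrightarrow> j \<in> set xs \<Longrightarrow> ((\<lambda>n. Q n i j) \<longlongrightarrow> D i j) F"
  shows "eventually (\<lambda>n. pivots_pos xs (Q n)) F"
  using assms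
proof (induction xs arbitrary: Q D)
  case (Cons x xs)
  have "eventually (\<lambda>n. pivots_pos xs (schur (Q n) x)) F"
    using Cons.prems by (intro Cons.IH[of "schur D x"] schur_tendsto[where S="set xs"]) auto
  moreover have "eventually (\<lambda>n. 0 < Q n x x) F"
    using Cons.prems(1) by (intro order_tendstoD[OF Cons.prems(2)]) auto
  ultimately show ?case by eventually_elim simp
qed simp

lemma inv_quad_list_tendsto:
  assumes "pivots_pos xs D" "\<And>i j. i \<in> set xs \<Longrightarrow> j \<in> set xs \<Longrightarrow> ((\<lambda>n. Q n i j) \<longlongrightarrow> D i j) F"
    "\<And>i. i \<in> set xs \<Longrightarrow> ((\<lambda>n. b n i) \<longlongrightarrow> c i) F"
  shows "((\<lambda>n. inv_quad_list xs (Q n) (b n)) \<longlongrightarrow> inv_quad_list xs D c) F"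
  using assms
proof (induction xs arbitrary: Q D b c)
  case (Cons x xs)
  have "((\<lambda>n. inv_quad_list xs (schur (Q n) x) (\<lambda>i. b n i - Q n i x * b n x / Q n x x)) \<longlongrightarrow>
     inv_quad_list xs (schur D x) (\<lambda>i. c i - D i x * c x / D x x)) F"
    using Cons.prems by (intro Cons.IH schur_tendsto[where S="set xs"] tendsto_intros) auto
  then show ?case using Cons.prems unfolding inv_quad_list.simps
    by (intro tendsto_intros) auto
qed simp

lemma Bseq_plus:
  fixes X Y :: "nat \<Rightarrow> 'a::real_normed_vector"
  assumes "Bseq X" "Bseq Y"
  shows "Bseq (\<lambda>n. X n + Y n)"
proof -
  from assms obtain K L where "\<And>n. norm (X n) \<le> K" "\<And>n. norm (Y n) \<le> L" by (metis BseqE)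
  then have "norm (X n + Y n) \<le> K + L" for n by (meson add_mono norm_triangle_ineq order_trans)
  then show ?thesis by (rule BseqI')
qed

text \<open>Serves the vector X^T \<epsilon> / sqrt n, which stays bounded along admissible data but
  need not converge; the matrix alone has a limit.\<close>

lemma inv_quad_list_bounded:
  assumes "pivots_pos xs D" "\<And>i j. i \<in> set xs \<Longrightarrow> j \<in> set xs \<Longrightarrow> ((\<lambda>n. Q n i j) \<longlonglongrightarrow> D i j)"
    "\<And>i. i \<in> set xs \<Longrightarrow> Bseq (\<lambda>n. b n i)"
  shows "Bseq (\<lambda>n. inv_quad_list xs (Q n) (b n))"
  using assms
proof (induction xs arbitrary: Q D b)
  case (Cons x xs)
  have inv: "Bseq (\<lambda>n. inverse (Q n x x))"
    using Cons.prems(1) by (intro convergent_imp_Bseq convergentI[of _ "inverse (D x x)"] tendsto_inverse Cons.prems(2)) auto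
  have Qb: "Bseq (\<lambda>n. Q n i x)" if "i \<in> set xs" for i
    using that by (intro convergent_imp_Bseq convergentI[of _ "D i x"] Cons.prems(2)) auto
  have "Bseq (\<lambda>n. b n i - Q n i x * b n x / Q n x x)" if "i \<in> set xs" for i
    unfolding diff_conv_add_uminus divide_inverse
    using that by (intro Bseq_plus Bseq_mult inv Qb Cons.prems(3) iffD2[OF Bseq_minus_iff]) auto
  then have "Bseq (\<lambda>n. inv_quad_list xs (schur (Q n) x) (\<lambda>i. b n i - Q n i x * b n x / Q n x x))"
    using Cons.prems by (intro Cons.IH[of "schur D x"] schur_tendsto[where S="set xs"]) auto
  moreover have "Bseq (\<lambda>n. (b n x)\<^sup>2 / Q n x x)"
    unfolding divide_inverse power2_eq_square
    by (intro Bseq_mult inv Cons.prems(3)) auto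
  ultimately show ?case unfolding inv_quad_list.simps by (rule Bseq_plus[rotated])
qed simp

lemma inv_quad_list_measurable [measurable]:
  assumes [measurable]: "\<And>i. i \<in> set xs \<Longrightarrow> (\<lambda>\<omega>. b \<omega> i) \<in> borel_measurable M"
  shows "(\<lambda>\<omega>. inv_quad_list xs Q (b \<omega>)) \<in> borel_measurable M"
  using assms
proof (induction xs arbitrary: Q b)
  case (Cons x xs)
  have [measurable]: "(\<lambda>\<omega>. b \<omega> i) \<in> borel_measurable M" if "i = x \<or> i \<in> set xs" for i
    using Cons.prems that by auto
  have [measurable]: "(\<lambda>\<omega>. inv_quad_list xs (schur Q x) (\<lambda>i. b \<omega> i - Q i x * b \<omega> x / Q x x)) \<in> borel_measurable M"
    by (intro Cons.IH) measurable
  show ?case unfolding inv_quad_list.simps by measurable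
qed simp

text \<open>The reduced system is solved first; back substitution into row \<open>x\<close> then
  gives the coordinate at \<open>x\<close>.\<close>

lemma elim_solve:
  assumes "pivots_pos xs Q" "distinct xs"
  shows "\<exists>c. \<forall>i\<in>set xs. (\<Sum>j\<in>set xs. Q i j * c j) = b i"
  using assms
proof (induction xs arbitrary: Q b)
  case (Cons x xs)
  have "pivots_pos xs (schur Q x)" "distinct xs" using Cons.prems by simp_all
  from Cons.IH[OF this, of "\<lambda>i. b i - Q i x * b x / Q x x"]
  obtain c where c: "\<And>i. i \<in> set xs \<Longrightarrow> (\<Sum>j\<in>set xs. schur Q x i j * c j) = b i - Q i x * b x / Q x x"
    by blast
  have x: "x \<notin> set xs" and pos: "0 < Q x x" using Cons.prems by auto
  define s where "s = (\<Sum>j\<in>set xs. Q x j * c j)"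
  define c' where "c' = c(x := (b x - s) / Q x x)"
  have sum: "(\<Sum>j\<in>set xs. Q i j * c' j) = (\<Sum>j\<in>set xs. Q i j * c j)" for i
    unfolding c'_def using x by (auto intro!: sum.cong)
  have "(\<Sum>j\<in>set (x#xs). Q i j * c' j) = b i" if i: "i \<in> set (x#xs)" for i
  proof (cases "i = x")
    case True
    then show ?thesis using x pos unfolding s_def[symmetric] by (simp add: sum s_def[symmetric]) (simp add: c'_def)
  next
    case False
    have "(\<Sum>j\<in>set xs. schur Q x i j * c j) = (\<Sum>j\<in>set xs. Q i j * c j) - Q i x * s / Q x x"
      unfolding s_def schur_def
      by (simp add: algebra_simps sum_subtractf sum_distrib_left sum_divide_distrib)
    with c[of i] False i have "(\<Sum>j\<in>set xs. Q i j * c j) = b i - Q i x * b x / Q x x + Q i x * s / Q x x"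
      by simp
    then show ?thesis using x pos by (simp add: sum) (simp add: c'_def field_simps)
  qed
  then show ?case by blast
qed simp

text \<open>Identifies the recursion with b^T Q^(-1) b without introducing an inverse matrix: any
  solution \<open>c\<close> of the linear system stands for Q^(-1) b. Symmetry turns the sum along
  column \<open>x\<close> into the sum \<open>s\<close> along row \<open>x\<close>.\<close>

lemma inv_quad_list_eq_solution:
  assumes "pivots_pos xs Q" "distinct xs" "sym_on (set xs) Q"
    "\<And>i. i \<in> set xs \<Longrightarrow> (\<Sum>j\<in>set xs. Q i j * c j) = b i"
  shows "inv_quad_list xs Q b = (\<Sum>i\<in>set xs. b i * c i)"
  using assms
proof (induction xs arbitrary: Q b)
  case (Cons x xs)
  have x: "x \<notin> set xs" and pos: "0 < Q x x" using Cons.prems by auto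
  define s where "s = (\<Sum>j\<in>set xs. Q x j * c j)"
  have bx: "Q x x * c x + s = b x" using Cons.prems(4)[of x] x by (simp add: s_def)
  have b: "(\<Sum>j\<in>set xs. Q i j * c j) = b i - Q i x * c x" if "i \<in> set xs" for i
    using Cons.prems(4)[of i] that x by simp
  have s': "(\<Sum>i\<in>set xs. Q i x * c i) = s"
    unfolding s_def by (intro sum.cong refl arg_cong2[where f=times] sym_onD[OF Cons.prems(3)]) simp_all
  have "inv_quad_list xs (schur Q x) (\<lambda>i. b i - Q i x * b x / Q x x) = (\<Sum>i\<in>set xs. (b i - Q i x * b x / Q x x) * c i)"
  proof (rule Cons.IH)
    fix i assume i: "i \<in> set xs"
    have "(\<Sum>j\<in>set xs. schur Q x i j * c j) = (\<Sum>j\<in>set xs. Q i j * c j) - Q i x * s / Q x x"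
      unfolding s_def schur_def
      by (simp add: algebra_simps sum_subtractf sum_distrib_left sum_divide_distrib)
    also have "\<dots> = b i - Q i x * b x / Q x x"
      unfolding b[OF i] bx[symmetric] using pos by (simp add: field_simps)
    finally show "(\<Sum>j\<in>set xs. schur Q x i j * c j) = b i - Q i x * b x / Q x x" .
  next
    show "pivots_pos xs (schur Q x)" "distinct xs" using Cons.prems(1,2) by simp_all
    show "sym_on (set xs) (schur Q x)" using Cons.prems(3) by (intro sym_on_schur) simp
  qed
  also have "\<dots> = (\<Sum>i\<in>set xs. b i * c i) - b x / Q x x * s"
    unfolding s'[symmetric] by (simp add: algebra_simps sum_subtractf sum_distrib_left sum_divide_distrib)
  finally show ?case using x pos bx[symmetric]
    by (simp add: field_simps power2_eq_square)
qed simp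

section \<open>Leibniz determinants under column operations and elimination\<close>

lemma det_on_equal_columns:
  assumes "finite S" "b \<in> S" "c \<in> S" "b \<noteq> c" "\<And>i. i \<in> S \<Longrightarrow> Q i b = Q i c"
  shows "det_on S Q = 0"
proof -
  let ?t = "Transposition.transpose b c"
  let ?f = "\<lambda>p. of_int (sign p) * (\<Prod>j\<in>S. Q j (p j)) :: real"
  have t: "?t permutes S" using assms by (intro permutes_swap_id)
  have "det_on S Q = (\<Sum>p | p permutes S. ?f (?t \<circ> p))"
    unfolding det_on_def by (rule setum_permutations_compose_left[OF t])
  \<comment> \<open>Exchanging the two equal columns keeps every product and reverses the sign, so
    the determinant equals its own negative.\<close>
  also have "\<dots> = (\<Sum>p | p permutes S. - ?f p)"
  proof (intro sum.cong refl)
    fix p assume p: "p \<in> {p. p permutes S}"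
    have "sign (?t \<circ> p) = - sign p"
      using p assms permutes_imp_permutation[OF assms(1)]
      by (simp add: sign_compose permutation_swap_id sign_swap_id)
    moreover have "(\<Prod>j\<in>S. Q j (?t (p j))) = (\<Prod>j\<in>S. Q j (p j))"
      using assms(5) by (intro prod.cong refl) (auto simp: Transposition.transpose_def)
    ultimately show "?f (?t \<circ> p) = - ?f p" by simp
  qed
  also have "\<dots> = - det_on S Q" by (simp add: det_on_def sum_negf)
  finally show ?thesis by simp
qed

text \<open>A permutation meets column \<open>b\<close> in exactly one row, \<open>inv p b\<close>;
  this makes every Leibniz term linear in that column.\<close>

lemma prod_perm_column:
  assumes "finite S" "b \<in> S" "p permutes S"
  shows "(\<Prod>j\<in>S. if p j = b then u j else Q j (p j)) = u (inv p b) * (\<Prod>j\<in>S - {inv p b}. Q j (p j) :: real)"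
proof -
  have j0: "inv p b \<in> S" "p (inv p b) = b"
    using assms by (auto simp: permutes_inverses permutes_in_image[OF permutes_inv])
  have "p j \<noteq> b" if "j \<in> S - {inv p b}" for j
    using that assms permutes_inverses(2)[OF assms(3)] by force
  then show ?thesis
    by (subst prod.remove[OF assms(1) j0(1)]) (auto simp: j0 intro!: prod.cong)
qed

lemma det_on_column_linear:
  assumes "finite S" "b \<in> S"
  shows "det_on S (\<lambda>i j. if j = b then u i - k * v i else Q i j)
    = det_on S (\<lambda>i j. if j = b then u i else Q i j) - k * det_on S (\<lambda>i j. if j = b then v i else Q i j)"
proof -
  have "of_int (sign p) * (\<Prod>j\<in>S. if p j = b then u j - k * v j else Q j (p j))
      = of_int (sign p) * (\<Prod>j\<in>S. if p j = b then u j else Q j (p j))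
      - k * (of_int (sign p) * (\<Prod>j\<in>S. if p j = b then v j else Q j (p j)))"
    if "p permutes S" for p
    unfolding prod_perm_column[OF assms that, of u] prod_perm_column[OF assms that, of v]
      prod_perm_column[OF assms that, of "\<lambda>j. u j - k * v j"] by (simp add: algebra_simps)
  then show ?thesis
    unfolding det_on_def by (simp add: sum_subtractf sum_distrib_left)
qed

text \<open>A column operation: multiples of column \<open>b\<close>, which is \<open>u\<close>, are
  subtracted from the columns in \<open>A\<close>. By linearity each subtraction adds a determinant
  with two columns equal to \<open>u\<close>, hence zero.\<close>

lemma det_on_rank_one_column:
  assumes "finite S" "b \<in> S" "finite A" "A \<subseteq> S" "b \<notin> A"
  shows "det_on S (\<lambda>i j. if j = b then u i else if j \<in> A then Q i j - u i * v j else Q i j)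
    = det_on S (\<lambda>i j. if j = b then u i else Q i j)"
  using assms(3-5)
proof (induction A)
  case (insert a A)
  let ?M = "\<lambda>i j. if j = b then u i else if j \<in> A then Q i j - u i * v j else Q i j"
  have "det_on S (\<lambda>i j. if j = b then u i else if j \<in> insert a A then Q i j - u i * v j else Q i j)
      = det_on S (\<lambda>i j. if j = a then Q i a - v a * u i else ?M i j)"
    using insert by (intro arg_cong[where f="det_on S"] ext) auto
  also have "\<dots> = det_on S (\<lambda>i j. if j = a then Q i a else ?M i j)
      - v a * det_on S (\<lambda>i j. if j = a then u i else ?M i j)"
    using insert by (intro det_on_column_linear assms) auto
  also have "det_on S (\<lambda>i j. if j = a then u i else ?M i j) = 0"
    using insert assms by (intro det_on_equal_columns[of _ a b]) auto
  also have "(\<lambda>i j. if j = a then Q i a else ?M i j) = ?M"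
    using insert by (intro ext) auto
  finally show ?case using insert by simp
qed (simp cong: if_cong)

text \<open>Expanding in the columns, a term that takes \<open>u\<close> from two columns vanishes,
  so the terms of degree at most one in \<open>v\<close> are all that survives.\<close>

lemma det_on_rank_one:
  assumes "finite S"
  shows "det_on S (\<lambda>i j. Q i j - u i * v j)
    = det_on S Q - (\<Sum>b\<in>S. v b * det_on S (\<lambda>i j. if j = b then u i else Q i j))"
proof -
  have "det_on S (\<lambda>i j. if j \<in> A then Q i j - u i * v j else Q i j)
    = det_on S Q - (\<Sum>b\<in>A. v b * det_on S (\<lambda>i j. if j = b then u i else Q i j))"
    if "finite A" "A \<subseteq> S" for A
    using that
  proof (induction A)
    case (insert a A)
    let ?M = "\<lambda>i j. if j \<in> A then Q i j - u i * v j else Q i j"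
    have "det_on S (\<lambda>i j. if j \<in> insert a A then Q i j - u i * v j else Q i j)
      = det_on S (\<lambda>i j. if j = a then Q i a - v a * u i else ?M i j)"
      using insert by (intro arg_cong[where f="det_on S"] ext) auto
    also have "\<dots> = det_on S (\<lambda>i j. if j = a then Q i a else ?M i j)
        - v a * det_on S (\<lambda>i j. if j = a then u i else ?M i j)"
      using insert by (intro det_on_column_linear assms) auto
    also have "det_on S (\<lambda>i j. if j = a then u i else ?M i j) = det_on S (\<lambda>i j. if j = a then u i else Q i j)"
      using insert assms by (intro det_on_rank_one_column) auto
    also have "(\<lambda>i j. if j = a then Q i a else ?M i j) = ?M"
      using insert by (intro ext) auto
    finally show ?case using insert by simp
  qed simp
  from this[OF assms subset_refl] show ?thesis
    unfolding det_on_def by (simp add: permutes_in_image cong: prod.cong)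
qed

text \<open>Permutations of \<open>insert x S\<close> are sorted by the image \<open>b\<close> of
  \<open>x\<close>: each is the transposition of \<open>x\<close> and \<open>b\<close> after a
  permutation of \<open>S\<close>. The resulting sum has the shape produced by
  \<open>det_on_rank_one\<close>.\<close>

lemma det_on_insert:
  assumes "finite S" "x \<notin> S"
  shows "det_on (insert x S) Q
    = Q x x * det_on S Q - (\<Sum>b\<in>S. Q x b * det_on S (\<lambda>i j. if j = b then Q i x else Q i j))"
proof -
  let ?f = "\<lambda>p. of_int (sign p) * (\<Prod>j\<in>insert x S. Q j (p j))"
  have px: "q x = x" if "q permutes S" for q using that assms(2) by (rule permutes_not_in)
  have "det_on (insert x S) Q = (\<Sum>b\<in>insert x S. \<Sum>q | q permutes S. ?f (Transposition.transpose x b \<circ> q))"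
    unfolding det_on_def by (rule sum_over_permutations_insert[OF assms])
  also have "\<dots> = (\<Sum>q | q permutes S. ?f q) + (\<Sum>b\<in>S. \<Sum>q | q permutes S. ?f (Transposition.transpose x b \<circ> q))"
    using assms by simp
  also have "(\<Sum>q | q permutes S. ?f q) = Q x x * det_on S Q"
    unfolding det_on_def sum_distrib_left
  proof (intro sum.cong refl)
    fix q assume "q \<in> {q. q permutes S}"
    then show "?f q = Q x x * (of_int (sign q) * (\<Prod>j\<in>S. Q j (q j)))"
      using assms(1,2) px[of q] by simp
  qed
  also have "(\<Sum>b\<in>S. \<Sum>q | q permutes S. ?f (Transposition.transpose x b \<circ> q))
    = (\<Sum>b\<in>S. - (Q x b * det_on S (\<lambda>i j. if j = b then Q i x else Q i j)))"
    unfolding det_on_def sum_distrib_left sum_negf[symmetric]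
  proof (intro sum.cong refl)
    fix b q assume b: "b \<in> S" and q: "q \<in> {q. q permutes S}"
    have "x \<noteq> b" using b assms(2) by blast
    then have "sign (Transposition.transpose x b \<circ> q) = - sign q"
      using q permutes_imp_permutation[OF assms(1)]
      by (simp add: sign_compose permutation_swap_id sign_swap_id)
    moreover have "(\<Prod>j\<in>S. Q j (Transposition.transpose x b (q j))) = (\<Prod>j\<in>S. if q j = b then Q j x else Q j (q j))"
    proof (intro prod.cong refl)
      fix j assume "j \<in> S"
      then have "q j \<noteq> x" using q assms(2) permutes_in_image[of q S j] by auto
      then show "Q j (Transposition.transpose x b (q j)) = (if q j = b then Q j x else Q j (q j))"
        by (auto simp: Transposition.transpose_def)
    qed
    ultimately show "?f (Transposition.transpose x b \<circ> q) = - (Q x b * (of_int (sign q) * (\<Prod>j\<in>S. if q j = b then Q j x else Q j (q j))))"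
      using assms px[of q] q by simp
  qed
  finally show ?thesis by (simp add: sum_negf)
qed

text \<open>With column \<open>x\<close> as \<open>u\<close> and row \<open>x\<close> over the pivot
  as \<open>v\<close>, the rank-one expansion of the Schur complement matches the bordered expansion
  term by term. Determinants thus follow the same elimination as
  \<open>inv_quad_list\<close>.\<close>

lemma det_on_schur:
  assumes "finite S" "x \<notin> S" "Q x x \<noteq> 0"
  shows "det_on (insert x S) Q = Q x x * det_on S (schur Q x)"
proof -
  have "det_on S (schur Q x) = det_on S (\<lambda>i j. Q i j - Q i x * (Q x j / Q x x))"
    unfolding schur_def by simp
  also have "\<dots> = det_on S Q - (\<Sum>b\<in>S. Q x b / Q x x * det_on S (\<lambda>i j. if j = b then Q i x else Q i j))"
    by (rule det_on_rank_one[OF assms(1)])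
  finally show ?thesis
    using assms(3) by (simp add: det_on_insert[OF assms(1,2)] right_diff_distrib sum_distrib_left)
qed

lemma det_on_pos:
  assumes "pivots_pos xs Q" "distinct xs"
  shows "0 < det_on (set xs) Q"
  using assms
proof (induction xs arbitrary: Q)
  case Nil
  have "{p. p permutes ({} :: 'a set)} = {id}" by auto
  then show ?case by (simp add: det_on_def)
next
  case (Cons x xs)
  then show ?case by (simp add: det_on_schur)
qed

lemma det_on_scale: "det_on S (\<lambda>i j. c * Q i j) = c ^ card S * det_on S Q"
  by (simp add: det_on_def prod.distrib sum_distrib_left mult.left_commute)

section \<open>Gaussian integrals over finite index sets\<close>

lemma nn_integral_gaussian:
  assumes "0 < q"
  shows "(\<integral>\<^sup>+ t. ennreal (exp (- (q * t\<^sup>2) / 2 + l * t)) \<partial>lborel) = ennreal (sqrt (2 * pi / q) * exp (l\<^sup>2 / (2 * q)))"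
proof -
  \<comment> \<open>Completing the square exhibits a multiple of the normal density with mean l / q
    and variance 1 / q.\<close>
  have eq: "exp (- (q * t\<^sup>2) / 2 + l * t) = (sqrt (2 * pi / q) * exp (l\<^sup>2 / (2 * q))) * normal_density (l / q) (1 / sqrt q) t" for t
  proof -
    have 1: "(1 / sqrt q)\<^sup>2 = 1 / q" using assms by (simp add: power_divide)
    have 2: "- (q * t\<^sup>2) / 2 + l * t = l\<^sup>2 / (2 * q) + - ((t - l / q)\<^sup>2 / (2 * (1 / q)))"
      using assms by (simp add: field_simps power2_eq_square)
    show ?thesis unfolding normal_density_def 1 2 exp_add using assms by (simp add: real_sqrt_divide)
  qed
  have "(\<integral>\<^sup>+ t. ennreal (normal_density (l / q) (1 / sqrt q) t) \<partial>lborel) = 1"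
    using prob_space.emeasure_space_1[OF prob_space_normal_density[of "1 / sqrt q" "l / q"]] assms
    by (simp add: emeasure_density)
  then show ?thesis
    unfolding eq using assms by (subst ennreal_mult) (auto simp: nn_integral_cmult)
qed

lemma borel_measurable_PiM_component:
  "i \<in> I \<Longrightarrow> (\<lambda>\<beta>. \<beta> i) \<in> borel_measurable (PiM I (\<lambda>_. lborel))"
  using measurable_component_singleton[of i I "\<lambda>_. lborel"] by simp

interpretation lborel_product: product_sigma_finite "\<lambda>_. lborel :: real measure"
  by standard

text \<open>Tonelli, one coordinate at a time. Integrating out \<open>x\<close> leaves a Gaussian
  integrand in the other coordinates whose matrix is the Schur complement and whose linear term is
  the updated \<open>b\<close>: precisely the recursion of \<open>inv_quad_list\<close>.\<close>

lemma nn_integral_gaussian_PiM: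
  assumes "pivots_pos xs Q" "distinct xs" "sym_on (set xs) Q"
  shows "(\<integral>\<^sup>+ \<beta>. ennreal (exp (- (\<Sum>i\<in>set xs. \<Sum>j\<in>set xs. \<beta> i * Q i j * \<beta> j) / 2 + (\<Sum>i\<in>set xs. b i * \<beta> i))) \<partial>PiM (set xs) (\<lambda>_. lborel))
    = ennreal (sqrt ((2 * pi) ^ length xs / det_on (set xs) Q) * exp (inv_quad_list xs Q b / 2))"
  using assms
proof (induction xs arbitrary: Q b)
  case Nil
  have "{p. p permutes ({} :: 'a set)} = {id}" by auto
  then show ?case by (simp add: det_on_def space_PiM_empty)
next
  case (Cons x xs)
  define S where "S = set xs"
  have x: "x \<notin> S" and pos: "0 < Q x x" and fin: "finite S" and len: "distinct xs" "pivots_pos xs (schur Q x)"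
    using Cons.prems by (auto simp: S_def)
  have sym: "sym_on (insert x S) Q" using Cons.prems(3) by (simp add: S_def)
  let ?b = "\<lambda>i. b i - Q i x * b x / Q x x"
  let ?q = "\<lambda>S Q \<beta>. \<Sum>i\<in>S. \<Sum>j\<in>S. \<beta> i * Q i j * \<beta> j :: real"
  let ?f = "\<lambda>\<beta>. ennreal (exp (- ?q (insert x S) Q \<beta> / 2 + (\<Sum>i\<in>insert x S. b i * \<beta> i)))"
  have [measurable]: "?f \<in> borel_measurable (PiM (insert x S) (\<lambda>_. lborel))"
    by (intro measurable_compose[OF _ measurable_ennreal] borel_measurable_exp[THEN measurable_compose[rotated]]
      borel_measurable_exp borel_measurable_add borel_measurable_divide borel_measurable_uminus borel_measurable_sum
      borel_measurable_times borel_measurable_PiM_component borel_measurable_const) auto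
  have inner: "(\<integral>\<^sup>+ t. ?f (\<beta>(x := t)) \<partial>lborel)
      = ennreal (sqrt (2 * pi / Q x x) * exp ((b x)\<^sup>2 / Q x x / 2))
        * ennreal (exp (- ?q S (schur Q x) \<beta> / 2 + (\<Sum>i\<in>S. ?b i * \<beta> i)))" for \<beta>
  proof -
    define s where "s = (\<Sum>j\<in>S. Q x j * \<beta> j)"
    have eq: "(\<Sum>j\<in>S. Q x j * (\<beta>(x := t)) j) = s" "?q S Q (\<beta>(x := t)) = ?q S Q \<beta>"
      "(\<Sum>i\<in>S. b i * (\<beta>(x := t)) i) = (\<Sum>i\<in>S. b i * \<beta> i)" for t
      unfolding s_def using x by (auto intro!: sum.cong)
    have bs: "(\<Sum>i\<in>S. ?b i * \<beta> i) = (\<Sum>i\<in>S. b i * \<beta> i) - b x / Q x x * s"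
    proof -
      have "(\<Sum>i\<in>S. ?b i * \<beta> i) = (\<Sum>i\<in>S. b i * \<beta> i - b x / Q x x * (Q x i * \<beta> i))"
      proof (intro sum.cong refl)
        fix i assume "i \<in> S"
        then have "Q i x = Q x i" by (intro sym_onD[OF sym]) auto
        then show "?b i * \<beta> i = b i * \<beta> i - b x / Q x x * (Q x i * \<beta> i)"
          by (simp add: algebra_simps)
      qed
      then show ?thesis by (simp add: sum_subtractf sum_distrib_left s_def)
    qed
    have feq: "?f (\<beta>(x := t)) = ennreal (exp (- ?q S Q \<beta> / 2 + (\<Sum>i\<in>S. b i * \<beta> i))) *
        ennreal (exp (- (Q x x * t\<^sup>2) / 2 + (b x - s) * t))" for t
      unfolding quad_insert[OF fin x sym] eq using x fin
      by (simp add: eq ennreal_mult[symmetric] exp_add[symmetric] del: fun_upd_apply)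
         (simp add: field_simps)
    have "(\<integral>\<^sup>+ t. ?f (\<beta>(x := t)) \<partial>lborel) = ennreal (exp (- ?q S Q \<beta> / 2 + (\<Sum>i\<in>S. b i * \<beta> i))) *
        ennreal (sqrt (2 * pi / Q x x) * exp ((b x - s)\<^sup>2 / (2 * Q x x)))"
      unfolding feq by (subst nn_integral_cmult) (simp, simp only: nn_integral_gaussian[OF pos])
    also have "\<dots> = ennreal (sqrt (2 * pi / Q x x) * (exp (- ?q S Q \<beta> / 2 + (\<Sum>i\<in>S. b i * \<beta> i)) * exp ((b x - s)\<^sup>2 / (2 * Q x x))))"
      by (subst ennreal_mult[symmetric]) (simp_all add: mult_ac pos less_imp_le)
    \<comment> \<open>Expanding (b x - s)^2: the square of \<open>b x\<close> is the pivot term of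
      the recursion, the cross term updates the linear part, and s^2 turns \<open>Q\<close> into its
      Schur complement.\<close>
    also have "exp (- ?q S Q \<beta> / 2 + (\<Sum>i\<in>S. b i * \<beta> i)) * exp ((b x - s)\<^sup>2 / (2 * Q x x))
       = exp ((b x)\<^sup>2 / Q x x / 2) * exp (- ?q S (schur Q x) \<beta> / 2 + (\<Sum>i\<in>S. ?b i * \<beta> i))"
      unfolding exp_add[symmetric] bs quad_schur[OF fin sym] s_def[symmetric] using pos
      by (simp add: field_simps power2_eq_square)
    finally show ?thesis
      by (subst ennreal_mult[symmetric]) (simp_all add: mult_ac pos less_imp_le)
  qed
  have "(\<integral>\<^sup>+ \<beta>. ?f \<beta> \<partial>PiM (insert x S) (\<lambda>_. lborel)) = (\<integral>\<^sup>+ \<beta>. (\<integral>\<^sup>+ t. ?f (\<beta>(x := t)) \<partial>lborel) \<partial>PiM S (\<lambda>_. lborel))"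
    by (rule lborel_product.product_nn_integral_insert[OF fin x]) measurable
  also have "\<dots> = ennreal (sqrt (2 * pi / Q x x) * exp ((b x)\<^sup>2 / Q x x / 2)) *
     (\<integral>\<^sup>+ \<beta>. ennreal (exp (- ?q S (schur Q x) \<beta> / 2 + (\<Sum>i\<in>S. ?b i * \<beta> i))) \<partial>PiM S (\<lambda>_. lborel))"
    unfolding inner
    by (intro nn_integral_cmult measurable_compose[OF _ measurable_ennreal]
      borel_measurable_exp borel_measurable_add borel_measurable_divide borel_measurable_uminus borel_measurable_sum
      borel_measurable_times borel_measurable_PiM_component borel_measurable_const) auto
  also have "(\<integral>\<^sup>+ \<beta>. ennreal (exp (- ?q S (schur Q x) \<beta> / 2 + (\<Sum>i\<in>S. ?b i * \<beta> i))) \<partial>PiM S (\<lambda>_. lborel))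
    = ennreal (sqrt ((2 * pi) ^ length xs / det_on S (schur Q x)) * exp (inv_quad_list xs (schur Q x) ?b / 2))"
    unfolding S_def using sym by (intro Cons.IH len sym_on_schur) (simp add: S_def)
  also have "ennreal (sqrt (2 * pi / Q x x) * exp ((b x)\<^sup>2 / Q x x / 2)) * \<dots>
    = ennreal (sqrt ((2 * pi) ^ length (x # xs) / det_on (insert x S) Q) * exp (inv_quad_list (x # xs) Q b / 2))"
  proof -
    have "det_on (insert x S) Q = Q x x * det_on S (schur Q x)"
      using fin x pos by (intro det_on_schur) auto
    moreover have "0 < det_on S (schur Q x)" unfolding S_def using len by (intro det_on_pos)
    ultimately show ?thesis using pos
      by (subst ennreal_mult[symmetric])
         (auto simp: real_sqrt_mult[symmetric] exp_add[symmetric] add_divide_distrib mult_ac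
           simp flip: exp_add)
  qed
  finally show ?case by (simp add: S_def)
qed

section \<open>The marginal likelihood as a hyper-$g$ integral\<close>

definition hyperg :: "real \<Rightarrow> real measure" where
  "hyperg a = density lborel (\<lambda>t. ennreal (hyperg_density a t))"

definition inv_quad :: "nat set \<Rightarrow> (nat \<Rightarrow> nat \<Rightarrow> real) \<Rightarrow> (nat \<Rightarrow> real) \<Rightarrow> real" where
  "inv_quad S Q b = inv_quad_list (sorted_list_of_set S) Q b"

definition posdef_on :: "nat set \<Rightarrow> (nat \<Rightarrow> nat \<Rightarrow> real) \<Rightarrow> bool" where
  "posdef_on S Q \<longleftrightarrow> pivots_pos (sorted_list_of_set S) Q"

definition xty :: "(nat \<Rightarrow> nat \<Rightarrow> nat \<Rightarrow> real) \<Rightarrow> nat \<Rightarrow> (nat \<Rightarrow> real) \<Rightarrow> nat \<Rightarrow> real" where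
  "xty X n y j = (\<Sum>r<n. X n r j * y r)"

definition sst :: "nat \<Rightarrow> (nat \<Rightarrow> real) \<Rightarrow> real" where
  "sst n y = (\<Sum>r<n. (y r)\<^sup>2) - (\<Sum>r<n. y r)\<^sup>2 / real n"

text \<open>What remains of the integral over $s = \sigma^2$ once $\alpha$ and $\beta$ are integrated out;
  $h$ is the residual sum of squares for given $g$.\<close>
definition sigma2_integral :: "nat \<Rightarrow> real \<Rightarrow> ennreal" where
  "sigma2_integral n h = (\<integral>\<^sup>+ s. ennreal (indicator {0<..} s / s * (1 / sqrt (2 * pi * s)) ^ n
     * sqrt (2 * pi * s / real n) * exp (- h / (2 * s))) \<partial>lborel)"

lemma sets_hyperg [measurable_cong, simp]: "sets (hyperg a) = sets borel"
  and space_hyperg [simp]: "space (hyperg a) = UNIV"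
  by (simp_all add: hyperg_def)

lemma hyperg_density_measurable [measurable]: "hyperg_density a \<in> borel_measurable borel"
  unfolding hyperg_density_def[abs_def] by measurable

lemma hyperg_density_nonneg: "2 < a \<Longrightarrow> 0 \<le> hyperg_density a t"
  by (simp add: hyperg_density_def)

lemma AE_hyperg_pos: "AE t in hyperg a. 0 < t"
  unfolding hyperg_def by (subst AE_density) (auto simp: hyperg_density_def)

lemma prob_space_hyperg:
  assumes "2 < a"
  shows "prob_space (hyperg a)"
proof
  have "emeasure (hyperg a) (space (hyperg a)) = (\<integral>\<^sup>+ t. ennreal (hyperg_density a t) \<partial>lborel)"
    by (simp add: hyperg_def emeasure_density)
  \<comment> \<open>The density is 0 at the origin, while the antiderivative rule works on the
    closed half-line; the single point is a null set.\<close>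
  also have "\<dots> = (\<integral>\<^sup>+ t. ennreal ((a - 2) / 2 * (1 + t) powr (-(a / 2))) * indicator {0..} t \<partial>lborel)"
  proof (rule nn_integral_cong_AE)
    have "AE t in lborel. t \<noteq> (0::real)" by (rule AE_lborel_singleton)
    then show "AE t in lborel. ennreal (hyperg_density a t)
        = ennreal ((a - 2) / 2 * (1 + t) powr (-(a / 2))) * indicator {0..} t"
      by eventually_elim (auto simp: hyperg_density_def indicator_def)
  qed
  also have "\<dots> = ennreal (0 - (- ((1 + 0) powr (1 - a / 2))))"
  proof (rule nn_integral_FTC_atLeast)
    fix x :: real assume "0 \<le> x"
    then show "((\<lambda>x. - ((1 + x) powr (1 - a / 2))) has_real_derivative (a - 2) / 2 * (1 + x) powr (-(a / 2))) (at x)"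
      by (auto intro!: derivative_eq_intros simp: field_simps powr_minus)
    show "0 \<le> (a - 2) / 2 * (1 + x) powr (-(a / 2))" using assms by simp
  next
    have "filterlim (\<lambda>x::real. 1 + x) at_top at_top"
      by (rule filterlim_tendsto_add_at_top[OF tendsto_const filterlim_ident])
    then have "((\<lambda>x. (1 + x) powr (1 - a / 2)) \<longlongrightarrow> 0) at_top"
      using assms by (intro tendsto_neg_powr) auto
    from tendsto_minus[OF this] show "((\<lambda>x. - ((1 + x) powr (1 - a / 2))) \<longlongrightarrow> 0) at_top" by simp
  qed auto
  finally show "emeasure (hyperg a) (space (hyperg a)) = 1" by simp
qed

text \<open>Tonelli with whole blocks in the role of coordinates. The prior factor of a block reads
  the coefficients of that block alone, so the integral over all coefficients becomes a product over
  blocks.\<close>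

lemma (in product_sigma_finite) nn_integral_PiM_prod_blocks:
  assumes "finite I" "\<And>i. i \<in> I \<Longrightarrow> finite (S i)" "disjoint_family_on S I"
    and "\<And>i. i \<in> I \<Longrightarrow> f i \<in> borel_measurable (PiM (S i) M)"
  shows "(\<integral>\<^sup>+ x. (\<Prod>i\<in>I. f i (restrict x (S i))) \<partial>PiM (\<Union>i\<in>I. S i) M) = (\<Prod>i\<in>I. \<integral>\<^sup>+ x. f i x \<partial>PiM (S i) M)"
  using assms
proof (induction I)
  case empty
  then show ?case by (simp add: space_PiM_empty)
next
  case (insert k I)
  let ?U = "\<Union>i\<in>I. S i"
  have disj: "S k \<inter> ?U = {}"
    using insert.prems(2) insert.hyps by (auto simp: disjoint_family_on_def)
  have fin: "finite (S k)" "finite ?U" using insert by auto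
  note [measurable] = insert.prems(3)
  have meas: "(\<lambda>x. \<Prod>i\<in>J. f i (restrict x (S i))) \<in> borel_measurable (PiM U M)"
    if "J \<subseteq> insert k I" "(\<Union>i\<in>J. S i) \<subseteq> U" for J U
    using that
    by (intro borel_measurable_prod_ennreal measurable_compose[OF measurable_restrict_subset insert.prems(3)]) auto
  have eq: "(\<Prod>i\<in>insert k I. f i (restrict (merge (S k) ?U (x, y)) (S i)))
     = f k (restrict x (S k)) * (\<Prod>i\<in>I. f i (restrict y (S i)))" for x y
  proof -
    have "restrict (merge (S k) ?U (x, y)) (S i) = restrict y (S i)" if "i \<in> I" for i
      using that disj by (auto simp: restrict_def merge_def fun_eq_iff)
    then show ?thesis using disj insert.hyps by simp
  qed
  have "(\<integral>\<^sup>+ x. (\<Prod>i\<in>insert k I. f i (restrict x (S i))) \<partial>PiM (S k \<union> ?U) M)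
    = (\<integral>\<^sup>+ x. \<integral>\<^sup>+ y. f k (restrict x (S k)) * (\<Prod>i\<in>I. f i (restrict y (S i))) \<partial>PiM ?U M \<partial>PiM (S k) M)"
    by (subst product_nn_integral_fold[OF disj fin meas]) (auto simp: eq)
  also have "\<dots> = (\<integral>\<^sup>+ x. f k (restrict x (S k)) * (\<Prod>i\<in>I. \<integral>\<^sup>+ x. f i x \<partial>PiM (S i) M) \<partial>PiM (S k) M)"
  proof -
    have "(\<integral>\<^sup>+ x. (\<Prod>i\<in>I. f i (restrict x (S i))) \<partial>PiM ?U M) = (\<Prod>i\<in>I. \<integral>\<^sup>+ x. f i x \<partial>PiM (S i) M)"
      using insert.prems by (intro insert.IH) (auto simp: disjoint_family_on_def)
    then show ?thesis by (subst nn_integral_cmult) (auto intro!: meas)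
  qed
  also have "\<dots> = (\<integral>\<^sup>+ x. f k (restrict x (S k)) \<partial>PiM (S k) M) * (\<Prod>i\<in>I. \<integral>\<^sup>+ x. f i x \<partial>PiM (S i) M)"
    using meas[of "{k}" "S k"] insert.hyps by (intro nn_integral_multc) auto
  also have "(\<integral>\<^sup>+ x. f k (restrict x (S k)) \<partial>PiM (S k) M) = (\<integral>\<^sup>+ x. f k x \<partial>PiM (S k) M)"
    by (intro nn_integral_cong) (auto simp: space_PiM PiE_restrict)
  finally show ?case using insert.hyps by simp
qed

section \<open>Integrating out coefficients and intercept\<close>

lemma gram_quadratic:
  "(\<Sum>r<n. (\<Sum>j\<in>S. X n r j * \<beta> j)\<^sup>2) = (\<Sum>j\<in>S. \<Sum>j'\<in>S. \<beta> j * gram X n j j' * \<beta> j')"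
proof -
  have "(\<Sum>r<n. (\<Sum>j\<in>S. X n r j * \<beta> j)\<^sup>2) = (\<Sum>r<n. \<Sum>j\<in>S. \<Sum>j'\<in>S. (X n r j * \<beta> j) * (X n r j' * \<beta> j'))"
    by (simp add: power2_eq_square sum_product)
  also have "\<dots> = (\<Sum>j\<in>S. \<Sum>r<n. \<Sum>j'\<in>S. (X n r j * \<beta> j) * (X n r j' * \<beta> j'))"
    by (rule sum.swap)
  also have "\<dots> = (\<Sum>j\<in>S. \<Sum>j'\<in>S. \<Sum>r<n. (X n r j * \<beta> j) * (X n r j' * \<beta> j'))"
    by (intro sum.cong refl sum.swap)
  also have "\<dots> = (\<Sum>j\<in>S. \<Sum>j'\<in>S. \<beta> j * gram X n j j' * \<beta> j')"
    by (simp add: gram_def sum_distrib_left sum_distrib_right mult_ac)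
  finally show ?thesis .
qed

text \<open>Centred columns kill the cross term between \<alpha> and the regression part, so the
  likelihood splits into a factor in \<alpha> and one in \<beta>, and \<open>xty\<close> may be
  formed with the uncentred response.\<close>

lemma lik_eq:
  assumes "0 < s" "finite \<gamma>" "\<And>j. j \<in> \<gamma> \<Longrightarrow> (\<Sum>r<n. X n r j) = 0"
  shows "lik X n \<gamma> y \<alpha> \<beta> s = (1 / sqrt (2 * pi * s)) ^ n * exp (- (\<Sum>r<n. (y r - \<alpha>)\<^sup>2) / (2 * s))
    * exp (- ((\<Sum>j\<in>\<gamma>. \<Sum>j'\<in>\<gamma>. \<beta> j * gram X n j j' * \<beta> j') - 2 * (\<Sum>j\<in>\<gamma>. xty X n y j * \<beta> j)) / (2 * s))"
proof -
  define m where "m r = (\<Sum>j\<in>\<gamma>. X n r j * \<beta> j)" for r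
  have 1: "(\<Sum>r<n. (m r)\<^sup>2) = (\<Sum>j\<in>\<gamma>. \<Sum>j'\<in>\<gamma>. \<beta> j * gram X n j j' * \<beta> j')"
    unfolding m_def by (rule gram_quadratic)
  have 2: "(\<Sum>r<n. (y r - \<alpha>) * m r) = (\<Sum>j\<in>\<gamma>. xty X n y j * \<beta> j)"
  proof -
    have "(\<Sum>r<n. (y r - \<alpha>) * m r) = (\<Sum>r<n. \<Sum>j\<in>\<gamma>. (y r - \<alpha>) * (X n r j * \<beta> j))"
      by (simp add: m_def sum_distrib_left)
    also have "\<dots> = (\<Sum>j\<in>\<gamma>. \<Sum>r<n. (y r - \<alpha>) * (X n r j * \<beta> j))" by (rule sum.swap)
    also have "\<dots> = (\<Sum>j\<in>\<gamma>. (xty X n y j - \<alpha> * (\<Sum>r<n. X n r j)) * \<beta> j)"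
      by (simp add: xty_def sum_distrib_left sum_distrib_right sum_subtractf[symmetric] algebra_simps)
    finally show ?thesis using assms(3) by simp
  qed
  have "(\<Sum>r<n. (y r - (\<alpha> + m r))\<^sup>2) = (\<Sum>r<n. (y r - \<alpha>)\<^sup>2 - 2 * ((y r - \<alpha>) * m r) + (m r)\<^sup>2)"
    by (intro sum.cong refl) (simp add: power2_eq_square algebra_simps)
  also have "\<dots> = (\<Sum>r<n. (y r - \<alpha>)\<^sup>2) - 2 * (\<Sum>r<n. (y r - \<alpha>) * m r) + (\<Sum>r<n. (m r)\<^sup>2)"
    by (simp add: sum.distrib sum_subtractf sum_distrib_left)
  finally have sq: "(\<Sum>r<n. (y r - (\<alpha> + m r))\<^sup>2) = \<dots>" .
  have "lik X n \<gamma> y \<alpha> \<beta> s = (\<Prod>r<n. 1 / sqrt (2 * pi * s) * exp (- ((y r - (\<alpha> + m r))\<^sup>2) / (2 * s)))"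
    using assms(1) by (simp add: lik_def normal_density_def m_def)
  also have "\<dots> = (1 / sqrt (2 * pi * s)) ^ n * exp (\<Sum>r<n. - ((y r - (\<alpha> + m r))\<^sup>2) / (2 * s))"
    by (simp only: prod.distrib prod_constant card_lessThan exp_sum[OF finite_lessThan])
  also have "(\<Sum>r<n. - ((y r - (\<alpha> + m r))\<^sup>2) / (2 * s)) = - (\<Sum>r<n. (y r - (\<alpha> + m r))\<^sup>2) / (2 * s)"
    by (simp add: sum_negf sum_divide_distrib)
  also have "\<dots> = - (\<Sum>r<n. (y r - \<alpha>)\<^sup>2) / (2 * s)
     + - ((\<Sum>j\<in>\<gamma>. \<Sum>j'\<in>\<gamma>. \<beta> j * gram X n j j' * \<beta> j') - 2 * (\<Sum>j\<in>\<gamma>. xty X n y j * \<beta> j)) / (2 * s)"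
    unfolding sq 1 2 add_divide_distrib[symmetric] by simp
  finally show ?thesis unfolding exp_add by (simp only: mult.assoc)
qed

lemma block_set_UN: "\<gamma> = (\<Union>i\<in>blk ` \<gamma>. block_set blk \<gamma> i)"
  by (auto simp: block_set_def)

lemma disjoint_block_set: "disjoint_family_on (block_set blk \<gamma>) I"
  by (auto simp: disjoint_family_on_def block_set_def)

lemma finite_block_set [simp]: "finite \<gamma> \<Longrightarrow> finite (block_set blk \<gamma> i)"
  by (simp add: block_set_def)

lemma sum_block_set: "finite \<gamma> \<Longrightarrow> (\<Sum>j\<in>\<gamma>. f j) = (\<Sum>i\<in>blk ` \<gamma>. \<Sum>j\<in>block_set blk \<gamma> i. f j)"
  unfolding block_set_def by (rule sum.image_gen)

lemma quad_block_set:
  fixes Q :: "nat \<Rightarrow> nat \<Rightarrow> real"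
  assumes "finite \<gamma>" "\<And>j j'. j \<in> \<gamma> \<Longrightarrow> j' \<in> \<gamma> \<Longrightarrow> blk j \<noteq> blk j' \<Longrightarrow> Q j j' = 0"
  shows "(\<Sum>j\<in>\<gamma>. \<Sum>j'\<in>\<gamma>. b j * Q j j' * c j')
    = (\<Sum>i\<in>blk ` \<gamma>. \<Sum>j\<in>block_set blk \<gamma> i. \<Sum>j'\<in>block_set blk \<gamma> i. b j * Q j j' * c j')"
  unfolding sum_block_set[OF assms(1), of "\<lambda>j. \<Sum>j'\<in>\<gamma>. b j * Q j j' * c j'" blk]
proof (rule sum.cong[OF refl], rule sum.cong[OF refl])
  fix i j assume "j \<in> block_set blk \<gamma> i"
  then show "(\<Sum>j'\<in>\<gamma>. b j * Q j j' * c j') = (\<Sum>j'\<in>block_set blk \<gamma> i. b j * Q j j' * c j')"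
  proof (intro sum.mono_neutral_right)
    have j: "j \<in> \<gamma>" "blk j = i" using \<open>j \<in> block_set blk \<gamma> i\<close> by (auto simp: block_set_def)
    show "\<forall>j'\<in>\<gamma> - block_set blk \<gamma> i. b j * Q j j' * c j' = 0"
    proof
      fix j' assume "j' \<in> \<gamma> - block_set blk \<gamma> i"
      then have "j' \<in> \<gamma>" "blk j \<noteq> blk j'" using j by (auto simp: block_set_def)
      then have "Q j j' = 0" using j by (intro assms(2))
      then show "b j * Q j j' * c j' = 0" by simp
    qed
  qed (auto simp: block_set_def assms(1))
qed

lemma sym_on_gram: "sym_on S (gram X n)"
  unfolding sym_on_def gram_def by (simp add: mult.commute)

text \<open>The likelihood contributes precision Q / s and the prior Q / (g s). Their sum is (1 +
  1/g) Q / s, whence the shrinkage factor g / (1 + g) in the exponent; the ratio of prior to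
  posterior determinants gives the power of 1 + g.\<close>

lemma nn_integral_block:
  assumes "0 < g" "0 < s" "finite S" "posdef_on S Q" "sym_on S Q"
  shows "(\<integral>\<^sup>+ \<beta>. ennreal (mvn_prec_density S (\<lambda>j j'. Q j j' / (g * s)) \<beta>
      * exp (- ((\<Sum>j\<in>S. \<Sum>j'\<in>S. \<beta> j * Q j j' * \<beta> j') - 2 * (\<Sum>j\<in>S. b j * \<beta> j)) / (2 * s))) \<partial>PiM S (\<lambda>_. lborel))
    = ennreal ((1 + g) powr (- real (card S) / 2) * exp (g / (1 + g) * inv_quad S Q b / (2 * s)))"
proof -
  define c where "c = (1 / g + 1) / s"
  define xs where "xs = sorted_list_of_set S"
  have c: "0 < c" using assms by (simp add: c_def add_pos_pos)
  have xs: "set xs = S" "distinct xs" "length xs = card S" "pivots_pos xs Q"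
    using assms(3,4) by (auto simp: xs_def posdef_on_def)
  define K where "K = (2 * pi) powr (- real (card S) / 2) * sqrt (det_on S (\<lambda>j j'. Q j j' / (g * s)))"
  have det: "0 < det_on S Q" using det_on_pos[OF xs(4,2)] xs(1) by simp
  have "det_on S (\<lambda>j j'. Q j j' / (g * s)) = (1 / (g * s)) ^ card S * det_on S Q"
    using det_on_scale[of S "1 / (g * s)" Q] by simp
  then have K: "K = (2 * pi) powr (- real (card S) / 2) * sqrt ((1 / (g * s)) ^ card S * det_on S Q)" by (simp add: K_def)
  have "0 \<le> K" unfolding K using assms det by simp
  have int: "mvn_prec_density S (\<lambda>j j'. Q j j' / (g * s)) \<beta>
      * exp (- ((\<Sum>j\<in>S. \<Sum>j'\<in>S. \<beta> j * Q j j' * \<beta> j') - 2 * (\<Sum>j\<in>S. b j * \<beta> j)) / (2 * s))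
     = K * exp (- (\<Sum>i\<in>set xs. \<Sum>j\<in>set xs. \<beta> i * (c * Q i j) * \<beta> j) / 2 + (\<Sum>i\<in>set xs. (1 / s * b i) * \<beta> i))" for \<beta>
  proof -
    define q where "q = (\<Sum>j\<in>S. \<Sum>j'\<in>S. \<beta> j * Q j j' * \<beta> j')"
    define l where "l = (\<Sum>j\<in>S. b j * \<beta> j)"
    have 1: "(\<Sum>i\<in>set xs. \<Sum>j\<in>set xs. \<beta> i * (c * Q i j) * \<beta> j) = c * q"
      unfolding q_def xs(1) by (simp add: sum_distrib_left mult_ac)
    have 2: "(\<Sum>i\<in>set xs. (1 / s * b i) * \<beta> i) = l / s"
      unfolding l_def xs(1) by (simp add: sum_divide_distrib)
    have 3: "(\<Sum>j\<in>S. \<Sum>j'\<in>S. \<beta> j * (Q j j' / (g * s)) * \<beta> j') = q / (g * s)"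
      unfolding q_def by (simp add: sum_divide_distrib)
    have 4: "- (q / (g * s)) / 2 + - (q - 2 * l) / (2 * s) = - (c * q) / 2 + l / s"
      using assms by (simp add: c_def field_simps)
    show ?thesis unfolding mvn_prec_density_def 1 2 3 q_def[symmetric] l_def[symmetric]
      unfolding K_def 4[symmetric] exp_add by simp
  qed
  have "(\<integral>\<^sup>+ \<beta>. ennreal (exp (- (\<Sum>i\<in>set xs. \<Sum>j\<in>set xs. \<beta> i * (c * Q i j) * \<beta> j) / 2 + (\<Sum>i\<in>set xs. (1 / s * b i) * \<beta> i))) \<partial>PiM (set xs) (\<lambda>_. lborel))
    = ennreal (sqrt ((2 * pi) ^ length xs / det_on (set xs) (\<lambda>i j. c * Q i j)) * exp (inv_quad_list xs (\<lambda>i j. c * Q i j) (\<lambda>i. 1 / s * b i) / 2))"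
    using c xs assms(5)
    by (intro nn_integral_gaussian_PiM) (auto simp: pivots_pos_scale sym_on_def)
  also have "inv_quad_list xs (\<lambda>i j. c * Q i j) (\<lambda>i. 1 / s * b i) / 2 = g / (1 + g) * inv_quad S Q b / (2 * s)"
    unfolding inv_quad_list_scale[OF c] inv_quad_def xs_def[symmetric] using assms(1,2)
    by (simp add: c_def field_simps power2_eq_square)
  also have "det_on (set xs) (\<lambda>i j. c * Q i j) = c ^ card S * det_on S Q"
    unfolding xs(1) by (rule det_on_scale)
  finally have main: "(\<integral>\<^sup>+ \<beta>. ennreal (exp (- (\<Sum>i\<in>set xs. \<Sum>j\<in>set xs. \<beta> i * (c * Q i j) * \<beta> j) / 2 + (\<Sum>i\<in>set xs. (1 / s * b i) * \<beta> i))) \<partial>PiM S (\<lambda>_. lborel))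
    = ennreal (sqrt ((2 * pi) ^ card S / (c ^ card S * det_on S Q)) * exp (g / (1 + g) * inv_quad S Q b / (2 * s)))"
    by (simp only: xs)
  \<comment> \<open>The powers of 2 pi and the determinant of \<open>Q\<close> cancel. What is left
    is (g s c)^(-|S|/2), and g s c = 1 + g.\<close>
  have const: "K * sqrt ((2 * pi) ^ card S / (c ^ card S * det_on S Q)) = (1 + g) powr (- real (card S) / 2)"
  proof -
    have p: "x powr (- real (card S) / 2) = sqrt (1 / x ^ card S)" if "0 < x" for x
    proof -
      have "x powr (- real (card S) / 2) = (x powr (- real (card S))) powr (1 / 2)" by (simp add: powr_powr)
      also have "\<dots> = sqrt (x powr (- real (card S)))" by (rule powr_half_sqrt) simp
      also have "x powr (- real (card S)) = 1 / x ^ card S"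
        using that by (simp add: powr_minus powr_realpow inverse_eq_divide)
      finally show ?thesis .
    qed
    have "K * sqrt ((2 * pi) ^ card S / (c ^ card S * det_on S Q))
      = sqrt (1 / (2 * pi) ^ card S * ((1 / (g * s)) ^ card S * det_on S Q) * ((2 * pi) ^ card S / (c ^ card S * det_on S Q)))"
      proof -
      have p2: "(2 * pi) powr (- real (card S) / 2) = sqrt (1 / (2 * pi) ^ card S)" by (rule p) simp
      show ?thesis by (simp only: K p2 real_sqrt_mult mult.assoc)
    qed
    also have "1 / (2 * pi) ^ card S * ((1 / (g * s)) ^ card S * det_on S Q) * ((2 * pi) ^ card S / (c ^ card S * det_on S Q))
       = 1 / ((g * s) ^ card S * c ^ card S)"
      using det c assms(1,2) by (simp add: power_divide)
    also have "(g * s) ^ card S * c ^ card S = (1 + g) ^ card S"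
    proof -
      have "(g * s) * c = 1 + g" using assms(1,2) by (simp add: c_def field_simps)
      then show ?thesis by (simp only: power_mult_distrib[symmetric])
    qed
    finally show ?thesis using p[of "1 + g"] assms(1) by simp
  qed
  have meas: "(\<lambda>\<beta>. ennreal (exp (- (\<Sum>i\<in>set xs. \<Sum>j\<in>set xs. \<beta> i * (c * Q i j) * \<beta> j) / 2 + (\<Sum>i\<in>set xs. (1 / s * b i) * \<beta> i)))) \<in> borel_measurable (PiM S (\<lambda>_. lborel))"
    unfolding xs(1)
    by (intro measurable_compose[OF _ measurable_ennreal]
      borel_measurable_exp borel_measurable_add borel_measurable_divide borel_measurable_uminus borel_measurable_sum
      borel_measurable_times borel_measurable_PiM_component borel_measurable_const) auto
  show ?thesis
    unfolding int ennreal_mult'[OF \<open>0 \<le> K\<close>] nn_integral_cmult[OF meas] main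
    by (subst ennreal_mult'[OF \<open>0 \<le> K\<close>, symmetric]) (simp only: const[symmetric] mult.assoc)
qed

lemma mvn_prec_density_nonneg:
  assumes "finite S" "posdef_on S Q" "0 < c"
  shows "0 \<le> mvn_prec_density S (\<lambda>j j'. Q j j' / c) \<beta>"
proof -
  have "det_on S (\<lambda>j j'. Q j j' / c) = (1 / c) ^ card S * det_on S Q"
    using det_on_scale[of S "1 / c" Q] by simp
  moreover have "0 < det_on S Q" using det_on_pos[of "sorted_list_of_set S" Q] assms by (simp add: posdef_on_def)
  ultimately show ?thesis using assms by (simp add: mvn_prec_density_def)
qed

text \<open>Under the flat prior this is a Gaussian integral in \<alpha> centred at the mean of
  \<open>y\<close>; the centred sum of squares is what remains in the exponent.\<close>

lemma nn_integral_alpha: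
  assumes "0 < s" "0 < n"
  shows "(\<integral>\<^sup>+ \<alpha>. ennreal (exp (- (\<Sum>r<n. (y r - \<alpha>)\<^sup>2) / (2 * s))) \<partial>lborel)
    = ennreal (sqrt (2 * pi * s / real n) * exp (- sst n y / (2 * s)))"
proof -
  define q where "q = real n / s"
  define l where "l = (\<Sum>r<n. y r) / s"
  have q: "0 < q" using assms by (simp add: q_def)
  have sq: "(\<Sum>r<n. (y r - \<alpha>)\<^sup>2) = (\<Sum>r<n. (y r)\<^sup>2) - 2 * \<alpha> * (\<Sum>r<n. y r) + real n * \<alpha>\<^sup>2" for \<alpha>
    by (simp add: power2_diff sum.distrib sum_subtractf sum_distrib_left mult_ac)
  have "exp (- (\<Sum>r<n. (y r - \<alpha>)\<^sup>2) / (2 * s))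
     = exp (- (\<Sum>r<n. (y r)\<^sup>2) / (2 * s)) * exp (- (q * \<alpha>\<^sup>2) / 2 + l * \<alpha>)" for \<alpha>
    unfolding exp_add[symmetric] sq using assms by (simp add: q_def l_def field_simps)
  then have "(\<integral>\<^sup>+ \<alpha>. ennreal (exp (- (\<Sum>r<n. (y r - \<alpha>)\<^sup>2) / (2 * s))) \<partial>lborel)
    = (\<integral>\<^sup>+ \<alpha>. ennreal (exp (- (\<Sum>r<n. (y r)\<^sup>2) / (2 * s))) * ennreal (exp (- (q * \<alpha>\<^sup>2) / 2 + l * \<alpha>)) \<partial>lborel)"
    by (simp only: ennreal_mult' exp_ge_zero)
  also have "\<dots> = ennreal (exp (- (\<Sum>r<n. (y r)\<^sup>2) / (2 * s))) * ennreal (sqrt (2 * pi / q) * exp (l\<^sup>2 / (2 * q)))"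
    by (subst nn_integral_cmult) (simp, simp only: nn_integral_gaussian[OF q])
  also have "\<dots> = ennreal (sqrt (2 * pi / q) * (exp (- (\<Sum>r<n. (y r)\<^sup>2) / (2 * s)) * exp (l\<^sup>2 / (2 * q))))"
    by (subst ennreal_mult'[symmetric]) (simp_all add: mult_ac)
  also have "exp (- (\<Sum>r<n. (y r)\<^sup>2) / (2 * s)) * exp (l\<^sup>2 / (2 * q)) = exp (- sst n y / (2 * s))"
    unfolding exp_add[symmetric] using assms
    by (simp add: q_def l_def sst_def field_simps power2_eq_square)
  also have "2 * pi / q = 2 * pi * s / real n" by (simp add: q_def)
  finally show ?thesis .
qed

lemma PiM_component_measurable_hyperg:
  "i \<in> B \<Longrightarrow> (\<lambda>g. g i) \<in> borel_measurable (PiM B (\<lambda>_. hyperg a))"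
  using measurable_component_singleton[of i B "\<lambda>_. hyperg a"] by simp

text \<open>Coordinates outside \<open>I\<close> integrate to one. Every model can thus be
  integrated against one law over all blocks, and integrands of different models may be compared
  pointwise in \<open>g\<close>.\<close>

lemma nn_integral_PiM_subset_prod:
  assumes "2 < a" "finite B" "I \<subseteq> B" "\<And>i. i \<in> I \<Longrightarrow> f i \<in> borel_measurable borel"
  shows "(\<integral>\<^sup>+ g. (\<Prod>i\<in>I. f i (g i)) \<partial>PiM B (\<lambda>_. hyperg a)) = (\<Prod>i\<in>I. \<integral>\<^sup>+ t. f i t \<partial>hyperg a)"
proof -
  interpret P: prob_space "hyperg a" by (rule prob_space_hyperg[OF assms(1)])
  interpret product_sigma_finite "\<lambda>_. hyperg a" by standard
  let ?f = "\<lambda>i t. if i \<in> I then f i t else 1"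
  have "(\<integral>\<^sup>+ g. (\<Prod>i\<in>I. f i (g i)) \<partial>PiM B (\<lambda>_. hyperg a)) = (\<integral>\<^sup>+ g. (\<Prod>i\<in>B. ?f i (g i)) \<partial>PiM B (\<lambda>_. hyperg a))"
    using assms(2,3) by (intro nn_integral_cong prod.mono_neutral_cong_left) auto
  also have "\<dots> = (\<Prod>i\<in>B. \<integral>\<^sup>+ t. ?f i t \<partial>hyperg a)"
  proof (intro product_nn_integral_prod assms(2))
    show "?f i \<in> borel_measurable (hyperg a)" for i
      using assms(4)[of i] by (cases "i \<in> I") (simp_all add: measurable_cong_sets[OF sets_hyperg refl])
  qed
  also have "\<dots> = (\<Prod>i\<in>I. \<integral>\<^sup>+ t. f i t \<partial>hyperg a)"
    using assms(2,3) P.emeasure_space_1 by (intro prod.mono_neutral_cong_right) auto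
  finally show ?thesis .
qed

text \<open>The innermost integral over \<beta> is Gaussian in each block and the one over \<alpha>
  is Gaussian too; Tonelli then moves \<open>g\<close> outside, so that a single integral over
  \<sigma>^2 remains for fixed \<open>g\<close>. The identity holds for every response, which later
  gives measurability on the whole sample space.\<close>

lemma marg_lik_eq:
  assumes n: "0 < n" and a: "2 < a" and fin: "finite \<gamma>" "finite B" and sub: "blk ` \<gamma> \<subseteq> B"
    and centered: "\<And>j. j \<in> \<gamma> \<Longrightarrow> (\<Sum>r<n. X n r j) = 0"
    and orth: "\<And>j j'. j \<in> \<gamma> \<Longrightarrow> j' \<in> \<gamma> \<Longrightarrow> blk j \<noteq> blk j' \<Longrightarrow> gram X n j j' = 0"
    and posdef_on: "\<And>i. i \<in> blk ` \<gamma> \<Longrightarrow> posdef_on (block_set blk \<gamma> i) (gram X n)"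
  shows "marg_lik a X blk n \<gamma> y = (\<integral>\<^sup>+ g. ennreal (\<Prod>i\<in>blk ` \<gamma>. (1 + g i) powr (- real (card (block_set blk \<gamma> i)) / 2))
    * sigma2_integral n (sst n y - (\<Sum>i\<in>blk ` \<gamma>. g i / (1 + g i) * inv_quad (block_set blk \<gamma> i) (gram X n) (xty X n y)))
    \<partial>PiM B (\<lambda>_. hyperg a))"
proof -
  let ?I = "blk ` \<gamma>" and ?S = "block_set blk \<gamma>" and ?G = "gram X n" and ?b = "xty X n y"
  let ?H = "PiM B (\<lambda>_. hyperg a)"
  interpret P: prob_space "hyperg a" by (rule prob_space_hyperg[OF a])
  interpret PB: product_prob_space "\<lambda>_. hyperg a" B by standard
  have finI: "finite ?I" using fin by simp
  \<comment> \<open>\<open>A\<close> collects what depends on neither \<beta> nor \<open>g\<close>,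
    \<open>A'\<close> is its integral over \<alpha>, and \<open>F\<close> is what a block leaves
    once its coefficients are integrated out.\<close>
  define A where "A s \<alpha> = indicator {0<..} s / s * (1 / sqrt (2 * pi * s)) ^ n * exp (- (\<Sum>r<n. (y r - \<alpha>)\<^sup>2) / (2 * s))" for s \<alpha> :: real
  define A' where "A' s = indicator {0<..} s / s * (1 / sqrt (2 * pi * s)) ^ n * sqrt (2 * pi * s / real n) * exp (- sst n y / (2 * s))" for s :: real
  define F where "F i s t = (1 + t) powr (- real (card (?S i)) / 2) * exp (t / (1 + t) * inv_quad (?S i) ?G ?b / (2 * s))" for i and s t :: real
  have A_nonneg: "0 \<le> A s \<alpha>" "0 \<le> A' s" for s \<alpha> by (auto simp: A_def A'_def indicator_def)
  have F_nonneg: "0 \<le> F i s t" for i s t by (simp add: F_def)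
  have F_meas [measurable]: "case_prod (F i) \<in> borel_measurable (borel \<Otimes>\<^sub>M borel)" for i
    unfolding F_def[abs_def] by measurable
  define h where "h g s i \<beta> = mvn_prec_density (?S i) (\<lambda>j j'. ?G j j' / (g i * s)) \<beta>
      * exp (- ((\<Sum>j\<in>?S i. \<Sum>j'\<in>?S i. \<beta> j * ?G j j' * \<beta> j') - 2 * (\<Sum>j\<in>?S i. ?b j * \<beta> j)) / (2 * s))" for g s i \<beta>
  have h_restrict: "h g s i (restrict \<beta> (?S i)) = h g s i \<beta>" for g s i \<beta>
    unfolding h_def mvn_prec_density_def by (simp cong: sum.cong)
  have h_meas: "(\<lambda>\<beta>. ennreal (h g s i \<beta>)) \<in> borel_measurable (PiM (?S i) (\<lambda>_. lborel))" for g s i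
    unfolding h_def mvn_prec_density_def
    by (intro measurable_compose[OF _ measurable_ennreal] borel_measurable_diff
      borel_measurable_exp borel_measurable_add borel_measurable_divide borel_measurable_uminus borel_measurable_sum
      borel_measurable_times borel_measurable_PiM_component borel_measurable_const) auto
  have inner: "(\<integral>\<^sup>+ \<beta>. ennreal (indicator {0<..} s / s * lik X n \<gamma> y \<alpha> \<beta> s * prior_beta X blk n \<gamma> g s \<beta>
        * (\<Prod>i\<in>?I. hyperg_density a (g i))) \<partial>PiM \<gamma> (\<lambda>_. lborel))
      = ennreal (A s \<alpha>) * (\<Prod>i\<in>?I. ennreal (hyperg_density a (g i)) * ennreal (F i s (g i)))" for s \<alpha> :: real and g
  \<comment> \<open>The Gaussian formula for a block needs positive \<open>s\<close> and
    \<open>g\<close>; elsewhere the indicator or a hyper-g density vanishes and both sides are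
    0.\<close>
  proof (cases "0 < s \<and> (\<forall>i\<in>?I. 0 < g i)")
    case False
    then have "indicator {0<..} s = (0::real) \<or> (\<exists>i\<in>?I. hyperg_density a (g i) = 0)"
      by (auto simp: hyperg_density_def indicator_def)
    then show ?thesis
    proof
      assume "\<exists>i\<in>?I. hyperg_density a (g i) = 0"
      then obtain i where i: "i \<in> ?I" "hyperg_density a (g i) = 0" by blast
      have z1: "(\<Prod>i\<in>?I. hyperg_density a (g i)) = 0"
        using i by (intro prod_zero[OF finI]) blast
      have z2: "(\<Prod>i\<in>?I. ennreal (hyperg_density a (g i)) * ennreal (F i s (g i))) = 0"
        using i by (intro prod_zero[OF finI] bexI[of _ i]) simp_all
      show ?thesis by (simp only: z1 z2 mult_zero_right mult_zero_left ennreal_0 nn_integral_const)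
    qed (simp add: A_def)
  next
    case True
    then have s: "0 < s" and g: "\<And>i. i \<in> ?I \<Longrightarrow> 0 < g i" by auto
    have h_nonneg: "0 \<le> h g s i \<beta>" if "i \<in> ?I" for i \<beta>
      unfolding h_def using mvn_prec_density_nonneg[OF finite_block_set[OF fin(1)] posdef_on[OF that], of "g i * s"] s g[OF that]
      by simp
    have "lik X n \<gamma> y \<alpha> \<beta> s * prior_beta X blk n \<gamma> g s \<beta>
       = (1 / sqrt (2 * pi * s)) ^ n * exp (- (\<Sum>r<n. (y r - \<alpha>)\<^sup>2) / (2 * s)) * (\<Prod>i\<in>?I. h g s i \<beta>)" for \<beta>
    proof -
      have lk: "lik X n \<gamma> y \<alpha> \<beta> s = (1 / sqrt (2 * pi * s)) ^ n * exp (- (\<Sum>r<n. (y r - \<alpha>)\<^sup>2) / (2 * s))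
        * exp (- ((\<Sum>j\<in>\<gamma>. \<Sum>j'\<in>\<gamma>. \<beta> j * ?G j j' * \<beta> j') - 2 * (\<Sum>j\<in>\<gamma>. ?b j * \<beta> j)) / (2 * s))"
        by (intro lik_eq s fin(1) centered)
      have qb: "(\<Sum>j\<in>\<gamma>. \<Sum>j'\<in>\<gamma>. \<beta> j * ?G j j' * \<beta> j')
        = (\<Sum>i\<in>?I. \<Sum>j\<in>?S i. \<Sum>j'\<in>?S i. \<beta> j * ?G j j' * \<beta> j')"
        by (intro quad_block_set fin(1) orth)
      have "(\<Sum>j\<in>\<gamma>. \<Sum>j'\<in>\<gamma>. \<beta> j * ?G j j' * \<beta> j') - 2 * (\<Sum>j\<in>\<gamma>. ?b j * \<beta> j)
        = (\<Sum>i\<in>?I. (\<Sum>j\<in>?S i. \<Sum>j'\<in>?S i. \<beta> j * ?G j j' * \<beta> j') - 2 * (\<Sum>j\<in>?S i. ?b j * \<beta> j))"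
        unfolding qb sum_block_set[OF fin(1), of "\<lambda>j. ?b j * \<beta> j" blk]
        by (simp add: sum_subtractf sum_distrib_left)
      then have "exp (- ((\<Sum>j\<in>\<gamma>. \<Sum>j'\<in>\<gamma>. \<beta> j * ?G j j' * \<beta> j') - 2 * (\<Sum>j\<in>\<gamma>. ?b j * \<beta> j)) / (2 * s))
        = exp (\<Sum>i\<in>?I. - ((\<Sum>j\<in>?S i. \<Sum>j'\<in>?S i. \<beta> j * ?G j j' * \<beta> j') - 2 * (\<Sum>j\<in>?S i. ?b j * \<beta> j)) / (2 * s))"
        by (simp only: sum_divide_distrib sum_negf[symmetric])
      then show ?thesis
        unfolding lk prior_beta_def h_def exp_sum[OF finI] prod.distrib by simp
    qed
    then have "indicator {0<..} s / s * lik X n \<gamma> y \<alpha> \<beta> s * prior_beta X blk n \<gamma> g s \<beta> * (\<Prod>i\<in>?I. hyperg_density a (g i))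
       = (A s \<alpha> * (\<Prod>i\<in>?I. hyperg_density a (g i))) * (\<Prod>i\<in>?I. h g s i \<beta>)" for \<beta>
      by (simp add: A_def mult_ac)
    moreover have nn: "0 \<le> A s \<alpha> * (\<Prod>i\<in>?I. hyperg_density a (g i))"
      using A_nonneg hyperg_density_nonneg[OF a] by (intro mult_nonneg_nonneg prod_nonneg) auto
    ultimately have "(\<integral>\<^sup>+ \<beta>. ennreal (indicator {0<..} s / s * lik X n \<gamma> y \<alpha> \<beta> s * prior_beta X blk n \<gamma> g s \<beta>
        * (\<Prod>i\<in>?I. hyperg_density a (g i))) \<partial>PiM \<gamma> (\<lambda>_. lborel))
      = (\<integral>\<^sup>+ \<beta>. ennreal (A s \<alpha> * (\<Prod>i\<in>?I. hyperg_density a (g i))) *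
          (\<Prod>i\<in>?I. ennreal (h g s i (restrict \<beta> (?S i)))) \<partial>PiM \<gamma> (\<lambda>_. lborel))"
      using h_nonneg by (simp add: ennreal_mult' prod_ennreal h_restrict)
    also have "\<dots> = (\<integral>\<^sup>+ \<beta>. ennreal (A s \<alpha> * (\<Prod>i\<in>?I. hyperg_density a (g i))) *
          (\<Prod>i\<in>?I. ennreal (h g s i (restrict \<beta> (?S i)))) \<partial>PiM (\<Union>i\<in>?I. ?S i) (\<lambda>_. lborel))"
      by (simp only: block_set_UN[of \<gamma> blk, symmetric])
    also have "\<dots> = ennreal (A s \<alpha> * (\<Prod>i\<in>?I. hyperg_density a (g i))) * (\<Prod>i\<in>?I. \<integral>\<^sup>+ \<beta>. ennreal (h g s i \<beta>) \<partial>PiM (?S i) (\<lambda>_. lborel))"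
    proof (subst nn_integral_cmult)
      show "(\<lambda>\<beta>. \<Prod>i\<in>?I. ennreal (h g s i (restrict \<beta> (?S i)))) \<in> borel_measurable (PiM (\<Union>i\<in>?I. ?S i) (\<lambda>_. lborel))"
        by (intro borel_measurable_prod_ennreal measurable_compose[OF measurable_restrict_subset h_meas]) auto
      show "ennreal (A s \<alpha> * (\<Prod>i\<in>?I. hyperg_density a (g i))) *
         (\<integral>\<^sup>+ \<beta>. (\<Prod>i\<in>?I. ennreal (h g s i (restrict \<beta> (?S i)))) \<partial>PiM (\<Union>i\<in>?I. ?S i) (\<lambda>_. lborel))
         = ennreal (A s \<alpha> * (\<Prod>i\<in>?I. hyperg_density a (g i))) * (\<Prod>i\<in>?I. \<integral>\<^sup>+ \<beta>. ennreal (h g s i \<beta>) \<partial>PiM (?S i) (\<lambda>_. lborel))"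
        by (subst lborel_product.nn_integral_PiM_prod_blocks[where f="\<lambda>i \<beta>. ennreal (h g s i \<beta>)"])
           (use finI fin h_meas disjoint_block_set in auto)
    qed
    also have "(\<Prod>i\<in>?I. \<integral>\<^sup>+ \<beta>. ennreal (h g s i \<beta>) \<partial>PiM (?S i) (\<lambda>_. lborel)) = (\<Prod>i\<in>?I. ennreal (F i s (g i)))"
      unfolding h_def F_def using fin posdef_on
      by (intro prod.cong refl nn_integral_block g s finite_block_set sym_on_gram) auto
    also have "ennreal (A s \<alpha> * (\<Prod>i\<in>?I. hyperg_density a (g i))) = ennreal (A s \<alpha>) * (\<Prod>i\<in>?I. ennreal (hyperg_density a (g i)))"
      using A_nonneg hyperg_density_nonneg[OF a] by (simp add: ennreal_mult' prod_ennreal)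
    finally show ?thesis by (simp add: prod.distrib mult.assoc)
  qed
  have gint: "(\<integral>\<^sup>+ g. ennreal (A s \<alpha>) * (\<Prod>i\<in>?I. ennreal (hyperg_density a (g i)) * ennreal (F i s (g i))) \<partial>PiM ?I (\<lambda>_. lborel))
     = ennreal (A s \<alpha>) * (\<integral>\<^sup>+ g. (\<Prod>i\<in>?I. ennreal (F i s (g i))) \<partial>?H)" for s \<alpha>
  proof -
    have "(\<integral>\<^sup>+ g. ennreal (A s \<alpha>) * (\<Prod>i\<in>?I. ennreal (hyperg_density a (g i)) * ennreal (F i s (g i))) \<partial>PiM ?I (\<lambda>_. lborel))
      = ennreal (A s \<alpha>) * (\<integral>\<^sup>+ g. (\<Prod>i\<in>?I. ennreal (hyperg_density a (g i)) * ennreal (F i s (g i))) \<partial>PiM ?I (\<lambda>_. lborel))"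
      by (intro nn_integral_cmult borel_measurable_prod_ennreal measurable_compose[OF borel_measurable_PiM_component]) auto
    also have "(\<integral>\<^sup>+ g. (\<Prod>i\<in>?I. ennreal (hyperg_density a (g i)) * ennreal (F i s (g i))) \<partial>PiM ?I (\<lambda>_. lborel))
      = (\<Prod>i\<in>?I. \<integral>\<^sup>+ t. ennreal (hyperg_density a t) * ennreal (F i s t) \<partial>lborel)"
      using finI by (intro lborel_product.product_nn_integral_prod) auto
    also have "\<dots> = (\<Prod>i\<in>?I. \<integral>\<^sup>+ t. ennreal (F i s t) \<partial>hyperg a)"
      unfolding hyperg_def by (intro prod.cong refl nn_integral_density[symmetric]) auto
    also have "\<dots> = (\<integral>\<^sup>+ g. (\<Prod>i\<in>?I. ennreal (F i s (g i))) \<partial>?H)"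
      by (intro nn_integral_PiM_subset_prod[symmetric] a fin sub) auto
    finally show ?thesis .
  qed
  have aint: "(\<integral>\<^sup>+ \<alpha>. ennreal (A s \<alpha>) * c \<partial>lborel) = ennreal (A' s) * c" for s c
  proof (cases "0 < s")
    case True
    have "(\<integral>\<^sup>+ \<alpha>. ennreal (A s \<alpha>) * c \<partial>lborel) = (\<integral>\<^sup>+ \<alpha>. ennreal (A s \<alpha>) \<partial>lborel) * c"
      by (rule nn_integral_multc) (simp add: A_def)
    also have "(\<integral>\<^sup>+ \<alpha>. ennreal (A s \<alpha>) \<partial>lborel)
      = (\<integral>\<^sup>+ \<alpha>. ennreal (indicator {0<..} s / s * (1 / sqrt (2 * pi * s)) ^ n) * ennreal (exp (- (\<Sum>r<n. (y r - \<alpha>)\<^sup>2) / (2 * s))) \<partial>lborel)"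
      unfolding A_def using True by (intro nn_integral_cong ennreal_mult') simp
    also have "\<dots> = ennreal (indicator {0<..} s / s * (1 / sqrt (2 * pi * s)) ^ n) * ennreal (sqrt (2 * pi * s / real n) * exp (- sst n y / (2 * s)))"
      by (subst nn_integral_cmult) (simp, simp only: nn_integral_alpha[OF True n])
    also have "\<dots> = ennreal (A' s)"
      using True by (subst ennreal_mult'[symmetric]) (simp_all add: A'_def mult.assoc)
    finally show ?thesis .
  qed (simp add: A_def A'_def)
  have Fg: "(\<lambda>(g, s). \<Prod>i\<in>?I. ennreal (F i s (g i))) \<in> borel_measurable (?H \<Otimes>\<^sub>M lborel)"
  proof -
    have [measurable]: "(\<lambda>x. fst x i) \<in> borel_measurable (?H \<Otimes>\<^sub>M lborel)" if "i \<in> ?I" for i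
      using that sub by (intro measurable_compose[OF measurable_fst PiM_component_measurable_hyperg]) auto
    show ?thesis unfolding split_beta
      by (intro borel_measurable_prod_ennreal measurable_compose[OF _ measurable_ennreal]) measurable
  qed
  have A'_meas [measurable]: "A' \<in> borel_measurable borel" unfolding A'_def[abs_def] by measurable
  have "marg_lik a X blk n \<gamma> y = (\<integral>\<^sup>+ s. ennreal (A' s) * (\<integral>\<^sup>+ g. (\<Prod>i\<in>?I. ennreal (F i s (g i))) \<partial>?H) \<partial>lborel)"
    unfolding marg_lik_def inner gint aint ..
  also have "\<dots> = (\<integral>\<^sup>+ s. \<integral>\<^sup>+ g. ennreal (A' s) * (\<Prod>i\<in>?I. ennreal (F i s (g i))) \<partial>?H \<partial>lborel)"
    using measurable_Pair1'[THEN measurable_compose, OF _ Fg] measurable_compose[OF measurable_Pair2' Fg]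
    by (intro nn_integral_cong nn_integral_cmult[symmetric]) simp
  \<comment> \<open>Tonelli exchanges \<open>s\<close> and \<open>g\<close>; \<open>Fg\<close>
    supplies the joint measurability.\<close>
  also have "\<dots> = (\<integral>\<^sup>+ g. \<integral>\<^sup>+ s. ennreal (A' s) * (\<Prod>i\<in>?I. ennreal (F i s (g i))) \<partial>lborel \<partial>?H)"
  proof (rule pair_sigma_finite.Fubini')
    show "pair_sigma_finite ?H lborel"
      by (intro pair_sigma_finite.intro PB.P.sigma_finite_measure_axioms lborel.sigma_finite_measure_axioms)
    show "(\<lambda>(g, s). ennreal (A' s) * (\<Prod>i\<in>?I. ennreal (F i s (g i)))) \<in> borel_measurable (?H \<Otimes>\<^sub>M lborel)"
      using Fg unfolding split_beta by measurable
  qed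
  also have "\<dots> = (\<integral>\<^sup>+ g. ennreal (\<Prod>i\<in>?I. (1 + g i) powr (- real (card (?S i)) / 2))
    * sigma2_integral n (sst n y - (\<Sum>i\<in>?I. g i / (1 + g i) * inv_quad (?S i) ?G ?b)) \<partial>?H)"
  proof (intro nn_integral_cong)
    fix g
    let ?p = "\<Prod>i\<in>?I. (1 + g i) powr (- real (card (?S i)) / 2)"
    let ?h = "sst n y - (\<Sum>i\<in>?I. g i / (1 + g i) * inv_quad (?S i) ?G ?b)"
    have "ennreal (A' s) * (\<Prod>i\<in>?I. ennreal (F i s (g i))) = ennreal ?p * ennreal (indicator {0<..} s / s * (1 / sqrt (2 * pi * s)) ^ n
        * sqrt (2 * pi * s / real n) * exp (- ?h / (2 * s)))" for s
    proof -
      have "(\<Prod>i\<in>?I. F i s (g i)) = ?p * exp (\<Sum>i\<in>?I. g i / (1 + g i) * inv_quad (?S i) ?G ?b / (2 * s))"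
        unfolding F_def prod.distrib exp_sum[OF finI] ..
      also have "(\<Sum>i\<in>?I. g i / (1 + g i) * inv_quad (?S i) ?G ?b / (2 * s)) = (\<Sum>i\<in>?I. g i / (1 + g i) * inv_quad (?S i) ?G ?b) / (2 * s)"
        by (simp only: sum_divide_distrib)
      finally have 1: "(\<Prod>i\<in>?I. F i s (g i)) = ?p * exp (\<dots>)" .
      have "- ?h / (2 * s) = - sst n y / (2 * s) + (\<Sum>i\<in>?I. g i / (1 + g i) * inv_quad (?S i) ?G ?b) / (2 * s)"
        by (simp add: diff_divide_distrib)
      then have 2: "exp (- ?h / (2 * s)) = exp (- sst n y / (2 * s)) * exp ((\<Sum>i\<in>?I. g i / (1 + g i) * inv_quad (?S i) ?G ?b) / (2 * s))"
        by (simp only: exp_add)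
      have "ennreal (A' s) * (\<Prod>i\<in>?I. ennreal (F i s (g i))) = ennreal (A' s * (\<Prod>i\<in>?I. F i s (g i)))"
        using A_nonneg F_nonneg by (simp add: prod_ennreal ennreal_mult' prod_nonneg)
      also have "A' s * (\<Prod>i\<in>?I. F i s (g i)) = ?p * (indicator {0<..} s / s * (1 / sqrt (2 * pi * s)) ^ n
        * sqrt (2 * pi * s / real n) * exp (- ?h / (2 * s)))"
        unfolding 1 2 A'_def by (simp only: mult_ac)
      also have "ennreal \<dots> = ennreal ?p * ennreal (indicator {0<..} s / s * (1 / sqrt (2 * pi * s)) ^ n
        * sqrt (2 * pi * s / real n) * exp (- ?h / (2 * s)))"
        by (intro ennreal_mult' prod_nonneg) simp
      finally show ?thesis .
    qed
    then show "(\<integral>\<^sup>+ s. ennreal (A' s) * (\<Prod>i\<in>?I. ennreal (F i s (g i))) \<partial>lborel) = ennreal ?p * sigma2_integral n ?h"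
      unfolding sigma2_integral_def by (subst nn_integral_cmult[symmetric]) auto
  qed
  finally show ?thesis .
qed

section \<open>The integral over the error variance\<close>

lemma sigma2_integral_measurable [measurable]: "sigma2_integral n \<in> borel_measurable borel"
  unfolding sigma2_integral_def[abs_def] by measurable

text \<open>Substituting h s for s: the measure ds / s is invariant, the n normal factors give
  h^(-n/2), and the square root left by the integral over \<alpha> gives one factor h^(1/2)
  back.\<close>

lemma sigma2_integral_scale:
  assumes "0 < h" "0 < n"
  shows "sigma2_integral n h = ennreal (h powr (- (real n - 1) / 2)) * sigma2_integral n 1"
proof -
  let ?f = "\<lambda>h s. indicator {0<..} s / s * (1 / sqrt (2 * pi * s)) ^ n * sqrt (2 * pi * s / real n) * exp (- h / (2 * s)) :: real"
  have "sigma2_integral n h = ennreal h * (\<integral>\<^sup>+ s. ennreal (?f h (0 + h * s)) \<partial>lborel)"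
    unfolding sigma2_integral_def using assms
    by (subst nn_integral_real_affine[where c=h and t=0]) auto
  also have "\<dots> = (\<integral>\<^sup>+ s. ennreal h * ennreal (?f h (0 + h * s)) \<partial>lborel)"
    by (intro nn_integral_cmult[symmetric]) auto
  also have "\<dots> = (\<integral>\<^sup>+ s. ennreal (h powr (- (real n - 1) / 2)) * ennreal (?f 1 s) \<partial>lborel)"
  proof (intro nn_integral_cong)
    fix s :: real
    have e: "h * ?f h (h * s) = h powr (- (real n - 1) / 2) * ?f 1 s"
    proof (cases "0 < s")
      case True
      have "(1 / sqrt h) ^ n * sqrt h = h powr (- (real n - 1) / 2)"
      proof -
        have "(1 / sqrt h) ^ n = (h powr (- 1 / 2)) ^ n"
          using assms by (simp add: powr_minus powr_half_sqrt inverse_eq_divide)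
        also have "\<dots> = h powr (- real n / 2)"
          using assms by (simp add: powr_realpow[symmetric] powr_powr)
        finally have 1: "(1 / sqrt h) ^ n = h powr (- real n / 2)" .
        have 2: "sqrt h = h powr (1 / 2)" using assms by (simp add: powr_half_sqrt)
        have 3: "- (real n - 1) / 2 = - real n / 2 + 1 / 2" by (simp add: field_simps)
        show ?thesis unfolding 1 3 powr_add unfolding 2 ..
      qed
      moreover have "(1 / sqrt (2 * pi * (h * s))) ^ n = (1 / sqrt h) ^ n * (1 / sqrt (2 * pi * s)) ^ n"
        by (simp add: power_mult_distrib[symmetric] real_sqrt_mult mult_ac)
      moreover have "sqrt (2 * pi * (h * s) / real n) = sqrt h * sqrt (2 * pi * s / real n)"
        by (simp add: real_sqrt_mult[symmetric] mult_ac)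
      moreover have "- h / (2 * (h * s)) = - 1 / (2 * s)" using assms by simp
      ultimately show ?thesis using True assms by (simp add: mult_ac)
    next
      case False
      then have "\<not> 0 < h * s" using assms by (simp add: zero_less_mult_iff)
      then show ?thesis using False by simp
    qed
    show "ennreal h * ennreal (?f h (0 + h * s)) = ennreal (h powr (- (real n - 1) / 2)) * ennreal (?f 1 s)"
      by (simp only: ennreal_mult'[symmetric] powr_ge_zero less_imp_le[OF assms(1)] add_0_left e)
  qed
  also have "\<dots> = ennreal (h powr (- (real n - 1) / 2)) * sigma2_integral n 1"
    unfolding sigma2_integral_def by (intro nn_integral_cmult) auto
  finally show ?thesis .
qed

lemma sigma2_integral_one_pos: "0 < n \<Longrightarrow> 0 < sigma2_integral n 1"
proof -
  assume n: "0 < n"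
  let ?f = "\<lambda>s. indicator {0<..} s / s * (1 / sqrt (2 * pi * s)) ^ n * sqrt (2 * pi * s / real n) * exp (- 1 / (2 * s)) :: real"
  have "sigma2_integral n 1 \<noteq> 0"
  proof
    assume "sigma2_integral n 1 = 0"
    then have AE: "AE s in lborel. ennreal (?f s) = 0"
      unfolding sigma2_integral_def by (subst (asm) nn_integral_0_iff_AE) auto
    have pos: "ennreal (?f s) \<noteq> 0" if "0 < s" for s
      using that n by simp
    from AE have "AE s in lborel. s \<notin> {0<..1::real}"
      by eventually_elim (metis pos greaterThanAtMost_iff)
    then have "{0<..1::real} \<in> null_sets lborel" by (subst AE_iff_null_sets) auto
    then have "emeasure lborel {0<..1::real} = 0" by auto
    then show False by simp
  qed
  then show ?thesis by (simp add: zero_less_iff_neq_zero)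
qed

text \<open>At infinity the integrand decays like s^(-(n+1)/2), integrable from n = 2 on; near 0 the
  exponential beats every power. Finiteness matters because \<open>enn2real\<close> sends infinity
  to 0, and the constant could then not be cancelled from the Bayes factor.\<close>

lemma sigma2_integral_one_finite:
  assumes "2 \<le> n"
  shows "sigma2_integral n 1 < \<infinity>"
proof -
  let ?f = "\<lambda>s. indicator {0<..} s / s * (1 / sqrt (2 * pi * s)) ^ n * sqrt (2 * pi * s / real n) * exp (- 1 / (2 * s)) :: real"
  define c where "c = (1 / sqrt (2 * pi)) ^ n * sqrt (2 * pi / real n)"
  have c: "0 \<le> c" by (simp add: c_def)
  have sp: "?f s = c * (s powr (- (real n + 1) / 2) * exp (- 1 / (2 * s)))" if "0 < s" for s
  proof -
    have "1 / s * (1 / sqrt s) ^ n * sqrt s = s powr (-1) * (s powr (- real n / 2)) * s powr (1 / 2)"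
    proof -
      have "(1 / sqrt s) ^ n = (s powr (- 1 / 2)) ^ n"
        using that by (simp add: powr_minus powr_half_sqrt inverse_eq_divide)
      also have "\<dots> = s powr (- real n / 2)" using that by (simp add: powr_realpow[symmetric] powr_powr)
      finally show ?thesis using that by (simp add: powr_half_sqrt powr_minus inverse_eq_divide)
    qed
    also have "\<dots> = s powr (- 1 + - real n / 2 + 1 / 2)" by (simp only: powr_add)
    also have "- 1 + - real n / 2 + 1 / 2 = - (real n + 1) / 2" by (simp add: field_simps)
    finally have 1: "1 / s * (1 / sqrt s) ^ n * sqrt s = s powr (- (real n + 1) / 2)" .
    have "?f s = 1 / s * ((1 / sqrt (2 * pi)) ^ n * (1 / sqrt s) ^ n) * (sqrt (2 * pi / real n) * sqrt s) * exp (- 1 / (2 * s))"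
      using that by (simp add: real_sqrt_mult real_sqrt_divide power_mult_distrib power_divide)
    then show ?thesis unfolding 1[symmetric] c_def by (simp only: mult_ac)
  qed
  \<comment> \<open>For s \<le> 1 the power is dominated by s^(-(n+1)) = (2 x)^k with x = 1 / (2 s),
    an integer power, and (x / k)^k \<le> exp x.\<close>
  define k where "k = n + 1"
  have small: "s powr (- (real n + 1) / 2) * exp (- 1 / (2 * s)) \<le> (2 * real k) ^ k" if "0 < s" "s \<le> 1" for s
  proof -
    define x where "x = 1 / (2 * s)"
    have x: "0 < x" using that by (simp add: x_def)
    have "x / real k \<le> exp (x / real k)" using exp_ge_add_one_self[of "x / real k"] by linarith
    then have "(x / real k) ^ k \<le> exp (x / real k) ^ k" using x by (intro power_mono) auto
    also have "\<dots> = exp (real k * (x / real k))" by (rule exp_of_nat_mult[symmetric])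
    also have "real k * (x / real k) = x" by (simp add: k_def)
    finally have "(2 * real k) ^ k * (x / real k) ^ k \<le> (2 * real k) ^ k * exp x"
      by (intro mult_left_mono) auto
    moreover have "2 * real k * (x / real k) = 2 * x"
    proof -
      have "real k \<noteq> 0" by (simp add: k_def)
      then show ?thesis by simp
    qed
    ultimately have "(2 * x) ^ k \<le> (2 * real k) ^ k * exp x"
      by (simp only: power_mult_distrib[symmetric])
    moreover have "s powr (- (real n + 1) / 2) \<le> s powr (- (real n + 1))"
      using that by (intro powr_mono') auto
    moreover have "s powr (- (real n + 1)) = (2 * x) ^ k"
    proof -
      have "s powr (- (real n + 1)) = 1 / s powr real k" by (simp add: k_def powr_minus[symmetric] inverse_eq_divide[symmetric] add.commute)
      also have "\<dots> = (1 / s) ^ k" using that by (simp add: powr_realpow power_divide)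
      also have "1 / s = 2 * x" by (simp add: x_def)
      finally show ?thesis .
    qed
    ultimately have "s powr (- (real n + 1) / 2) \<le> (2 * real k) ^ k * exp x" by linarith
    then have "s powr (- (real n + 1) / 2) * exp (- x) \<le> (2 * real k) ^ k * exp x * exp (- x)"
      by (intro mult_right_mono) auto
    then show ?thesis by (simp add: x_def mult.assoc exp_add[symmetric])
  qed
  have large: "s powr (- (real n + 1) / 2) * exp (- 1 / (2 * s)) \<le> s powr (- 3 / 2)" if "1 \<le> s" for s
  proof -
    have "s powr (- (real n + 1) / 2) \<le> s powr (- 3 / 2)"
      using that assms by (intro powr_mono) auto
    moreover have "exp (- 1 / (2 * s)) \<le> 1" using that by simp
    ultimately show ?thesis using mult_mono[of _ "s powr (- 3 / 2)" "exp (- 1 / (2 * s))" 1] by simp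
  qed
  have "sigma2_integral n 1 \<le> (\<integral>\<^sup>+ s. ennreal c * (ennreal ((2 * real k) ^ k) * indicator {0..1} s + ennreal (s powr (- 3 / 2)) * indicator {1..} s) \<partial>lborel)"
    unfolding sigma2_integral_def
  proof (intro nn_integral_mono)
    fix s :: real
    consider "s \<le> 0" | "0 < s" "s \<le> 1" | "1 < s" by linarith
    then show "ennreal (?f s) \<le> ennreal c * (ennreal ((2 * real k) ^ k) * indicator {0..1} s + ennreal (s powr (- 3 / 2)) * indicator {1..} s)"
    proof cases
      case 2
      have "ennreal (?f s) \<le> ennreal c * ennreal ((2 * real k) ^ k)"
        unfolding sp[OF 2(1)] using small[OF 2] c by (simp add: ennreal_mult'[symmetric] mult_left_mono)
      also have "\<dots> \<le> ennreal c * (ennreal ((2 * real k) ^ k) * indicator {0..1} s + ennreal (s powr (- 3 / 2)) * indicator {1..} s)"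
        using 2 by (intro mult_left_mono) auto
      finally show ?thesis .
    next
      case 3
      have "ennreal (?f s) \<le> ennreal c * ennreal (s powr (- 3 / 2))"
        using sp[of s] large[of s] 3 c by (simp add: ennreal_mult'[symmetric] mult_left_mono)
      then show ?thesis using 3 by simp
    qed simp
  qed
  also have "\<dots> = ennreal c * (ennreal ((2 * real k) ^ k) + (\<integral>\<^sup>+ s. ennreal (s powr (- 3 / 2)) * indicator {1..} s \<partial>lborel))"
    by (simp add: nn_integral_cmult nn_integral_add)
  also have "(\<integral>\<^sup>+ s. ennreal (s powr (- 3 / 2)) * indicator {1..} s \<partial>lborel) = ennreal (0 - (- 2 * 1 powr (- 1 / 2)))"
  proof (rule nn_integral_FTC_atLeast[where F="\<lambda>x. - 2 * x powr (- 1 / 2)"])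
    fix x :: real assume "1 \<le> x"
    then show "((\<lambda>x. - 2 * x powr (- 1 / 2)) has_real_derivative x powr (- 3 / 2)) (at x)"
      by (auto intro!: derivative_eq_intros)
  next
    have "((\<lambda>x::real. x powr (- 1 / 2)) \<longlongrightarrow> 0) at_top"
      by (intro tendsto_neg_powr filterlim_ident) auto
    from tendsto_mult_left[OF this, of "- 2"] show "((\<lambda>x::real. - 2 * x powr (- 1 / 2)) \<longlongrightarrow> 0) at_top" by simp
  qed auto
  also have "ennreal c * (ennreal ((2 * real k) ^ k) + ennreal (0 - (- 2 * 1 powr (- 1 / 2)))) < \<infinity>"
    by (simp add: ennreal_mult_eq_top_iff less_top[symmetric])
  finally show ?thesis .
qed

section \<open>Asymptotics of hyper-$g$ integrals\<close>

definition shrink_weight :: "nat set \<Rightarrow> (nat \<Rightarrow> nat) \<Rightarrow> (nat \<Rightarrow> real) \<Rightarrow> real" where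
  "shrink_weight I d g = (\<Prod>i\<in>I. (1 + g i) powr (- real (d i) / 2))"

definition shrunk_rss :: "nat set \<Rightarrow> real \<Rightarrow> (nat \<Rightarrow> real) \<Rightarrow> (nat \<Rightarrow> real) \<Rightarrow> real" where
  "shrunk_rss I S q g = S - (\<Sum>i\<in>I. g i / (1 + g i) * q i)"

text \<open>\<open>m\<close> stands for (n - 1)/2, the exponent found in
  \<open>sigma2_integral_scale\<close>. The law runs over all of \<open>B\<close>, although the
  integrand reads the blocks in \<open>I\<close>, so that different models share one probability
  space.\<close>

definition hyperg_integral :: "real \<Rightarrow> nat set \<Rightarrow> nat set \<Rightarrow> (nat \<Rightarrow> nat) \<Rightarrow> real \<Rightarrow> real \<Rightarrow> (nat \<Rightarrow> real) \<Rightarrow> ennreal" where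
  "hyperg_integral a B I d m S q = (\<integral>\<^sup>+ g. ennreal (shrink_weight I d g * shrunk_rss I S q g powr (- m)) \<partial>PiM B (\<lambda>_. hyperg a))"

text \<open>With u = t / (1 + t) and a > 2 this is (a - 2)/(a + d - 2) times Kummer's function
  1F1(1; (a + d)/2; x): what a null block of \<open>d\<close> predictors contributes in the
  limit.\<close>

definition psi :: "real \<Rightarrow> nat \<Rightarrow> real \<Rightarrow> ennreal" where
  "psi a d x = (\<integral>\<^sup>+ t. ennreal ((1 + t) powr (- real d / 2) * exp (t / (1 + t) * x)) \<partial>hyperg a)"

section \<open>Bounds at a fixed sample size\<close>

lemma shrink_weight_nonneg: "0 \<le> shrink_weight I d g"
  by (simp add: shrink_weight_def prod_nonneg)

lemma shrink_weight_le_1: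
  assumes "\<And>i. i \<in> I \<Longrightarrow> 0 < g i"
  shows "shrink_weight I d g \<le> 1"
  unfolding shrink_weight_def
proof (intro prod_le_1 conjI)
  fix i assume "i \<in> I"
  then show "(1 + g i) powr (- real (d i) / 2) \<le> 1"
    using assms[of i] powr_mono[of "- real (d i) / 2" 0 "1 + g i"] by simp
qed simp

lemma shrunk_rss_ge:
  assumes "finite I" "\<And>i. i \<in> I \<Longrightarrow> 0 < g i" "\<And>i. i \<in> I \<Longrightarrow> 0 \<le> q i"
  shows "S - (\<Sum>i\<in>I. q i) \<le> shrunk_rss I S q g"
  unfolding shrunk_rss_def
proof (intro diff_left_mono sum_mono)
  fix i assume i: "i \<in> I"
  then have "g i / (1 + g i) \<le> 1" using assms(2)[of i] by simp
  then show "g i / (1 + g i) * q i \<le> q i" using assms(3)[OF i] by (rule mult_left_le_one_le[rotated 2]) (use assms(2)[OF i] in simp)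
qed

lemma shrink_weight_measurable [measurable]:
  assumes "I \<subseteq> B"
  shows "shrink_weight I d \<in> borel_measurable (PiM B (\<lambda>_. hyperg a))"
proof -
  have [measurable]: "(\<lambda>g. g i) \<in> borel_measurable (PiM B (\<lambda>_. hyperg a))" if "i \<in> I" for i
    using that assms by (intro PiM_component_measurable_hyperg) auto
  show ?thesis unfolding shrink_weight_def by measurable
qed

lemma shrunk_rss_measurable [measurable]:
  assumes "I \<subseteq> B"
  shows "shrunk_rss I S q \<in> borel_measurable (PiM B (\<lambda>_. hyperg a))"
proof -
  have [measurable]: "(\<lambda>g. g i) \<in> borel_measurable (PiM B (\<lambda>_. hyperg a))" if "i \<in> I" for i
    using that assms by (intro PiM_component_measurable_hyperg) auto
  show ?thesis unfolding shrunk_rss_def by measurable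
qed

lemma prob_space_PiM_hyperg: "2 < a \<Longrightarrow> prob_space (PiM B (\<lambda>_. hyperg a))"
  by (intro prob_space_PiM prob_space_hyperg)

lemma AE_PiM_hyperg_pos:
  assumes "2 < a" "finite B"
  shows "AE g in PiM B (\<lambda>_. hyperg a). \<forall>i\<in>B. 0 < g i"
proof (rule AE_finite_allI[OF assms(2)])
  fix i assume "i \<in> B"
  then show "AE g in PiM B (\<lambda>_. hyperg a). 0 < g i"
    by (intro AE_PiM_component prob_space_hyperg assms AE_hyperg_pos)
qed

lemma nn_integral_mono_PiM_hyperg:
  assumes "2 < a" "finite B" "\<And>g. (\<And>i. i \<in> B \<Longrightarrow> 0 < g i) \<Longrightarrow> F g \<le> F' g"
  shows "(\<integral>\<^sup>+ g. F g \<partial>PiM B (\<lambda>_. hyperg a)) \<le> (\<integral>\<^sup>+ g. F' g \<partial>PiM B (\<lambda>_. hyperg a))"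
  using AE_PiM_hyperg_pos[OF assms(1,2)]
  by (intro nn_integral_mono_AE) (auto intro: assms(3))

text \<open>The weight is at most 1 and shrinkage can only enlarge the residual sum, so the unshrunk
  residual sum bounds the integrand.\<close>

lemma hyperg_integral_le:
  assumes "2 < a" "finite B" "I \<subseteq> B" "\<And>i. i \<in> I \<Longrightarrow> 0 \<le> q i" "0 < S - (\<Sum>i\<in>I. q i)" "0 \<le> m"
  shows "hyperg_integral a B I d m S q \<le> ennreal ((S - (\<Sum>i\<in>I. q i)) powr (- m))"
proof -
  interpret prob_space "PiM B (\<lambda>_. hyperg a)" by (rule prob_space_PiM_hyperg[OF assms(1)])
  have "hyperg_integral a B I d m S q \<le> (\<integral>\<^sup>+ g. ennreal ((S - (\<Sum>i\<in>I. q i)) powr (- m)) \<partial>PiM B (\<lambda>_. hyperg a))"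
    unfolding hyperg_integral_def
  proof (intro nn_integral_mono_PiM_hyperg assms(1,2) ennreal_leI)
    fix g assume g: "\<And>i. i \<in> B \<Longrightarrow> (0::real) < g i"
    have "shrunk_rss I S q g powr (- m) \<le> (S - (\<Sum>i\<in>I. q i)) powr (- m)"
      using assms g by (intro powr_mono2' shrunk_rss_ge finite_subset[OF assms(3,2)]) auto
    moreover have "shrink_weight I d g \<le> 1" using g assms(3) by (intro shrink_weight_le_1) auto
    ultimately show "shrink_weight I d g * shrunk_rss I S q g powr (- m) \<le> (S - (\<Sum>i\<in>I. q i)) powr (- m)"
      using mult_mono[of "shrink_weight I d g" 1 "shrunk_rss I S q g powr (- m)" "(S - (\<Sum>i\<in>I. q i)) powr (- m)"] by simp
  qed
  then show ?thesis by (simp add: emeasure_space_1)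
qed

text \<open>The bound is the density at the right end point x + 1, where it is smallest, times the
  length 1.\<close>

lemma emeasure_hyperg_Ioc:
  assumes "2 < a" "0 \<le> x"
  shows "ennreal ((a - 2) / 2 * (x + 2) powr (- (a / 2))) \<le> emeasure (hyperg a) {x<..x+1}"
proof -
  have "ennreal ((a - 2) / 2 * (x + 2) powr (- (a / 2))) = (\<integral>\<^sup>+ t. ennreal ((a - 2) / 2 * (x + 2) powr (- (a / 2))) * indicator {x<..x+1} t \<partial>lborel)"
    by (simp add: nn_integral_cmult)
  also have "\<dots> \<le> (\<integral>\<^sup>+ t. ennreal (hyperg_density a t) * indicator {x<..x+1} t \<partial>lborel)"
  proof (intro nn_integral_mono)
    fix t show "ennreal ((a - 2) / 2 * (x + 2) powr (- (a / 2))) * indicator {x<..x+1} t \<le> ennreal (hyperg_density a t) * indicator {x<..x+1} t"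
    proof (cases "t \<in> {x<..x+1}")
      case True
      then have "(x + 2) powr (- (a / 2)) \<le> (1 + t) powr (- (a / 2))"
        using assms by (intro powr_mono2') auto
      then show ?thesis using True assms by (auto simp: hyperg_density_def intro!: ennreal_leI mult_left_mono)
    qed simp
  qed
  also have "\<dots> = emeasure (hyperg a) {x<..x+1}"
    unfolding hyperg_def by (subst emeasure_density) auto
  finally show ?thesis .
qed

text \<open>The integral is cut down to the box where every g_i with i in \<open>I\<close> lies in
  (x, x + 1]. There the shrunk residual sum exceeds the unshrunk one by at most the explained sum
  over x + 1, while weight and prior mass cost a power of x + 2 per block.\<close>

lemma hyperg_integral_lower:
  assumes a: "2 < a" and B: "finite B" "I \<subseteq> B" and q: "\<And>i. i \<in> I \<Longrightarrow> 0 \<le> q i"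
    and R: "0 < S - (\<Sum>i\<in>I. q i)" and "0 \<le> m" "0 \<le> x"
  shows "ennreal ((\<Prod>i\<in>I. (a - 2) / 2 * (x + 2) powr (- (a + real (d i)) / 2))
      * (S - (\<Sum>i\<in>I. q i) + (\<Sum>i\<in>I. q i) / (x + 1)) powr (- m)) \<le> hyperg_integral a B I d m S q"
proof -
  let ?R = "S - (\<Sum>i\<in>I. q i)"
  define h0 where "h0 = ?R + (\<Sum>i\<in>I. q i) / (x + 1)"
  have fin: "finite I" using B finite_subset by blast
  let ?f = "\<lambda>i t. ennreal ((x + 2) powr (- real (d i) / 2)) * indicator {x<..x+1} t :: ennreal"
  have "ennreal ((\<Prod>i\<in>I. (a - 2) / 2 * (x + 2) powr (- (a + real (d i)) / 2)) * h0 powr (- m))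
     = (\<Prod>i\<in>I. ennreal ((x + 2) powr (- real (d i) / 2)) * ennreal ((a - 2) / 2 * (x + 2) powr (- (a / 2)))) * ennreal (h0 powr (- m))"
  proof -
    have e: "(a - 2) / 2 * (x + 2) powr (- (a + real (d i)) / 2)
       = (x + 2) powr (- real (d i) / 2) * ((a - 2) / 2 * (x + 2) powr (- (a / 2)))" for i
    proof -
      have "- (a + real (d i)) / 2 = - real (d i) / 2 + - (a / 2)" by (simp add: field_simps)
      then show ?thesis by (simp only: powr_add mult_ac)
    qed
    have nn: "0 \<le> (x + 2) powr (- real (d i) / 2) * ((a - 2) / 2 * (x + 2) powr (- (a / 2)))" for i
      using a by simp
    show ?thesis
      by (simp only: e ennreal_mult'[symmetric] powr_ge_zero prod_ennreal prod_nonneg nn)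
  qed
  also have "\<dots> \<le> (\<Prod>i\<in>I. \<integral>\<^sup>+ t. ?f i t \<partial>hyperg a) * ennreal (h0 powr (- m))"
    using emeasure_hyperg_Ioc[OF a assms(7)]
    by (intro mult_right_mono prod_mono_ennreal) (auto simp: nn_integral_cmult intro!: mult_left_mono)
  also have "(\<Prod>i\<in>I. \<integral>\<^sup>+ t. ?f i t \<partial>hyperg a) = (\<integral>\<^sup>+ g. (\<Prod>i\<in>I. ?f i (g i)) \<partial>PiM B (\<lambda>_. hyperg a))"
    by (intro nn_integral_PiM_subset_prod[symmetric] a B) auto
  also have "\<dots> * ennreal (h0 powr (- m)) = (\<integral>\<^sup>+ g. (\<Prod>i\<in>I. ?f i (g i)) * ennreal (h0 powr (- m)) \<partial>PiM B (\<lambda>_. hyperg a))"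
    using B by (intro nn_integral_multc[symmetric] borel_measurable_prod_ennreal measurable_compose[OF PiM_component_measurable_hyperg]) auto
  also have "\<dots> \<le> hyperg_integral a B I d m S q"
    unfolding hyperg_integral_def
  proof (intro nn_integral_mono_PiM_hyperg a B(1))
    fix g assume g: "\<And>i. i \<in> B \<Longrightarrow> (0::real) < g i"
    show "(\<Prod>i\<in>I. ?f i (g i)) * ennreal (h0 powr (- m)) \<le> ennreal (shrink_weight I d g * shrunk_rss I S q g powr (- m))"
    proof (cases "\<forall>i\<in>I. g i \<in> {x<..x+1}")
      case False
      then obtain i where i: "i \<in> I" "g i \<notin> {x<..x+1}" by blast
      have z: "(\<Prod>i\<in>I. ?f i (g i)) = 0"
        using i by (intro prod_zero fin bexI[of _ i]) (simp_all add: indicator_def)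
      show ?thesis by (simp only: z mult_zero_left zero_le)
    next
      case True
      then have g2: "x < g i" "g i \<le> x + 1" if "i \<in> I" for i using that by auto
      have "shrunk_rss I S q g \<le> h0"
      proof -
        have "(\<Sum>i\<in>I. q i) - (\<Sum>i\<in>I. q i) / (x + 1) = (\<Sum>i\<in>I. x / (1 + x) * q i)"
          unfolding sum_distrib_left[symmetric] using assms(7) by (simp add: field_simps)
        also have "\<dots> \<le> (\<Sum>i\<in>I. g i / (1 + g i) * q i)"
        proof (intro sum_mono mult_right_mono q)
          fix i assume "i \<in> I"
          then show "x / (1 + x) \<le> g i / (1 + g i)"
            using g2[of i] assms(7) by (simp add: field_simps)
        qed
        finally show ?thesis unfolding shrunk_rss_def h0_def by linarith
      qed
      moreover have "?R \<le> shrunk_rss I S q g" using g B q by (intro shrunk_rss_ge fin) auto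
      ultimately have h: "h0 powr (- m) \<le> shrunk_rss I S q g powr (- m)"
        using R assms(6) by (intro powr_mono2') auto
      have "(\<Prod>i\<in>I. ?f i (g i)) = ennreal (\<Prod>i\<in>I. (x + 2) powr (- real (d i) / 2))"
        using True by (subst prod_ennreal[symmetric]) (auto intro!: prod.cong)
      moreover have "(\<Prod>i\<in>I. (x + 2) powr (- real (d i) / 2)) \<le> shrink_weight I d g"
        unfolding shrink_weight_def
      proof (intro prod_mono conjI)
        fix i assume "i \<in> I"
        then show "(x + 2) powr (- real (d i) / 2) \<le> (1 + g i) powr (- real (d i) / 2)"
          using g2[of i] assms(7) by (intro powr_mono2') auto
      qed simp
      ultimately show ?thesis using h
        by (simp add: ennreal_mult'[symmetric] prod_nonneg mult_mono shrink_weight_nonneg)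
    qed
  qed
  finally show ?thesis by (simp add: h0_def)
qed

text \<open>Both power comparisons are ln z \<le> z - 1 at a ratio of \<open>h\<close> and the
  shifted value. Here the lower bound \<open>R\<close> on the shifted value makes the exponential
  factor independent of \<open>h\<close>.\<close>

lemma powr_shift_le:
  fixes h C R m :: real
  assumes "0 \<le> C" "R \<le> h - C" "0 < R" "0 \<le> m"
  shows "(h - C) powr (- m) \<le> h powr (- m) * exp (m * C / R)"
proof -
  have pos: "0 < h - C" "0 < h" using assms by auto
  have "ln (h / (h - C)) \<le> h / (h - C) - 1" using pos by (intro ln_le_minus_one) auto
  also have "\<dots> = C / (h - C)" using pos by (simp add: field_simps)
  also have "\<dots> \<le> C / R" using assms pos by (intro divide_left_mono) auto
  finally have "m * ln (h / (h - C)) \<le> m * (C / R)" using assms(4) by (rule mult_left_mono)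
  then have "- m * ln (h - C) \<le> - m * ln h + m * C / R"
    using pos by (simp add: ln_div algebra_simps)
  then show ?thesis using pos by (simp add: powr_def exp_add[symmetric])
qed

text \<open>This direction is uniform for \<open>h\<close> below a level \<open>H\<close>, which is
  why regions with a large residual sum need separate treatment.\<close>

lemma powr_shift_ge:
  fixes h t H m :: real
  assumes "0 \<le> t" "0 < h - t" "h \<le> H" "0 \<le> m"
  shows "h powr (- m) * exp (m * t / H) \<le> (h - t) powr (- m)"
proof -
  have pos: "0 < h" using assms by linarith
  have "ln ((h - t) / h) \<le> (h - t) / h - 1" using pos assms by (intro ln_le_minus_one) auto
  also have "\<dots> = - (t / h)" using pos by (simp add: field_simps)
  also have "\<dots> \<le> - (t / H)" using assms pos by (simp add: divide_left_mono)
  finally have "m * ln ((h - t) / h) \<le> m * - (t / H)" using assms(4) by (rule mult_left_mono)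
  then have "- m * ln h + m * t / H \<le> - m * ln (h - t)"
    using pos assms by (simp add: ln_div algebra_simps)
  then show ?thesis using pos assms by (simp add: powr_def exp_add[symmetric])
qed

text \<open>An extra predictor in block \<open>i0\<close> contributes at most the square root of u =
  1 / (1 + g_i0). Where u \<le> \<delta> this factor is small; where u > \<delta> the block is
  visibly shrunk, and the residual sum exceeds its minimum by at least \<delta> times
  \<open>q i0\<close>. Passing from \<open>q\<close> to \<open>q'\<close> shifts the residual sum by
  at most \<open>C\<close> and costs the exponential prefactor.\<close>

lemma hyperg_integral_growing_block:
  assumes a: "2 < a" and B: "finite B" "I' \<subseteq> B" and I: "I \<subseteq> I'" "i0 \<in> I"
    and q: "\<And>i. i \<in> I \<Longrightarrow> 0 \<le> q i" "\<And>i. i \<in> I' - I \<Longrightarrow> q i = 0"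
    and d: "\<And>i. i \<in> I \<Longrightarrow> d i \<le> d' i" "d i0 < d' i0"
    and C: "(\<Sum>i\<in>I'. \<bar>q' i - q i\<bar>) \<le> C" "C < S - (\<Sum>i\<in>I. q i)"
    and m: "0 \<le> m" and \<delta>: "0 < \<delta>"
  shows "hyperg_integral a B I' d' m S q' \<le> ennreal (exp (m * C / (S - (\<Sum>i\<in>I. q i) - C))) *
    (ennreal (sqrt \<delta>) * hyperg_integral a B I d m S q + ennreal ((S - (\<Sum>i\<in>I. q i) + \<delta> * q i0) powr (- m)))"
proof -
  interpret prob_space "PiM B (\<lambda>_. hyperg a)" by (rule prob_space_PiM_hyperg[OF a])
  let ?R = "S - (\<Sum>i\<in>I. q i)"
  define e where "e = exp (m * C / (?R - C))"
  have fin: "finite I'" "finite I" using B I finite_subset by metis+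
  have C0: "0 \<le> C" by (rule order_trans[OF sum_nonneg C(1)]) simp
  have [measurable]: "shrink_weight I d \<in> borel_measurable (PiM B (\<lambda>_. hyperg a))" "shrunk_rss I S q \<in> borel_measurable (PiM B (\<lambda>_. hyperg a))"
    using B I by (auto intro!: shrink_weight_measurable shrunk_rss_measurable)
  have "hyperg_integral a B I' d' m S q' \<le> (\<integral>\<^sup>+ g. ennreal e * (ennreal (sqrt \<delta>) * ennreal (shrink_weight I d g * shrunk_rss I S q g powr (- m)) + ennreal ((?R + \<delta> * q i0) powr (- m))) \<partial>PiM B (\<lambda>_. hyperg a))"
    unfolding hyperg_integral_def
  proof (intro nn_integral_mono_PiM_hyperg a B(1))
    fix g assume g: "\<And>i. i \<in> B \<Longrightarrow> (0::real) < g i"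
    have gI: "0 < g i" if "i \<in> I'" for i using that g B by auto
    define u where "u = 1 / (1 + g i0)"
    have g0: "0 < g i0" using gI I by auto
    have u: "0 < u" using g0 by (simp add: u_def)
    have hR: "?R \<le> shrunk_rss I S q g" using gI I q by (intro shrunk_rss_ge fin) auto
    \<comment> \<open>The models are compared on the larger index set: blocks outside
      \<open>I\<close> receive dimension 0, hence weight 1.\<close>
    have "shrink_weight I' d' g \<le> shrink_weight I' (\<lambda>i. if i \<in> I then d i else 0) g * (1 + g i0) powr (- 1 / 2)"
    proof -
      have i0: "i0 \<in> I'" using I by auto
      have "(1 + g i0) powr (- real (d' i0) / 2) \<le> (1 + g i0) powr (- real (d i0) / 2 + - 1 / 2)"
        using g0 d(2) by (intro powr_mono) (auto simp: field_simps)
      then have "(1 + g i0) powr (- real (d' i0) / 2) \<le> (1 + g i0) powr (- real (d i0) / 2) * (1 + g i0) powr (- 1 / 2)"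
        by (simp only: powr_add)
      then have 1: "(1 + g i0) powr (- real (d' i0) / 2) \<le> (1 + g i0) powr (- real (if i0 \<in> I then d i0 else 0) / 2) * (1 + g i0) powr (- 1 / 2)"
        using I by simp
      have 2: "(\<Prod>i\<in>I' - {i0}. (1 + g i) powr (- real (d' i) / 2)) \<le> (\<Prod>i\<in>I' - {i0}. (1 + g i) powr (- real (if i \<in> I then d i else 0) / 2))"
      proof (intro prod_mono conjI)
        fix i assume "i \<in> I' - {i0}"
        then show "(1 + g i) powr (- real (d' i) / 2) \<le> (1 + g i) powr (- real (if i \<in> I then d i else 0) / 2)"
          using gI[of i] d(1)[of i] by (intro powr_mono) auto
      qed simp
      show ?thesis unfolding shrink_weight_def prod.remove[OF fin(1) i0]
        using mult_mono[OF 1 2] by (simp add: prod_nonneg mult_ac)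
    qed
    also have "shrink_weight I' (\<lambda>i. if i \<in> I then d i else 0) g = shrink_weight I d g"
      unfolding shrink_weight_def
    proof (intro prod.mono_neutral_cong_right fin I ballI)
      fix i assume "i \<in> I' - I"
      then show "(1 + g i) powr (- real (if i \<in> I then d i else 0) / 2) = 1" using gI[of i] by simp
    qed simp
    also have "(1 + g i0) powr (- 1 / 2) = sqrt u"
      using g0 by (simp add: u_def powr_minus powr_half_sqrt real_sqrt_divide inverse_eq_divide)
    finally have shrink_weight: "shrink_weight I' d' g \<le> shrink_weight I d g * sqrt u" .
    have "shrunk_rss I S q g = shrunk_rss I' S q g"
      unfolding shrunk_rss_def using I fin q by (intro arg_cong2[where f="(-)"] refl sum.mono_neutral_left) auto
    moreover have "\<bar>shrunk_rss I' S q' g - shrunk_rss I' S q g\<bar> \<le> C"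
    proof -
      have "shrunk_rss I' S q' g - shrunk_rss I' S q g = (\<Sum>i\<in>I'. g i / (1 + g i) * (q i - q' i))"
        unfolding shrunk_rss_def right_diff_distrib by (simp add: sum_subtractf)
      also have "\<bar>\<dots>\<bar> \<le> (\<Sum>i\<in>I'. \<bar>g i / (1 + g i) * (q i - q' i)\<bar>)" by (rule sum_abs)
      also have "\<dots> \<le> (\<Sum>i\<in>I'. \<bar>q' i - q i\<bar>)"
      proof (intro sum_mono)
        fix i assume "i \<in> I'"
        from gI[OF this] have "\<bar>g i / (1 + g i)\<bar> \<le> 1" by simp
        from mult_right_mono[OF this, of "\<bar>q i - q' i\<bar>"]
        show "\<bar>g i / (1 + g i) * (q i - q' i)\<bar> \<le> \<bar>q' i - q i\<bar>"
          unfolding abs_mult by (simp add: abs_minus_commute)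
      qed
      finally show ?thesis using C(1) by linarith
    qed
    ultimately have "shrunk_rss I S q g - C \<le> shrunk_rss I' S q' g" by linarith
    then have "shrunk_rss I' S q' g powr (- m) \<le> (shrunk_rss I S q g - C) powr (- m)"
      using hR C m by (intro powr_mono2') auto
    also have "\<dots> \<le> shrunk_rss I S q g powr (- m) * e"
      unfolding e_def using hR C m C0 by (intro powr_shift_le) auto
    finally have h: "shrunk_rss I' S q' g powr (- m) \<le> shrunk_rss I S q g powr (- m) * e" .
    have "shrink_weight I' d' g * shrunk_rss I' S q' g powr (- m) \<le> e * (sqrt u * (shrink_weight I d g * shrunk_rss I S q g powr (- m)))"
      using mult_mono[OF shrink_weight h] u shrink_weight_nonneg by (simp add: mult_ac)
    also have "\<dots> \<le> e * (sqrt \<delta> * (shrink_weight I d g * shrunk_rss I S q g powr (- m)) + (?R + \<delta> * q i0) powr (- m))"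
    proof (intro mult_left_mono)
      show "sqrt u * (shrink_weight I d g * shrunk_rss I S q g powr (- m)) \<le> sqrt \<delta> * (shrink_weight I d g * shrunk_rss I S q g powr (- m)) + (?R + \<delta> * q i0) powr (- m)"
      proof (cases "u \<le> \<delta>")
        case True
        then have "sqrt u * (shrink_weight I d g * shrunk_rss I S q g powr (- m)) \<le> sqrt \<delta> * (shrink_weight I d g * shrunk_rss I S q g powr (- m))"
          using shrink_weight_nonneg by (intro mult_right_mono) auto
        then show ?thesis by (simp add: add_increasing2)
      next
        case False
        have "?R + \<delta> * q i0 \<le> shrunk_rss I S q g"
        proof -
          have "(\<Sum>i\<in>I. g i / (1 + g i) * q i) \<le> (\<Sum>i\<in>I. q i) - \<delta> * q i0"
          proof -
            have "(\<Sum>i\<in>I - {i0}. g i / (1 + g i) * q i) \<le> (\<Sum>i\<in>I - {i0}. q i)"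
            proof (intro sum_mono)
              fix i assume i: "i \<in> I - {i0}"
              then have "0 < g i" using gI I by auto
              then show "g i / (1 + g i) * q i \<le> q i" using q(1)[of i] i by (intro mult_left_le_one_le) auto
            qed
            moreover have "g i0 / (1 + g i0) * q i0 \<le> q i0 - \<delta> * q i0"
            proof -
              have e: "g i0 / (1 + g i0) = 1 - u" using g0 by (simp add: u_def field_simps)
              have "\<delta> * q i0 \<le> u * q i0" using False q(1)[OF I(2)] by (intro mult_right_mono) auto
              then show ?thesis unfolding e left_diff_distrib by linarith
            qed
            ultimately show ?thesis unfolding sum.remove[OF fin(2) I(2)] by linarith
          qed
          then show ?thesis unfolding shrunk_rss_def by linarith
        qed
        moreover have "0 < ?R + \<delta> * q i0"
          using C C0 \<delta> q(1)[OF I(2)] by (intro add_pos_nonneg) auto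
        ultimately have "shrunk_rss I S q g powr (- m) \<le> (?R + \<delta> * q i0) powr (- m)"
          using m by (intro powr_mono2') auto
        moreover have "sqrt u * shrink_weight I d g \<le> 1"
        proof (rule mult_le_one)
          show "sqrt u \<le> 1" using g0 by (simp add: u_def)
          show "shrink_weight I d g \<le> 1" using gI I by (intro shrink_weight_le_1) auto
        qed (rule shrink_weight_nonneg)
        ultimately have "sqrt u * shrink_weight I d g * shrunk_rss I S q g powr (- m) \<le> 1 * (?R + \<delta> * q i0) powr (- m)"
          using u shrink_weight_nonneg by (intro mult_mono) auto
        moreover have "0 \<le> sqrt \<delta> * (shrink_weight I d g * shrunk_rss I S q g powr (- m))" using shrink_weight_nonneg \<delta> by simp
        ultimately show ?thesis by (simp add: mult.assoc)
      qed
    qed (simp add: e_def)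
    finally have "ennreal (shrink_weight I' d' g * shrunk_rss I' S q' g powr (- m))
      \<le> ennreal (e * (sqrt \<delta> * (shrink_weight I d g * shrunk_rss I S q g powr (- m)) + (?R + \<delta> * q i0) powr (- m)))"
      by (rule ennreal_leI)
    also have "\<dots> = ennreal e * (ennreal (sqrt \<delta>) * ennreal (shrink_weight I d g * shrunk_rss I S q g powr (- m)) + ennreal ((?R + \<delta> * q i0) powr (- m)))"
      using \<delta> shrink_weight_nonneg by (simp add: ennreal_mult' e_def)
    finally show "ennreal (shrink_weight I' d' g * shrunk_rss I' S q' g powr (- m)) \<le> \<dots>" .
  qed
  also have "\<dots> = ennreal e * (ennreal (sqrt \<delta>) * hyperg_integral a B I d m S q + ennreal ((?R + \<delta> * q i0) powr (- m)))"
    unfolding hyperg_integral_def by (subst nn_integral_cmult, measurable, subst nn_integral_add, measurable, subst nn_integral_cmult, measurable)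
      (simp add: emeasure_space_1)
  finally show ?thesis by (simp add: e_def)
qed

text \<open>Independence of \<open>F\<close> from coordinate \<open>j\<close> is expressed as
  invariance under updating it. The coordinate is split off, integrated, and put back as an idle
  integral against a probability measure.\<close>

lemma nn_integral_PiM_hyperg_indep:
  fixes j :: nat
  assumes a: "2 < a" and B: "finite B" "j \<in> B" and F: "F \<in> borel_measurable (PiM B (\<lambda>_. hyperg a))"
    and f: "f \<in> borel_measurable borel" and indep: "\<And>g t. F (g(j := t)) = F g"
  shows "(\<integral>\<^sup>+ g. F g * f (g j) \<partial>PiM B (\<lambda>_. hyperg a))
    = (\<integral>\<^sup>+ g. F g \<partial>PiM B (\<lambda>_. hyperg a)) * (\<integral>\<^sup>+ t. f t \<partial>hyperg a)"
proof -
  interpret P: prob_space "hyperg a" by (rule prob_space_hyperg[OF a])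
  interpret product_sigma_finite "\<lambda>_. hyperg a" by standard
  define B' where "B' = B - {j}"
  have B': "B = insert j B'" "finite B'" "j \<notin> B'" using B by (auto simp: B'_def)
  note [measurable] = F[unfolded B'(1)] f
  have [measurable]: "(\<lambda>g. f (g j)) \<in> borel_measurable (PiM (insert j B') (\<lambda>_. hyperg a))"
    by (rule measurable_compose[OF PiM_component_measurable_hyperg f]) simp
  have f': "f \<in> borel_measurable (hyperg a)" using f by (simp add: measurable_cong_sets[OF sets_hyperg refl])
  have u: "restrict x B' = x" if "x \<in> space (PiM B' (\<lambda>_. hyperg a))" for x
    using that by (simp add: space_PiM PiE_restrict)
  have "(\<integral>\<^sup>+ g. F g * f (g j) \<partial>PiM B (\<lambda>_. hyperg a)) = (\<integral>\<^sup>+ x. \<integral>\<^sup>+ t. F x * f t \<partial>hyperg a \<partial>PiM B' (\<lambda>_. hyperg a))"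
    unfolding B'(1) by (subst product_nn_integral_insert[OF B'(2,3)]) (simp_all add: indep)
  also have "\<dots> = (\<integral>\<^sup>+ x. F x * (\<integral>\<^sup>+ t. f t \<partial>hyperg a) \<partial>PiM B' (\<lambda>_. hyperg a))"
    by (simp add: nn_integral_cmult[OF f'])
  also have "\<dots> = (\<integral>\<^sup>+ x. \<integral>\<^sup>+ s. F x * (\<integral>\<^sup>+ t. f t \<partial>hyperg a) \<partial>hyperg a \<partial>PiM B' (\<lambda>_. hyperg a))"
    using P.emeasure_space_1 by simp
  also have "\<dots> = (\<integral>\<^sup>+ g. F g * (\<integral>\<^sup>+ t. f t \<partial>hyperg a) \<partial>PiM B (\<lambda>_. hyperg a))"
    unfolding B'(1) by (subst product_nn_integral_insert[OF B'(2,3)]) (simp_all add: indep)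
  also have "\<dots> = (\<integral>\<^sup>+ g. F g \<partial>PiM B (\<lambda>_. hyperg a)) * (\<integral>\<^sup>+ t. f t \<partial>hyperg a)"
    using F by (rule nn_integral_multc)
  finally show ?thesis .
qed

lemma nn_integral_PiM_hyperg_indep_prod:
  fixes N :: "nat set"
  assumes a: "2 < a" and B: "finite B" and N: "N \<subseteq> B" and F: "F \<in> borel_measurable (PiM B (\<lambda>_. hyperg a))"
    and f: "\<And>j. j \<in> N \<Longrightarrow> f j \<in> borel_measurable borel" and indep: "\<And>g j t. j \<in> N \<Longrightarrow> F (g(j := t)) = F g"
  shows "(\<integral>\<^sup>+ g. F g * (\<Prod>j\<in>N. f j (g j)) \<partial>PiM B (\<lambda>_. hyperg a))
    = (\<integral>\<^sup>+ g. F g \<partial>PiM B (\<lambda>_. hyperg a)) * (\<Prod>j\<in>N. \<integral>\<^sup>+ t. f j t \<partial>hyperg a)"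
proof -
  have "finite N" using N B finite_subset by blast
  then show ?thesis using N f indep
  proof (induction N)
    case (insert k N)
    have meas: "(\<lambda>g. F g * (\<Prod>j\<in>N. f j (g j))) \<in> borel_measurable (PiM B (\<lambda>_. hyperg a))"
      using insert.prems F
      by (intro borel_measurable_times_ennreal borel_measurable_prod_ennreal measurable_compose[OF PiM_component_measurable_hyperg]) auto
    have "(\<integral>\<^sup>+ g. F g * (\<Prod>j\<in>insert k N. f j (g j)) \<partial>PiM B (\<lambda>_. hyperg a))
      = (\<integral>\<^sup>+ g. (F g * (\<Prod>j\<in>N. f j (g j))) * f k (g k) \<partial>PiM B (\<lambda>_. hyperg a))"
      using insert.hyps by (simp add: mult_ac)
    also have "\<dots> = (\<integral>\<^sup>+ g. F g * (\<Prod>j\<in>N. f j (g j)) \<partial>PiM B (\<lambda>_. hyperg a)) * (\<integral>\<^sup>+ t. f k t \<partial>hyperg a)"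
    proof (intro nn_integral_PiM_hyperg_indep a B meas)
      fix g :: "nat \<Rightarrow> real" and t
      have pe: "(\<Prod>j\<in>N. f j ((g(k := t)) j)) = (\<Prod>j\<in>N. f j (g j))"
        using insert.hyps by (intro prod.cong) auto
      have "F (g(k := t)) = F g" by (rule insert.prems(3)) simp
      then show "F (g(k := t)) * (\<Prod>j\<in>N. f j ((g(k := t)) j)) = F g * (\<Prod>j\<in>N. f j (g j))"
        by (simp only: pe)
    qed (use insert.prems in auto)
    also have "(\<integral>\<^sup>+ g. F g * (\<Prod>j\<in>N. f j (g j)) \<partial>PiM B (\<lambda>_. hyperg a))
       = (\<integral>\<^sup>+ g. F g \<partial>PiM B (\<lambda>_. hyperg a)) * (\<Prod>j\<in>N. \<integral>\<^sup>+ t. f j t \<partial>hyperg a)"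
      using insert.prems by (intro insert.IH) auto
    finally show ?case using insert.hyps by (simp add: mult_ac)
  qed simp
qed

text \<open>Adding the blocks in \<open>N\<close> lowers the residual sum h by \<theta>, and (h -
  \<theta>)^(-m) is compared with h^(-m) times an exponential in \<theta>, which factorises over
  \<open>N\<close> and does not read the blocks in \<open>I\<close>. The upper bound uses the
  smallest possible value of h - \<theta>; the lower bound needs h \<le> H, and the complement is
  paid for by the term with H^(-m).\<close>

lemma hyperg_integral_null_blocks:
  assumes a: "2 < a" and B: "finite B" "I \<union> N \<subseteq> B" and disj: "I \<inter> N = {}"
    and q: "\<And>i. i \<in> I \<union> N \<Longrightarrow> 0 \<le> q i" and R': "0 < S - (\<Sum>i\<in>I \<union> N. q i)" and m: "0 \<le> m"
  shows "hyperg_integral a B (I \<union> N) d m S q \<le> hyperg_integral a B I d m S q * (\<Prod>j\<in>N. psi a (d j) (m * q j / (S - (\<Sum>i\<in>I \<union> N. q i))))"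
    and "0 < H \<Longrightarrow> hyperg_integral a B I d m S q * (\<Prod>j\<in>N. psi a (d j) (m * q j / H))
      \<le> hyperg_integral a B (I \<union> N) d m S q + ennreal (H powr (- m)) * (\<Prod>j\<in>N. psi a (d j) (m * q j / H))"
proof -
  interpret prob_space "PiM B (\<lambda>_. hyperg a)" by (rule prob_space_PiM_hyperg[OF a])
  let ?R = "S - (\<Sum>i\<in>I. q i)" and ?R' = "S - (\<Sum>i\<in>I \<union> N. q i)"
  have fin: "finite I" "finite N" using B finite_subset[of _ B] by auto
  let ?f = "\<lambda>H j t. ennreal ((1 + t) powr (- real (d j) / 2) * exp (t / (1 + t) * (m * q j / H)))"
  have [measurable]: "shrink_weight I d \<in> borel_measurable (PiM B (\<lambda>_. hyperg a))" "shrunk_rss I S q \<in> borel_measurable (PiM B (\<lambda>_. hyperg a))"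
    using B by (auto intro!: shrink_weight_measurable shrunk_rss_measurable)
  have fm: "?f H j \<in> borel_measurable borel" for H j by measurable
  have upd: "shrink_weight I d (g(j := t)) = shrink_weight I d g" "shrunk_rss I S q (g(j := t)) = shrunk_rss I S q g" if "j \<in> N" for g j t
    using that disj by (auto simp: shrink_weight_def shrunk_rss_def intro!: prod.cong sum.cong)
  have split: "(\<integral>\<^sup>+ g. ennreal (shrink_weight I d g * shrunk_rss I S q g powr (- m)) * (\<Prod>j\<in>N. ?f H j (g j)) \<partial>PiM B (\<lambda>_. hyperg a))
     = hyperg_integral a B I d m S q * (\<Prod>j\<in>N. psi a (d j) (m * q j / H))" for H
    unfolding hyperg_integral_def psi_def
    using B by (intro nn_integral_PiM_hyperg_indep_prod a fm) (auto simp: upd)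
  have split1: "(\<integral>\<^sup>+ g. ennreal c * (\<Prod>j\<in>N. ?f H j (g j)) \<partial>PiM B (\<lambda>_. hyperg a))
     = ennreal c * (\<Prod>j\<in>N. psi a (d j) (m * q j / H))" for H c
  proof -
    have "(\<integral>\<^sup>+ g. ennreal c * (\<Prod>j\<in>N. ?f H j (g j)) \<partial>PiM B (\<lambda>_. hyperg a))
      = (\<integral>\<^sup>+ g. ennreal c \<partial>PiM B (\<lambda>_. hyperg a)) * (\<Prod>j\<in>N. psi a (d j) (m * q j / H))"
      unfolding psi_def using B by (intro nn_integral_PiM_hyperg_indep_prod a fm) auto
    then show ?thesis by (simp add: emeasure_space_1)
  qed
  define \<theta> where "\<theta> g = (\<Sum>j\<in>N. g j / (1 + g j) * q j)" for g
  have hU: "shrunk_rss (I \<union> N) S q g = shrunk_rss I S q g - \<theta> g" for g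
    unfolding shrunk_rss_def \<theta>_def using fin disj by (simp add: sum.union_disjoint)
  have wtU: "shrink_weight (I \<union> N) d g = shrink_weight I d g * shrink_weight N d g" for g
    unfolding shrink_weight_def using fin disj by (simp add: prod.union_disjoint)
  have prodf: "(\<Prod>j\<in>N. ?f H j (g j)) = ennreal (shrink_weight N d g * exp (m * \<theta> g / H))" for H g
  proof -
    have "m * \<theta> g / H = (\<Sum>j\<in>N. g j / (1 + g j) * (m * q j / H))"
      unfolding \<theta>_def by (simp add: sum_distrib_left sum_divide_distrib mult_ac)
    then show ?thesis unfolding shrink_weight_def
      by (simp only: prod_ennreal mult_nonneg_nonneg powr_ge_zero exp_ge_zero prod.distrib exp_sum[OF fin(2)])
  qed
  have th: "0 \<le> \<theta> g" "?R' \<le> shrunk_rss I S q g - \<theta> g" if g: "\<And>i. i \<in> B \<Longrightarrow> 0 < g i" for g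
  proof -
    show "0 \<le> \<theta> g" unfolding \<theta>_def using B q less_imp_le[OF g] by (intro sum_nonneg mult_nonneg_nonneg divide_nonneg_nonneg) auto
    show "?R' \<le> shrunk_rss I S q g - \<theta> g" unfolding hU[symmetric] using B g q fin by (intro shrunk_rss_ge) auto
  qed
  show "hyperg_integral a B (I \<union> N) d m S q \<le> hyperg_integral a B I d m S q * (\<Prod>j\<in>N. psi a (d j) (m * q j / ?R'))"
    unfolding split[symmetric] hyperg_integral_def[of a B "I \<union> N"]
  proof (intro nn_integral_mono_PiM_hyperg a B(1))
    fix g assume g: "\<And>i. i \<in> B \<Longrightarrow> (0::real) < g i"
    have t: "0 \<le> \<theta> g" "?R' \<le> shrunk_rss I S q g - \<theta> g" by (rule th, rule g, assumption)+
    have "shrunk_rss (I \<union> N) S q g powr (- m) \<le> shrunk_rss I S q g powr (- m) * exp (m * \<theta> g / ?R')"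
      unfolding hU using t R' m by (intro powr_shift_le) auto
    then have "shrink_weight (I \<union> N) d g * shrunk_rss (I \<union> N) S q g powr (- m)
      \<le> (shrink_weight I d g * shrink_weight N d g) * (shrunk_rss I S q g powr (- m) * exp (m * \<theta> g / ?R'))"
      unfolding wtU by (intro mult_left_mono mult_nonneg_nonneg shrink_weight_nonneg)
    then show "ennreal (shrink_weight (I \<union> N) d g * shrunk_rss (I \<union> N) S q g powr (- m))
       \<le> ennreal (shrink_weight I d g * shrunk_rss I S q g powr (- m)) * (\<Prod>j\<in>N. ?f ?R' j (g j))"
      unfolding prodf by (subst ennreal_mult'[symmetric]) (auto simp: shrink_weight_nonneg mult_ac intro!: ennreal_leI)
  qed
  assume H: "0 < H"
  have [measurable]: "(\<lambda>g. \<Prod>j\<in>N. ?f H j (g j)) \<in> borel_measurable (PiM B (\<lambda>_. hyperg a))"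
    using B by (intro borel_measurable_prod_ennreal measurable_compose[OF PiM_component_measurable_hyperg fm]) auto
  have [measurable]: "shrink_weight (I \<union> N) d \<in> borel_measurable (PiM B (\<lambda>_. hyperg a))" "shrunk_rss (I \<union> N) S q \<in> borel_measurable (PiM B (\<lambda>_. hyperg a))"
    using B by (auto intro!: shrink_weight_measurable shrunk_rss_measurable)
  have "hyperg_integral a B I d m S q * (\<Prod>j\<in>N. psi a (d j) (m * q j / H))
     \<le> (\<integral>\<^sup>+ g. ennreal (shrink_weight (I \<union> N) d g * shrunk_rss (I \<union> N) S q g powr (- m)) + ennreal (H powr (- m)) * (\<Prod>j\<in>N. ?f H j (g j)) \<partial>PiM B (\<lambda>_. hyperg a))"
    unfolding split[symmetric]
  proof (intro nn_integral_mono_PiM_hyperg a B(1))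
    fix g assume g: "\<And>i. i \<in> B \<Longrightarrow> (0::real) < g i"
    have t: "0 \<le> \<theta> g" "?R' \<le> shrunk_rss I S q g - \<theta> g" by (rule th, rule g, assumption)+
    have "shrink_weight I d g * shrunk_rss I S q g powr (- m) * (shrink_weight N d g * exp (m * \<theta> g / H))
      \<le> shrink_weight (I \<union> N) d g * shrunk_rss (I \<union> N) S q g powr (- m) + H powr (- m) * (shrink_weight N d g * exp (m * \<theta> g / H))"
    \<comment> \<open>Beyond \<open>H\<close> no comparison is attempted: the left side is itself at
      most the error term, since the weight over \<open>I\<close> is bounded by 1.\<close>
    proof (cases "shrunk_rss I S q g \<le> H")
      case True
      have "shrunk_rss I S q g powr (- m) * exp (m * \<theta> g / H) \<le> shrunk_rss (I \<union> N) S q g powr (- m)"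
        unfolding hU using t R' m True by (intro powr_shift_ge) auto
      then have "shrink_weight (I \<union> N) d g * (shrunk_rss I S q g powr (- m) * exp (m * \<theta> g / H)) \<le> shrink_weight (I \<union> N) d g * shrunk_rss (I \<union> N) S q g powr (- m)"
        by (intro mult_left_mono shrink_weight_nonneg)
      then have "shrink_weight I d g * shrunk_rss I S q g powr (- m) * (shrink_weight N d g * exp (m * \<theta> g / H)) \<le> shrink_weight (I \<union> N) d g * shrunk_rss (I \<union> N) S q g powr (- m)"
        unfolding wtU by (simp only: mult_ac)
      moreover have "0 \<le> H powr (- m) * (shrink_weight N d g * exp (m * \<theta> g / H))" using shrink_weight_nonneg by simp
      ultimately show ?thesis by linarith
    next
      case False
      then have "shrunk_rss I S q g powr (- m) \<le> H powr (- m)" using H m by (intro powr_mono2') auto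
      moreover have "shrink_weight I d g \<le> 1" using g B by (intro shrink_weight_le_1) auto
      ultimately have "shrink_weight I d g * shrunk_rss I S q g powr (- m) \<le> 1 * H powr (- m)"
        by (intro mult_mono) auto
      then have "shrink_weight I d g * shrunk_rss I S q g powr (- m) * (shrink_weight N d g * exp (m * \<theta> g / H)) \<le> H powr (- m) * (shrink_weight N d g * exp (m * \<theta> g / H))"
        using shrink_weight_nonneg by (intro mult_right_mono) auto
      moreover have "0 \<le> shrink_weight (I \<union> N) d g * shrunk_rss (I \<union> N) S q g powr (- m)" using shrink_weight_nonneg by simp
      ultimately show ?thesis by linarith
    qed
    from ennreal_leI[OF this]
    show "ennreal (shrink_weight I d g * shrunk_rss I S q g powr (- m)) * (\<Prod>j\<in>N. ?f H j (g j))
       \<le> ennreal (shrink_weight (I \<union> N) d g * shrunk_rss (I \<union> N) S q g powr (- m)) + ennreal (H powr (- m)) * (\<Prod>j\<in>N. ?f H j (g j))"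
      unfolding prodf by (simp only: ennreal_mult'[symmetric] ennreal_plus[symmetric] mult_nonneg_nonneg shrink_weight_nonneg powr_ge_zero exp_ge_zero)
  qed
  also have "\<dots> = hyperg_integral a B (I \<union> N) d m S q + ennreal (H powr (- m)) * (\<Prod>j\<in>N. psi a (d j) (m * q j / H))"
    unfolding hyperg_integral_def split1[symmetric] by (rule nn_integral_add) measurable
  finally show "hyperg_integral a B I d m S q * (\<Prod>j\<in>N. psi a (d j) (m * q j / H))
      \<le> hyperg_integral a B (I \<union> N) d m S q + ennreal (H powr (- m)) * (\<Prod>j\<in>N. psi a (d j) (m * q j / H))" .
qed

lemma inv_quad_nonneg: "posdef_on S Q \<Longrightarrow> 0 \<le> inv_quad S Q b"
  by (simp add: posdef_on_def inv_quad_def inv_quad_list_nonneg)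

text \<open>With a positive residual sum the shrunk sum is positive for almost every
  \<open>g\<close>, so scaling pulls out a constant that depends on n alone.\<close>

lemma marg_lik_hyperg_integral:
  assumes n: "0 < n" and a: "2 < a" and fin: "finite \<gamma>" "finite B" and sub: "blk ` \<gamma> \<subseteq> B"
    and centered: "\<And>j. j \<in> \<gamma> \<Longrightarrow> (\<Sum>r<n. X n r j) = 0"
    and orth: "\<And>j j'. j \<in> \<gamma> \<Longrightarrow> j' \<in> \<gamma> \<Longrightarrow> blk j \<noteq> blk j' \<Longrightarrow> gram X n j j' = 0"
    and posdef_on: "\<And>i. i \<in> blk ` \<gamma> \<Longrightarrow> posdef_on (block_set blk \<gamma> i) (gram X n)"
    and R: "0 < sst n y - (\<Sum>i\<in>blk ` \<gamma>. inv_quad (block_set blk \<gamma> i) (gram X n) (xty X n y))"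
  shows "marg_lik a X blk n \<gamma> y = hyperg_integral a B (blk ` \<gamma>) (\<lambda>i. card (block_set blk \<gamma> i)) ((real n - 1) / 2) (sst n y)
      (\<lambda>i. inv_quad (block_set blk \<gamma> i) (gram X n) (xty X n y)) * sigma2_integral n 1"
proof -
  let ?I = "blk ` \<gamma>" and ?d = "\<lambda>i. card (block_set blk \<gamma> i)" and ?S = "sst n y"
  let ?q = "\<lambda>i. inv_quad (block_set blk \<gamma> i) (gram X n) (xty X n y)" and ?m = "(real n - 1) / 2"
  have "marg_lik a X blk n \<gamma> y = (\<integral>\<^sup>+ g. ennreal (shrink_weight ?I ?d g) * sigma2_integral n (shrunk_rss ?I ?S ?q g) \<partial>PiM B (\<lambda>_. hyperg a))"
    unfolding shrink_weight_def shrunk_rss_def by (intro marg_lik_eq n a fin sub centered orth posdef_on)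
  also have "\<dots> = (\<integral>\<^sup>+ g. ennreal (shrink_weight ?I ?d g * shrunk_rss ?I ?S ?q g powr (- ?m)) * sigma2_integral n 1 \<partial>PiM B (\<lambda>_. hyperg a))"
  proof (rule nn_integral_cong_AE)
    show "AE g in PiM B (\<lambda>_. hyperg a). ennreal (shrink_weight ?I ?d g) * sigma2_integral n (shrunk_rss ?I ?S ?q g) = ennreal (shrink_weight ?I ?d g * shrunk_rss ?I ?S ?q g powr (- ?m)) * sigma2_integral n 1"
      using AE_PiM_hyperg_pos[OF a fin(2)]
    proof eventually_elim
      case (elim g)
      have "?S - (\<Sum>i\<in>?I. ?q i) \<le> shrunk_rss ?I ?S ?q g"
        using elim sub fin by (intro shrunk_rss_ge inv_quad_nonneg posdef_on) auto
      then have "0 < shrunk_rss ?I ?S ?q g" using R by linarith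
      from sigma2_integral_scale[OF this n]
      have "sigma2_integral n (shrunk_rss ?I ?S ?q g) = ennreal (shrunk_rss ?I ?S ?q g powr (- ?m)) * sigma2_integral n 1" by (simp only: minus_divide_left)
      then show ?case by (simp only: ennreal_mult' shrink_weight_nonneg mult.assoc)
    qed
  qed
  also have "\<dots> = hyperg_integral a B ?I ?d ?m ?S ?q * sigma2_integral n 1"
    unfolding hyperg_integral_def using sub
    by (intro nn_integral_multc measurable_compose[OF _ measurable_ennreal] borel_measurable_times
      shrink_weight_measurable powr_real_measurable shrunk_rss_measurable) auto
  finally show ?thesis .
qed

section \<open>The limiting factor of a null block\<close>

definition psi_real :: "real \<Rightarrow> nat \<Rightarrow> real \<Rightarrow> real" where
  "psi_real a d x = enn2real (psi a d x)"

lemma AE_mono_hyperg: "(\<And>t. 0 < t \<Longrightarrow> P t) \<Longrightarrow> AE t in hyperg a. P t"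
  using AE_hyperg_pos by (rule eventually_mono) blast

lemma psi_le:
  assumes "2 < a" "0 \<le> x"
  shows "psi a d x \<le> ennreal (exp x)"
proof -
  interpret prob_space "hyperg a" by (rule prob_space_hyperg[OF assms(1)])
  have "psi a d x \<le> (\<integral>\<^sup>+ t. ennreal (exp x) \<partial>hyperg a)"
    unfolding psi_def
  proof (intro nn_integral_mono_AE AE_mono_hyperg ennreal_leI)
    fix t :: real assume t: "0 < t"
    have "(1 + t) powr (- real d / 2) \<le> 1" using t powr_mono[of "- real d / 2" 0 "1 + t"] by simp
    moreover have "t / (1 + t) * x \<le> x" using t assms by (intro mult_left_le_one_le) auto
    ultimately show "(1 + t) powr (- real d / 2) * exp (t / (1 + t) * x) \<le> exp x"
      using mult_mono[of "(1 + t) powr (- real d / 2)" 1 "exp (t / (1 + t) * x)" "exp x"] by simp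
  qed
  with emeasure_space_1 show ?thesis by simp
qed

text \<open>Since t / (1 + t) lies in [0, 1], moving \<open>y\<close> to \<open>x\<close> changes
  the integrand by at most the factor exp |x - y|. A multiplicative modulus of this kind passes
  directly to products over blocks.\<close>

lemma psi_lip: "psi a d x \<le> ennreal (exp \<bar>x - y\<bar>) * psi a d y"
proof -
  have "psi a d x \<le> (\<integral>\<^sup>+ t. ennreal (exp \<bar>x - y\<bar>) * ennreal ((1 + t) powr (- real d / 2) * exp (t / (1 + t) * y)) \<partial>hyperg a)"
    unfolding psi_def
  proof (intro nn_integral_mono_AE AE_mono_hyperg)
    fix t :: real assume t: "0 < t"
    define c where "c = t / (1 + t)"
    have "c * (x - y) \<le> c * \<bar>x - y\<bar>" using t by (intro mult_left_mono) (auto simp: c_def)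
    also have "\<dots> \<le> \<bar>x - y\<bar>" using t by (intro mult_left_le_one_le) (auto simp: c_def)
    finally have "c * x \<le> \<bar>x - y\<bar> + c * y" unfolding right_diff_distrib by linarith
    then have "t / (1 + t) * x \<le> \<bar>x - y\<bar> + t / (1 + t) * y" by (simp only: c_def)
    then have "exp (t / (1 + t) * x) \<le> exp \<bar>x - y\<bar> * exp (t / (1 + t) * y)" by (simp only: exp_add[symmetric] exp_le_cancel_iff)
    then have "(1 + t) powr (- real d / 2) * exp (t / (1 + t) * x) \<le> (1 + t) powr (- real d / 2) * (exp \<bar>x - y\<bar> * exp (t / (1 + t) * y))"
      by (rule mult_left_mono) simp
    then show "ennreal ((1 + t) powr (- real d / 2) * exp (t / (1 + t) * x)) \<le> ennreal (exp \<bar>x - y\<bar>) * ennreal ((1 + t) powr (- real d / 2) * exp (t / (1 + t) * y))"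
      by (subst ennreal_mult'[symmetric]) (auto intro!: ennreal_leI simp: mult_ac)
  qed
  also have "\<dots> = ennreal (exp \<bar>x - y\<bar>) * psi a d y"
    unfolding psi_def by (intro nn_integral_cmult) (simp add: measurable_cong_sets[OF sets_hyperg refl])
  finally show ?thesis .
qed

lemma psi_less_top: "2 < a \<Longrightarrow> psi a d x < \<top>"
proof -
  assume a: "2 < a"
  have "psi a d x \<le> ennreal (exp \<bar>x\<bar>) * psi a d 0" using psi_lip[of a d x 0] by simp
  also have "\<dots> \<le> ennreal (exp \<bar>x\<bar>) * ennreal (exp 0)" by (intro mult_left_mono psi_le a) auto
  also have "\<dots> < \<top>" by (simp add: ennreal_mult_less_top)
  finally show ?thesis .
qed

lemma ennreal_psi_real: "2 < a \<Longrightarrow> ennreal (psi_real a d x) = psi a d x"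
  unfolding psi_real_def using psi_less_top by (intro ennreal_enn2real) auto

lemma psi_real_nonneg [simp]: "0 \<le> psi_real a d x"
  by (simp add: psi_real_def)

lemma psi_real_le:
  assumes "2 < a" "0 \<le> x"
  shows "psi_real a d x \<le> exp x"
  using psi_le[OF assms, of d] unfolding ennreal_psi_real[OF assms(1), symmetric] by (simp add: ennreal_le_iff)

lemma psi_real_lip:
  assumes "2 < a"
  shows "psi_real a d x \<le> exp \<bar>x - y\<bar> * psi_real a d y"
  using psi_lip[of a d x y] unfolding ennreal_psi_real[OF assms, symmetric]
  by (simp add: ennreal_mult'[symmetric] ennreal_le_iff)

text \<open>Strictness comes from t / (1 + t) > 0 almost surely. It is what keeps the limit law from
  being a point mass; monotonicity also yields measurability.\<close>

lemma psi_real_strict_mono: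
  assumes "2 < a" "x < y"
  shows "psi_real a d x < psi_real a d y"
proof -
  interpret prob_space "hyperg a" by (rule prob_space_hyperg[OF assms(1)])
  let ?f = "\<lambda>x t. (1 + t) powr (- real d / 2) * exp (t / (1 + t) * x)"
  have m: "?f x \<in> borel_measurable (hyperg a)" for x by (simp add: measurable_cong_sets[OF sets_hyperg refl])
  have "psi a d x < psi a d y"
    unfolding psi_def
  proof (rule nn_integral_less)
    show "(\<lambda>t. ennreal (?f x t)) \<in> borel_measurable (hyperg a)" "(\<lambda>t. ennreal (?f y t)) \<in> borel_measurable (hyperg a)"
      using m by auto
    show "(\<integral>\<^sup>+ t. ennreal (?f x t) \<partial>hyperg a) \<noteq> \<infinity>"
      using psi_less_top[OF assms(1), of d x] by (simp add: psi_def)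
    have less: "?f x t < ?f y t" if "0 < t" for t
    proof -
      have "t / (1 + t) * x < t / (1 + t) * y" using that assms(2) by (intro mult_strict_left_mono) auto
      then show ?thesis using that by simp
    qed
    show "AE t in hyperg a. ennreal (?f x t) \<le> ennreal (?f y t)"
      by (intro AE_mono_hyperg ennreal_leI less_imp_le less)
    show "\<not> (AE t in hyperg a. ennreal (?f y t) \<le> ennreal (?f x t))"
    proof
      assume "AE t in hyperg a. ennreal (?f y t) \<le> ennreal (?f x t)"
      with AE_hyperg_pos[of a] have "AE t in hyperg a. False"
      proof eventually_elim
        case (elim t)
        have "ennreal (?f x t) < ennreal (?f y t)"
          using less[OF elim(1)] elim(1) by (intro ennreal_lessI mult_pos_pos) auto
        then show ?case using elim(2) not_le by blast
      qed
      then show False by simp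
    qed
  qed
  then show ?thesis
    unfolding psi_real_def using psi_less_top[OF assms(1)] by (intro enn2real_less_iff[THEN iffD2]) auto
qed

section \<open>Ratios of hyper-g integrals as the sample size grows\<close>

lemma poly_times_geometric:
  fixes K \<theta> :: real
  assumes "0 < \<theta>" "\<theta> < 1"
  shows "(\<lambda>n. (real n + 2) powr K * \<theta> powr ((real n - 1) / 2)) \<longlonglongrightarrow> 0"
proof -
  define k where "k = nat \<lceil>\<bar>K\<bar>\<rceil> + 1"
  have k: "0 < k" "K \<le> real k" unfolding k_def by (simp, linarith)
  \<comment> \<open>The root is chosen so that (y^n)^k equals \<theta>^(n/2). The claim reduces to n
    y^n tending to 0; the bound n + 2 \<le> 3 n absorbs the shift.\<close>
  define y where "y = \<theta> powr (1 / (2 * real k))"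
  have y: "0 < y" "y < 1" using assms k powr_less_mono2[of "1 / (2 * real k)" \<theta> 1] by (auto simp: y_def)
  have "(\<lambda>n. (3 * (real n * y ^ n)) ^ k * \<theta> powr (- 1 / 2)) \<longlonglongrightarrow> (3 * 0) ^ k * \<theta> powr (- 1 / 2)"
    using y by (intro tendsto_intros powser_times_n_limit_0) auto
  then have lim: "(\<lambda>n. (3 * (real n * y ^ n)) ^ k * \<theta> powr (- 1 / 2)) \<longlonglongrightarrow> 0" using k by (simp add: zero_power)
  show ?thesis
  proof (rule tendsto_sandwich[OF _ _ tendsto_const lim])
    show "\<forall>\<^sub>F n in sequentially. (real n + 2) powr K * \<theta> powr ((real n - 1) / 2) \<le> (3 * (real n * y ^ n)) ^ k * \<theta> powr (- 1 / 2)"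
      using eventually_ge_at_top[of 1]
    proof eventually_elim
      case (elim n)
      have "(real n + 2) powr K \<le> (real n + 2) powr real k" using k by (intro powr_mono) auto
      also have "\<dots> = (real n + 2) ^ k" by (rule powr_realpow) simp
      also have "\<dots> \<le> (3 * real n) ^ k" using elim by (intro power_mono) auto
      finally have 1: "(real n + 2) powr K \<le> (3 * real n) ^ k" .
      have "(real n - 1) / 2 = real n / 2 + - 1 / 2" by (simp add: field_simps)
      then have 2: "\<theta> powr ((real n - 1) / 2) = \<theta> powr (real n / 2) * \<theta> powr (- 1 / 2)" by (simp only: powr_add)
      have "(y ^ n) ^ k = y powr (real (n * k))" using y by (simp only: power_mult[symmetric] powr_realpow)
      also have "\<dots> = \<theta> powr (1 / (2 * real k) * real (n * k))" by (simp only: y_def powr_powr)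
      also have "1 / (2 * real k) * real (n * k) = real n / 2" using k by simp
      finally have 3: "\<theta> powr (real n / 2) = (y ^ n) ^ k" by simp
      have "0 \<le> (y ^ n) ^ k * \<theta> powr (- 1 / 2)" using y by simp
      from mult_right_mono[OF 1 this] show ?case unfolding 2 3 by (simp only: power_mult_distrib mult_ac)
    qed
  qed simp
qed

text \<open>The lower bound is used with x = n: the excess over the residual sum is the explained
  sum over n + 1, negligible against n, and the box costs a power of n. As \<open>H\<close> exceeds
  the residual sum by a constant factor in the limit, H^(-m) is smaller by a factor geometric in n,
  which beats that power.\<close>

lemma hyperg_integral_concentration:
  fixes S H :: "nat \<Rightarrow> real" and q :: "nat \<Rightarrow> nat \<Rightarrow> real"
  assumes a: "2 < a" and B: "finite B" "I \<subseteq> B" and q: "\<forall>\<^sub>F n in sequentially. \<forall>i\<in>I. 0 \<le> q n i"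
    and R: "(\<lambda>n. (S n - (\<Sum>i\<in>I. q n i)) / real n) \<longlonglongrightarrow> \<rho>" "0 < \<rho>" and S: "(\<lambda>n. S n / real n) \<longlonglongrightarrow> s"
    and H: "(\<lambda>n. H n / real n) \<longlonglongrightarrow> \<eta>" "\<rho> < \<eta>"
  shows "\<exists>\<epsilon>. \<epsilon> \<longlonglongrightarrow> 0 \<and> (\<forall>\<^sub>F n in sequentially. 0 \<le> \<epsilon> n \<and>
    ennreal (H n powr (- ((real n - 1) / 2))) \<le> ennreal (\<epsilon> n) * hyperg_integral a B I d ((real n - 1) / 2) (S n) (q n))"
proof -
  define m where "m n = (real n - 1) / 2" for n
  define Q where "Q n = (\<Sum>i\<in>I. q n i)" for n
  define h where "h n = S n - Q n + Q n / (real n + 1)" for n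
  define P where "P n = (\<Prod>i\<in>I. (a - 2) / 2 * (real n + 2) powr (- (a + real (d i)) / 2))" for n
  define \<epsilon> where "\<epsilon> n = (h n / H n) powr m n / P n" for n
  \<comment> \<open>The midpoint between \<rho> / \<eta> and 1, so that h / H eventually stays below
    it.\<close>
  define \<theta> where "\<theta> = (1 + \<rho> / \<eta>) / 2"
  define K where "K = (\<Sum>i\<in>I. (a + real (d i)) / 2)"
  have fin: "finite I" using B finite_subset by blast
  have \<eta>: "0 < \<eta>" using R H by linarith
  have \<theta>: "0 < \<theta>" "\<theta> < 1" "\<rho> / \<eta> < \<theta>" using R H \<eta> by (auto simp: \<theta>_def field_simps add_pos_pos)
  have P: "0 < P n" for n unfolding P_def using a by (intro prod_pos) auto
  have P': "1 / P n = (2 / (a - 2)) ^ card I * (real n + 2) powr K" for n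
  proof -
    have "P n = ((a - 2) / 2) ^ card I * (\<Prod>i\<in>I. (real n + 2) powr (- (a + real (d i)) / 2))"
      unfolding P_def prod.distrib by simp
    also have "(\<Prod>i\<in>I. (real n + 2) powr (- (a + real (d i)) / 2)) = (real n + 2) powr (\<Sum>i\<in>I. - (a + real (d i)) / 2)"
      by (rule powr_sum[symmetric]) (use fin in auto)
    also have "(\<Sum>i\<in>I. - (a + real (d i)) / 2) = - K" unfolding K_def sum_negf[symmetric] by (intro sum.cong refl) (simp only: minus_divide_left)
    finally have P_eq: "P n = ((a - 2) / 2) ^ card I * (real n + 2) powr (- K)" .
    have "((a - 2) / 2) ^ card I * (2 / (a - 2)) ^ card I = 1"
    proof -
      have "x / 2 * (2 / x) = 1" if "x \<noteq> 0" for x :: real using that by simp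
      then have e: "(a - 2) / 2 * (2 / (a - 2)) = 1" using a by simp
      show ?thesis by (simp only: power_mult_distrib[symmetric] e power_one)
    qed
    moreover have "(real n + 2) powr (- K) * (real n + 2) powr K = 1" by (simp add: powr_add[symmetric])
    ultimately have "P n * ((2 / (a - 2)) ^ card I * (real n + 2) powr K) = 1"
      unfolding P_eq by (metis mult.assoc mult.left_commute mult_1)
    then show ?thesis using P[of n] by (metis less_irrefl nonzero_eq_divide_eq mult.commute)
  qed
  have n1: "\<forall>\<^sub>F n in sequentially. 1 \<le> n" by (rule eventually_ge_at_top)
  have Qlim: "(\<lambda>n. Q n / real n) \<longlonglongrightarrow> s - \<rho>"
    using tendsto_diff[OF S R(1)] by (simp add: Q_def diff_divide_distrib)
  have inv: "(\<lambda>n. 1 / (real n + 1)) \<longlonglongrightarrow> 0"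
    using LIMSEQ_inverse_real_of_nat by (simp add: inverse_eq_divide add.commute)
  have "(\<lambda>n. (S n - Q n) / real n + Q n / real n * (1 / (real n + 1))) \<longlonglongrightarrow> \<rho> + (s - \<rho>) * 0"
    using R(1) by (intro tendsto_intros Qlim inv) (simp add: Q_def)
  then have hlim: "(\<lambda>n. h n / real n) \<longlonglongrightarrow> \<rho>" by (simp add: h_def add_divide_distrib mult.commute)
  have "(\<lambda>n. (h n / real n) / (H n / real n)) \<longlonglongrightarrow> \<rho> / \<eta>" using \<eta> by (intro tendsto_divide hlim H) auto
  from order_tendstoD(2)[OF this \<theta>(3)] have ratio: "\<forall>\<^sub>F n in sequentially. (h n / real n) / (H n / real n) < \<theta>" .
  have Hpos: "\<forall>\<^sub>F n in sequentially. 0 < H n / real n" using order_tendstoD(1)[OF H(1) \<eta>] .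
  have hpos: "\<forall>\<^sub>F n in sequentially. 0 < h n / real n" using order_tendstoD(1)[OF hlim R(2)] .
  have Rpos: "\<forall>\<^sub>F n in sequentially. 0 < (S n - Q n) / real n" using order_tendstoD(1)[OF R(1,2)] by (simp add: Q_def)
  have "(\<lambda>n. (2 / (a - 2)) ^ card I * ((real n + 2) powr K * \<theta> powr ((real n - 1) / 2))) \<longlonglongrightarrow> (2 / (a - 2)) ^ card I * 0"
    by (intro tendsto_mult_left poly_times_geometric \<theta>)
  then have lim: "(\<lambda>n. (2 / (a - 2)) ^ card I * ((real n + 2) powr K * \<theta> powr m n)) \<longlonglongrightarrow> 0" by (simp add: m_def)
  have "\<epsilon> \<longlonglongrightarrow> 0"
  proof (rule tendsto_sandwich[OF _ _ tendsto_const lim])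
    show "\<forall>\<^sub>F n in sequentially. 0 \<le> \<epsilon> n" using P by (simp add: \<epsilon>_def less_imp_le)
    show "\<forall>\<^sub>F n in sequentially. \<epsilon> n \<le> (2 / (a - 2)) ^ card I * ((real n + 2) powr K * \<theta> powr m n)"
      using ratio Hpos hpos n1
    proof eventually_elim
      case (elim n)
      have "0 \<le> h n / H n" "h n / H n \<le> \<theta>" using elim by (auto simp: zero_less_divide_iff)
      then have "(h n / H n) powr m n \<le> \<theta> powr m n" using elim by (intro powr_mono2) (auto simp: m_def)
      then have "(h n / H n) powr m n * (1 / P n) \<le> \<theta> powr m n * (1 / P n)" using P[of n] by (intro mult_right_mono) auto
      moreover have "\<epsilon> n = (h n / H n) powr m n * (1 / P n)" by (simp add: \<epsilon>_def)
      ultimately show ?case by (simp only: P' mult_ac)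
    qed
  qed
  moreover have "\<forall>\<^sub>F n in sequentially. 0 \<le> \<epsilon> n \<and> ennreal (H n powr (- m n)) \<le> ennreal (\<epsilon> n) * hyperg_integral a B I d (m n) (S n) (q n)"
    using q Hpos hpos Rpos n1
  proof eventually_elim
    case (elim n)
    have pos: "0 < H n" "0 < h n" "0 < S n - Q n" "0 \<le> m n" using elim by (auto simp: zero_less_divide_iff m_def)
    have "\<epsilon> n * (P n * h n powr (- m n)) = H n powr (- m n)"
      using P[of n] pos by (simp add: \<epsilon>_def powr_divide powr_minus field_simps)
    then have "ennreal (H n powr (- m n)) = ennreal (\<epsilon> n) * ennreal (P n * h n powr (- m n))"
      using P[of n] by (simp add: ennreal_mult'[symmetric] \<epsilon>_def)
    also have "\<dots> \<le> ennreal (\<epsilon> n) * hyperg_integral a B I d (m n) (S n) (q n)"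
      unfolding P_def h_def Q_def using elim(1) pos
      by (intro mult_left_mono hyperg_integral_lower a B) (auto simp: Q_def)
    finally show ?case using P[of n] by (simp add: \<epsilon>_def less_imp_le)
  qed
  ultimately show ?thesis by (auto simp: m_def)
qed

lemma half_ratio: "1 \<le> n \<Longrightarrow> (1 / 2 - (1 / 2) / real n) / (h / real n) = (real n - 1) / 2 / h"
proof -
  assume "1 \<le> n"
  moreover from this have "1 / 2 - (1 / 2) / real n = (real n - 1) / 2 / real n" by (simp add: field_simps)
  ultimately show ?thesis by simp
qed

lemma hyperg_integral_pos:
  assumes a: "2 < a" and B: "finite B" "I \<subseteq> B" and q: "\<And>i. i \<in> I \<Longrightarrow> 0 \<le> q i"
    and R: "0 < S - (\<Sum>i\<in>I. q i)" and m: "0 \<le> m"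
  shows "0 < enn2real (hyperg_integral a B I d m S q)" "hyperg_integral a B I d m S q < \<top>"
proof -
  show fin: "hyperg_integral a B I d m S q < \<top>"
    using hyperg_integral_le[OF a B q R m, of d] by (rule order_le_less_trans) simp_all
  have "0 < (\<Prod>i\<in>I. (a - 2) / 2 * (0 + 2) powr (- (a + real (d i)) / 2)) * (S - (\<Sum>i\<in>I. q i) + (\<Sum>i\<in>I. q i) / (0 + 1)) powr (- m)"
    using a R sum_nonneg[of I q, OF q] by (intro mult_pos_pos prod_pos) auto
  then have "0 < hyperg_integral a B I d m S q"
    using hyperg_integral_lower[OF a B q R m, of 0 d] by (simp add: order_less_le_trans[OF _ hyperg_integral_lower[OF a B q R m, of 0 d]])
  then show "0 < enn2real (hyperg_integral a B I d m S q)" using fin by (simp add: enn2real_positive_iff)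
qed

lemma enn2real_ratio_le:
  assumes "x \<le> ennreal c * y" "0 \<le> c" "0 < enn2real y"
  shows "enn2real x / enn2real y \<le> c"
proof -
  have y: "y < \<top>" using assms(3) by (auto simp: enn2real_positive_iff)
  then have "ennreal c * y < \<top>" by (simp add: ennreal_mult_less_top)
  then have "enn2real x \<le> enn2real (ennreal c * y)" using assms(1) by (intro enn2real_mono) auto
  also have "\<dots> = c * enn2real y" using assms(2) by (simp add: enn2real_mult)
  finally show ?thesis using assms(3) by (simp add: pos_divide_le_eq)
qed

definition hyperg_ratio :: "real \<Rightarrow> nat set \<Rightarrow> nat set \<Rightarrow> (nat \<Rightarrow> nat) \<Rightarrow> (nat \<Rightarrow> real) \<Rightarrow> nat set \<Rightarrow> (nat \<Rightarrow> nat) \<Rightarrow> (nat \<Rightarrow> real) \<Rightarrow> nat \<Rightarrow> real \<Rightarrow> real" where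
  "hyperg_ratio a B I' d' q' I d q n S = enn2real (hyperg_integral a B I' d' ((real n - 1) / 2) S q') / enn2real (hyperg_integral a B I d ((real n - 1) / 2) S q)"

lemma hyperg_ratio_nonneg: "0 \<le> hyperg_ratio a B I' d' q' I d q n S"
  by (simp add: hyperg_ratio_def)

text \<open>The numerator is at most the power of its own residual sum, and that residual sum serves
  as \<open>H\<close> in the concentration lemma.\<close>

lemma hyperg_ratio_missing:
  fixes S :: "nat \<Rightarrow> real" and q q' :: "nat \<Rightarrow> nat \<Rightarrow> real"
  assumes a: "2 < a" and B: "finite B" "I \<subseteq> B" "I' \<subseteq> B"
    and q: "\<forall>\<^sub>F n in sequentially. \<forall>i\<in>I. 0 \<le> q n i" "\<forall>\<^sub>F n in sequentially. \<forall>i\<in>I'. 0 \<le> q' n i"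
    and R: "(\<lambda>n. (S n - (\<Sum>i\<in>I. q n i)) / real n) \<longlonglongrightarrow> \<rho>" "0 < \<rho>" and S: "(\<lambda>n. S n / real n) \<longlonglongrightarrow> s"
    and R': "(\<lambda>n. (S n - (\<Sum>i\<in>I'. q' n i)) / real n) \<longlonglongrightarrow> \<rho>'" "\<rho> < \<rho>'"
  shows "(\<lambda>n. hyperg_ratio a B I' d' (q' n) I d (q n) n (S n)) \<longlonglongrightarrow> 0"
proof -
  obtain \<epsilon> where \<epsilon>: "\<epsilon> \<longlonglongrightarrow> 0" "\<forall>\<^sub>F n in sequentially. 0 \<le> \<epsilon> n \<and>
    ennreal ((S n - (\<Sum>i\<in>I'. q' n i)) powr (- ((real n - 1) / 2))) \<le> ennreal (\<epsilon> n) * hyperg_integral a B I d ((real n - 1) / 2) (S n) (q n)"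
    using hyperg_integral_concentration[OF a B(1,2) q(1) R S R'] by blast
  have pos: "\<forall>\<^sub>F n in sequentially. 0 < (S n - (\<Sum>i\<in>I. q n i)) / real n" using order_tendstoD(1)[OF R] .
  have pos': "\<forall>\<^sub>F n in sequentially. 0 < (S n - (\<Sum>i\<in>I'. q' n i)) / real n"
    using order_tendstoD(1)[OF R'(1), of 0] R R' by auto
  show ?thesis
  proof (rule tendsto_sandwich[OF _ _ tendsto_const \<epsilon>(1)])
    show "\<forall>\<^sub>F n in sequentially. hyperg_ratio a B I' d' (q' n) I d (q n) n (S n) \<le> \<epsilon> n"
      using \<epsilon>(2) pos pos' q eventually_ge_at_top[of 1]
    proof eventually_elim
      case (elim n)
      have "hyperg_integral a B I' d' ((real n - 1) / 2) (S n) (q' n) \<le> ennreal (\<epsilon> n) * hyperg_integral a B I d ((real n - 1) / 2) (S n) (q n)"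
        using elim by (intro order_trans[OF hyperg_integral_le conjunct2[OF elim(1)]] a B) (auto simp: zero_less_divide_iff)
      then show ?case unfolding hyperg_ratio_def using elim a B
        by (intro enn2real_ratio_le hyperg_integral_pos) (auto simp: zero_less_divide_iff)
    qed
  qed (simp add: hyperg_ratio_nonneg)
qed

text \<open>In the bound for fixed n, a small \<delta> controls the first term. For that fixed
  \<delta> the linear growth of \<open>q n i0\<close> raises the level by a constant factor, so
  concentration controls the second.\<close>

lemma hyperg_ratio_growing_block:
  fixes S :: "nat \<Rightarrow> real" and q q' :: "nat \<Rightarrow> nat \<Rightarrow> real"
  assumes a: "2 < a" and B: "finite B" "I' \<subseteq> B" and I: "I \<subseteq> I'" "i0 \<in> I"
    and q: "\<forall>\<^sub>F n in sequentially. \<forall>i\<in>I. 0 \<le> q n i" "\<And>n i. i \<in> I' - I \<Longrightarrow> q n i = 0"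
    and d: "\<And>i. i \<in> I \<Longrightarrow> d i \<le> d' i" "d i0 < d' i0"
    and C: "\<forall>\<^sub>F n in sequentially. (\<Sum>i\<in>I'. \<bar>q' n i - q n i\<bar>) \<le> C"
    and R: "(\<lambda>n. (S n - (\<Sum>i\<in>I. q n i)) / real n) \<longlonglongrightarrow> \<rho>" "0 < \<rho>" and S: "(\<lambda>n. S n / real n) \<longlonglongrightarrow> s"
    and q0: "(\<lambda>n. q n i0 / real n) \<longlonglongrightarrow> \<iota>" "0 < \<iota>"
  shows "(\<lambda>n. hyperg_ratio a B I' d' (q' n) I d (q n) n (S n)) \<longlonglongrightarrow> 0"
proof (rule tendstoI)
  fix e :: real assume e: "0 < e"
  define E where "E n = exp ((real n - 1) / 2 * C / (S n - (\<Sum>i\<in>I. q n i) - C))" for n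
  \<comment> \<open>Limit of the prefactor: (n - 1)/2 over the residual sum less \<open>C\<close>
    tends to 1 / (2 \<rho>).\<close>
  define E0 where "E0 = exp (1 / (2 * \<rho>) * C)"
  have n1: "\<forall>\<^sub>F n in sequentially. 1 \<le> n" by (rule eventually_ge_at_top)
  have inv: "(\<lambda>n. c / real n) \<longlonglongrightarrow> 0" for c by (rule lim_const_over_n)
  have "(\<lambda>n. exp ((1 / 2 - (1 / 2) / real n) / ((S n - (\<Sum>i\<in>I. q n i)) / real n - C / real n) * C)) \<longlonglongrightarrow> exp ((1 / 2 - 0) / (\<rho> - 0) * C)"
    using R(2) by (intro tendsto_intros R(1) inv) auto
  also have "exp ((1 / 2 - 0) / (\<rho> - 0) * C) = E0" by (simp add: E0_def)
  finally have "E \<longlonglongrightarrow> E0"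
    unfolding diff_divide_distrib[symmetric]
  proof (rule Lim_transform_eventually)
    show "\<forall>\<^sub>F n in sequentially. exp ((1 / 2 - 1 / 2 / real n) / ((S n - (\<Sum>i\<in>I. q n i) - C) / real n) * C) = E n"
      using n1 by eventually_elim (simp only: E_def half_ratio times_divide_eq_left)
  qed
  \<comment> \<open>Solves E0 sqrt \<delta> = e/2; the other half is left for concentration.\<close>
  define \<delta> where "\<delta> = (e / (2 * E0))\<^sup>2"
  have E0: "0 < E0" by (simp add: E0_def)
  have \<delta>: "0 < \<delta>" "E0 * sqrt \<delta> = e / 2" using e E0 by (auto simp: \<delta>_def real_sqrt_abs)
  have "(\<lambda>n. (S n - (\<Sum>i\<in>I. q n i)) / real n + \<delta> * (q n i0 / real n)) \<longlonglongrightarrow> \<rho> + \<delta> * \<iota>"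
    by (intro tendsto_intros R q0)
  then have H: "(\<lambda>n. (S n - (\<Sum>i\<in>I. q n i) + \<delta> * q n i0) / real n) \<longlonglongrightarrow> \<rho> + \<delta> * \<iota>" by (simp add: add_divide_distrib)
  have "I \<subseteq> B" using I B by auto
  obtain \<epsilon> where \<epsilon>: "\<epsilon> \<longlonglongrightarrow> 0" "\<forall>\<^sub>F n in sequentially. 0 \<le> \<epsilon> n \<and>
    ennreal ((S n - (\<Sum>i\<in>I. q n i) + \<delta> * q n i0) powr (- ((real n - 1) / 2))) \<le> ennreal (\<epsilon> n) * hyperg_integral a B I d ((real n - 1) / 2) (S n) (q n)"
    using hyperg_integral_concentration[OF a B(1) \<open>I \<subseteq> B\<close> q(1) R S H] \<delta> q0 by auto
  have "(\<lambda>n. E n * (sqrt \<delta> + \<epsilon> n)) \<longlonglongrightarrow> E0 * (sqrt \<delta> + 0)" by (intro tendsto_intros \<open>E \<longlonglongrightarrow> E0\<close> \<epsilon>)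
  moreover have "E0 * (sqrt \<delta> + 0) < e" using \<delta> e by simp
  ultimately have small: "\<forall>\<^sub>F n in sequentially. E n * (sqrt \<delta> + \<epsilon> n) < e" by (rule order_tendstoD(2))
  have "(\<lambda>n. (S n - (\<Sum>i\<in>I. q n i)) / real n - C / real n) \<longlonglongrightarrow> \<rho> - 0" by (intro tendsto_intros R inv)
  then have pos: "\<forall>\<^sub>F n in sequentially. 0 < (S n - (\<Sum>i\<in>I. q n i)) / real n - C / real n"
    using R(2) by (intro order_tendstoD(1)) auto
  show "\<forall>\<^sub>F n in sequentially. dist (hyperg_ratio a B I' d' (q' n) I d (q n) n (S n)) 0 < e"
    using small \<epsilon>(2) pos q(1) C n1
  proof eventually_elim
    case (elim n)
    let ?m = "(real n - 1) / 2"
    have C0: "0 \<le> C" by (rule order_trans[OF sum_nonneg elim(5)]) simp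
    have CR: "C < S n - (\<Sum>i\<in>I. q n i)" using elim by (simp add: diff_divide_distrib[symmetric] zero_less_divide_iff)
    have "hyperg_integral a B I' d' ?m (S n) (q' n) \<le> ennreal (E n) *
      (ennreal (sqrt \<delta>) * hyperg_integral a B I d ?m (S n) (q n) + ennreal ((S n - (\<Sum>i\<in>I. q n i) + \<delta> * q n i0) powr (- ?m)))"
      unfolding E_def using elim CR by (intro hyperg_integral_growing_block a B I q d \<delta>) auto
    also have "\<dots> \<le> ennreal (E n) * (ennreal (sqrt \<delta>) * hyperg_integral a B I d ?m (S n) (q n) + ennreal (\<epsilon> n) * hyperg_integral a B I d ?m (S n) (q n))"
      using elim by (intro mult_left_mono add_left_mono) auto
    also have "\<dots> = ennreal (E n * (sqrt \<delta> + \<epsilon> n)) * hyperg_integral a B I d ?m (S n) (q n)"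
      using elim \<delta> by (simp add: E_def ennreal_mult' ennreal_plus distrib_right mult.assoc)
    finally have "hyperg_ratio a B I' d' (q' n) I d (q n) n (S n) \<le> E n * (sqrt \<delta> + \<epsilon> n)"
      unfolding hyperg_ratio_def using elim \<delta> CR C0 a B \<open>I \<subseteq> B\<close>
      by (intro enn2real_ratio_le hyperg_integral_pos) (auto simp: E_def)
    then show ?case using elim(1) hyperg_ratio_nonneg[of a B I' d' "q' n" I d "q n" n "S n"] by simp
  qed
qed

lemma prod_psi_real_lip:
  assumes "2 < a" "finite N"
  shows "(\<Prod>j\<in>N. psi_real a (d j) (x j)) \<le> exp (\<Sum>j\<in>N. \<bar>x j - y j\<bar>) * (\<Prod>j\<in>N. psi_real a (d j) (y j))"
  unfolding exp_sum[OF assms(2)] prod.distrib[symmetric]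
  by (intro prod_mono conjI psi_real_nonneg psi_real_lip assms)

lemma ennreal_prod_psi_real:
  assumes "2 < a"
  shows "(\<Prod>j\<in>N. psi a (d j) (x j)) = ennreal (\<Prod>j\<in>N. psi_real a (d j) (x j))"
  by (simp add: prod_ennreal[symmetric] ennreal_psi_real[OF assms])

text \<open>The explained sums of null blocks are bounded but need not converge, so the ratio is
  compared with the product at the current values. Both fixed-n bounds carry arguments close to q /
  (2 \<rho>), because m over the residual sum tends to 1 / (2 \<rho>).\<close>

lemma hyperg_ratio_null_blocks:
  fixes S :: "nat \<Rightarrow> real" and q :: "nat \<Rightarrow> nat \<Rightarrow> real"
  assumes a: "2 < a" and B: "finite B" "I \<union> N \<subseteq> B" and disj: "I \<inter> N = {}"
    and q: "\<forall>\<^sub>F n in sequentially. \<forall>i\<in>I \<union> N. 0 \<le> q n i"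
    and C: "\<forall>\<^sub>F n in sequentially. \<forall>j\<in>N. q n j \<le> C" "0 < C"
    and R': "(\<lambda>n. (S n - (\<Sum>i\<in>I \<union> N. q n i)) / real n) \<longlonglongrightarrow> \<rho>"
    and R: "(\<lambda>n. (S n - (\<Sum>i\<in>I. q n i)) / real n) \<longlonglongrightarrow> \<rho>" and \<rho>: "0 < \<rho>" and S: "(\<lambda>n. S n / real n) \<longlonglongrightarrow> s"
  shows "(\<lambda>n. hyperg_ratio a B (I \<union> N) d (q n) I d (q n) n (S n) - (\<Prod>j\<in>N. psi_real a (d j) (q n j / (2 * \<rho>)))) \<longlonglongrightarrow> 0"
proof (rule tendstoI)
  fix e :: real assume e: "0 < e"
  define W where "W n = (\<Prod>j\<in>N. psi_real a (d j) (q n j / (2 * \<rho>)))" for n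
  define \<rho>' where "\<rho>' = 1 / (2 * \<rho>)"
  define k where "k = real (card N) * C"
  \<comment> \<open>A common bound for the products with coefficient up to 2 \<rho>'; the factor 2
    leaves room for m / H as well as for \<rho>' itself.\<close>
  define w where "w = exp (2 * k * \<rho>')"
  define m where "m n = (real n - 1) / 2" for n
  have fin: "finite N" using B finite_subset by auto
  have k: "0 \<le> k" "0 < \<rho>'" using C \<rho> by (auto simp: k_def \<rho>'_def)
  have w: "0 < w" by (simp add: w_def)
  \<comment> \<open>The level \<open>H\<close> lies a fraction \<delta> above the residual sum,
    which biases the coefficient by at most \<rho>' \<delta>. The resulting error w k \<rho>'
    \<delta> stays below e/2.\<close>
  define \<delta> where "\<delta> = e / (2 * (w * k * \<rho>' + 1))"
  have wk: "0 \<le> w * k * \<rho>'" using w k by simp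
  then have \<delta>: "0 < \<delta>" using e by (simp add: \<delta>_def)
  have n1: "\<forall>\<^sub>F n in sequentially. 1 \<le> n" by (rule eventually_ge_at_top)
  have inv: "(\<lambda>n. c / real n) \<longlonglongrightarrow> 0" for c by (rule lim_const_over_n)
  have mH: "(\<lambda>n. m n / H n) \<longlonglongrightarrow> 1 / (2 * \<eta>)" if H: "(\<lambda>n. H n / real n) \<longlonglongrightarrow> \<eta>" "0 < \<eta>" for H and \<eta> :: real
  proof -
    have "(\<lambda>n. (1 / 2 - (1 / 2) / real n) / (H n / real n)) \<longlonglongrightarrow> (1 / 2 - 0) / \<eta>"
      using H by (intro tendsto_intros inv) auto
    then have "(\<lambda>n. m n / H n) \<longlonglongrightarrow> (1 / 2 - 0) / \<eta>"
      by (rule Lim_transform_eventually) (use n1 in eventually_elim, simp only: m_def half_ratio)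
    then show ?thesis by simp
  qed
  define H where "H n = (1 + \<delta>) * (S n - (\<Sum>i\<in>I. q n i))" for n
  define \<eta> where "\<eta> = (1 + \<delta>) * \<rho>"
  have \<eta>: "\<rho> < \<eta>" using \<delta> \<rho> by (simp add: \<eta>_def)
  have H: "(\<lambda>n. H n / real n) \<longlonglongrightarrow> \<eta>" unfolding H_def \<eta>_def times_divide_eq_right[symmetric] by (intro tendsto_intros R)
  have "I \<subseteq> B" using B by auto
  obtain \<epsilon> where \<epsilon>: "\<epsilon> \<longlonglongrightarrow> 0" "\<forall>\<^sub>F n in sequentially. 0 \<le> \<epsilon> n \<and>
    ennreal (H n powr (- m n)) \<le> ennreal (\<epsilon> n) * hyperg_integral a B I d (m n) (S n) (q n)"
    using hyperg_integral_concentration[OF a B(1) \<open>I \<subseteq> B\<close> _ R \<rho> S H \<eta>] q unfolding m_def by (auto simp: ball_Un eventually_conj_iff)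
  define u where "u n = k * \<bar>m n / (S n - (\<Sum>i\<in>I \<union> N. q n i)) - \<rho>'\<bar>" for n
  define v where "v n = k * \<bar>m n / H n - \<rho>'\<bar>" for n
  have "(\<lambda>n. w * (exp (u n) - 1)) \<longlonglongrightarrow> w * (exp (k * \<bar>1 / (2 * \<rho>) - \<rho>'\<bar>) - 1)"
    unfolding u_def by (intro tendsto_intros mH R' \<rho>)
  then have u: "\<forall>\<^sub>F n in sequentially. w * (exp (u n) - 1) < e"
    using e by (intro order_tendstoD(2)) (auto simp: \<rho>'_def)
  have "(\<lambda>n. w * v n + \<epsilon> n * w) \<longlonglongrightarrow> w * (k * \<bar>1 / (2 * \<eta>) - \<rho>'\<bar>) + 0 * w"
    unfolding v_def using \<rho> \<eta> by (intro tendsto_intros mH H \<epsilon>) auto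
  moreover have "w * (k * \<bar>1 / (2 * \<eta>) - \<rho>'\<bar>) + 0 * w < e"
  proof -
    have "\<rho>' - 1 / (2 * \<eta>) = \<rho>' * (\<delta> / (1 + \<delta>))" 
    proof -
      have "1 / (2 * \<eta>) = \<rho>' / (1 + \<delta>)" by (simp add: \<rho>'_def \<eta>_def mult_ac)
      then show ?thesis using \<delta> by (simp add: field_simps)
    qed
    then have "\<bar>1 / (2 * \<eta>) - \<rho>'\<bar> = \<rho>' * (\<delta> / (1 + \<delta>))" using k \<delta>
      by (metis abs_minus_commute abs_of_nonneg add_nonneg_nonneg divide_nonneg_nonneg less_imp_le mult_nonneg_nonneg zero_le_one)
    also have "\<dots> \<le> \<rho>' * \<delta>" using k \<delta> by (intro mult_left_mono) (auto simp: field_simps)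
    finally have "w * (k * \<bar>1 / (2 * \<eta>) - \<rho>'\<bar>) \<le> w * (k * (\<rho>' * \<delta>))" using w k by (intro mult_left_mono) auto
    also have "\<dots> = w * k * \<rho>' * \<delta>" by simp
    also have "\<dots> \<le> (w * k * \<rho>' + 1) * \<delta>" using \<delta> by (intro mult_right_mono) auto
    also have "\<dots> = e / 2"
    proof -
      have "A * (e / (2 * A)) = e / 2" if "A \<noteq> 0" for A :: real using that by simp
      moreover have "w * k * \<rho>' + 1 \<noteq> 0" using wk by linarith
      ultimately show ?thesis unfolding \<delta>_def by blast
    qed
    finally show ?thesis using e by simp
  qed
  ultimately have v: "\<forall>\<^sub>F n in sequentially. w * v n + \<epsilon> n * w < e" by (rule order_tendstoD(2))
  have mHb: "\<forall>\<^sub>F n in sequentially. m n / H n < 2 * \<rho>'"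
    using \<rho> \<eta> by (intro order_tendstoD(2)[OF mH[OF H]]) (auto simp: \<rho>'_def field_simps)
  have pos: "\<forall>\<^sub>F n in sequentially. 0 < (S n - (\<Sum>i\<in>I. q n i)) / real n" using order_tendstoD(1)[OF R \<rho>] .
  have pos': "\<forall>\<^sub>F n in sequentially. 0 < (S n - (\<Sum>i\<in>I \<union> N. q n i)) / real n" using order_tendstoD(1)[OF R' \<rho>] .
  show "\<forall>\<^sub>F n in sequentially. dist (hyperg_ratio a B (I \<union> N) d (q n) I d (q n) n (S n) - W n) 0 < e"
    using \<epsilon>(2) u v mHb pos pos' q C(1) n1
  proof eventually_elim
    case (elim n)
    let ?b = "hyperg_integral a B I d (m n) (S n) (q n)" and ?b' = "hyperg_integral a B (I \<union> N) d (m n) (S n) (q n)"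
    let ?R' = "S n - (\<Sum>i\<in>I \<union> N. q n i)"
    let ?r = "hyperg_ratio a B (I \<union> N) d (q n) I d (q n) n (S n)"
    have R': "0 < ?R'" "0 < S n - (\<Sum>i\<in>I. q n i)" and m: "0 \<le> m n"
      using elim by (auto simp: zero_less_divide_iff m_def)
    have Hpos: "0 < H n" using R' \<delta> by (simp add: H_def)
    have q: "\<And>i. i \<in> I \<union> N \<Longrightarrow> 0 \<le> q n i" using elim by blast
    have bpos: "0 < enn2real ?b" "?b < \<top>" using q R' m B by (auto intro!: hyperg_integral_pos a)
    have r: "?r = enn2real ?b' / enn2real ?b" by (simp add: hyperg_ratio_def m_def)
    have dist: "(\<Sum>j\<in>N. \<bar>c * q n j - \<rho>' * q n j\<bar>) \<le> k * \<bar>c - \<rho>'\<bar>" for c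
    proof -
      have "(\<Sum>j\<in>N. \<bar>c * q n j - \<rho>' * q n j\<bar>) = (\<Sum>j\<in>N. q n j * \<bar>c - \<rho>'\<bar>)"
        using q by (intro sum.cong) (auto simp: left_diff_distrib[symmetric] abs_mult)
      also have "\<dots> \<le> (\<Sum>j\<in>N. C * \<bar>c - \<rho>'\<bar>)"
        using elim(8) by (intro sum_mono mult_right_mono) auto
      finally show ?thesis by (simp add: k_def)
    qed
    have Weq: "W n = (\<Prod>j\<in>N. psi_real a (d j) (\<rho>' * q n j))" by (simp add: W_def \<rho>'_def)
    have bound: "(\<Prod>j\<in>N. psi_real a (d j) (c * q n j)) \<le> w" if "0 \<le> c" "c \<le> 2 * \<rho>'" for c
    proof -
      have "(\<Prod>j\<in>N. psi_real a (d j) (c * q n j)) \<le> (\<Prod>j\<in>N. exp (2 * \<rho>' * C))"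
      proof (intro prod_mono conjI psi_real_nonneg)
        fix j assume j: "j \<in> N"
        have "psi_real a (d j) (c * q n j) \<le> exp (c * q n j)" using that q j by (intro psi_real_le a) auto
        also have "c * q n j \<le> 2 * \<rho>' * C" using that q[of j] elim(8) j k by (intro mult_mono) auto
        finally show "psi_real a (d j) (c * q n j) \<le> exp (2 * \<rho>' * C)" by simp
      qed
      also have "\<dots> = w" by (simp add: w_def k_def exp_of_nat_mult[symmetric] mult_ac)
      finally show ?thesis .
    qed
    have Ww: "0 \<le> W n" "W n \<le> w" unfolding Weq using bound[of \<rho>'] k by (auto intro!: prod_nonneg)
    have "?r \<le> W n * exp (u n)"
    proof -
      have "?b' \<le> ?b * ennreal (\<Prod>j\<in>N. psi_real a (d j) (m n / ?R' * q n j))"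
        using hyperg_integral_null_blocks(1)[OF a B disj q R'(1) m, of d] by (simp add: ennreal_prod_psi_real[OF a])
      then have "?r \<le> (\<Prod>j\<in>N. psi_real a (d j) (m n / ?R' * q n j))"
        unfolding r using bpos by (intro enn2real_ratio_le) (auto simp: mult.commute intro!: prod_nonneg)
      also have "\<dots> \<le> exp (\<Sum>j\<in>N. \<bar>m n / ?R' * q n j - \<rho>' * q n j\<bar>) * W n"
        unfolding Weq by (rule prod_psi_real_lip[OF a fin])
      also have "\<dots> \<le> exp (u n) * W n" unfolding u_def by (intro mult_right_mono iffD2[OF exp_le_cancel_iff] dist Ww(1))
      finally show ?thesis by (simp add: mult.commute)
    qed
    moreover have "W n * (exp (u n) - 1) \<le> w * (exp (u n) - 1)"
      using Ww k by (intro mult_right_mono) (auto simp: u_def)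
    ultimately have up: "?r - W n < e" using elim(2) by (simp add: right_diff_distrib)
    define Z where "Z = (\<Prod>j\<in>N. psi_real a (d j) (m n / H n * q n j))"
    have Z: "0 \<le> Z" "Z \<le> w" unfolding Z_def using bound[of "m n / H n"] elim(4) m Hpos by (auto intro!: prod_nonneg)
    \<comment> \<open>The lower bound divided by the integral over \<open>I\<close>; concentration
      turns the H^(-m) term into \<epsilon> times that integral.\<close>
    have "Z \<le> ?r + \<epsilon> n * Z"
    proof -
      have "?b * ennreal Z \<le> ?b' + ennreal (H n powr (- m n)) * ennreal Z"
        using hyperg_integral_null_blocks(2)[OF a B disj q R'(1) m Hpos, of d] by (simp add: ennreal_prod_psi_real[OF a] Z_def)
      also have "\<dots> \<le> ?b' + ennreal (\<epsilon> n) * ?b * ennreal Z"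
        using elim(1) by (intro add_left_mono mult_right_mono) auto
      finally have 1: "?b * ennreal Z \<le> ?b' + ennreal (\<epsilon> n) * ?b * ennreal Z" .
      have "?b' < \<top>" using q R' m B by (intro hyperg_integral_pos a) auto
      then obtain x y where xy: "?b = ennreal x" "?b' = ennreal y" "0 \<le> x" "0 \<le> y"
        using bpos(2) by (metis enn2real_nonneg ennreal_enn2real)
      have x: "0 < x" using bpos(1) xy by simp
      have "x * Z \<le> y + \<epsilon> n * x * Z"
        using 1 elim(1) xy Z by (simp add: ennreal_mult'[symmetric] ennreal_plus[symmetric] ennreal_le_iff del: ennreal_plus)
      then have "x * Z / x \<le> (y + \<epsilon> n * x * Z) / x" using x by (intro divide_right_mono) auto
      then show ?thesis using x xy by (simp add: r add_divide_distrib)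
    qed
    moreover have "W n \<le> exp (v n) * Z"
    proof -
      have "W n \<le> exp (\<Sum>j\<in>N. \<bar>\<rho>' * q n j - m n / H n * q n j\<bar>) * Z"
        unfolding Weq Z_def by (rule prod_psi_real_lip[OF a fin])
      also have "\<dots> \<le> exp (v n) * Z"
        unfolding v_def abs_minus_commute[of "\<rho>' * _"] by (intro mult_right_mono iffD2[OF exp_le_cancel_iff] dist Z(1))
      finally show ?thesis .
    qed
    \<comment> \<open>1 - exp(-v) \<le> v turns the multiplicative comparison into a
      difference.\<close>
    moreover have "W n - Z \<le> w * v n"
    proof -
      have "exp (- v n) * W n \<le> Z" using calculation(2) by (simp add: exp_minus field_simps)
      then have "W n - Z \<le> (1 - exp (- v n)) * W n" by (simp add: left_diff_distrib)
      also have "\<dots> \<le> v n * W n" using exp_ge_add_one_self[of "- v n"] Ww by (intro mult_right_mono) auto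
      also have "\<dots> \<le> v n * w" using Ww k by (intro mult_left_mono) (auto simp: v_def)
      finally show ?thesis by (simp add: mult.commute)
    qed
    moreover have "\<epsilon> n * Z \<le> \<epsilon> n * w" using Z elim(1) by (intro mult_left_mono) auto
    ultimately have "W n - ?r < e" using elim(3) by linarith
    with up show ?case by (simp add: dist_real_def abs_less_iff)
  qed
qed

section \<open>Orthonormalisation and joint laws of normal coordinates\<close>

definition inner_upto :: "nat \<Rightarrow> (nat \<Rightarrow> real) \<Rightarrow> (nat \<Rightarrow> real) \<Rightarrow> real" where
  "inner_upto n u v = (\<Sum>r<n. u r * v r)"

lemma inner_upto_commute: "inner_upto n u v = inner_upto n v u"
  by (simp add: inner_upto_def mult.commute)

lemma inner_upto_diff_scale: "inner_upto n (\<lambda>r. u r - c * w r) v = inner_upto n u v - c * inner_upto n w v"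
  by (simp add: inner_upto_def sum_subtractf sum_distrib_left left_diff_distrib mult.assoc)

lemma inner_upto_divide: "inner_upto n (\<lambda>r. u r / c) v = inner_upto n u v / c"
  by (simp add: inner_upto_def sum_divide_distrib)

text \<open>Gram-Schmidt runs in step with elimination: removing from the columns their component
  along column \<open>x\<close> turns the Gram matrix into the Schur complement. The middle clause
  records in dual form that each \<open>e i\<close> lies in the span of the columns; it gives
  orthogonality to column \<open>x\<close> here and across blocks later.\<close>

lemma inv_quad_list_orthonormal:
  assumes "pivots_pos xs (\<lambda>i j. inner_upto n (X i) (X j))" "distinct xs"
  shows "\<exists>e. (\<forall>i\<in>set xs. \<forall>j\<in>set xs. inner_upto n (e i) (e j) = (if i = j then 1 else 0)) \<and>
    (\<forall>v. (\<forall>i\<in>set xs. inner_upto n (X i) v = 0) \<longrightarrow> (\<forall>i\<in>set xs. inner_upto n (e i) v = 0)) \<and>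
    (\<forall>y. inv_quad_list xs (\<lambda>i j. inner_upto n (X i) (X j)) (\<lambda>i. inner_upto n (X i) y) = (\<Sum>i\<in>set xs. (inner_upto n (e i) y)\<^sup>2))"
  using assms
proof (induction xs arbitrary: X)
  case (Cons x xs)
  define Q where "Q i j = inner_upto n (X i) (X j)" for i j
  define X' where "X' i r = X i r - Q i x / Q x x * X x r" for i r
  have pos: "0 < Q x x" and x: "x \<notin> set xs" "distinct xs" using Cons.prems by (auto simp: Q_def)
  have ipX': "inner_upto n (X' i) v = inner_upto n (X i) v - Q i x / Q x x * inner_upto n (X x) v" for i v
    unfolding X'_def by (rule inner_upto_diff_scale)
  have sch: "(\<lambda>i j. inner_upto n (X' i) (X' j)) = schur Q x"
  proof (intro ext)
    fix i j
    have "inner_upto n (X' i) (X' j) = inner_upto n (X' j) (X i) - Q i x / Q x x * inner_upto n (X' j) (X x)"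
      unfolding ipX'[of i] by (simp only: inner_upto_commute[of n _ "X' j"])
    also have "inner_upto n (X' j) (X i) = Q i j - Q j x / Q x x * Q i x"
      unfolding ipX' by (simp only: Q_def inner_upto_commute[of n "X j" "X i"] inner_upto_commute[of n "X x" "X i"])
    also have "inner_upto n (X' j) (X x) = 0" unfolding ipX' using pos by (simp add: Q_def)
    also have "Q j x = Q x j" by (simp add: Q_def inner_upto_commute)
    finally show "inner_upto n (X' i) (X' j) = schur Q x i j" by (simp add: schur_def mult.commute)
  qed
  have "pivots_pos xs (\<lambda>i j. inner_upto n (X' i) (X' j))" unfolding sch using Cons.prems(1) by (simp add: Q_def[abs_def])
  from Cons.IH[OF this x(2)] obtain e where
    e1: "\<And>i j. i \<in> set xs \<Longrightarrow> j \<in> set xs \<Longrightarrow> inner_upto n (e i) (e j) = (if i = j then 1 else 0)" and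
    e2: "\<And>v i. (\<And>i. i \<in> set xs \<Longrightarrow> inner_upto n (X' i) v = 0) \<Longrightarrow> i \<in> set xs \<Longrightarrow> inner_upto n (e i) v = 0" and
    e3: "\<And>y. inv_quad_list xs (\<lambda>i j. inner_upto n (X' i) (X' j)) (\<lambda>i. inner_upto n (X' i) y) = (\<Sum>i\<in>set xs. (inner_upto n (e i) y)\<^sup>2)"
    by blast
  define e' where "e' = e(x := (\<lambda>r. X x r / sqrt (Q x x)))"
  have e'x: "inner_upto n (e' x) v = inner_upto n (X x) v / sqrt (Q x x)" for v by (simp add: e'_def inner_upto_divide)
  have e'i: "e' i = e i" if "i \<in> set xs" for i using that x by (auto simp: e'_def)
  have orth: "inner_upto n (e i) (X x) = 0" if "i \<in> set xs" for i
    by (rule e2[OF _ that]) (use pos in \<open>simp add: ipX' Q_def\<close>)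
  have xx: "inner_upto n (e' x) (e' x) = 1"
  proof -
    have "inner_upto n (e' x) (e' x) = inner_upto n (e' x) (X x) / sqrt (Q x x)" unfolding e'x[of "e' x"] by (simp only: inner_upto_commute)
    also have "inner_upto n (e' x) (X x) = Q x x / sqrt (Q x x)" unfolding e'x Q_def ..
    finally show ?thesis using pos by (simp add: real_div_sqrt)
  qed
  have xi: "inner_upto n (e' x) (e' i) = 0" if "i \<in> set xs" for i
    unfolding e'x e'i[OF that] using orth[OF that] by (simp add: inner_upto_commute)
  have "inner_upto n (e' i) (e' j) = (if i = j then 1 else 0)" if ij: "i \<in> set (x # xs)" "j \<in> set (x # xs)" for i j
  proof -
    consider "i = x" "j = x" | "i = x" "j \<in> set xs" | "j = x" "i \<in> set xs" | "i \<in> set xs" "j \<in> set xs"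
      using ij by auto
    then show ?thesis
    proof cases
      case 1
      then show ?thesis using xx by simp
    next
      case 2
      then show ?thesis using xi[of j] x(1) by auto
    next
      case 3
      have "inner_upto n (e' i) (e' x) = 0" using xi[OF 3(2)] by (simp only: inner_upto_commute[of n "e' i" "e' x"])
      then show ?thesis using 3 x(1) by auto
    next
      case 4
      then show ?thesis using e1[of i j] by (simp add: e'i)
    qed
  qed
  moreover have "inner_upto n (e' i) v = 0" if v: "\<And>i. i \<in> set (x # xs) \<Longrightarrow> inner_upto n (X i) v = 0" and i: "i \<in> set (x # xs)" for v i
  proof (cases "i = x")
    case True
    then show ?thesis using v[of x] by (simp add: e'x)
  next
    case False
    then have "i \<in> set xs" using i by simp
    moreover have "inner_upto n (X' k) v = 0" if "k \<in> set xs" for k using v[of k] v[of x] that by (simp add: ipX')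
    ultimately show ?thesis using e2[of v i] by (simp add: e'i)
  qed
  moreover have "inv_quad_list (x # xs) Q (\<lambda>i. inner_upto n (X i) y) = (\<Sum>i\<in>set (x # xs). (inner_upto n (e' i) y)\<^sup>2)" for y
  proof -
    have b: "(\<lambda>i. inner_upto n (X' i) y) = (\<lambda>i. inner_upto n (X i) y - Q i x * inner_upto n (X x) y / Q x x)"
      by (intro ext) (simp add: ipX')
    have "inv_quad_list (x # xs) Q (\<lambda>i. inner_upto n (X i) y) = (inner_upto n (X x) y)\<^sup>2 / Q x x + inv_quad_list xs (\<lambda>i j. inner_upto n (X' i) (X' j)) (\<lambda>i. inner_upto n (X' i) y)"
      by (simp only: inv_quad_list.simps sch b)
    also have "\<dots> = (inner_upto n (e' x) y)\<^sup>2 + (\<Sum>i\<in>set xs. (inner_upto n (e' i) y)\<^sup>2)"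
      unfolding e3 e'x using pos by (simp add: power_divide e'i)
    finally show ?thesis using x by simp
  qed
  ultimately show ?case unfolding Q_def by blast
qed simp

text \<open>The bases of the blocks are glued by block label. Across blocks the span property is
  applied twice, replacing columns by basis vectors first on one side and then on the other.\<close>

lemma block_orthonormal:
  assumes "finite N" "\<And>i. i \<in> blk ` N \<Longrightarrow> posdef_on (block_set blk N i) (gram X n)"
    and orth: "\<And>j j'. j \<in> N \<Longrightarrow> j' \<in> N \<Longrightarrow> blk j \<noteq> blk j' \<Longrightarrow> gram X n j j' = 0"
  shows "\<exists>e. (\<forall>i\<in>N. \<forall>j\<in>N. inner_upto n (e i) (e j) = (if i = j then 1 else 0)) \<and>
    (\<forall>y. \<forall>i\<in>blk ` N. inv_quad (block_set blk N i) (gram X n) (xty X n y) = (\<Sum>j\<in>block_set blk N i. (inner_upto n (e j) y)\<^sup>2))"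
proof -
  let ?x = "\<lambda>j r. X n r j" and ?S = "block_set blk N"
  have G: "gram X n = (\<lambda>i j. inner_upto n (?x i) (?x j))" by (intro ext) (simp add: gram_def inner_upto_def)
  have b: "xty X n y = (\<lambda>j. inner_upto n (?x j) y)" for y by (intro ext) (simp add: xty_def inner_upto_def)
  have fin: "finite (?S i)" for i using assms(1) by simp
  define P where "P i e \<longleftrightarrow> (\<forall>k\<in>?S i. \<forall>j\<in>?S i. inner_upto n (e k) (e j) = (if k = j then 1 else 0)) \<and>
    (\<forall>v. (\<forall>k\<in>?S i. inner_upto n (?x k) v = 0) \<longrightarrow> (\<forall>k\<in>?S i. inner_upto n (e k) v = 0)) \<and>
    (\<forall>y. inv_quad (?S i) (gram X n) (xty X n y) = (\<Sum>j\<in>?S i. (inner_upto n (e j) y)\<^sup>2))" for i and e :: "nat \<Rightarrow> nat \<Rightarrow> real"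
  have "\<forall>i\<in>blk ` N. \<exists>e. P i e"
  proof
    fix i assume i: "i \<in> blk ` N"
    have S: "set (sorted_list_of_set (?S i)) = ?S i" using fin by simp
    show "\<exists>e. P i e"
      using inv_quad_list_orthonormal[of "sorted_list_of_set (?S i)" n ?x] assms(2)[OF i]
      unfolding P_def posdef_on_def inv_quad_def G b S by simp
  qed
  then obtain e where e: "\<forall>i\<in>blk ` N. P i (e i)" by (rule bchoice[THEN exE])
  have e1: "inner_upto n (e i k) (e i j) = (if k = j then 1 else 0)" if "i \<in> blk ` N" "k \<in> ?S i" "j \<in> ?S i" for i j k
    using bspec[OF e that(1)] that(2,3) unfolding P_def by blast
  have e2: "inner_upto n (e i k) v = 0" if "i \<in> blk ` N" "\<forall>k\<in>?S i. inner_upto n (?x k) v = 0" "k \<in> ?S i" for i v k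
    using bspec[OF e that(1)] that(2,3) unfolding P_def by blast
  have e3: "inv_quad (?S i) (gram X n) (xty X n y) = (\<Sum>j\<in>?S i. (inner_upto n (e i j) y)\<^sup>2)" if "i \<in> blk ` N" for i y
    using bspec[OF e that(1)] unfolding P_def by blast
  define e' where "e' j = e (blk j) j" for j
  have mem: "j \<in> ?S (blk j)" if "j \<in> N" for j using that by (simp add: block_set_def)
  have "inner_upto n (e' i) (e' j) = (if i = j then 1 else 0)" if ij: "i \<in> N" "j \<in> N" for i j
  proof (cases "blk i = blk j")
    case True
    then show ?thesis using e1[of "blk i" i j] mem[of i] mem[of j] ij by (simp add: e'_def)
  next
    case False
    have "inner_upto n (e' i) (?x k) = 0" if k: "k \<in> ?S (blk j)" for k
      unfolding e'_def
    proof (rule e2)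
      show "\<forall>l\<in>?S (blk i). inner_upto n (?x l) (?x k) = 0"
        using orth[of _ k] False k by (auto simp: G block_set_def)
    qed (use ij mem in auto)
    then have "\<forall>k\<in>?S (blk j). inner_upto n (?x k) (e' i) = 0" by (simp add: inner_upto_commute)
    then have "inner_upto n (e (blk j) j) (e' i) = 0" using ij mem by (intro e2) auto
    then show ?thesis using False by (auto simp: e'_def inner_upto_commute)
  qed
  moreover have "inv_quad (?S i) (gram X n) (xty X n y) = (\<Sum>j\<in>?S i. (inner_upto n (e' j) y)\<^sup>2)" if "i \<in> blk ` N" for i y
    unfolding e3[OF that] e'_def by (intro sum.cong refl) (auto simp: block_set_def)
  ultimately show ?thesis by blast
qed

section \<open>Characteristic functions and joint laws\<close>

definition centered_normal :: "real \<Rightarrow> real measure" where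
  "centered_normal \<sigma> = density lborel (\<lambda>x. ennreal (normal_density 0 \<sigma> x))"

lemma prob_space_centered_normal: "0 < \<sigma> \<Longrightarrow> prob_space (centered_normal \<sigma>)"
  unfolding centered_normal_def by (rule prob_space_normal_density)

lemma sets_centered_normal [simp, measurable_cong]: "sets (centered_normal \<sigma>) = sets borel"
  and space_centered_normal [simp]: "space (centered_normal \<sigma>) = UNIV"
  by (simp_all add: centered_normal_def)

lemma real_distribution_centered_normal: "0 < \<sigma> \<Longrightarrow> real_distribution (centered_normal \<sigma>)"
  by (simp add: real_distribution_def real_distribution_axioms_def prob_space_centered_normal)

lemma char_centered_normal:
  assumes "0 < \<sigma>"
  shows "char (centered_normal \<sigma>) t = of_real (exp (- (\<sigma>\<^sup>2 * t\<^sup>2) / 2))"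
proof -
  interpret prob_space "centered_normal \<sigma>" by (rule prob_space_centered_normal[OF assms])
  have "distributed (centered_normal \<sigma>) lborel (\<lambda>x. x) (normal_density 0 \<sigma>)"
    unfolding distributed_def by (auto simp: centered_normal_def intro!: distr_id2[THEN trans])
  then have "distributed (centered_normal \<sigma>) lborel (\<lambda>x. (x - 0) / \<sigma>) std_normal_density"
    by (subst (asm) normal_standard_normal_convert[OF assms])
  then have "distr (centered_normal \<sigma>) lborel (\<lambda>x. x / \<sigma>) = std_normal_distribution"
    by (simp add: distributed_def)
  moreover have "distr (centered_normal \<sigma>) lborel (\<lambda>x. x / \<sigma>) = distr (centered_normal \<sigma>) borel (\<lambda>x. x / \<sigma>)"
    by (rule distr_cong) simp_all
  ultimately have d: "distr (centered_normal \<sigma>) borel (\<lambda>x. x / \<sigma>) = std_normal_distribution" by simp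
  have "char (centered_normal \<sigma>) t = (CLINT x|centered_normal \<sigma>. iexp (t * \<sigma> * (x / \<sigma>)))"
    using assms by (simp add: char_def)
  also have "\<dots> = char (distr (centered_normal \<sigma>) borel (\<lambda>x. x / \<sigma>)) (t * \<sigma>)"
    unfolding char_def by (subst integral_distr) auto
  also have "\<dots> = of_real (exp (- (\<sigma>\<^sup>2 * t\<^sup>2) / 2))"
    unfolding d char_std_normal_distribution by (simp add: power_mult_distrib mult.commute)
  finally show ?thesis .
qed

lemma distr_eq_centered_normal:
  assumes "distributed M lborel X (normal_density 0 \<sigma>)"
  shows "distr M borel X = centered_normal \<sigma>"
proof -
  have "distr M lborel X = centered_normal \<sigma>" using assms by (simp add: distributed_def centered_normal_def)
  moreover have "distr M lborel X = distr M borel X" by (rule distr_cong) simp_all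
  ultimately show ?thesis by simp
qed

text \<open>The weight is shifted to the positive function $2 + h$ so that uniqueness of characteristic functions
  applies to a reweighted probability measure.\<close>
lemma (in prob_space) char_weighted:
  fixes \<eta> h :: "'a \<Rightarrow> real"
  assumes [measurable]: "\<eta> \<in> borel_measurable M" "h \<in> borel_measurable M" and h: "\<And>\<omega>. \<bar>h \<omega>\<bar> \<le> 1"
    and \<nu>: "real_distribution \<nu>"
    and char0: "\<And>s. (CLINT \<omega>|M. iexp (s * \<eta> \<omega>)) = char \<nu> s"
    and charh: "\<And>s. (CLINT \<omega>|M. h \<omega> *\<^sub>R iexp (s * \<eta> \<omega>)) = char \<nu> s * of_real (expectation h)"
    and A: "A \<in> sets borel"
  shows "expectation (\<lambda>\<omega>. h \<omega> * indicator A (\<eta> \<omega>)) = expectation h * measure \<nu> A"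
proof -
  interpret \<nu>: real_distribution \<nu> by (rule \<nu>)
  have [measurable]: "A \<in> sets borel" by (rule A)
  have [simp]: "integrable M h" using h by (intro integrable_const_bound[of _ 1]) auto
  have main: "expectation (\<lambda>\<omega>. g \<omega> * indicator A (\<eta> \<omega>)) = expectation g * measure \<nu> A"
    if [measurable]: "g \<in> borel_measurable M" and g: "\<And>\<omega>. 1 \<le> g \<omega>" "\<And>\<omega>. g \<omega> \<le> 3"
      and charg: "\<And>s. (CLINT \<omega>|M. g \<omega> *\<^sub>R iexp (s * \<eta> \<omega>)) = char \<nu> s * of_real (expectation g)" for g
  proof -
    have int: "integrable M g"
    proof (intro integrable_const_bound[of _ 3])
      show "AE x in M. norm (g x) \<le> 3"
      proof (rule AE_I2)
        fix x show "norm (g x) \<le> 3" using g[of x] by simp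
      qed
    qed simp
    define G where "G = expectation g"
    have "expectation (\<lambda>_. 1) \<le> G" unfolding G_def using g int by (intro integral_mono) auto
    then have G: "1 \<le> G" by (simp add: prob_space)
    have g0: "0 \<le> g \<omega> / G" for \<omega> using g(1)[of \<omega>] G by simp
    define Mg where "Mg = density M (\<lambda>\<omega>. ennreal (g \<omega> / G))"
    have "emeasure Mg (space Mg) = (\<integral>\<^sup>+ \<omega>. ennreal (g \<omega> / G) \<partial>M)"
      unfolding Mg_def by (subst emeasure_density) (auto intro!: nn_integral_cong)
    also have "\<dots> = ennreal (expectation (\<lambda>\<omega>. g \<omega> / G))"
      using g0 int by (intro nn_integral_eq_integral) auto
    also have "expectation (\<lambda>\<omega>. g \<omega> / G) = 1" using G by (simp add: G_def)
    finally interpret Mg: prob_space Mg by (intro prob_spaceI) simp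
    have [measurable]: "\<eta> \<in> borel_measurable Mg" by (simp add: Mg_def)
    have "distr Mg borel \<eta> = \<nu>"
    proof (rule Levy_uniqueness)
      show "real_distribution (distr Mg borel \<eta>)" by (rule Mg.real_distribution_distr) simp
      show "char (distr Mg borel \<eta>) = char \<nu>"
      proof
        fix s
        have "char (distr Mg borel \<eta>) s = (CLINT \<omega>|Mg. iexp (s * \<eta> \<omega>))"
          unfolding char_def by (subst integral_distr) auto
        also have "\<dots> = (CLINT \<omega>|M. (g \<omega> / G) *\<^sub>R iexp (s * \<eta> \<omega>))"
          unfolding Mg_def using g0 by (subst integral_density) auto
        also have "\<dots> = (CLINT \<omega>|M. (1 / G) *\<^sub>R (g \<omega> *\<^sub>R iexp (s * \<eta> \<omega>)))"
          by (intro Bochner_Integration.integral_cong) auto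
        also have "\<dots> = (1 / G) *\<^sub>R (char \<nu> s * of_real G)"
          by (simp only: integral_scaleR_right charg G_def)
        also have "\<dots> = char \<nu> s" using G by (simp add: scaleR_conv_of_real)
        finally show "char (distr Mg borel \<eta>) s = char \<nu> s" .
      qed
    qed (rule \<nu>)
    then have "measure \<nu> A = measure (distr Mg borel \<eta>) A" by simp
    also have "\<dots> = Mg.expectation (\<lambda>\<omega>. indicator A (\<eta> \<omega>))"
    proof -
      have "measure (distr Mg borel \<eta>) A = integral\<^sup>L (distr Mg borel \<eta>) (indicator A)" by simp
      also have "\<dots> = Mg.expectation (\<lambda>\<omega>. indicator A (\<eta> \<omega>))" by (subst integral_distr) auto
      finally show ?thesis .
    qed
    also have "\<dots> = expectation (\<lambda>\<omega>. (g \<omega> / G) * indicator A (\<eta> \<omega>))"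
      unfolding Mg_def using g0 by (subst integral_density) auto
    also have "\<dots> = expectation (\<lambda>\<omega>. g \<omega> * indicator A (\<eta> \<omega>)) / G"
      by (simp add: integral_divide_zero[symmetric] del: integral_divide_zero)
    finally show ?thesis using G by (simp add: G_def field_simps)
  qed
  have intexp: "complex_integrable M (\<lambda>\<omega>. iexp (s * \<eta> \<omega>))" "complex_integrable M (\<lambda>\<omega>. h \<omega> *\<^sub>R iexp (s * \<eta> \<omega>))" for s
    using h by (auto intro!: integrable_const_bound[of _ 1])
  have e1: "expectation (\<lambda>_. 1 :: real) = 1" by (simp add: prob_space)
  \<comment> \<open>The weight 1 gives the plain law of \<eta>; twice this result subtracted from
    that for 2 + h leaves the claim for \<open>h\<close>.\<close>
  have "expectation (\<lambda>\<omega>. 1 * indicator A (\<eta> \<omega>)) = expectation (\<lambda>_. 1) * measure \<nu> A"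
  proof (rule main)
    show "(CLINT \<omega>|M. 1 *\<^sub>R iexp (s * \<eta> \<omega>)) = char \<nu> s * of_real (expectation (\<lambda>_. 1))" for s
      by (simp only: scaleR_one char0 e1 of_real_1 mult_1_right)
  qed auto
  then have base: "expectation (\<lambda>\<omega>. indicator A (\<eta> \<omega>)) = measure \<nu> A" by (simp add: prob_space)
  have "expectation (\<lambda>\<omega>. (2 + h \<omega>) * indicator A (\<eta> \<omega>)) = expectation (\<lambda>\<omega>. 2 + h \<omega>) * measure \<nu> A"
  proof (rule main)
    show "1 \<le> 2 + h \<omega>" "2 + h \<omega> \<le> 3" for \<omega> using h[of \<omega>] by (auto simp: abs_le_iff)
    show "(CLINT \<omega>|M. (2 + h \<omega>) *\<^sub>R iexp (s * \<eta> \<omega>)) = char \<nu> s * of_real (expectation (\<lambda>\<omega>. 2 + h \<omega>))" for s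
    proof -
      have "(CLINT \<omega>|M. (2 + h \<omega>) *\<^sub>R iexp (s * \<eta> \<omega>)) = (CLINT \<omega>|M. 2 *\<^sub>R iexp (s * \<eta> \<omega>) + h \<omega> *\<^sub>R iexp (s * \<eta> \<omega>))"
        by (simp only: scaleR_add_left)
      also have "\<dots> = (CLINT \<omega>|M. 2 *\<^sub>R iexp (s * \<eta> \<omega>)) + (CLINT \<omega>|M. h \<omega> *\<^sub>R iexp (s * \<eta> \<omega>))"
        by (intro Bochner_Integration.integral_add integrable_scaleR_right intexp)
      also have "\<dots> = 2 *\<^sub>R char \<nu> s + char \<nu> s * of_real (expectation h)"
        by (simp only: integral_scaleR_right char0 charh)
      also have "expectation (\<lambda>\<omega>. 2 + h \<omega>) = 2 + expectation h" by (simp add: prob_space)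
      ultimately show ?thesis by (simp add: scaleR_conv_of_real algebra_simps prob_space)
    qed
  qed simp
  also have "expectation (\<lambda>\<omega>. 2 + h \<omega>) = 2 + expectation h" by (simp add: prob_space)
  finally have "expectation (\<lambda>\<omega>. 2 * indicator A (\<eta> \<omega>) + h \<omega> * indicator A (\<eta> \<omega>)) = (2 + expectation h) * measure \<nu> A"
    by (simp add: distrib_right)
  moreover have "expectation (\<lambda>\<omega>. 2 * indicator A (\<eta> \<omega>) + h \<omega> * indicator A (\<eta> \<omega>))
    = 2 * measure \<nu> A + expectation (\<lambda>\<omega>. h \<omega> * indicator A (\<eta> \<omega>))"
  proof -
    have "integrable M (\<lambda>\<omega>. indicator A (\<eta> \<omega>) :: real)" by (intro integrable_const_bound[of _ 1]) (auto simp: indicator_def)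
    moreover have "integrable M (\<lambda>\<omega>. h \<omega> * indicator A (\<eta> \<omega>))"
      using h by (intro integrable_const_bound[of _ 1]) (auto simp: indicator_def)
    ultimately show ?thesis by (subst Bochner_Integration.integral_add) (auto simp: base)
  qed
  ultimately show ?thesis by (simp add: distrib_right)
qed

text \<open>Reduces to uniqueness in one dimension. Conditioning on the event for \<open>k\<close>
  yields another probability measure under which the remaining variables still have the product
  characteristic function, so the induction hypothesis is needed for arbitrary
  \<open>M\<close>.\<close>

lemma joint_char_unique:
  fixes \<eta> :: "'i \<Rightarrow> 'a \<Rightarrow> real" and \<nu> :: "'i \<Rightarrow> real measure"
  assumes "prob_space M" "finite N" "\<And>j. j \<in> N \<Longrightarrow> \<eta> j \<in> borel_measurable M" "\<And>j. j \<in> N \<Longrightarrow> real_distribution (\<nu> j)"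
    and "\<And>t. (CLINT \<omega>|M. iexp (\<Sum>j\<in>N. t j * \<eta> j \<omega>)) = (\<Prod>j\<in>N. char (\<nu> j) (t j))"
    and "\<And>j. j \<in> N \<Longrightarrow> A j \<in> sets borel"
  shows "measure M {\<omega> \<in> space M. \<forall>j\<in>N. \<eta> j \<omega> \<in> A j} = (\<Prod>j\<in>N. measure (\<nu> j) (A j))"
  using assms(2,1,3-)
proof (induction N arbitrary: M)
  case empty
  then show ?case by (simp add: prob_space.prob_space)
next
  case (insert k N)
  interpret prob_space M by (rule insert.prems(1))
  interpret \<nu>: real_distribution "\<nu> k" using insert.prems(3) by simp
  have [measurable]: "\<eta> j \<in> borel_measurable M" if "j = k \<or> j \<in> N" for j using insert.prems(2) that by auto
  have [measurable]: "A j \<in> sets borel" if "j = k \<or> j \<in> N" for j using insert.prems(5) that by auto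
  have fin: "finite N" and k: "k \<notin> N" using insert.hyps by auto
  define th where "th t \<omega> = (\<Sum>j\<in>N. t j * \<eta> j \<omega>)" for t \<omega>
  define c where "c t = (\<Prod>j\<in>N. char (\<nu> j) (t j))" for t
  have [measurable]: "th t \<in> borel_measurable M" for t unfolding th_def[abs_def] by measurable
  have joint: "(CLINT \<omega>|M. iexp (th t \<omega> + s * \<eta> k \<omega>)) = char (\<nu> k) s * c t" for t s
  proof -
    have "(\<Sum>j\<in>insert k N. (t(k := s)) j * \<eta> j \<omega>) = th t \<omega> + s * \<eta> k \<omega>" for \<omega>
      unfolding th_def using fin k by (simp add: add.commute) (intro sum.cong, auto)
    moreover have "(\<Prod>j\<in>insert k N. char (\<nu> j) ((t(k := s)) j)) = char (\<nu> k) s * c t"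
      unfolding c_def using fin k by simp (intro disjI2 prod.cong, auto)
    ultimately show ?thesis using insert.prems(4)[of "t(k := s)"] by simp
  qed
  have th_neg: "th (\<lambda>j. - t j) \<omega> = - th t \<omega>" for t \<omega> by (simp add: th_def sum_negf)
  have th_zero: "th (\<lambda>j. 0) \<omega> = 0" for \<omega> by (simp add: th_def)
  have c_zero: "c (\<lambda>j. 0) = 1"
    unfolding c_def using insert.prems(3) by (intro prod.neutral ballI real_distribution.char_zero) auto
  have char_th: "(CLINT \<omega>|M. iexp (th t \<omega>)) = c t" for t using joint[of t 0] by (simp add: \<nu>.char_zero)
  have char_eta: "(CLINT \<omega>|M. iexp (s * \<eta> k \<omega>)) = char (\<nu> k) s" for s
    using joint[of "\<lambda>_. 0" s] by (simp add: th_zero c_zero)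
  have int: "complex_integrable M (\<lambda>\<omega>. iexp (f \<omega>))" if "f \<in> borel_measurable M" for f
    using that by (intro integrable_const_bound[of _ 1]) auto
  have iI: "complex_integrable M (\<lambda>\<omega>. iexp (th t \<omega> + s * \<eta> k \<omega>))" for t s by (rule int) measurable
  \<comment> \<open>Cosine and sine of the remaining linear combination are bounded weights and
    combinations of exponentials at t and -t; the joint characteristic function therefore supplies
    what \<open>char_weighted\<close> asks for.\<close>
  have cos: "expectation (\<lambda>\<omega>. cos (th t \<omega>) * indicator (A k) (\<eta> k \<omega>)) = expectation (\<lambda>\<omega>. cos (th t \<omega>)) * measure (\<nu> k) (A k)"
    and sin: "expectation (\<lambda>\<omega>. sin (th t \<omega>) * indicator (A k) (\<eta> k \<omega>)) = expectation (\<lambda>\<omega>. sin (th t \<omega>)) * measure (\<nu> k) (A k)" for t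
  proof -
    have C: "(CLINT \<omega>|M. cos (th t \<omega>) *\<^sub>R iexp (s * \<eta> k \<omega>)) = char (\<nu> k) s * ((c t + c (\<lambda>j. - t j)) / 2)" for s
    proof -
      have eq: "cos (th t \<omega>) *\<^sub>R iexp (s * \<eta> k \<omega>) = (iexp (th t \<omega> + s * \<eta> k \<omega>) + iexp (th (\<lambda>j. - t j) \<omega> + s * \<eta> k \<omega>)) / 2" for \<omega>
        by (simp add: th_neg scaleR_conv_of_real cos_exp_eq cos_of_real[symmetric] distrib_left exp_add exp_diff exp_minus field_simps)
      have "(CLINT \<omega>|M. cos (th t \<omega>) *\<^sub>R iexp (s * \<eta> k \<omega>))
        = (CLINT \<omega>|M. (iexp (th t \<omega> + s * \<eta> k \<omega>) + iexp (th (\<lambda>j. - t j) \<omega> + s * \<eta> k \<omega>)) / 2)" by (simp only: eq)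
      also have "\<dots> = (char (\<nu> k) s * c t + char (\<nu> k) s * c (\<lambda>j. - t j)) / 2"
        unfolding joint[symmetric] by (simp only: integral_divide_zero Bochner_Integration.integral_add[OF iI iI])
      finally show ?thesis by (simp add: algebra_simps)
    qed
    have S: "(CLINT \<omega>|M. sin (th t \<omega>) *\<^sub>R iexp (s * \<eta> k \<omega>)) = char (\<nu> k) s * ((c t - c (\<lambda>j. - t j)) / (2 * \<i>))" for s
    proof -
      have eq: "sin (th t \<omega>) *\<^sub>R iexp (s * \<eta> k \<omega>) = (iexp (th t \<omega> + s * \<eta> k \<omega>) - iexp (th (\<lambda>j. - t j) \<omega> + s * \<eta> k \<omega>)) / (2 * \<i>)" for \<omega>
        by (simp add: th_neg scaleR_conv_of_real sin_exp_eq sin_of_real[symmetric] distrib_left exp_add exp_diff exp_minus field_simps)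
      have "(CLINT \<omega>|M. sin (th t \<omega>) *\<^sub>R iexp (s * \<eta> k \<omega>))
        = (CLINT \<omega>|M. (iexp (th t \<omega> + s * \<eta> k \<omega>) - iexp (th (\<lambda>j. - t j) \<omega> + s * \<eta> k \<omega>)) / (2 * \<i>))" by (simp only: eq)
      also have "\<dots> = (char (\<nu> k) s * c t - char (\<nu> k) s * c (\<lambda>j. - t j)) / (2 * \<i>)"
        unfolding joint[symmetric] by (simp only: integral_divide_zero Bochner_Integration.integral_diff[OF iI iI])
      finally show ?thesis by (simp add: algebra_simps diff_divide_distrib)
    qed
    have C0: "of_real (expectation (\<lambda>\<omega>. cos (th t \<omega>))) = (c t + c (\<lambda>j. - t j)) / 2"
      using C[of 0] by (simp add: \<nu>.char_zero scaleR_conv_of_real)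
    have S0: "of_real (expectation (\<lambda>\<omega>. sin (th t \<omega>))) = (c t - c (\<lambda>j. - t j)) / (2 * \<i>)"
      using S[of 0] by (simp add: \<nu>.char_zero scaleR_conv_of_real)
    show "expectation (\<lambda>\<omega>. cos (th t \<omega>) * indicator (A k) (\<eta> k \<omega>)) = expectation (\<lambda>\<omega>. cos (th t \<omega>)) * measure (\<nu> k) (A k)"
    proof (rule char_weighted)
      show "real_distribution (\<nu> k)" "A k \<in> sets borel" using insert.prems(3,5) by simp_all
      show "(CLINT \<omega>|M. iexp (s * \<eta> k \<omega>)) = char (\<nu> k) s" for s by (rule char_eta)
      show "(CLINT \<omega>|M. cos (th t \<omega>) *\<^sub>R iexp (s * \<eta> k \<omega>)) = char (\<nu> k) s * of_real (expectation (\<lambda>\<omega>. cos (th t \<omega>)))" for s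
        by (simp only: C C0)
      show "\<eta> k \<in> borel_measurable M" "(\<lambda>\<omega>. cos (th t \<omega>)) \<in> borel_measurable M" by measurable
      show "\<bar>cos (th t \<omega>)\<bar> \<le> 1" for \<omega> by simp
    qed
    show "expectation (\<lambda>\<omega>. sin (th t \<omega>) * indicator (A k) (\<eta> k \<omega>)) = expectation (\<lambda>\<omega>. sin (th t \<omega>)) * measure (\<nu> k) (A k)"
    proof (rule char_weighted)
      show "real_distribution (\<nu> k)" "A k \<in> sets borel" using insert.prems(3,5) by simp_all
      show "(CLINT \<omega>|M. iexp (s * \<eta> k \<omega>)) = char (\<nu> k) s" for s by (rule char_eta)
      show "(CLINT \<omega>|M. sin (th t \<omega>) *\<^sub>R iexp (s * \<eta> k \<omega>)) = char (\<nu> k) s * of_real (expectation (\<lambda>\<omega>. sin (th t \<omega>)))" for s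
        by (simp only: S S0)
      show "\<eta> k \<in> borel_measurable M" "(\<lambda>\<omega>. sin (th t \<omega>)) \<in> borel_measurable M" by measurable
      show "\<bar>sin (th t \<omega>)\<bar> \<le> 1" for \<omega> by simp
    qed
  qed
  have one: "expectation (\<lambda>\<omega>. indicator (A k) (\<eta> k \<omega>)) = measure (\<nu> k) (A k)"
    using cos[of "\<lambda>_. 0"] by (simp add: th_zero prob_space)
  define p where "p = measure (\<nu> k) (A k)"
  have p0: "0 \<le> p" by (simp add: p_def)
  let ?E = "{\<omega> \<in> space M. \<forall>j\<in>insert k N. \<eta> j \<omega> \<in> A j}" and ?F = "{\<omega> \<in> space M. \<eta> k \<omega> \<in> A k}"
  have coll: "{\<omega> \<in> space M. \<forall>j\<in>J. \<eta> j \<omega> \<in> A j} \<in> sets M" if "J \<subseteq> insert k N" for J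
  proof (rule sets.sets_Collect_finite_All)
    show "finite J" using that fin finite_subset by blast
    fix j assume "j \<in> J"
    then have "\<eta> j -` A j \<inter> space M \<in> sets M" using that by (intro measurable_sets[of _ M borel]) auto
    then show "{\<omega> \<in> space M. \<eta> j \<omega> \<in> A j} \<in> sets M" by (simp add: vimage_def Int_def conj_commute)
  qed
  have [measurable]: "?E \<in> sets M" by (rule coll) simp
  have F: "measure M ?F = p"
  proof -
    have "measure M ?F = expectation (indicator ?F)" by simp
    also have "\<dots> = expectation (\<lambda>\<omega>. indicator (A k) (\<eta> k \<omega>))"
      by (intro Bochner_Integration.integral_cong) (auto simp: indicator_def)
    finally show ?thesis by (simp add: one p_def)
  qed
  show ?case
  \<comment> \<open>Conditioning needs positive probability; otherwise both sides vanish.\<close>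
  proof (cases "p = 0")
    case True
    have "measure M ?E \<le> measure M ?F" by (intro finite_measure_mono) auto
    then have "measure M ?E = 0" using True F by (simp add: measure_le_0_iff)
    moreover have "(\<Prod>j\<in>insert k N. measure (\<nu> j) (A j)) = 0" using True fin k by (simp add: p_def)
    ultimately show ?thesis by simp
  next
    case False
    then have p: "0 < p" using p0 by simp
    define w where "w \<omega> = indicator (A k) (\<eta> k \<omega>) / p" for \<omega>
    have [measurable]: "w \<in> borel_measurable M" unfolding w_def[abs_def] by measurable
    have w0: "0 \<le> w \<omega>" for \<omega> using p by (simp add: w_def)
    define M' where "M' = density M (\<lambda>\<omega>. ennreal (w \<omega>))"
    have "emeasure M' (space M') = (\<integral>\<^sup>+ \<omega>. ennreal (w \<omega>) \<partial>M)"
      unfolding M'_def by (subst emeasure_density) (auto intro!: nn_integral_cong)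
    also have "\<dots> = ennreal (expectation w)"
      using w0 p by (intro nn_integral_eq_integral integrable_const_bound[of _ "1 / p"]) (auto simp: w_def indicator_def)
    also have "expectation w = 1" unfolding w_def using p one by (simp add: p_def)
    finally interpret M': prob_space M' by (intro prob_spaceI) simp
    \<comment> \<open>Cosine and sine are uncorrelated with the event for \<open>k\<close>, so
      conditioning on it leaves the characteristic function of the other variables
      unchanged.\<close>
    have char': "(CLINT \<omega>|M'. iexp (\<Sum>j\<in>N. t j * \<eta> j \<omega>)) = (\<Prod>j\<in>N. char (\<nu> j) (t j))" for t
    proof -
      have comb: "(CLINT \<omega>|M. of_real (f \<omega>) + \<i> * of_real (g \<omega>)) = of_real (expectation f) + \<i> * of_real (expectation g)"
        if "integrable M f" "integrable M g" for f g :: "'a \<Rightarrow> real"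
        using that by (subst Bochner_Integration.integral_add) (auto intro!: integrable_of_real)
      have iexp_eq: "iexp x = of_real (cos x) + \<i> * of_real (sin x)" for x
        by (simp add: exp_Euler cos_of_real sin_of_real)
      have intr: "integrable M (\<lambda>\<omega>. cos (th t \<omega>) * indicator (A k) (\<eta> k \<omega>))" "integrable M (\<lambda>\<omega>. sin (th t \<omega>) * indicator (A k) (\<eta> k \<omega>))"
        "integrable M (\<lambda>\<omega>. cos (th t \<omega>))" "integrable M (\<lambda>\<omega>. sin (th t \<omega>))"
        by (auto intro!: integrable_const_bound[of _ 1] simp: indicator_def)
      have "(CLINT \<omega>|M'. iexp (th t \<omega>)) = (CLINT \<omega>|M. w \<omega> *\<^sub>R iexp (th t \<omega>))"
        unfolding M'_def using w0 by (subst integral_density) auto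
      also have "\<dots> = (CLINT \<omega>|M. (of_real (cos (th t \<omega>) * indicator (A k) (\<eta> k \<omega>)) + \<i> * of_real (sin (th t \<omega>) * indicator (A k) (\<eta> k \<omega>))) / of_real p)"
        by (intro Bochner_Integration.integral_cong refl) (simp add: iexp_eq w_def scaleR_conv_of_real algebra_simps add_divide_distrib)
      also have "\<dots> = (of_real (expectation (\<lambda>\<omega>. cos (th t \<omega>) * indicator (A k) (\<eta> k \<omega>))) + \<i> * of_real (expectation (\<lambda>\<omega>. sin (th t \<omega>) * indicator (A k) (\<eta> k \<omega>)))) / of_real p"
        unfolding integral_divide_zero comb[OF intr(1,2)] ..
      also have "\<dots> = of_real (expectation (\<lambda>\<omega>. cos (th t \<omega>))) + \<i> * of_real (expectation (\<lambda>\<omega>. sin (th t \<omega>)))"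
        unfolding cos sin p_def[symmetric] using p by (simp add: field_simps)
      also have "\<dots> = (CLINT \<omega>|M. iexp (th t \<omega>))"
        unfolding iexp_eq comb[OF intr(3,4)] ..
      also have "\<dots> = c t" by (rule char_th)
      finally show ?thesis unfolding c_def th_def .
    qed
    have "measure M' {\<omega> \<in> space M'. \<forall>j\<in>N. \<eta> j \<omega> \<in> A j} = (\<Prod>j\<in>N. measure (\<nu> j) (A j))"
    proof (rule insert.IH)
      show "prob_space M'" by (rule M'.prob_space_axioms)
      show "\<eta> j \<in> borel_measurable M'" if "j \<in> N" for j using that by (simp add: M'_def)
    qed (use char' insert.prems in auto)
    moreover have "measure M' {\<omega> \<in> space M'. \<forall>j\<in>N. \<eta> j \<omega> \<in> A j} = measure M ?E / p"
    proof -
      let ?E' = "{\<omega> \<in> space M'. \<forall>j\<in>N. \<eta> j \<omega> \<in> A j}"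
      have E'm: "?E' \<in> sets M" using coll[of N] by (auto simp: M'_def)
      have "measure M' ?E' = M'.expectation (indicator ?E')" using E'm by (simp add: M'_def)
      also have "\<dots> = expectation (\<lambda>\<omega>. w \<omega> *\<^sub>R indicator ?E' \<omega>)"
        unfolding M'_def using w0 E'm by (subst integral_density) (auto simp: M'_def)
      also have "\<dots> = expectation (\<lambda>\<omega>. indicator ?E \<omega> / p)"
        by (intro Bochner_Integration.integral_cong refl) (auto simp: w_def indicator_def M'_def)
      also have "\<dots> = measure M (?E \<inter> space M) / p" by simp
      also have "?E \<inter> space M = ?E" by blast
      finally show ?thesis .
    qed
    ultimately show ?thesis using p fin k by (simp add: p_def field_simps)
  qed
qed

section \<open>Linear systems behind the quadratic form\<close>

lemma inv_quad_solution:
  assumes "finite S" "posdef_on S Q" "sym_on S Q" "\<And>i. i \<in> S \<Longrightarrow> (\<Sum>j\<in>S. Q i j * c j) = b i"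
  shows "inv_quad S Q b = (\<Sum>i\<in>S. b i * c i)"
  using inv_quad_list_eq_solution[of "sorted_list_of_set S" Q c b] assms by (simp add: inv_quad_def posdef_on_def)

lemma posdef_on_solve:
  assumes "finite S" "posdef_on S Q"
  obtains c where "\<And>i. i \<in> S \<Longrightarrow> (\<Sum>j\<in>S. Q i j * c j) = b i"
  using elim_solve[of "sorted_list_of_set S" Q b] assms by (auto simp: posdef_on_def)

text \<open>With u the coefficients \<beta> padded by zeros the vector is Q u + w, and in (Q u +
  w)^T Q^(-1) (Q u + w) the inverse survives in the pure noise term alone.
  \<open>T \<subseteq> S\<close> is what puts the signal into the column space.\<close>

lemma inv_quad_shift:
  assumes S: "finite S" "posdef_on S Q" "sym_on S Q" and T: "T \<subseteq> S"
  shows "inv_quad S Q (\<lambda>j. (\<Sum>j'\<in>T. Q j j' * \<beta> j') + w j)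
    = (\<Sum>j\<in>T. \<Sum>j'\<in>T. \<beta> j * Q j j' * \<beta> j') + 2 * (\<Sum>j\<in>T. \<beta> j * w j) + inv_quad S Q w"
proof -
  obtain c0 where c0: "\<And>i. i \<in> S \<Longrightarrow> (\<Sum>j\<in>S. Q i j * c0 j) = w i" using posdef_on_solve[OF S(1,2)] by blast
  define u where "u j = (if j \<in> T then \<beta> j else 0)" for j
  have uS: "(\<Sum>j\<in>S. f j * u j) = (\<Sum>j\<in>T. f j * \<beta> j)" for f
    unfolding u_def using S(1) T by (intro sum.mono_neutral_cong_right) auto
  let ?b = "\<lambda>j. (\<Sum>j'\<in>T. Q j j' * \<beta> j') + w j"
  have "inv_quad S Q ?b = (\<Sum>j\<in>S. ?b j * (u j + c0 j))"
    by (intro inv_quad_solution S) (simp add: distrib_left sum.distrib uS c0)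
  also have "\<dots> = (\<Sum>j\<in>S. ?b j * u j) + (\<Sum>j\<in>S. (\<Sum>j'\<in>T. Q j j' * \<beta> j') * c0 j) + (\<Sum>j\<in>S. w j * c0 j)"
    by (simp add: distrib_left distrib_right sum.distrib)
  also have "(\<Sum>j\<in>S. ?b j * u j) = (\<Sum>j\<in>T. \<Sum>j'\<in>T. \<beta> j * Q j j' * \<beta> j') + (\<Sum>j\<in>T. \<beta> j * w j)"
    unfolding uS by (simp add: distrib_left sum.distrib sum_distrib_left mult_ac)
  also have "(\<Sum>j\<in>S. (\<Sum>j'\<in>T. Q j j' * \<beta> j') * c0 j) = (\<Sum>j'\<in>T. \<beta> j' * w j')"
  proof -
    have "(\<Sum>j\<in>S. (\<Sum>j'\<in>T. Q j j' * \<beta> j') * c0 j) = (\<Sum>j\<in>S. \<Sum>j'\<in>T. \<beta> j' * (Q j' j * c0 j))"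
      unfolding sum_distrib_right
    proof (rule sum.cong[OF refl], rule sum.cong[OF refl])
      fix j j' assume "j \<in> S" "j' \<in> T"
      then have "Q j j' = Q j' j" using T by (intro sym_onD[OF S(3)]) auto
      then show "Q j j' * \<beta> j' * c0 j = \<beta> j' * (Q j' j * c0 j)" by simp
    qed
    also have "\<dots> = (\<Sum>j'\<in>T. \<Sum>j\<in>S. \<beta> j' * (Q j' j * c0 j))" by (rule sum.swap)
    also have "\<dots> = (\<Sum>j'\<in>T. \<beta> j' * w j')"
      using T by (intro sum.cong refl) (auto simp: sum_distrib_left[symmetric] c0)
    finally show ?thesis .
  qed
  also have "(\<Sum>j\<in>S. w j * c0 j) = inv_quad S Q w" by (intro inv_quad_solution[symmetric] S c0)
  finally show ?thesis by simp
qed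

lemma inv_quad_scale: "0 < c \<Longrightarrow> inv_quad S (\<lambda>i j. c * Q i j) (\<lambda>i. d * b i) = d\<^sup>2 / c * inv_quad S Q b"
  unfolding inv_quad_def by (rule inv_quad_list_scale)

lemma inv_quad_cong:
  assumes "finite S" "\<And>i j. i \<in> S \<Longrightarrow> j \<in> S \<Longrightarrow> Q i j = Q' i j" "\<And>i. i \<in> S \<Longrightarrow> b i = b' i"
  shows "inv_quad S Q b = inv_quad S Q' b'"
  unfolding inv_quad_def using assms by (intro inv_quad_list_cong) auto

lemma inv_quad_empty [simp]: "inv_quad {} Q b = 0"
  by (simp add: inv_quad_def)

lemma hyperg_integral_cong:
  assumes "\<And>i. i \<in> I \<Longrightarrow> d i = d' i" "\<And>i. i \<in> I \<Longrightarrow> q i = q' i"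
  shows "hyperg_integral a B I d m S q = hyperg_integral a B I d' m S q'"
proof -
  have "shrink_weight I d g = shrink_weight I d' g" "shrunk_rss I S q g = shrunk_rss I S q' g" for g
    using assms by (auto simp: shrink_weight_def shrunk_rss_def intro!: prod.cong sum.cong)
  then show ?thesis by (simp add: hyperg_integral_def)
qed

section \<open>Limits along deterministic data\<close>

text \<open>Collects what does not involve probability, so that limits can be taken along arbitrary
  deterministic noise. Nonzero \<beta> on \<open>T\<close> is the form in which identifiability
  enters.\<close>

locale regression =
  fixes X :: "nat \<Rightarrow> nat \<Rightarrow> nat \<Rightarrow> real" and blk :: "nat \<Rightarrow> nat" and p :: nat and D :: "nat \<Rightarrow> nat \<Rightarrow> real"
    and a \<sigma> :: real and T :: "nat set" and \<beta> :: "nat \<Rightarrow> real"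
  assumes centered: "\<And>n j. j < p \<Longrightarrow> (\<Sum>r<n. X n r j) = 0"
    and orth: "\<And>n j j'. j < p \<Longrightarrow> j' < p \<Longrightarrow> blk j \<noteq> blk j' \<Longrightarrow> gram X n j j' = 0"
    and limD: "\<And>i j. i < p \<Longrightarrow> j < p \<Longrightarrow> (\<lambda>n. gram X n i j / real n) \<longlonglongrightarrow> D i j"
    and posdef: "\<And>v. \<exists>i<p. v i \<noteq> 0 \<Longrightarrow> 0 < (\<Sum>i<p. \<Sum>j<p. v i * D i j * v j)"
    and a: "2 < a" and T: "T \<subseteq> {..<p}" and \<sigma>: "0 < \<sigma>" and \<beta>: "\<And>j. j \<in> T \<Longrightarrow> \<beta> j \<noteq> 0"
begin

abbreviation blocks :: "nat set" where "blocks \<equiv> blk ` {..<p}"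
abbreviation bs :: "nat set \<Rightarrow> nat \<Rightarrow> nat set" where "bs \<equiv> block_set blk"

text \<open>The statistics of the response, in terms of the noise statistics $w = X^T\epsilon$,
  $V = \lVert\epsilon\rVert^2/n$ and $e = \bar\epsilon$.\<close>
definition xty_of :: "nat \<Rightarrow> (nat \<Rightarrow> real) \<Rightarrow> nat \<Rightarrow> real" where
  "xty_of n w j = (\<Sum>j'\<in>T. gram X n j j' * \<beta> j') + w j"

definition tss :: "nat \<Rightarrow> (nat \<Rightarrow> real) \<Rightarrow> real \<Rightarrow> real \<Rightarrow> real" where
  "tss n w V e = (\<Sum>j\<in>T. \<Sum>j'\<in>T. \<beta> j * gram X n j j' * \<beta> j') + 2 * (\<Sum>j\<in>T. \<beta> j * w j) + real n * V - real n * e\<^sup>2"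

definition ess :: "nat \<Rightarrow> nat set \<Rightarrow> (nat \<Rightarrow> real) \<Rightarrow> nat \<Rightarrow> real" where
  "ess n \<gamma> w i = inv_quad (bs \<gamma> i) (gram X n) (xty_of n w)"

text \<open>The Bayes factor as a function of the noise statistics alone. The two agree on typical
  data for large n, see \<open>bayes_factor_eq\<close>.\<close>

definition bf_of :: "nat \<Rightarrow> nat set \<Rightarrow> (nat \<Rightarrow> real) \<Rightarrow> real \<Rightarrow> real \<Rightarrow> real" where
  "bf_of n \<gamma> w V e = hyperg_ratio a blocks (blk ` \<gamma>) (\<lambda>i. card (bs \<gamma> i)) (ess n \<gamma> w) (blk ` T) (\<lambda>i. card (bs T i)) (ess n T w) n (tss n w V e)"

definition D_beta :: "nat \<Rightarrow> real" where "D_beta i = (\<Sum>j\<in>T. D i j * \<beta> j)"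

text \<open>The limit of $\frac1n \beta_T^T X_T^T (I - P_{X_\gamma}) X_T \beta_T$.\<close>
definition lack :: "nat set \<Rightarrow> real" where
  "lack \<gamma> = (\<Sum>j\<in>T. \<Sum>j'\<in>T. \<beta> j * D j j' * \<beta> j') - (\<Sum>i\<in>blk ` \<gamma>. inv_quad (bs \<gamma> i) D D_beta)"

lemma fin: "\<gamma> \<subseteq> {..<p} \<Longrightarrow> finite \<gamma>"
  by (rule finite_subset[OF _ finite_lessThan])

lemma sym_D: "S \<subseteq> {..<p} \<Longrightarrow> sym_on S D"
  unfolding sym_on_def
proof (intro ballI)
  fix i j assume S: "S \<subseteq> {..<p}" and ij: "i \<in> S" "j \<in> S"
  have "gram X n i j = gram X n j i" for n by (simp add: gram_def mult.commute)
  then show "D i j = D j i"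
    using limD[of i j] limD[of j i] ij S by (intro LIMSEQ_unique[of "\<lambda>n. gram X n i j / real n"]) auto
qed

lemma orth_D: "j < p \<Longrightarrow> j' < p \<Longrightarrow> blk j \<noteq> blk j' \<Longrightarrow> D j j' = 0"
  using limD[of j j'] orth[of j j'] by (simp add: LIMSEQ_const_iff)

lemma posdef_on_D: assumes "S \<subseteq> {..<p}" shows "posdef_on S D"
  unfolding posdef_on_def
proof (rule pivots_pos_if_posdef)
  have S: "set (sorted_list_of_set S) = S" using fin[OF assms] by simp
  show "distinct (sorted_list_of_set S)" by simp
  show "sym_on (set (sorted_list_of_set S)) D" unfolding S by (rule sym_D[OF assms])
  fix v :: "nat \<Rightarrow> real" assume v: "\<exists>i\<in>set (sorted_list_of_set S). v i \<noteq> 0"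
  define u where "u i = (if i \<in> S then v i else 0)" for i
  have "0 < (\<Sum>i<p. \<Sum>j<p. u i * D i j * u j)"
    using v assms unfolding S by (intro posdef) (auto simp: u_def)
  also have "\<dots> = (\<Sum>i\<in>S. \<Sum>j<p. u i * D i j * u j)"
    using assms by (intro sum.mono_neutral_right) (auto simp: u_def)
  also have "\<dots> = (\<Sum>i\<in>S. \<Sum>j\<in>S. v i * D i j * v j)"
    using assms by (intro sum.cong refl sum.mono_neutral_cong_right) (auto simp: u_def)
  finally show "0 < (\<Sum>i\<in>set (sorted_list_of_set S). \<Sum>j\<in>set (sorted_list_of_set S). v i * D i j * v j)"
    unfolding S .
qed

lemma scaled_gram_tendsto: "i < p \<Longrightarrow> j < p \<Longrightarrow> (\<lambda>n. 1 / real n * gram X n i j) \<longlonglongrightarrow> D i j"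
  using limD[of i j] by simp

text \<open>After scaling by 1/n, which keeps the signs of the pivots, the Gram matrix converges to
  the positive definite \<open>D\<close>.\<close>

lemma posdef_on_gram: assumes "S \<subseteq> {..<p}" shows "\<forall>\<^sub>F n in sequentially. posdef_on S (gram X n)"
proof -
  have "\<forall>\<^sub>F n in sequentially. pivots_pos (sorted_list_of_set S) (\<lambda>i j. 1 / real n * gram X n i j)"
  proof (rule pivots_pos_eventually)
    show "pivots_pos (sorted_list_of_set S) D" using posdef_on_D[OF assms] by (simp add: posdef_on_def)
    fix i j assume "i \<in> set (sorted_list_of_set S)" "j \<in> set (sorted_list_of_set S)"
    then show "(\<lambda>n. 1 / real n * gram X n i j) \<longlonglongrightarrow> D i j"
      using assms fin[OF assms] by (intro scaled_gram_tendsto) auto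
  qed
  then show ?thesis using eventually_gt_at_top[of 0]
  proof eventually_elim
    case (elim n)
    then show ?case using pivots_pos_scale[of "1 / real n" "sorted_list_of_set S" "gram X n"] by (simp add: posdef_on_def)
  qed
qed

lemma bs_subset: "\<gamma> \<subseteq> {..<p} \<Longrightarrow> bs \<gamma> i \<subseteq> {..<p}"
  by (auto simp: block_set_def)

lemma block_sum_orth:
  assumes "\<gamma> \<subseteq> {..<p}" "j < p" "\<And>j'. j' < p \<Longrightarrow> blk j \<noteq> blk j' \<Longrightarrow> Q j j' = 0"
  shows "(\<Sum>j'\<in>\<gamma>. Q j j' * c j') = (\<Sum>j'\<in>bs \<gamma> (blk j). Q j j' * c j' :: real)"
proof (rule sum.mono_neutral_right)
  show "\<forall>i\<in>\<gamma> - bs \<gamma> (blk j). Q j i * c i = 0"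
  proof
    fix i assume "i \<in> \<gamma> - bs \<gamma> (blk j)"
    then have "i < p" "blk j \<noteq> blk i" using assms(1) by (auto simp: block_set_def)
    then show "Q j i * c i = 0" using assms(3)[of i] by simp
  qed
qed (use fin[OF assms(1)] in \<open>auto simp: block_set_def\<close>)

text \<open>Block orthogonality of \<open>D\<close> decouples the normal equations: a solution for
  the whole model restricts to a solution in each block.\<close>

lemma inv_quad_blocks_solution:
  assumes \<gamma>: "\<gamma> \<subseteq> {..<p}" and c: "\<And>j. j \<in> \<gamma> \<Longrightarrow> (\<Sum>j'\<in>\<gamma>. D j j' * c j') = b j"
  shows "(\<Sum>i\<in>blk ` \<gamma>. inv_quad (bs \<gamma> i) D b) = (\<Sum>j\<in>\<gamma>. b j * c j)"
proof -
  have "inv_quad (bs \<gamma> i) D b = (\<Sum>j\<in>bs \<gamma> i. b j * c j)" for i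
  proof (rule inv_quad_solution)
    fix j assume j: "j \<in> bs \<gamma> i"
    then have "j \<in> \<gamma>" "blk j = i" "j < p" using \<gamma> by (auto simp: block_set_def)
    then show "(\<Sum>j'\<in>bs \<gamma> i. D j j' * c j') = b j"
      using block_sum_orth[OF \<gamma>, of j D c] orth_D[of j] c[of j] by auto
  qed (use fin[OF \<gamma>] posdef_on_D[OF bs_subset[OF \<gamma>]] sym_D[OF bs_subset[OF \<gamma>]] in auto)
  then show ?thesis unfolding sum_block_set[OF fin[OF \<gamma>], of "\<lambda>j. b j * c j" blk] by simp
qed

text \<open>The true coefficients, padded with zeros, solve the normal equations of \<gamma>, so the
  model explains the whole signal.\<close>

lemma lack_superset: assumes "T \<subseteq> \<gamma>" "\<gamma> \<subseteq> {..<p}" shows "lack \<gamma> = 0"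
proof -
  define c where "c j = (if j \<in> T then \<beta> j else 0)" for j
  have cS: "(\<Sum>j\<in>\<gamma>. f j * c j) = (\<Sum>j\<in>T. f j * \<beta> j)" for f
    unfolding c_def using fin[OF assms(2)] assms(1) by (intro sum.mono_neutral_cong_right) auto
  have "(\<Sum>i\<in>blk ` \<gamma>. inv_quad (bs \<gamma> i) D D_beta) = (\<Sum>j\<in>\<gamma>. D_beta j * c j)"
    by (rule inv_quad_blocks_solution[OF assms(2)]) (simp add: cS D_beta_def)
  then show ?thesis unfolding lack_def cS by (simp add: D_beta_def sum_distrib_left mult_ac)
qed

text \<open>\<open>lack\<close> is the squared D-norm of the true coefficients minus those of the
  projection onto the model. At a missing predictor this difference is the nonzero true coefficient,
  so positive definiteness applies.\<close>

lemma lack_pos: assumes "\<not> T \<subseteq> \<gamma>" "\<gamma> \<subseteq> {..<p}" shows "0 < lack \<gamma>"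
proof -
  have sol: "\<exists>c. \<forall>j\<in>\<gamma>. (\<Sum>j'\<in>\<gamma>. D j j' * c j') = D_beta j"
    using posdef_on_solve[OF fin[OF assms(2)] posdef_on_D[OF assms(2)], of D_beta] by metis
  then obtain c where c: "\<And>j. j \<in> \<gamma> \<Longrightarrow> (\<Sum>j'\<in>\<gamma>. D j j' * c j') = D_beta j" by blast
  define u where "u j = (if j \<in> T then \<beta> j else 0)" for j
  define v where "v j = (if j \<in> \<gamma> then c j else 0)" for j
  have uS: "(\<Sum>j<p. f j * u j) = (\<Sum>j\<in>T. f j * \<beta> j)" for f
    unfolding u_def using T by (intro sum.mono_neutral_cong_right) auto
  have vS: "(\<Sum>j<p. f j * v j) = (\<Sum>j\<in>\<gamma>. f j * c j)" for f
    unfolding v_def using assms(2) by (intro sum.mono_neutral_cong_right) auto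
  obtain j0 where j0: "j0 \<in> T" "j0 \<notin> \<gamma>" using assms(1) by blast
  have "0 < (\<Sum>i<p. \<Sum>j<p. (u i - v i) * D i j * (u j - v j))"
    using j0 T \<beta>[OF j0(1)] by (intro posdef exI[of _ j0]) (auto simp: u_def v_def)
  also have "\<dots> = (\<Sum>i<p. (\<Sum>j<p. D i j * u j) * u i) - (\<Sum>i<p. (\<Sum>j<p. D i j * v j) * u i)
      - (\<Sum>i<p. (\<Sum>j<p. D i j * u j) * v i) + (\<Sum>i<p. (\<Sum>j<p. D i j * v j) * v i)"
    by (simp add: sum_distrib_left sum_distrib_right sum_subtractf sum.distrib algebra_simps)
  also have "(\<Sum>i<p. (\<Sum>j<p. D i j * u j) * u i) = (\<Sum>j\<in>T. \<Sum>j'\<in>T. \<beta> j * D j j' * \<beta> j')"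
    unfolding uS by (simp add: sum_distrib_left mult_ac)
  also have "(\<Sum>i<p. (\<Sum>j<p. D i j * v j) * u i) = (\<Sum>i<p. (\<Sum>j<p. D i j * u j) * v i)"
  proof -
    have "(\<Sum>i<p. (\<Sum>j<p. D i j * v j) * u i) = (\<Sum>i<p. \<Sum>j<p. D i j * u i * v j)"
      by (simp add: sum_distrib_left mult_ac)
    also have "\<dots> = (\<Sum>j<p. \<Sum>i<p. D i j * u i * v j)" by (rule sum.swap)
    also have "\<dots> = (\<Sum>j<p. \<Sum>i<p. D j i * u i * v j)"
      using sym_onD[OF sym_D[OF subset_refl]] by (intro sum.cong refl arg_cong2[where f=times]) auto
    finally show ?thesis by (simp add: sum_distrib_right)
  qed
  also have "(\<Sum>i<p. (\<Sum>j<p. D i j * u j) * v i) = (\<Sum>j\<in>\<gamma>. D_beta j * c j)"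
    unfolding vS uS D_beta_def ..
  also have "(\<Sum>i<p. (\<Sum>j<p. D i j * v j) * v i) = (\<Sum>j\<in>\<gamma>. D_beta j * c j)"
    unfolding vS using c by simp
  finally have "0 < (\<Sum>j\<in>T. \<Sum>j'\<in>T. \<beta> j * D j j' * \<beta> j') - (\<Sum>j\<in>\<gamma>. D_beta j * c j)" by simp
  moreover have "(\<Sum>i\<in>blk ` \<gamma>. inv_quad (bs \<gamma> i) D D_beta) = (\<Sum>j\<in>\<gamma>. D_beta j * c j)"
    by (rule inv_quad_blocks_solution[OF assms(2) c])
  ultimately show ?thesis by (simp add: lack_def)
qed

text \<open>By block orthogonality a block sees the true predictors inside it and no others. The
  signal part does not depend on \<gamma>, so enlarging the true model changes explained sums by
  noise alone.\<close>

lemma ess_block: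
  assumes \<gamma>: "\<gamma> \<subseteq> {..<p}" and T\<gamma>: "T \<subseteq> \<gamma>" and posdef_on: "posdef_on (bs \<gamma> i) (gram X n)"
  shows "ess n \<gamma> w i = (\<Sum>j\<in>bs T i. \<Sum>j'\<in>bs T i. \<beta> j * gram X n j j' * \<beta> j') + 2 * (\<Sum>j\<in>bs T i. \<beta> j * w j)
    + inv_quad (bs \<gamma> i) (gram X n) w"
proof -
  have "ess n \<gamma> w i = inv_quad (bs \<gamma> i) (gram X n) (\<lambda>j. (\<Sum>j'\<in>bs T i. gram X n j j' * \<beta> j') + w j)"
    unfolding ess_def
  proof (rule inv_quad_cong)
    fix j assume "j \<in> bs \<gamma> i"
    then have j: "j < p" "blk j = i" using \<gamma> by (auto simp: block_set_def)
    then show "xty_of n w j = (\<Sum>j'\<in>bs T i. gram X n j j' * \<beta> j') + w j"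
      unfolding xty_of_def using block_sum_orth[OF T, of j "gram X n" \<beta>] orth[of j] by simp
  qed (use fin[OF \<gamma>] in auto)
  also have "\<dots> = (\<Sum>j\<in>bs T i. \<Sum>j'\<in>bs T i. \<beta> j * gram X n j j' * \<beta> j') + 2 * (\<Sum>j\<in>bs T i. \<beta> j * w j)
    + inv_quad (bs \<gamma> i) (gram X n) w"
    using fin[OF \<gamma>] T\<gamma> by (intro inv_quad_shift posdef_on sym_on_gram) (auto simp: block_set_def)
  finally show ?thesis .
qed

lemma \<sigma>2: "0 < \<sigma>\<^sup>2" using \<sigma> by simp

lemma blk_image_subset: "\<gamma> \<subseteq> {..<p} \<Longrightarrow> blk ` \<gamma> \<subseteq> blocks"
  by (rule image_mono)

section \<open>Limits along a fixed sequence of noise statistics\<close>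

context
  fixes w :: "nat \<Rightarrow> nat \<Rightarrow> real" and V e :: "nat \<Rightarrow> real" and K :: real
  assumes w: "\<And>n j. j < p \<Longrightarrow> \<bar>w n j\<bar> \<le> K * sqrt (real n)" and V: "V \<longlonglongrightarrow> \<sigma>\<^sup>2" and e: "e \<longlonglongrightarrow> 0"
begin

lemma w_tendsto: assumes "j < p" shows "(\<lambda>n. w n j / real n) \<longlonglongrightarrow> 0"
proof (rule Lim_null_comparison)
  have "(\<lambda>n. inverse (sqrt (real n))) \<longlonglongrightarrow> 0"
    by (intro tendsto_inverse_0_at_top filterlim_compose[OF sqrt_at_top filterlim_real_sequentially])
  then show "(\<lambda>n. K * inverse (sqrt (real n))) \<longlonglongrightarrow> 0" by (rule tendsto_mult_right_zero)
  show "\<forall>\<^sub>F n in sequentially. norm (w n j / real n) \<le> K * inverse (sqrt (real n))"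
    using eventually_gt_at_top[of 0]
  proof eventually_elim
    case (elim n)
    have "\<bar>w n j\<bar> / real n \<le> K * sqrt (real n) / real n" using w[OF assms, of n] by (intro divide_right_mono) auto
    also have "sqrt (real n) / real n = inverse (sqrt (real n))"
    proof -
      have "x / (x * x) = inverse x" if "0 < x" for x :: real using that by (simp add: field_simps)
      from this[of "sqrt (real n)"] elim show ?thesis by simp
    qed
    then have "K * sqrt (real n) / real n = K * inverse (sqrt (real n))" by (simp only: times_divide_eq_right[symmetric])
    finally show ?case by simp
  qed
qed

lemma xty_of_tendsto: assumes "j < p" shows "(\<lambda>n. xty_of n (w n) j / real n) \<longlonglongrightarrow> D_beta j"
proof -
  have "(\<lambda>n. (\<Sum>j'\<in>T. gram X n j j' / real n * \<beta> j') + w n j / real n) \<longlonglongrightarrow> (\<Sum>j'\<in>T. D j j' * \<beta> j') + 0"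
    using T assms by (intro tendsto_intros w_tendsto limD) auto
  then show ?thesis by (simp add: xty_of_def D_beta_def add_divide_distrib sum_divide_distrib)
qed

text \<open>Scaling both the Gram matrix and the vector by 1/n divides the form by n, and both then
  converge.\<close>

lemma ess_tendsto: assumes "\<gamma> \<subseteq> {..<p}" shows "(\<lambda>n. ess n \<gamma> (w n) i / real n) \<longlonglongrightarrow> inv_quad (bs \<gamma> i) D D_beta"
proof -
  have S: "set (sorted_list_of_set (bs \<gamma> i)) \<subseteq> {..<p}" using bs_subset[OF assms] fin[OF assms] by simp
  have "(\<lambda>n. inv_quad (bs \<gamma> i) (\<lambda>i j. 1 / real n * gram X n i j) (\<lambda>j. 1 / real n * xty_of n (w n) j)) \<longlonglongrightarrow> inv_quad (bs \<gamma> i) D D_beta"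
    unfolding inv_quad_def using posdef_on_D[OF bs_subset[OF assms, of i]] S xty_of_tendsto
    by (intro inv_quad_list_tendsto scaled_gram_tendsto) (auto simp: posdef_on_def)
  then show ?thesis
  proof (rule Lim_transform_eventually)
    show "\<forall>\<^sub>F n in sequentially. inv_quad (bs \<gamma> i) (\<lambda>i j. 1 / real n * gram X n i j) (\<lambda>j. 1 / real n * xty_of n (w n) j) = ess n \<gamma> (w n) i / real n"
      using eventually_gt_at_top[of 0]
    proof eventually_elim
      case (elim n)
      then have "0 < 1 / real n" by simp
      from inv_quad_scale[OF this, of "bs \<gamma> i" "gram X n" "1 / real n" "xty_of n (w n)"] elim
      show ?case unfolding ess_def by (simp add: power2_eq_square)
    qed
  qed
qed

lemma tss_tendsto: "(\<lambda>n. tss n (w n) (V n) (e n) / real n) \<longlonglongrightarrow> (\<Sum>j\<in>T. \<Sum>j'\<in>T. \<beta> j * D j j' * \<beta> j') + \<sigma>\<^sup>2"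
proof -
  have "(\<lambda>n. (\<Sum>j\<in>T. \<Sum>j'\<in>T. \<beta> j * (gram X n j j' / real n) * \<beta> j') + 2 * (\<Sum>j\<in>T. \<beta> j * (w n j / real n)) + V n - (e n)\<^sup>2)
     \<longlonglongrightarrow> (\<Sum>j\<in>T. \<Sum>j'\<in>T. \<beta> j * D j j' * \<beta> j') + 2 * (\<Sum>j\<in>T. \<beta> j * 0) + \<sigma>\<^sup>2 - 0\<^sup>2"
    using T by (intro tendsto_intros w_tendsto limD V e) auto
  then have "(\<lambda>n. (\<Sum>j\<in>T. \<Sum>j'\<in>T. \<beta> j * (gram X n j j' / real n) * \<beta> j') + 2 * (\<Sum>j\<in>T. \<beta> j * (w n j / real n)) + V n - (e n)\<^sup>2)
     \<longlonglongrightarrow> (\<Sum>j\<in>T. \<Sum>j'\<in>T. \<beta> j * D j j' * \<beta> j') + \<sigma>\<^sup>2" by simp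
  then show ?thesis
  proof (rule Lim_transform_eventually)
    show "\<forall>\<^sub>F n in sequentially. (\<Sum>j\<in>T. \<Sum>j'\<in>T. \<beta> j * (gram X n j j' / real n) * \<beta> j') + 2 * (\<Sum>j\<in>T. \<beta> j * (w n j / real n)) + V n - (e n)\<^sup>2
      = tss n (w n) (V n) (e n) / real n"
      using eventually_gt_at_top[of 0]
      by eventually_elim (simp add: tss_def add_divide_distrib diff_divide_distrib sum_divide_distrib sum_distrib_left)
  qed
qed

lemma rss_tendsto:
  assumes "\<gamma> \<subseteq> {..<p}"
  shows "(\<lambda>n. (tss n (w n) (V n) (e n) - (\<Sum>i\<in>blk ` \<gamma>. ess n \<gamma> (w n) i)) / real n) \<longlonglongrightarrow> \<sigma>\<^sup>2 + lack \<gamma>"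
proof -
  have "(\<lambda>n. tss n (w n) (V n) (e n) / real n - (\<Sum>i\<in>blk ` \<gamma>. ess n \<gamma> (w n) i / real n))
    \<longlonglongrightarrow> ((\<Sum>j\<in>T. \<Sum>j'\<in>T. \<beta> j * D j j' * \<beta> j') + \<sigma>\<^sup>2) - (\<Sum>i\<in>blk ` \<gamma>. inv_quad (bs \<gamma> i) D D_beta)"
    by (intro tendsto_intros tss_tendsto ess_tendsto assms)
  then show ?thesis by (simp add: lack_def diff_divide_distrib sum_divide_distrib algebra_simps)
qed

lemma ess_nonneg:
  assumes "\<gamma> \<subseteq> {..<p}"
  shows "\<forall>\<^sub>F n in sequentially. \<forall>i\<in>blk ` \<gamma>. 0 \<le> ess n \<gamma> (w n) i"
proof (intro eventually_ball_finite ballI)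
  show "finite (blk ` \<gamma>)" using fin[OF assms] by simp
  fix i show "\<forall>\<^sub>F n in sequentially. 0 \<le> ess n \<gamma> (w n) i"
    using posdef_on_gram[OF bs_subset[OF assms, of i]] by eventually_elim (simp add: ess_def inv_quad_nonneg)
qed

text \<open>Scaling the Gram matrix by 1/n and the vector by 1/sqrt n leaves the form unchanged; the
  matrix then converges and the vector is bounded.\<close>

lemma noise_inv_quad_bounded:
  assumes "S \<subseteq> {..<p}"
  shows "Bseq (\<lambda>n. inv_quad S (gram X n) (w n))"
proof -
  have S: "set (sorted_list_of_set S) = S" using fin[OF assms] by simp
  have "Bseq (\<lambda>n. inv_quad_list (sorted_list_of_set S) (\<lambda>i j. 1 / real n * gram X n i j) (\<lambda>j. 1 / sqrt (real n) * w n j))"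
  proof (rule inv_quad_list_bounded)
    show "pivots_pos (sorted_list_of_set S) D" using posdef_on_D[OF assms] by (simp add: posdef_on_def)
    fix i assume i: "i \<in> set (sorted_list_of_set S)"
    show "Bseq (\<lambda>n. 1 / sqrt (real n) * w n i)"
    proof (rule BseqI')
      fix n
      have "\<bar>w n i\<bar> \<le> K * sqrt (real n)" using i assms S by (intro w) auto
      then show "norm (1 / sqrt (real n) * w n i) \<le> \<bar>K\<bar>"
        by (cases "n = 0") (auto simp: abs_mult field_simps intro: order_trans[OF _ mult_right_mono[OF abs_ge_self]])
    qed
    fix j assume "j \<in> set (sorted_list_of_set S)"
    with i show "(\<lambda>n. 1 / real n * gram X n i j) \<longlonglongrightarrow> D i j" using assms S by (intro scaled_gram_tendsto) auto
  qed
  then show ?thesis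
  proof (rule Bseq_eventually_mono[rotated])
    show "\<forall>\<^sub>F n in sequentially. norm (inv_quad S (gram X n) (w n)) \<le>
      norm (inv_quad_list (sorted_list_of_set S) (\<lambda>i j. 1 / real n * gram X n i j) (\<lambda>j. 1 / sqrt (real n) * w n j))"
      using eventually_gt_at_top[of 0]
    proof eventually_elim
      case (elim n)
      then have "0 < 1 / real n" by simp
      from inv_quad_list_scale[OF this, of "sorted_list_of_set S" "gram X n" "1 / sqrt (real n)" "w n"] elim
      show ?case by (simp add: inv_quad_def power_divide)
    qed
  qed
qed

text \<open>The signal parts given by \<open>ess_block\<close> coincide and cancel; a difference of
  two noise forms remains.\<close>

lemma ess_diff_bounded:
  assumes "T \<subseteq> \<gamma>" "\<gamma> \<subseteq> {..<p}"
  shows "\<exists>C>0. \<forall>\<^sub>F n in sequentially. \<bar>ess n \<gamma> (w n) i - ess n T (w n) i\<bar> \<le> C"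
proof -
  have "Bseq (\<lambda>n. inv_quad (bs \<gamma> i) (gram X n) (w n) + - inv_quad (bs T i) (gram X n) (w n))"
    by (intro Bseq_plus noise_inv_quad_bounded iffD2[OF Bseq_minus_iff] bs_subset assms T)
  then obtain C where C: "0 < C" "\<And>n. \<bar>inv_quad (bs \<gamma> i) (gram X n) (w n) + - inv_quad (bs T i) (gram X n) (w n)\<bar> \<le> C"
    by (auto elim!: BseqE)
  have "\<forall>\<^sub>F n in sequentially. \<bar>ess n \<gamma> (w n) i - ess n T (w n) i\<bar> \<le> C"
    using posdef_on_gram[OF bs_subset[OF assms(2), of i]] posdef_on_gram[OF bs_subset[OF T, of i]]
  proof eventually_elim
    case (elim n)
    show ?case using C(2)[of n] by (simp add: ess_block[OF assms(2,1) elim(1)] ess_block[OF T subset_refl elim(2)])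
  qed
  then show ?thesis using C by blast
qed

lemma rss_T: "(\<lambda>n. (tss n (w n) (V n) (e n) - (\<Sum>i\<in>blk ` T. ess n T (w n) i)) / real n) \<longlonglongrightarrow> \<sigma>\<^sup>2"
  using rss_tendsto[OF T] lack_superset[OF subset_refl T] by simp

lemma bf_of_missing:
  assumes "\<gamma> \<subseteq> {..<p}" "\<not> T \<subseteq> \<gamma>"
  shows "(\<lambda>n. bf_of n \<gamma> (w n) (V n) (e n)) \<longlonglongrightarrow> 0"
  unfolding bf_of_def using lack_pos[OF assms(2,1)]
  by (intro hyperg_ratio_missing[OF a _ blk_image_subset[OF T] blk_image_subset[OF assms(1)] ess_nonneg[OF T] ess_nonneg[OF assms(1)] rss_T \<sigma>2 tss_tendsto rss_tendsto[OF assms(1)]]) auto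

lemma bf_of_growing_block:
  assumes "\<gamma> \<subseteq> {..<p}" "T \<subseteq> \<gamma>" "j0 \<in> \<gamma> - T" "blk j0 \<in> blk ` T"
  shows "(\<lambda>n. bf_of n \<gamma> (w n) (V n) (e n)) \<longlonglongrightarrow> 0"
proof -
  let ?i0 = "blk j0"
  have "\<exists>C. \<forall>i. 0 < C i \<and> (\<forall>\<^sub>F n in sequentially. \<bar>ess n \<gamma> (w n) i - ess n T (w n) i\<bar> \<le> C i)"
    using ess_diff_bounded[OF assms(2,1)] by (intro choice) blast
  then obtain C where C: "\<And>i. \<forall>\<^sub>F n in sequentially. \<bar>ess n \<gamma> (w n) i - ess n T (w n) i\<bar> \<le> C i" by blast
  have "\<forall>\<^sub>F n in sequentially. \<forall>i\<in>blk ` \<gamma>. \<bar>ess n \<gamma> (w n) i - ess n T (w n) i\<bar> \<le> C i"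
    using C fin[OF assms(1)] by (intro eventually_ball_finite) auto
  then have C': "\<forall>\<^sub>F n in sequentially. (\<Sum>i\<in>blk ` \<gamma>. \<bar>ess n \<gamma> (w n) i - ess n T (w n) i\<bar>) \<le> (\<Sum>i\<in>blk ` \<gamma>. C i)"
    by eventually_elim (auto intro: sum_mono)
  \<comment> \<open>The explained sum of a block with signal grows like n times the D-form of its
    true coefficients, which is positive.\<close>
  have pos: "0 < inv_quad (bs T ?i0) D D_beta"
  proof -
    define u where "u j = (if j \<in> bs T ?i0 then \<beta> j else 0)" for j
    obtain j1 where j1: "j1 \<in> T" "blk j1 = ?i0" using assms(4) by auto
    have "0 < (\<Sum>i<p. \<Sum>j<p. u i * D i j * u j)"
      using j1 T \<beta>[OF j1(1)] by (intro posdef exI[of _ j1]) (auto simp: u_def block_set_def)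
    also have "\<dots> = (\<Sum>i\<in>bs T ?i0. \<Sum>j<p. u i * D i j * u j)"
      using bs_subset[OF T] by (intro sum.mono_neutral_right) (auto simp: u_def)
    also have "\<dots> = (\<Sum>i\<in>bs T ?i0. \<Sum>j\<in>bs T ?i0. \<beta> i * D i j * \<beta> j)"
      using bs_subset[OF T] by (intro sum.cong refl sum.mono_neutral_cong_right) (auto simp: u_def)
    also have "\<dots> = (\<Sum>i\<in>bs T ?i0. D_beta i * \<beta> i)"
    proof (rule sum.cong[OF refl])
      fix i assume "i \<in> bs T ?i0"
      then have "i < p" "blk i = ?i0" using T by (auto simp: block_set_def)
      then have "D_beta i = (\<Sum>j\<in>bs T ?i0. D i j * \<beta> j)"
        unfolding D_beta_def using block_sum_orth[OF T, of i D \<beta>] orth_D[of i] by simp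
      then show "(\<Sum>j\<in>bs T ?i0. \<beta> i * D i j * \<beta> j) = D_beta i * \<beta> i" by (simp add: sum_distrib_left mult_ac)
    qed
    also have "\<dots> = inv_quad (bs T ?i0) D D_beta"
    proof (rule inv_quad_solution[symmetric])
      fix i assume "i \<in> bs T ?i0"
      then have "i < p" "blk i = ?i0" using T by (auto simp: block_set_def)
      then show "(\<Sum>j\<in>bs T ?i0. D i j * \<beta> j) = D_beta i"
        unfolding D_beta_def using block_sum_orth[OF T, of i D \<beta>] orth_D[of i] by simp
    qed (use fin[OF T] posdef_on_D[OF bs_subset[OF T]] sym_D[OF bs_subset[OF T]] in auto)
    finally show ?thesis .
  qed
  \<comment> \<open>A block without true predictors is empty in \<open>T\<close>; its explained sum
    is 0, as the comparison on the larger index set requires.\<close>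
  have zero: "ess n T (w n) i = 0" if "i \<in> blk ` \<gamma> - blk ` T" for n i
  proof -
    have "bs T i = {}" using that unfolding block_set_def by blast
    then show ?thesis by (simp add: ess_def)
  qed
  have card: "card (bs T i) \<le> card (bs \<gamma> i)" for i
    using fin[OF assms(1)] assms(2) by (intro card_mono) (auto simp: block_set_def)
  have card0: "card (bs T ?i0) < card (bs \<gamma> ?i0)"
    using fin[OF assms(1)] assms(2,3) by (intro psubset_card_mono psubsetI) (auto simp: block_set_def)
  show ?thesis unfolding bf_of_def
    by (rule hyperg_ratio_growing_block[where q="\<lambda>n. ess n T (w n)" and q'="\<lambda>n. ess n \<gamma> (w n)"
          and I="blk ` T" and I'="blk ` \<gamma>" and ?i0.0="?i0" and S="\<lambda>n. tss n (w n) (V n) (e n)"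
          and d="\<lambda>i. card (bs T i)" and d'="\<lambda>i. card (bs \<gamma> i)" and B=blocks])
       (rule a finite_imageI finite_lessThan blk_image_subset[OF assms(1)] image_mono[OF assms(2)] assms(4) ess_nonneg[OF T]
          zero card card0 C' rss_T \<sigma>2 tss_tendsto ess_tendsto[OF T] pos | assumption)+
qed

lemma bf_of_null_blocks:
  assumes \<gamma>: "\<gamma> \<subseteq> {..<p}" "T \<subseteq> \<gamma>" and null: "\<And>j. j \<in> \<gamma> - T \<Longrightarrow> blk j \<notin> blk ` T"
  shows "(\<lambda>n. bf_of n \<gamma> (w n) (V n) (e n) - (\<Prod>i\<in>blk ` (\<gamma> - T). psi_real a (card (bs (\<gamma> - T) i)) (inv_quad (bs (\<gamma> - T) i) (gram X n) (w n) / (2 * \<sigma>\<^sup>2)))) \<longlonglongrightarrow> 0"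
proof -
  let ?I = "blk ` T" and ?N = "blk ` (\<gamma> - T)" and ?d = "\<lambda>i. card (bs \<gamma> i)"
  have U: "?I \<union> ?N = blk ` \<gamma>" using \<gamma>(2) by blast
  have disj: "?I \<inter> ?N = {}"
  proof (rule equals0I)
    fix i assume "i \<in> ?I \<inter> ?N"
    then obtain j where "i \<in> blk ` T" "j \<in> \<gamma> - T" "i = blk j" by blast
    then show False using null[of j] by simp
  qed
  \<comment> \<open>Signal blocks are the same in both models and the remaining blocks contain no
    true predictor, so the models differ by whole null blocks.\<close>
  have bI: "bs \<gamma> i = bs T i" if "i \<in> ?I" for i
  proof -
    have "j \<in> T" if j: "j \<in> \<gamma>" "blk j = i" for j
      using null[of j] j \<open>i \<in> ?I\<close> by blast
    then show ?thesis using \<gamma>(2) by (auto simp: block_set_def)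
  qed
  have bN: "bs \<gamma> i = bs (\<gamma> - T) i" "bs T i = {}" if "i \<in> ?N" for i
  proof -
    have j: "j \<notin> T" if "blk j = i" for j
      using \<open>i \<in> ?N\<close> disj that by blast
    then show "bs \<gamma> i = bs (\<gamma> - T) i" "bs T i = {}" by (auto simp: block_set_def)
  qed
  have "\<exists>C. \<forall>i. 0 < C i \<and> (\<forall>\<^sub>F n in sequentially. \<bar>ess n \<gamma> (w n) i - ess n T (w n) i\<bar> \<le> C i)"
    using ess_diff_bounded[OF \<gamma>(2,1)] by (intro choice) blast
  then obtain C where C: "\<And>i. 0 < C i" "\<And>i. \<forall>\<^sub>F n in sequentially. \<bar>ess n \<gamma> (w n) i - ess n T (w n) i\<bar> \<le> C i" by blast
  have finN: "finite ?N" using fin[OF \<gamma>(1)] by simp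
  define C0 where "C0 = (\<Sum>i\<in>?N. C i) + 1"
  have C0: "0 < C0" unfolding C0_def using C(1) by (intro add_nonneg_pos sum_nonneg) (auto simp: less_imp_le)
  have "\<forall>\<^sub>F n in sequentially. \<forall>i\<in>?N. \<bar>ess n \<gamma> (w n) i - ess n T (w n) i\<bar> \<le> C i"
    using C finN by (intro eventually_ball_finite) auto
  then have bound: "\<forall>\<^sub>F n in sequentially. \<forall>i\<in>?N. ess n \<gamma> (w n) i \<le> C0"
  proof eventually_elim
    case (elim n)
    show ?case
    proof
      fix i assume i: "i \<in> ?N"
      have "ess n T (w n) i = 0" using bN[OF i] by (simp add: ess_def)
      then have "ess n \<gamma> (w n) i \<le> C i" using bspec[OF elim i] by linarith
      also have "C i \<le> C0" 
      proof -
        have "C i \<le> (\<Sum>i\<in>?N. C i)" by (rule member_le_sum[OF i less_imp_le[OF C(1)] finN])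
        then show ?thesis by (simp add: C0_def)
      qed
      finally show "ess n \<gamma> (w n) i \<le> C0" .
    qed
  qed
  have eqI: "ess n \<gamma> (w n) i = ess n T (w n) i" if "i \<in> ?I" for n i using bI[OF that] by (simp add: ess_def)
  have R1: "(\<lambda>n. (tss n (w n) (V n) (e n) - (\<Sum>i\<in>?I \<union> ?N. ess n \<gamma> (w n) i)) / real n) \<longlonglongrightarrow> \<sigma>\<^sup>2"
    using rss_tendsto[OF \<gamma>(1)] lack_superset[OF \<gamma>(2,1)] by (simp add: U)
  have R2: "(\<lambda>n. (tss n (w n) (V n) (e n) - (\<Sum>i\<in>?I. ess n \<gamma> (w n) i)) / real n) \<longlonglongrightarrow> \<sigma>\<^sup>2"
    using rss_T eqI by (simp cong: sum.cong)
  have nn: "\<forall>\<^sub>F n in sequentially. \<forall>i\<in>?I \<union> ?N. 0 \<le> ess n \<gamma> (w n) i"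
    using ess_nonneg[OF \<gamma>(1)] by (simp only: U)
  have UB: "?I \<union> ?N \<subseteq> blocks" unfolding U by (rule blk_image_subset[OF \<gamma>(1)])
  have lim: "(\<lambda>n. hyperg_ratio a blocks (?I \<union> ?N) ?d (ess n \<gamma> (w n)) ?I ?d (ess n \<gamma> (w n)) n (tss n (w n) (V n) (e n))
     - (\<Prod>j\<in>?N. psi_real a (?d j) (ess n \<gamma> (w n) j / (2 * \<sigma>\<^sup>2)))) \<longlonglongrightarrow> 0"
    by (rule hyperg_ratio_null_blocks[OF a _ UB disj nn bound C0 R1 R2 \<sigma>2 tss_tendsto]) simp
  have "hyperg_ratio a blocks (?I \<union> ?N) ?d (ess n \<gamma> (w n)) ?I ?d (ess n \<gamma> (w n)) n (tss n (w n) (V n) (e n)) = bf_of n \<gamma> (w n) (V n) (e n)" for n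
    unfolding bf_of_def U hyperg_ratio_def using bI eqI
    by (intro arg_cong2[where f="(/)"] refl arg_cong[where f=enn2real] hyperg_integral_cong) auto
  moreover have "(\<Prod>j\<in>?N. psi_real a (?d j) (ess n \<gamma> (w n) j / (2 * \<sigma>\<^sup>2)))
     = (\<Prod>i\<in>?N. psi_real a (card (bs (\<gamma> - T) i)) (inv_quad (bs (\<gamma> - T) i) (gram X n) (w n) / (2 * \<sigma>\<^sup>2)))" for n
  proof (intro prod.cong refl)
    fix i assume i: "i \<in> ?N"
    \<comment> \<open>Columns of a null block are orthogonal to the whole signal, so the response
      enters through the noise alone.\<close>
    have "ess n \<gamma> (w n) i = inv_quad (bs \<gamma> i) (gram X n) (w n)"
      unfolding ess_def
    proof (rule inv_quad_cong)
      fix j assume "j \<in> bs \<gamma> i"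
      then have j: "j < p" "blk j = i" using \<gamma> by (auto simp: block_set_def)
      then show "xty_of n (w n) j = w n j"
        unfolding xty_of_def using block_sum_orth[OF T, of j "gram X n" \<beta>] orth[of j] bN(2)[OF i] by simp
    qed (use fin[OF \<gamma>(1)] in auto)
    then show "psi_real a (?d i) (ess n \<gamma> (w n) i / (2 * \<sigma>\<^sup>2)) = psi_real a (card (bs (\<gamma> - T) i)) (inv_quad (bs (\<gamma> - T) i) (gram X n) (w n) / (2 * \<sigma>\<^sup>2))"
      by (simp add: bN(1)[OF i])
  qed
  ultimately show ?thesis using lim by simp
qed

end

end

section \<open>From deterministic to random data\<close>

locale noisy_regression = regression X blk p D a \<sigma> T \<beta> + prob_space M
  for X blk p D a \<sigma> T \<beta> and M :: "'w measure" +
  fixes \<epsilon> :: "nat \<Rightarrow> 'w \<Rightarrow> nat \<Rightarrow> real" and \<alpha> :: real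
  assumes indep: "\<And>n. indep_vars (\<lambda>_. borel) (\<lambda>r \<omega>. \<epsilon> n \<omega> r) {..<n}"
    and normal: "\<And>n r. r < n \<Longrightarrow> distributed M lborel (\<lambda>\<omega>. \<epsilon> n \<omega> r) (normal_density 0 \<sigma>)"
begin

lemma noise_measurable [measurable]: "r < n \<Longrightarrow> (\<lambda>\<omega>. \<epsilon> n \<omega> r) \<in> borel_measurable M"
  using normal[of r n] by (simp add: distributed_def)

text \<open>The value depends on \<open>v\<close> through its length alone. This rotation invariance
  is what makes orthonormal coordinates of the noise i.i.d.\<close>

lemma noise_char: "(CLINT \<omega>|M. iexp (\<Sum>r<n. v r * \<epsilon> n \<omega> r)) = of_real (exp (- (\<sigma>\<^sup>2 * (\<Sum>r<n. (v r)\<^sup>2)) / 2))"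
proof -
  have ind: "indep_vars (\<lambda>_. borel) (\<lambda>r \<omega>. v r * \<epsilon> n \<omega> r) {..<n}"
    using indep_vars_compose2[OF indep, where Y="\<lambda>r x. v r * x" and N="\<lambda>_. borel", of n] by simp
  have [measurable]: "(\<lambda>\<omega>. \<Sum>r<n. v r * \<epsilon> n \<omega> r) \<in> borel_measurable M" by measurable
  have single: "char (distr M borel (\<lambda>\<omega>. v r * \<epsilon> n \<omega> r)) 1 = of_real (exp (- (\<sigma>\<^sup>2 * (v r)\<^sup>2) / 2))" if "r < n" for r
  proof -
    note [measurable] = noise_measurable[OF that]
    have "char (distr M borel (\<lambda>\<omega>. v r * \<epsilon> n \<omega> r)) 1 = (CLINT \<omega>|M. iexp (v r * \<epsilon> n \<omega> r))"
      unfolding char_def by (subst integral_distr) auto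
    also have "\<dots> = char (distr M borel (\<lambda>\<omega>. \<epsilon> n \<omega> r)) (v r)"
      unfolding char_def by (subst integral_distr) auto
    finally show ?thesis unfolding distr_eq_centered_normal[OF normal[OF that]] char_centered_normal[OF \<sigma>] .
  qed
  have "(CLINT \<omega>|M. iexp (\<Sum>r<n. v r * \<epsilon> n \<omega> r)) = char (distr M borel (\<lambda>\<omega>. \<Sum>r<n. v r * \<epsilon> n \<omega> r)) 1"
    unfolding char_def by (subst integral_distr) auto
  also have "\<dots> = (\<Prod>r<n. of_real (exp (- (\<sigma>\<^sup>2 * (v r)\<^sup>2) / 2)))"
    unfolding char_distr_sum[OF ind] by (intro prod.cong refl single) simp
  also have "\<dots> = of_real (exp (\<Sum>r<n. - (\<sigma>\<^sup>2 * (v r)\<^sup>2) / 2))"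
    by (simp only: exp_sum[OF finite_lessThan] of_real_prod)
  also have "(\<Sum>r<n. - (\<sigma>\<^sup>2 * (v r)\<^sup>2) / 2) = - (\<sigma>\<^sup>2 * (\<Sum>r<n. (v r)\<^sup>2)) / 2"
    by (simp add: sum_distrib_left sum_negf sum_divide_distrib)
  finally show ?thesis .
qed

text \<open>Orthonormality turns the length of a combination of the vectors into the length of its
  coefficients. The joint characteristic function is thus a product that depends neither on n nor on
  the vectors chosen.\<close>

lemma noise_coordinates_law:
  fixes e :: "nat \<Rightarrow> nat \<Rightarrow> real"
  assumes N: "finite N" and e: "\<And>i j. i \<in> N \<Longrightarrow> j \<in> N \<Longrightarrow> inner_upto n (e i) (e j) = (if i = j then 1 else 0)"
  shows "(\<lambda>\<omega>. \<lambda>j\<in>N. inner_upto n (e j) (\<epsilon> n \<omega>)) \<in> measurable M (PiM N (\<lambda>_. borel))"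
    and "distr M (PiM N (\<lambda>_. borel)) (\<lambda>\<omega>. \<lambda>j\<in>N. inner_upto n (e j) (\<epsilon> n \<omega>)) = PiM N (\<lambda>_. centered_normal \<sigma>)"
proof -
  interpret centered_normal: prob_space "centered_normal \<sigma>" by (rule prob_space_centered_normal[OF \<sigma>])
  interpret centered_normal: product_sigma_finite "\<lambda>_. centered_normal \<sigma>" by standard
  have m [measurable]: "(\<lambda>\<omega>. inner_upto n (e j) (\<epsilon> n \<omega>)) \<in> borel_measurable M" for j unfolding inner_upto_def by measurable
  show meas: "(\<lambda>\<omega>. \<lambda>j\<in>N. inner_upto n (e j) (\<epsilon> n \<omega>)) \<in> measurable M (PiM N (\<lambda>_. borel))" by measurable
  have char: "(CLINT \<omega>|M. iexp (\<Sum>j\<in>N. t j * inner_upto n (e j) (\<epsilon> n \<omega>))) = (\<Prod>j\<in>N. char (centered_normal \<sigma>) (t j))" for t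
  proof -
    define v where "v r = (\<Sum>j\<in>N. t j * e j r)" for r
    have "(\<Sum>j\<in>N. t j * inner_upto n (e j) (\<epsilon> n \<omega>)) = (\<Sum>r<n. v r * \<epsilon> n \<omega> r)" for \<omega>
      unfolding inner_upto_def v_def sum_distrib_left sum_distrib_right by (subst sum.swap) (simp add: mult.assoc)
    then have "(CLINT \<omega>|M. iexp (\<Sum>j\<in>N. t j * inner_upto n (e j) (\<epsilon> n \<omega>))) = of_real (exp (- (\<sigma>\<^sup>2 * (\<Sum>r<n. (v r)\<^sup>2)) / 2))"
      by (simp only: noise_char)
    also have "(\<Sum>r<n. (v r)\<^sup>2) = (\<Sum>j\<in>N. (t j)\<^sup>2)"
    proof -
      have "(\<Sum>r<n. (v r)\<^sup>2) = (\<Sum>r<n. \<Sum>i\<in>N. \<Sum>j\<in>N. t i * t j * (e i r * e j r))"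
        by (simp add: v_def power2_eq_square sum_product mult_ac)
      also have "\<dots> = (\<Sum>i\<in>N. \<Sum>j\<in>N. \<Sum>r<n. t i * t j * (e i r * e j r))"
        by (subst sum.swap) (intro sum.cong refl sum.swap)
      also have "\<dots> = (\<Sum>i\<in>N. \<Sum>j\<in>N. t i * t j * inner_upto n (e i) (e j))"
        by (simp add: inner_upto_def sum_distrib_left)
      also have "\<dots> = (\<Sum>i\<in>N. \<Sum>j\<in>N. if i = j then t i * t j else 0)"
        using e by (intro sum.cong refl) auto
      also have "\<dots> = (\<Sum>j\<in>N. (t j)\<^sup>2)" using N by (simp add: power2_eq_square)
      finally show ?thesis .
    qed
    also have "of_real (exp (- (\<sigma>\<^sup>2 * (\<Sum>j\<in>N. (t j)\<^sup>2)) / 2)) = (\<Prod>j\<in>N. char (centered_normal \<sigma>) (t j))"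
    proof -
      have "- (\<sigma>\<^sup>2 * (\<Sum>j\<in>N. (t j)\<^sup>2)) / 2 = (\<Sum>j\<in>N. - (\<sigma>\<^sup>2 * (t j)\<^sup>2) / 2)"
        by (simp add: sum_distrib_left sum_negf sum_divide_distrib)
      then show ?thesis unfolding char_centered_normal[OF \<sigma>] by (simp only: exp_sum[OF N] of_real_prod)
    qed
    finally show ?thesis .
  qed
  show "distr M (PiM N (\<lambda>_. borel)) (\<lambda>\<omega>. \<lambda>j\<in>N. inner_upto n (e j) (\<epsilon> n \<omega>)) = PiM N (\<lambda>_. centered_normal \<sigma>)"
  proof (rule centered_normal.PiM_eqI[OF N])
    show "sets (distr M (PiM N (\<lambda>_. borel)) (\<lambda>\<omega>. \<lambda>j\<in>N. inner_upto n (e j) (\<epsilon> n \<omega>))) = sets (PiM N (\<lambda>_. centered_normal \<sigma>))"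
      unfolding sets_distr by (intro sets_PiM_cong) auto
    fix A :: "nat \<Rightarrow> real set" assume A: "\<And>i. i \<in> N \<Longrightarrow> A i \<in> sets (centered_normal \<sigma>)"
    have "emeasure (distr M (PiM N (\<lambda>_. borel)) (\<lambda>\<omega>. \<lambda>j\<in>N. inner_upto n (e j) (\<epsilon> n \<omega>))) (Pi\<^sub>E N A)
      = emeasure M ((\<lambda>\<omega>. \<lambda>j\<in>N. inner_upto n (e j) (\<epsilon> n \<omega>)) -` Pi\<^sub>E N A \<inter> space M)"
      using A N by (intro emeasure_distr meas sets_PiM_I_finite) auto
    also have "(\<lambda>\<omega>. \<lambda>j\<in>N. inner_upto n (e j) (\<epsilon> n \<omega>)) -` Pi\<^sub>E N A \<inter> space M = {\<omega> \<in> space M. \<forall>j\<in>N. inner_upto n (e j) (\<epsilon> n \<omega>) \<in> A j}"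
      by (auto simp: PiE_iff)
    also have "emeasure M \<dots> = ennreal (\<Prod>j\<in>N. measure (centered_normal \<sigma>) (A j))"
      unfolding emeasure_eq_measure
      using A by (subst joint_char_unique[OF prob_space_axioms N m real_distribution_centered_normal[OF \<sigma>] char]) auto
    also have "\<dots> = (\<Prod>i\<in>N. emeasure (centered_normal \<sigma>) (A i))"
      by (simp add: centered_normal.emeasure_eq_measure prod_ennreal)
    finally show "emeasure (distr M (PiM N (\<lambda>_. borel)) (\<lambda>\<omega>. \<lambda>j\<in>N. inner_upto n (e j) (\<epsilon> n \<omega>))) (Pi\<^sub>E N A)
      = (\<Prod>i\<in>N. emeasure (centered_normal \<sigma>) (A i))" .
  qed
qed

lemma indep_sum_second_moment:
  fixes Z :: "nat \<Rightarrow> 'w \<Rightarrow> real"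
  assumes "finite A" "indep_vars (\<lambda>_. borel) Z A" "\<And>r. r \<in> A \<Longrightarrow> integrable M (\<lambda>\<omega>. (Z r \<omega>)\<^sup>2)"
    "\<And>r. r \<in> A \<Longrightarrow> integrable M (Z r)" "\<And>r. r \<in> A \<Longrightarrow> expectation (Z r) = 0"
  shows "integrable M (\<lambda>\<omega>. (\<Sum>r\<in>A. Z r \<omega>)\<^sup>2) \<and> expectation (\<lambda>\<omega>. (\<Sum>r\<in>A. Z r \<omega>)\<^sup>2) = (\<Sum>r\<in>A. expectation (\<lambda>\<omega>. (Z r \<omega>)\<^sup>2))"
  using assms
proof (induction A)
  case (insert k A)
  define S where "S \<omega> = (\<Sum>r\<in>A. Z r \<omega>)" for \<omega>
  have ind: "indep_var borel (Z k) borel S"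
    unfolding S_def[abs_def] using insert by (intro indep_vars_sum) auto
  have IH: "integrable M (\<lambda>\<omega>. (S \<omega>)\<^sup>2)" "expectation (\<lambda>\<omega>. (S \<omega>)\<^sup>2) = (\<Sum>r\<in>A. expectation (\<lambda>\<omega>. (Z r \<omega>)\<^sup>2))"
    using insert.IH insert.prems indep_vars_subset[OF insert.prems(1), of A] by (auto simp: S_def)
  have S: "integrable M S" unfolding S_def[abs_def] using insert.prems by auto
  have Zk: "integrable M (Z k)" "integrable M (\<lambda>\<omega>. (Z k \<omega>)\<^sup>2)" "expectation (Z k) = 0" using insert.prems by auto
  have cross: "integrable M (\<lambda>\<omega>. Z k \<omega> * S \<omega>)" "expectation (\<lambda>\<omega>. Z k \<omega> * S \<omega>) = 0"
    using indep_var_integrable[OF ind Zk(1) S] indep_var_lebesgue_integral[OF ind Zk(1) S] Zk by auto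
  have eq: "(\<Sum>r\<in>insert k A. Z r \<omega>)\<^sup>2 = (Z k \<omega>)\<^sup>2 + 2 * (Z k \<omega> * S \<omega>) + (S \<omega>)\<^sup>2" for \<omega>
    using insert.hyps by (simp add: S_def power2_sum)
  show ?case unfolding eq using IH Zk cross insert.hyps by simp
qed simp

text \<open>Chebyshev for a sum of independent centred terms; one form serves X^T \<epsilon>, the
  mean square and the mean of the noise.\<close>

lemma noise_sum_tail:
  fixes f :: "nat \<Rightarrow> real \<Rightarrow> real"
  assumes [measurable]: "\<And>r. f r \<in> borel_measurable borel"
    and i2: "\<And>r. r < n \<Longrightarrow> integrable M (\<lambda>\<omega>. (f r (\<epsilon> n \<omega> r))\<^sup>2)" and i1: "\<And>r. r < n \<Longrightarrow> integrable M (\<lambda>\<omega>. f r (\<epsilon> n \<omega> r))"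
    and z: "\<And>r. r < n \<Longrightarrow> expectation (\<lambda>\<omega>. f r (\<epsilon> n \<omega> r)) = 0" and c: "0 < c"
  shows "prob {\<omega> \<in> space M. c < \<bar>\<Sum>r<n. f r (\<epsilon> n \<omega> r)\<bar>} \<le> (\<Sum>r<n. expectation (\<lambda>\<omega>. (f r (\<epsilon> n \<omega> r))\<^sup>2)) / c\<^sup>2"
proof -
  let ?S = "\<lambda>\<omega>. \<Sum>r<n. f r (\<epsilon> n \<omega> r)"
  have ind: "indep_vars (\<lambda>_. borel) (\<lambda>r \<omega>. f r (\<epsilon> n \<omega> r)) {..<n}"
    using indep_vars_compose2[OF indep, where Y=f and N="\<lambda>_. borel", of n] by simp
  have m: "integrable M (\<lambda>\<omega>. (?S \<omega>)\<^sup>2)" "expectation (\<lambda>\<omega>. (?S \<omega>)\<^sup>2) = (\<Sum>r<n. expectation (\<lambda>\<omega>. (f r (\<epsilon> n \<omega> r))\<^sup>2))"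
    using indep_sum_second_moment[OF finite_lessThan ind] i2 i1 z by auto
  have [measurable]: "?S \<in> borel_measurable M" by measurable
  have E: "expectation ?S = 0" using i1 z by simp
  have "prob {\<omega> \<in> space M. c < \<bar>?S \<omega>\<bar>} \<le> prob {\<omega> \<in> space M. c \<le> \<bar>?S \<omega> - expectation ?S\<bar>}"
    unfolding E by (intro finite_measure_mono) auto
  also have "\<dots> \<le> variance ?S / c\<^sup>2" by (intro Chebyshev_inequality m c) measurable
  also have "variance ?S = expectation (\<lambda>\<omega>. (?S \<omega>)\<^sup>2)" unfolding E by simp
  finally show ?thesis unfolding m(2) .
qed

lemma noise_integral:
  assumes "r < n" "g \<in> borel_measurable borel"
  shows "integrable M (\<lambda>\<omega>. g (\<epsilon> n \<omega> r)) \<longleftrightarrow> integrable lborel (\<lambda>x. normal_density 0 \<sigma> x * g x)"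
    "expectation (\<lambda>\<omega>. g (\<epsilon> n \<omega> r)) = (\<integral>x. normal_density 0 \<sigma> x * g x \<partial>lborel)"
  using distributed_integrable[OF normal[OF assms(1)], of g] distributed_integral[OF normal[OF assms(1)], of g] assms(2)
  by auto

lemma noise_moments:
  assumes "r < n"
  shows "integrable M (\<lambda>\<omega>. \<epsilon> n \<omega> r)" "expectation (\<lambda>\<omega>. \<epsilon> n \<omega> r) = 0"
    "integrable M (\<lambda>\<omega>. (\<epsilon> n \<omega> r)\<^sup>2)" "expectation (\<lambda>\<omega>. (\<epsilon> n \<omega> r)\<^sup>2) = \<sigma>\<^sup>2"
    "integrable M (\<lambda>\<omega>. ((\<epsilon> n \<omega> r)\<^sup>2 - \<sigma>\<^sup>2)\<^sup>2)" "expectation (\<lambda>\<omega>. ((\<epsilon> n \<omega> r)\<^sup>2 - \<sigma>\<^sup>2)\<^sup>2) = 2 * \<sigma> ^ 4"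
proof -
  note o1 = normal_moment_odd[OF \<sigma>, of 0 0, simplified] and e1 = normal_moment_even[OF \<sigma>, of 0 1, simplified]
    and e2 = normal_moment_even[OF \<sigma>, of 0 2, simplified]
  note [simp] = noise_integral[OF assms]
  show "integrable M (\<lambda>\<omega>. \<epsilon> n \<omega> r)" "expectation (\<lambda>\<omega>. \<epsilon> n \<omega> r) = 0"
    using noise_integral[OF assms, of "\<lambda>x. x"] o1 by (auto simp: has_bochner_integral_iff)
  show i2: "integrable M (\<lambda>\<omega>. (\<epsilon> n \<omega> r)\<^sup>2)" and m2: "expectation (\<lambda>\<omega>. (\<epsilon> n \<omega> r)\<^sup>2) = \<sigma>\<^sup>2"
    using noise_integral[OF assms, of "\<lambda>x. x\<^sup>2"] e1 by (auto simp: has_bochner_integral_iff)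
  have i4: "integrable M (\<lambda>\<omega>. (\<epsilon> n \<omega> r) ^ 4)" and m4: "expectation (\<lambda>\<omega>. (\<epsilon> n \<omega> r) ^ 4) = 3 * \<sigma> ^ 4"
    using noise_integral[OF assms, of "\<lambda>x. x ^ 4"] e2
    by (auto simp: has_bochner_integral_iff fact_numeral field_simps power2_eq_square power4_eq_xxxx)
  have eq: "((\<epsilon> n \<omega> r)\<^sup>2 - \<sigma>\<^sup>2)\<^sup>2 = (\<epsilon> n \<omega> r) ^ 4 - 2 * \<sigma>\<^sup>2 * (\<epsilon> n \<omega> r)\<^sup>2 + \<sigma> ^ 4" for \<omega>
    by (simp add: power2_diff power_mult[symmetric] mult_ac)
  show "integrable M (\<lambda>\<omega>. ((\<epsilon> n \<omega> r)\<^sup>2 - \<sigma>\<^sup>2)\<^sup>2)" unfolding eq using i2 i4 by simp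
  have "expectation (\<lambda>\<omega>. ((\<epsilon> n \<omega> r)\<^sup>2 - \<sigma>\<^sup>2)\<^sup>2) = 3 * \<sigma> ^ 4 - 2 * \<sigma>\<^sup>2 * \<sigma>\<^sup>2 + \<sigma> ^ 4"
    unfolding eq using i2 i4 m2 m4 by (simp add: prob_space)
  then show "expectation (\<lambda>\<omega>. ((\<epsilon> n \<omega> r)\<^sup>2 - \<sigma>\<^sup>2)\<^sup>2) = 2 * \<sigma> ^ 4" by (simp add: power2_eq_square power4_eq_xxxx)
qed

section \<open>Typical values of the noise statistics\<close>

definition noise_xty :: "nat \<Rightarrow> 'w \<Rightarrow> nat \<Rightarrow> real" where "noise_xty n \<omega> = xty X n (\<epsilon> n \<omega>)"
definition noise_ms :: "nat \<Rightarrow> 'w \<Rightarrow> real" where "noise_ms n \<omega> = (\<Sum>r<n. (\<epsilon> n \<omega> r)\<^sup>2) / real n"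
definition noise_mean :: "nat \<Rightarrow> 'w \<Rightarrow> real" where "noise_mean n \<omega> = (\<Sum>r<n. \<epsilon> n \<omega> r) / real n"

lemma stat_measurable [measurable]:
  "(\<lambda>\<omega>. noise_xty n \<omega> j) \<in> borel_measurable M" "noise_ms n \<in> borel_measurable M" "noise_mean n \<in> borel_measurable M"
  unfolding noise_xty_def xty_def noise_ms_def[abs_def] noise_mean_def[abs_def] by measurable

text \<open>The rate $n^{-1/4}$ turns convergence in probability into membership in a deterministic set,
  so that limits may be computed along arbitrary deterministic sequences of data in these sets.\<close>
definition typical :: "real \<Rightarrow> nat \<Rightarrow> ((nat \<Rightarrow> real) \<times> real \<times> real) set" where
  "typical K n = {(w, V, e). (\<forall>j<p. \<bar>w j\<bar> \<le> K * sqrt (real n)) \<and> \<bar>V - \<sigma>\<^sup>2\<bar> \<le> real n powr (-1/4) \<and> \<bar>e\<bar> \<le> real n powr (-1/4)}"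

lemma typical_measurable: "{\<omega> \<in> space M. (noise_xty n \<omega>, noise_ms n \<omega>, noise_mean n \<omega>) \<in> typical K n} \<in> sets M"
  unfolding typical_def by simp

text \<open>Each coordinate of X^T \<epsilon> has variance of order n, so a large \<open>K\<close>
  makes its tail at \<open>K * sqrt n\<close> small for all large n. For mean square and mean, a
  variance of order 1/n against the squared tolerance n^(-1/2) leaves a bound of order
  n^(-1/2).\<close>

lemma typical_prob:
  assumes "0 < \<eta>"
  shows "\<exists>K>0. \<forall>\<^sub>F n in sequentially. prob {\<omega> \<in> space M. (noise_xty n \<omega>, noise_ms n \<omega>, noise_mean n \<omega>) \<notin> typical K n} < \<eta>"
proof -
  \<comment> \<open>Limit of the summed variances of X^T \<epsilon> over n; the union bound calls
    for c / K^2 < \<eta>.\<close>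
  define c where "c = \<sigma>\<^sup>2 * (\<Sum>j<p. D j j)"
  have Djj: "0 < D j j" if "j < p" for j
    using posdef_on_D[of "{j}"] that by (simp add: posdef_on_def)
  have c: "0 \<le> c" unfolding c_def using Djj by (intro mult_nonneg_nonneg sum_nonneg) (auto simp: less_imp_le)
  obtain K where K: "0 < K" "c / K\<^sup>2 < \<eta>"
  proof
    \<comment> \<open>The summand 1 makes the inequality strict and keeps \<open>K\<close> positive
      when c = 0, that is without predictors.\<close>
    show "0 < sqrt (c / \<eta> + 1)" using c assms by (simp add: add_nonneg_pos)
    have "(sqrt (c / \<eta> + 1))\<^sup>2 = c / \<eta> + 1" using c assms by simp
    then show "c / (sqrt (c / \<eta> + 1))\<^sup>2 < \<eta>" using c assms by (simp add: field_simps add_nonneg_pos)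
  qed
  define b where "b n = (\<Sum>j<p. \<sigma>\<^sup>2 * (gram X n j j / real n) / K\<^sup>2) + 2 * \<sigma> ^ 4 * real n powr (-1/2) + \<sigma>\<^sup>2 * real n powr (-1/2)" for n
  have half: "(\<lambda>n. real n powr (-1/2)) \<longlonglongrightarrow> 0"
    by (intro tendsto_neg_powr filterlim_real_sequentially) simp
  have "b \<longlonglongrightarrow> (\<Sum>j<p. \<sigma>\<^sup>2 * D j j / K\<^sup>2) + 2 * \<sigma> ^ 4 * 0 + \<sigma>\<^sup>2 * 0"
    unfolding b_def[abs_def] using K by (intro tendsto_intros limD half) auto
  moreover have "(\<Sum>j<p. \<sigma>\<^sup>2 * D j j / K\<^sup>2) + 2 * \<sigma> ^ 4 * 0 + \<sigma>\<^sup>2 * 0 < \<eta>"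
    using K(2) by (simp add: c_def sum_distrib_left sum_divide_distrib)
  ultimately have small: "\<forall>\<^sub>F n in sequentially. b n < \<eta>" by (rule order_tendstoD(2))
  have bound: "prob {\<omega> \<in> space M. (noise_xty n \<omega>, noise_ms n \<omega>, noise_mean n \<omega>) \<notin> typical K n} \<le> b n" if n: "0 < n" for n
  proof -
    let ?q = "real n powr (-1/4)"
    have q: "0 < ?q" using n by simp
    have q2: "?q\<^sup>2 = real n powr (-1/2)" using n by (simp add: powr_realpow[symmetric] powr_powr)
    have q3: "1 / real n / ?q\<^sup>2 = real n powr (-1/2)"
    proof -
      have n1: "1 / real n = real n powr (- 1)" using n by (simp add: powr_minus_divide)
      show ?thesis unfolding q2 n1 powr_diff[symmetric] by simp
    qed
    have W: "prob {\<omega> \<in> space M. K * sqrt (real n) < \<bar>noise_xty n \<omega> j\<bar>} \<le> \<sigma>\<^sup>2 * (gram X n j j / real n) / K\<^sup>2" for j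
    proof -
      have "prob {\<omega> \<in> space M. K * sqrt (real n) < \<bar>\<Sum>r<n. X n r j * \<epsilon> n \<omega> r\<bar>}
        \<le> (\<Sum>r<n. expectation (\<lambda>\<omega>. (X n r j * \<epsilon> n \<omega> r)\<^sup>2)) / (K * sqrt (real n))\<^sup>2"
        using noise_moments K n by (intro noise_sum_tail) (auto simp: power_mult_distrib)
      also have "(\<Sum>r<n. expectation (\<lambda>\<omega>. (X n r j * \<epsilon> n \<omega> r)\<^sup>2)) = \<sigma>\<^sup>2 * gram X n j j"
        using noise_moments by (simp add: power_mult_distrib gram_def sum_distrib_left power2_eq_square[of "X _ _ _"] mult_ac)
      finally show ?thesis using n by (simp add: noise_xty_def xty_def power_mult_distrib mult_ac)
    qed
    have V: "prob {\<omega> \<in> space M. ?q < \<bar>noise_ms n \<omega> - \<sigma>\<^sup>2\<bar>} \<le> 2 * \<sigma> ^ 4 * real n powr (-1/2)"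
    proof -
      have "prob {\<omega> \<in> space M. real n * ?q < \<bar>\<Sum>r<n. ((\<epsilon> n \<omega> r)\<^sup>2 - \<sigma>\<^sup>2)\<bar>}
        \<le> (\<Sum>r<n. expectation (\<lambda>\<omega>. ((\<epsilon> n \<omega> r)\<^sup>2 - \<sigma>\<^sup>2)\<^sup>2)) / (real n * ?q)\<^sup>2"
        using noise_moments q n by (intro noise_sum_tail[of "\<lambda>_ x. x\<^sup>2 - \<sigma>\<^sup>2"]) (auto simp: prob_space)
      also have "\<dots> = 2 * \<sigma> ^ 4 * (1 / real n / ?q\<^sup>2)"
        using noise_moments n by (simp add: power_mult_distrib power2_eq_square)
      also have "{\<omega> \<in> space M. real n * ?q < \<bar>\<Sum>r<n. ((\<epsilon> n \<omega> r)\<^sup>2 - \<sigma>\<^sup>2)\<bar>} = {\<omega> \<in> space M. ?q < \<bar>noise_ms n \<omega> - \<sigma>\<^sup>2\<bar>}"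
      proof -
        have "(\<Sum>r<n. ((\<epsilon> n \<omega> r)\<^sup>2 - \<sigma>\<^sup>2)) = real n * (noise_ms n \<omega> - \<sigma>\<^sup>2)" for \<omega>
          using n by (simp add: noise_ms_def sum_subtractf right_diff_distrib)
        then show ?thesis using n by (simp add: abs_mult)
      qed
      finally show ?thesis unfolding q3 .
    qed
    have E: "prob {\<omega> \<in> space M. ?q < \<bar>noise_mean n \<omega>\<bar>} \<le> \<sigma>\<^sup>2 * real n powr (-1/2)"
    proof -
      have "prob {\<omega> \<in> space M. real n * ?q < \<bar>\<Sum>r<n. \<epsilon> n \<omega> r\<bar>}
        \<le> (\<Sum>r<n. expectation (\<lambda>\<omega>. (\<epsilon> n \<omega> r)\<^sup>2)) / (real n * ?q)\<^sup>2"
        using noise_moments q n by (intro noise_sum_tail[of "\<lambda>_ x. x"]) auto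
      also have "\<dots> = \<sigma>\<^sup>2 * (1 / real n / ?q\<^sup>2)"
        using noise_moments n by (simp add: power_mult_distrib power2_eq_square)
      also have "{\<omega> \<in> space M. real n * ?q < \<bar>\<Sum>r<n. \<epsilon> n \<omega> r\<bar>} = {\<omega> \<in> space M. ?q < \<bar>noise_mean n \<omega>\<bar>}"
        using n by (simp add: noise_mean_def field_simps)
      finally show ?thesis unfolding q3 .
    qed
    have "prob {\<omega> \<in> space M. (noise_xty n \<omega>, noise_ms n \<omega>, noise_mean n \<omega>) \<notin> typical K n}
      \<le> prob ((\<Union>j<p. {\<omega> \<in> space M. K * sqrt (real n) < \<bar>noise_xty n \<omega> j\<bar>}) \<union>
          ({\<omega> \<in> space M. ?q < \<bar>noise_ms n \<omega> - \<sigma>\<^sup>2\<bar>} \<union> {\<omega> \<in> space M. ?q < \<bar>noise_mean n \<omega>\<bar>}))"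
      by (intro finite_measure_mono) (auto simp: typical_def not_le)
    also have "\<dots> \<le> prob (\<Union>j<p. {\<omega> \<in> space M. K * sqrt (real n) < \<bar>noise_xty n \<omega> j\<bar>}) +
        (prob {\<omega> \<in> space M. ?q < \<bar>noise_ms n \<omega> - \<sigma>\<^sup>2\<bar>} + prob {\<omega> \<in> space M. ?q < \<bar>noise_mean n \<omega>\<bar>})"
      by (intro order_trans[OF measure_Un_le] add_left_mono measure_Un_le) auto
    also have "prob (\<Union>j<p. {\<omega> \<in> space M. K * sqrt (real n) < \<bar>noise_xty n \<omega> j\<bar>}) \<le> (\<Sum>j<p. \<sigma>\<^sup>2 * (gram X n j j / real n) / K\<^sup>2)"
      by (intro order_trans[OF measure_UNION_le] sum_mono W) auto
    finally show ?thesis using V E unfolding b_def by linarith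
  qed
  from small eventually_gt_at_top[of 0]
  have "\<forall>\<^sub>F n in sequentially. prob {\<omega> \<in> space M. (noise_xty n \<omega>, noise_ms n \<omega>, noise_mean n \<omega>) \<notin> typical K n} < \<eta>"
  proof eventually_elim
    case (elim n)
    show ?case by (rule order_le_less_trans[OF bound[OF elim(2)] elim(1)])
  qed
  then show ?thesis using K(1) by blast
qed

text \<open>If the bound failed for infinitely many n, violating points could be picked there; the
  picks extend to an admissible deterministic sequence, along which \<Phi> tends to 0. Convergence
  along all sequences thus becomes uniform on the typical sets.\<close>

lemma typical_uniform:
  assumes "0 < K" "0 < e"
    and lim: "\<And>w V s. (\<And>n j. j < p \<Longrightarrow> \<bar>w n j\<bar> \<le> K * sqrt (real n)) \<Longrightarrow> V \<longlonglongrightarrow> \<sigma>\<^sup>2 \<Longrightarrow> s \<longlonglongrightarrow> 0 \<Longrightarrow> (\<lambda>n. \<Phi> n (w n) (V n) (s n)) \<longlonglongrightarrow> (0::real)"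
  shows "\<forall>\<^sub>F n in sequentially. \<forall>(w, V, s)\<in>typical K n. \<bar>\<Phi> n w V s\<bar> < e"
proof -
  define bad where "bad n x \<longleftrightarrow> x \<in> typical K n \<and> e \<le> \<bar>\<Phi> n (fst x) (fst (snd x)) (snd (snd x))\<bar>" for n x
  have base: "(\<lambda>_. 0, \<sigma>\<^sup>2, 0) \<in> typical K n" for n using assms(1) by (simp add: typical_def)
  \<comment> \<open>Where nothing violates the bound, noise statistics at their limits serve as
    default; they are typical, so the sequence is admissible at every n.\<close>
  define x where "x n = (if \<exists>x. bad n x then SOME x. bad n x else (\<lambda>_. 0, \<sigma>\<^sup>2, 0))" for n
  have bad: "bad n (x n)" if "\<exists>x. bad n x" for n using someI_ex[OF that] that by (simp add: x_def)
  have xt: "x n \<in> typical K n" for n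
  proof (cases "\<exists>x. bad n x")
    case True
    from bad[OF this] show ?thesis by (simp add: bad_def)
  qed (simp add: x_def base)
  have "(\<lambda>n. \<Phi> n (fst (x n)) (fst (snd (x n))) (snd (snd (x n)))) \<longlonglongrightarrow> 0"
  proof (rule lim)
    have q: "(\<lambda>n. real n powr (-1/4)) \<longlonglongrightarrow> 0" by (intro tendsto_neg_powr filterlim_real_sequentially) simp
    show "\<bar>fst (x n) j\<bar> \<le> K * sqrt (real n)" if "j < p" for n j using xt[of n] that by (auto simp: typical_def)
    have xt': "\<bar>fst (snd (x n)) - \<sigma>\<^sup>2\<bar> \<le> real n powr (-1/4)" "\<bar>snd (snd (x n))\<bar> \<le> real n powr (-1/4)" for n
      using xt[of n] by (auto simp: typical_def)
    have "(\<lambda>n. fst (snd (x n)) - \<sigma>\<^sup>2) \<longlonglongrightarrow> 0"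
      by (rule Lim_null_comparison[OF _ q]) (simp only: real_norm_def xt' eventually_True)
    then show "(\<lambda>n. fst (snd (x n))) \<longlonglongrightarrow> \<sigma>\<^sup>2" by (simp only: LIM_zero_iff)
    show "(\<lambda>n. snd (snd (x n))) \<longlonglongrightarrow> 0"
      by (rule Lim_null_comparison[OF _ q]) (simp only: real_norm_def xt' eventually_True)
  qed
  then have "\<forall>\<^sub>F n in sequentially. dist (\<Phi> n (fst (x n)) (fst (snd (x n))) (snd (snd (x n)))) 0 < e"
    using assms(2) by (rule tendstoD)
  then show ?thesis
  proof eventually_elim
    case (elim n)
    have "\<not> bad n (x n)" using elim by (simp add: bad_def)
    then have "\<not> (\<exists>x. bad n x)" using bad by blast
    then show ?case by (auto simp: bad_def not_le)
  qed
qed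

text \<open>\<open>Z\<close> has to agree with \<Phi> on typical data for large n. A large value of
  \<open>Z\<close> then forces atypical data, and the event of atypical data is the one whose
  measurability is checked.\<close>

lemma conv_prob_zero_typical:
  assumes lim: "\<And>K w V s. (\<And>n j. j < p \<Longrightarrow> \<bar>w n j\<bar> \<le> K * sqrt (real n)) \<Longrightarrow> V \<longlonglongrightarrow> \<sigma>\<^sup>2 \<Longrightarrow> s \<longlonglongrightarrow> 0 \<Longrightarrow> (\<lambda>n. \<Phi> n (w n) (V n) (s n)) \<longlonglongrightarrow> (0::real)"
    and Z: "\<And>K. 0 < K \<Longrightarrow> \<forall>\<^sub>F n in sequentially. \<forall>\<omega>\<in>space M. (noise_xty n \<omega>, noise_ms n \<omega>, noise_mean n \<omega>) \<in> typical K n \<longrightarrow> Z n \<omega> = \<Phi> n (noise_xty n \<omega>) (noise_ms n \<omega>) (noise_mean n \<omega>)"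
  shows "conv_prob_zero M Z"
  unfolding conv_prob_zero_def
proof (intro allI impI tendstoI)
  fix e \<eta> :: real assume e: "0 < e" and \<eta>: "0 < \<eta>"
  obtain K where K: "0 < K" "\<forall>\<^sub>F n in sequentially. prob {\<omega> \<in> space M. (noise_xty n \<omega>, noise_ms n \<omega>, noise_mean n \<omega>) \<notin> typical K n} < \<eta>"
    using typical_prob[OF \<eta>] by blast
  have u: "\<forall>\<^sub>F n in sequentially. \<forall>(w, V, s)\<in>typical K n. \<bar>\<Phi> n w V s\<bar> < e"
    by (rule typical_uniform[OF K(1) e lim])
  show "\<forall>\<^sub>F n in sequentially. dist (prob {\<omega> \<in> space M. e < \<bar>Z n \<omega>\<bar>}) 0 < \<eta>"
    using K(2) u Z[OF K(1)]
  proof eventually_elim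
    case (elim n)
    have "prob {\<omega> \<in> space M. e < \<bar>Z n \<omega>\<bar>} \<le> prob {\<omega> \<in> space M. (noise_xty n \<omega>, noise_ms n \<omega>, noise_mean n \<omega>) \<notin> typical K n}"
    proof (rule finite_measure_mono)
      show "{\<omega> \<in> space M. e < \<bar>Z n \<omega>\<bar>} \<subseteq> {\<omega> \<in> space M. (noise_xty n \<omega>, noise_ms n \<omega>, noise_mean n \<omega>) \<notin> typical K n}"
      proof safe
        fix \<omega> assume \<omega>: "\<omega> \<in> space M" "e < \<bar>Z n \<omega>\<bar>" "(noise_xty n \<omega>, noise_ms n \<omega>, noise_mean n \<omega>) \<in> typical K n"
        then have "Z n \<omega> = \<Phi> n (noise_xty n \<omega>) (noise_ms n \<omega>) (noise_mean n \<omega>)" using elim(3) by blast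
        moreover have "\<bar>\<Phi> n (noise_xty n \<omega>) (noise_ms n \<omega>) (noise_mean n \<omega>)\<bar> < e" using elim(2) \<omega>(3) by blast
        ultimately show False using \<omega>(2) by simp
      qed
      have "{\<omega> \<in> space M. (noise_xty n \<omega>, noise_ms n \<omega>, noise_mean n \<omega>) \<notin> typical K n} = space M - {\<omega> \<in> space M. (noise_xty n \<omega>, noise_ms n \<omega>, noise_mean n \<omega>) \<in> typical K n}" by blast
      then show "{\<omega> \<in> space M. (noise_xty n \<omega>, noise_ms n \<omega>, noise_mean n \<omega>) \<notin> typical K n} \<in> sets M" using typical_measurable[of n K] by simp
    qed
    also have "\<dots> < \<eta>" by (rule elim(1))
    finally show ?case by simp
  qed
qed

end

section \<open>Convergence in distribution\<close>

lemma psi_real_measurable [measurable]: "2 < a \<Longrightarrow> psi_real a d \<in> borel_measurable borel"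
  by (intro borel_measurable_mono monoI) (metis less_eq_real_def psi_real_strict_mono)

text \<open>Since every late \<open>W n\<close> has exactly the law \<mu>, the distribution function
  of \<open>Y n\<close> at x is squeezed between those of \<mu> at x - \<delta> and x + \<delta>, up
  to a vanishing probability; continuity at x closes the gap.\<close>

lemma weak_conv_m_slutsky:
  fixes Y W :: "nat \<Rightarrow> 'w \<Rightarrow> real"
  assumes "prob_space M" and \<mu>: "real_distribution \<mu>"
    and Y: "\<forall>\<^sub>F n in sequentially. Y n \<in> borel_measurable M"
    and W: "\<forall>\<^sub>F n in sequentially. W n \<in> borel_measurable M \<and> distr M borel (W n) = \<mu>"
    and YW: "conv_prob_zero M (\<lambda>n \<omega>. Y n \<omega> - W n \<omega>)"
  shows "weak_conv_m (\<lambda>n. distr M borel (Y n)) \<mu>"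
  unfolding weak_conv_m_def weak_conv_def
proof (intro allI impI tendstoI)
  interpret prob_space M by fact
  interpret \<mu>: real_distribution \<mu> by fact
  fix x e :: real assume cont: "isCont (cdf \<mu>) x" and e: "0 < e"
  obtain d where d: "0 < d" "\<And>y. \<bar>y - x\<bar> < d \<Longrightarrow> \<bar>cdf \<mu> y - cdf \<mu> x\<bar> < e / 2"
    using cont e unfolding continuous_at_eps_delta by (metis dist_real_def half_gt_zero)
  define \<delta> where "\<delta> = d / 2"
  have \<delta>: "0 < \<delta>" using d by (simp add: \<delta>_def)
  have cd: "\<bar>cdf \<mu> (x + \<delta>) - cdf \<mu> x\<bar> < e / 2" "\<bar>cdf \<mu> (x - \<delta>) - cdf \<mu> x\<bar> < e / 2"
    using d by (auto simp: \<delta>_def)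
  have "(\<lambda>n. prob {\<omega> \<in> space M. \<delta> < \<bar>Y n \<omega> - W n \<omega>\<bar>}) \<longlonglongrightarrow> 0"
    using YW \<delta> unfolding conv_prob_zero_def by blast
  then have small: "\<forall>\<^sub>F n in sequentially. prob {\<omega> \<in> space M. \<delta> < \<bar>Y n \<omega> - W n \<omega>\<bar>} < e / 2"
    using e by (intro order_tendstoD(2)[where a="e / 2"]) auto
  show "\<forall>\<^sub>F n in sequentially. dist (cdf (distr M borel (Y n)) x) (cdf \<mu> x) < e"
    using small Y W
  proof eventually_elim
    case (elim n)
    note [measurable] = elim(2) conjunct1[OF elim(3)]
    have cdfY: "cdf (distr M borel (Y n)) z = prob {\<omega> \<in> space M. Y n \<omega> \<le> z}" for z
      unfolding cdf_def by (subst measure_distr) (auto intro!: arg_cong[where f=prob])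
    have cdfW: "cdf \<mu> z = prob {\<omega> \<in> space M. W n \<omega> \<le> z}" for z
      unfolding conjunct2[OF elim(3), symmetric] cdf_def by (subst measure_distr) (auto intro!: arg_cong[where f=prob])
    let ?B = "{\<omega> \<in> space M. \<delta> < \<bar>Y n \<omega> - W n \<omega>\<bar>}"
    have "prob {\<omega> \<in> space M. Y n \<omega> \<le> x} \<le> prob ({\<omega> \<in> space M. W n \<omega> \<le> x + \<delta>} \<union> ?B)"
      by (intro finite_measure_mono) auto
    also have "\<dots> \<le> prob {\<omega> \<in> space M. W n \<omega> \<le> x + \<delta>} + prob ?B" by (intro measure_Un_le) auto
    finally have 1: "cdf (distr M borel (Y n)) x \<le> cdf \<mu> (x + \<delta>) + prob ?B" unfolding cdfY cdfW .
    have "prob {\<omega> \<in> space M. W n \<omega> \<le> x - \<delta>} \<le> prob ({\<omega> \<in> space M. Y n \<omega> \<le> x} \<union> ?B)"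
      by (intro finite_measure_mono) auto
    also have "\<dots> \<le> prob {\<omega> \<in> space M. Y n \<omega> \<le> x} + prob ?B" by (intro measure_Un_le) auto
    finally have 2: "cdf \<mu> (x - \<delta>) \<le> cdf (distr M borel (Y n)) x + prob ?B" unfolding cdfY cdfW .
    show ?case using 1 2 cd elim(1) unfolding dist_real_def by linarith
  qed
qed

lemma centered_normal_interval_pos: "0 < \<sigma> \<Longrightarrow> x < y \<Longrightarrow> 0 < emeasure (centered_normal \<sigma>) {x..y}"
proof -
  assume \<sigma>: "0 < \<sigma>" and xy: "x < y"
  have "emeasure (centered_normal \<sigma>) {x..y} \<noteq> 0"
  proof
    assume "emeasure (centered_normal \<sigma>) {x..y} = 0"
    then have "(\<integral>\<^sup>+ t. ennreal (normal_density 0 \<sigma> t) * indicator {x..y} t \<partial>lborel) = 0"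
      unfolding centered_normal_def by (subst (asm) emeasure_density) auto
    then have AE: "AE t in lborel. ennreal (normal_density 0 \<sigma> t) * indicator {x..y} t = 0"
      by (subst (asm) nn_integral_0_iff_AE) auto
    have pos: "ennreal (normal_density 0 \<sigma> t) * indicator {x..y} t \<noteq> 0" if "t \<in> {x..y}" for t
      using normal_density_pos[OF \<sigma>, of 0 t] that by simp
    from AE have "AE t in lborel. t \<notin> {x..y}" by eventually_elim (metis pos)
    then have "{x..y} \<in> null_sets lborel" by (subst AE_iff_null_sets) auto
    then show False using xy by auto
  qed
  then show ?thesis by (simp add: zero_less_iff_neq_zero)
qed

context noisy_regression
begin

abbreviation y :: "nat \<Rightarrow> 'w \<Rightarrow> nat \<Rightarrow> real" where "y n \<omega> \<equiv> response X T \<alpha> \<beta> \<epsilon> n \<omega>"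

lemma xty_response:
  assumes "j < p"
  shows "xty X n (y n \<omega>) j = xty_of n (noise_xty n \<omega>) j"
proof -
  have "xty X n (y n \<omega>) j = (\<Sum>r<n. \<alpha> * X n r j + (\<Sum>j'\<in>T. X n r j * X n r j' * \<beta> j') + X n r j * \<epsilon> n \<omega> r)"
    unfolding xty_def response_def by (simp add: distrib_left sum_distrib_left mult_ac)
  also have "\<dots> = \<alpha> * (\<Sum>r<n. X n r j) + (\<Sum>r<n. \<Sum>j'\<in>T. X n r j * X n r j' * \<beta> j') + (\<Sum>r<n. X n r j * \<epsilon> n \<omega> r)"
    by (simp add: sum.distrib sum_distrib_left)
  also have "(\<Sum>r<n. \<Sum>j'\<in>T. X n r j * X n r j' * \<beta> j') = (\<Sum>j'\<in>T. gram X n j j' * \<beta> j')"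
    by (subst sum.swap) (simp add: gram_def sum_distrib_right)
  finally show ?thesis using centered[OF assms] by (simp add: xty_of_def noise_xty_def xty_def)
qed

lemma sst_response:
  assumes "0 < n"
  shows "sst n (y n \<omega>) = tss n (noise_xty n \<omega>) (noise_ms n \<omega>) (noise_mean n \<omega>)"
proof -
  define m where "m r = (\<Sum>j\<in>T. X n r j * \<beta> j)" for r
  have m0: "(\<Sum>r<n. m r) = 0"
  proof -
    have "(\<Sum>r<n. m r) = (\<Sum>j\<in>T. (\<Sum>r<n. X n r j) * \<beta> j)"
      unfolding m_def by (subst sum.swap) (simp add: sum_distrib_right)
    also have "\<dots> = 0" using centered T by (intro sum.neutral) auto
    finally show ?thesis .
  qed
  have me: "(\<Sum>r<n. m r * \<epsilon> n \<omega> r) = (\<Sum>j\<in>T. \<beta> j * noise_xty n \<omega> j)"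
    unfolding m_def noise_xty_def xty_def sum_distrib_left sum_distrib_right by (subst sum.swap) (simp add: mult_ac)
  have mm: "(\<Sum>r<n. (m r)\<^sup>2) = (\<Sum>j\<in>T. \<Sum>j'\<in>T. \<beta> j * gram X n j j' * \<beta> j')"
    unfolding m_def by (rule gram_quadratic)
  define s where "s = (\<Sum>r<n. \<epsilon> n \<omega> r)"
  have yr: "y n \<omega> r = \<alpha> + m r + \<epsilon> n \<omega> r" for r by (simp add: response_def m_def)
  have 1: "(\<Sum>r<n. y n \<omega> r) = real n * \<alpha> + s"
    unfolding yr by (simp add: sum.distrib m0 s_def)
  have "(\<Sum>r<n. (y n \<omega> r)\<^sup>2) = (\<Sum>r<n. \<alpha>\<^sup>2 + (m r)\<^sup>2 + (\<epsilon> n \<omega> r)\<^sup>2 + 2 * \<alpha> * m r + 2 * \<alpha> * \<epsilon> n \<omega> r + 2 * (m r * \<epsilon> n \<omega> r))"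
    unfolding yr by (intro sum.cong refl) (simp add: power2_eq_square algebra_simps)
  also have "\<dots> = real n * \<alpha>\<^sup>2 + (\<Sum>r<n. (m r)\<^sup>2) + (\<Sum>r<n. (\<epsilon> n \<omega> r)\<^sup>2) + 2 * \<alpha> * (\<Sum>r<n. m r) + 2 * \<alpha> * s + 2 * (\<Sum>r<n. m r * \<epsilon> n \<omega> r)"
    by (simp add: sum.distrib sum_distrib_left s_def)
  finally have 2: "(\<Sum>r<n. (y n \<omega> r)\<^sup>2) = real n * \<alpha>\<^sup>2 + (\<Sum>j\<in>T. \<Sum>j'\<in>T. \<beta> j * gram X n j j' * \<beta> j')
      + (\<Sum>r<n. (\<epsilon> n \<omega> r)\<^sup>2) + 2 * \<alpha> * s + 2 * (\<Sum>j\<in>T. \<beta> j * noise_xty n \<omega> j)"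
    by (simp add: m0 me mm)
  have noise_ms: "real n * noise_ms n \<omega> = (\<Sum>r<n. (\<epsilon> n \<omega> r)\<^sup>2)" using assms by (simp add: noise_ms_def)
  have noise_mean: "real n * (noise_mean n \<omega>)\<^sup>2 = s\<^sup>2 / real n" using assms by (simp add: noise_mean_def s_def power2_eq_square)
  have "(real n * \<alpha> + s)\<^sup>2 / real n = real n * \<alpha>\<^sup>2 + 2 * \<alpha> * s + s\<^sup>2 / real n"
    using assms by (simp add: power2_eq_square field_simps)
  then show ?thesis unfolding sst_def tss_def 1 2 noise_ms noise_mean by simp
qed

lemma ess_response:
  assumes "\<gamma> \<subseteq> {..<p}"
  shows "inv_quad (bs \<gamma> i) (gram X n) (xty X n (y n \<omega>)) = ess n \<gamma> (noise_xty n \<omega>) i"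
  unfolding ess_def using bs_subset[OF assms, of i] fin[OF assms]
  by (intro inv_quad_cong refl xty_response) auto

text \<open>\<open>2 \<le> n\<close> makes the constant \<open>sigma2_integral n 1\<close> finite,
  and the second condition is what the Gaussian integrals over the blocks require.\<close>

definition regular :: "nat \<Rightarrow> nat set \<Rightarrow> bool" where
  "regular n \<gamma> \<longleftrightarrow> 2 \<le> n \<and> (\<forall>i\<in>blk ` \<gamma>. posdef_on (bs \<gamma> i) (gram X n))"

lemma eventually_regular:
  assumes "\<gamma> \<subseteq> {..<p}"
  shows "\<forall>\<^sub>F n in sequentially. regular n \<gamma>"
  unfolding regular_def using fin[OF assms]
  by (intro eventually_conj eventually_ge_at_top eventually_ball_finite ballI posdef_on_gram bs_subset assms) auto

lemma marg_lik_response: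
  assumes \<gamma>: "\<gamma> \<subseteq> {..<p}" and reg: "regular n \<gamma>"
    and R: "0 < tss n (noise_xty n \<omega>) (noise_ms n \<omega>) (noise_mean n \<omega>) - (\<Sum>i\<in>blk ` \<gamma>. ess n \<gamma> (noise_xty n \<omega>) i)"
  shows "marg_lik a X blk n \<gamma> (y n \<omega>) = hyperg_integral a blocks (blk ` \<gamma>) (\<lambda>i. card (bs \<gamma> i)) ((real n - 1) / 2)
    (tss n (noise_xty n \<omega>) (noise_ms n \<omega>) (noise_mean n \<omega>)) (ess n \<gamma> (noise_xty n \<omega>)) * sigma2_integral n 1"
proof -
  have n: "0 < n" using reg by (simp add: regular_def)
  have "marg_lik a X blk n \<gamma> (y n \<omega>) = hyperg_integral a blocks (blk ` \<gamma>) (\<lambda>i. card (bs \<gamma> i)) ((real n - 1) / 2)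
    (sst n (y n \<omega>)) (\<lambda>i. inv_quad (bs \<gamma> i) (gram X n) (xty X n (y n \<omega>))) * sigma2_integral n 1"
  proof (rule marg_lik_hyperg_integral[OF n a fin[OF \<gamma>] _ blk_image_subset[OF \<gamma>]])
    show "finite blocks" by simp
    show "(\<Sum>r<n. X n r j) = 0" if "j \<in> \<gamma>" for j using that \<gamma> by (intro centered) auto
    show "gram X n j j' = 0" if "j \<in> \<gamma>" "j' \<in> \<gamma>" "blk j \<noteq> blk j'" for j j'
      using that \<gamma> by (intro orth) auto
    show "posdef_on (bs \<gamma> i) (gram X n)" if "i \<in> blk ` \<gamma>" for i using reg that unfolding regular_def by blast
    show "0 < sst n (y n \<omega>) - (\<Sum>i\<in>blk ` \<gamma>. inv_quad (bs \<gamma> i) (gram X n) (xty X n (y n \<omega>)))"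
      using R by (simp only: sst_response[OF n] ess_response[OF \<gamma>])
  qed
  then show ?thesis by (simp only: sst_response[OF n] ess_response[OF \<gamma>])
qed

text \<open>The residual sum over n tends to \<sigma>^2 plus the lack of fit, a positive number.
  Taking that limit as the tolerance gives positivity uniformly on typical data.\<close>

lemma rss_pos:
  assumes \<gamma>: "\<gamma> \<subseteq> {..<p}" and K: "0 < K"
  shows "\<forall>\<^sub>F n in sequentially. \<forall>(w, V, s)\<in>typical K n. 0 < tss n w V s - (\<Sum>i\<in>blk ` \<gamma>. ess n \<gamma> w i)"
proof -
  let ?L = "\<sigma>\<^sup>2 + lack \<gamma>"
  have L: "0 < ?L"
    using lack_superset[OF _ \<gamma>] \<sigma>2 add_pos_pos[OF \<sigma>2 lack_pos[OF _ \<gamma>]] by (cases "T \<subseteq> \<gamma>") simp_all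
  have "\<forall>\<^sub>F n in sequentially. \<forall>(w, V, s)\<in>typical K n. \<bar>(tss n w V s - (\<Sum>i\<in>blk ` \<gamma>. ess n \<gamma> w i)) / real n - ?L\<bar> < ?L"
  proof (rule typical_uniform[OF K L])
    fix w :: "nat \<Rightarrow> nat \<Rightarrow> real" and V s :: "nat \<Rightarrow> real"
    assume w: "\<And>n j. j < p \<Longrightarrow> \<bar>w n j\<bar> \<le> K * sqrt (real n)" and V: "V \<longlonglongrightarrow> \<sigma>\<^sup>2" and s: "s \<longlonglongrightarrow> 0"
    from rss_tendsto[where w=w and V=V and e=s and K=K, OF w V s \<gamma>]
    show "(\<lambda>n. (tss n (w n) (V n) (s n) - (\<Sum>i\<in>blk ` \<gamma>. ess n \<gamma> (w n) i)) / real n - ?L) \<longlonglongrightarrow> 0"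
      by (simp only: LIM_zero_iff)
  qed
  then show ?thesis using eventually_gt_at_top[of 0]
  proof eventually_elim
    case (elim n)
    show ?case
    proof safe
      fix w V s assume "(w, V, s) \<in> typical K n"
      then have "\<bar>(tss n w V s - (\<Sum>i\<in>blk ` \<gamma>. ess n \<gamma> w i)) / real n - ?L\<bar> < ?L" using elim(1) by blast
      then have "0 < (tss n w V s - (\<Sum>i\<in>blk ` \<gamma>. ess n \<gamma> w i)) / real n" by linarith
      then show "0 < tss n w V s - (\<Sum>i\<in>blk ` \<gamma>. ess n \<gamma> w i)" using elim(2) by (simp add: zero_less_divide_iff)
    qed
  qed
qed

text \<open>The factor \<open>sigma2_integral n 1\<close> is positive and finite, hence cancels
  after conversion to reals.\<close>

lemma bayes_factor_eq:
  assumes \<gamma>: "\<gamma> \<subseteq> {..<p}" and K: "0 < K"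
  shows "\<forall>\<^sub>F n in sequentially. \<forall>\<omega>\<in>space M. (noise_xty n \<omega>, noise_ms n \<omega>, noise_mean n \<omega>) \<in> typical K n \<longrightarrow>
    bayes_factor a X blk n \<gamma> T (y n \<omega>) = bf_of n \<gamma> (noise_xty n \<omega>) (noise_ms n \<omega>) (noise_mean n \<omega>)"
  using rss_pos[OF \<gamma> K] rss_pos[OF T K] eventually_regular[OF \<gamma>] eventually_regular[OF T]
proof eventually_elim
  case (elim n)
  show ?case
  proof (intro ballI impI)
    fix \<omega> assume \<omega>: "(noise_xty n \<omega>, noise_ms n \<omega>, noise_mean n \<omega>) \<in> typical K n"
    have R: "0 < tss n (noise_xty n \<omega>) (noise_ms n \<omega>) (noise_mean n \<omega>) - (\<Sum>i\<in>blk ` \<gamma>. ess n \<gamma> (noise_xty n \<omega>) i)"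
      "0 < tss n (noise_xty n \<omega>) (noise_ms n \<omega>) (noise_mean n \<omega>) - (\<Sum>i\<in>blk ` T. ess n T (noise_xty n \<omega>) i)"
      using elim(1,2) \<omega> by blast+
    have n: "2 \<le> n" using elim(3) by (simp add: regular_def)
    have "sigma2_integral n 1 < \<top>" using sigma2_integral_one_finite[OF n] by simp
    moreover have "0 < sigma2_integral n 1" using n by (intro sigma2_integral_one_pos) simp
    ultimately have "0 < enn2real (sigma2_integral n 1)" by (simp add: enn2real_positive_iff)
    then show "bayes_factor a X blk n \<gamma> T (y n \<omega>) = bf_of n \<gamma> (noise_xty n \<omega>) (noise_ms n \<omega>) (noise_mean n \<omega>)"
      unfolding bayes_factor_def marg_lik_response[OF \<gamma> elim(3) R(1)] marg_lik_response[OF T elim(4) R(2)]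
        bf_of_def hyperg_ratio_def enn2real_mult by simp
  qed
qed

text \<open>The representation before scaling is used because it holds at every sample point,
  typical or not.\<close>

lemma marg_lik_measurable:
  assumes \<gamma>: "\<gamma> \<subseteq> {..<p}" and reg: "regular n \<gamma>"
  shows "(\<lambda>\<omega>. marg_lik a X blk n \<gamma> (y n \<omega>)) \<in> borel_measurable M"
proof -
  let ?H = "PiM blocks (\<lambda>_. hyperg a)"
  interpret H: prob_space ?H by (rule prob_space_PiM_hyperg[OF a])
  have n: "0 < n" using reg by (simp add: regular_def)
  have ym [measurable]: "(\<lambda>\<omega>. y n \<omega> r) \<in> borel_measurable M" if "r < n" for r
    using noise_measurable[OF that] unfolding response_def by measurable
  have [measurable]: "(\<lambda>\<omega>. sst n (y n \<omega>)) \<in> borel_measurable M" unfolding sst_def by measurable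
  have [measurable]: "(\<lambda>\<omega>. xty X n (y n \<omega>) j) \<in> borel_measurable M" for j unfolding xty_def by measurable
  have [measurable]: "(\<lambda>\<omega>. inv_quad (bs \<gamma> i) (gram X n) (xty X n (y n \<omega>))) \<in> borel_measurable M" for i
    unfolding inv_quad_def by (intro inv_quad_list_measurable) measurable
  have eq: "marg_lik a X blk n \<gamma> (y n \<omega>) = (\<integral>\<^sup>+ g. ennreal (\<Prod>i\<in>blk ` \<gamma>. (1 + g i) powr (- real (card (bs \<gamma> i)) / 2))
    * sigma2_integral n (sst n (y n \<omega>) - (\<Sum>i\<in>blk ` \<gamma>. g i / (1 + g i) * inv_quad (bs \<gamma> i) (gram X n) (xty X n (y n \<omega>)))) \<partial>?H)" for \<omega>
  proof (rule marg_lik_eq[OF n a fin[OF \<gamma>] _ blk_image_subset[OF \<gamma>]])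
    show "finite blocks" by simp
    show "(\<Sum>r<n. X n r j) = 0" if "j \<in> \<gamma>" for j using that \<gamma> by (intro centered) auto
    show "gram X n j j' = 0" if "j \<in> \<gamma>" "j' \<in> \<gamma>" "blk j \<noteq> blk j'" for j j'
      using that \<gamma> by (intro orth) auto
    show "posdef_on (bs \<gamma> i) (gram X n)" if "i \<in> blk ` \<gamma>" for i using reg that unfolding regular_def by blast
  qed
  have g [measurable]: "(\<lambda>x. snd x i) \<in> borel_measurable (M \<Otimes>\<^sub>M ?H)" if "i \<in> blk ` \<gamma>" for i
    using that blk_image_subset[OF \<gamma>] by (intro measurable_compose[OF measurable_snd PiM_component_measurable_hyperg]) auto
  show ?thesis unfolding eq
    by (rule H.borel_measurable_nn_integral) (unfold split_beta, measurable)
qed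

lemma bayes_factor_measurable:
  assumes "\<gamma> \<subseteq> {..<p}"
  shows "\<forall>\<^sub>F n in sequentially. (\<lambda>\<omega>. bayes_factor a X blk n \<gamma> T (y n \<omega>)) \<in> borel_measurable M"
  using eventually_regular[OF assms] eventually_regular[OF T]
proof eventually_elim
  case (elim n)
  note [measurable] = marg_lik_measurable[OF assms elim(1)] marg_lik_measurable[OF T elim(2)]
  show ?case unfolding bayes_factor_def by measurable
qed

lemma bayes_factor_missing:
  assumes "\<gamma> \<subseteq> {..<p}" "\<not> T \<subseteq> \<gamma>"
  shows "conv_prob_zero M (\<lambda>n \<omega>. bayes_factor a X blk n \<gamma> T (y n \<omega>))"
  by (rule conv_prob_zero_typical[OF bf_of_missing bayes_factor_eq]) (use assms in auto)

lemma bayes_factor_growing_block: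
  assumes "\<gamma> \<subseteq> {..<p}" "T \<subseteq> \<gamma>" "j0 \<in> \<gamma> - T" "blk j0 \<in> blk ` T"
  shows "conv_prob_zero M (\<lambda>n \<omega>. bayes_factor a X blk n \<gamma> T (y n \<omega>))"
  by (rule conv_prob_zero_typical[OF bf_of_growing_block bayes_factor_eq]) (use assms in auto)

text \<open>The limiting variable: for i.i.d. N(0, \<sigma>^2) coordinates \<open>x\<close>, each
  block contributes its limit factor at half a chi-square variable with as many degrees of freedom
  as the block has predictors.\<close>

definition null_limit :: "nat set \<Rightarrow> (nat \<Rightarrow> real) \<Rightarrow> real" where
  "null_limit N x = (\<Prod>i\<in>blk ` N. psi_real a (card (bs N i)) ((\<Sum>j\<in>bs N i. (x j)\<^sup>2) / (2 * \<sigma>\<^sup>2)))"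

lemma null_limit_measurable [measurable]: "null_limit N \<in> borel_measurable (PiM N (\<lambda>_. borel))"
proof -
  have [measurable]: "(\<lambda>x. \<Sum>j\<in>bs N i. (x j)\<^sup>2) \<in> borel_measurable (PiM N (\<lambda>_. borel :: real measure))" for i
  proof (rule borel_measurable_sum)
    fix j assume "j \<in> bs N i"
    then have "(\<lambda>x. x j) \<in> borel_measurable (PiM N (\<lambda>_. borel :: real measure))"
      by (intro measurable_component_singleton) (simp add: block_set_def)
    then show "(\<lambda>x. (x j)\<^sup>2) \<in> borel_measurable (PiM N (\<lambda>_. borel :: real measure))" by (rule borel_measurable_power)
  qed
  note [measurable] = psi_real_measurable[OF a]
  show ?thesis unfolding null_limit_def[abs_def] by measurable
qed

text \<open>Two boxes of positive probability carry separated values: small coordinates give at most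
  \<open>g (1 / 4)\<close>, large ones at least \<open>g 1\<close>. A point mass would have to lie
  on both sides of the gap.\<close>

lemma null_limit_nondegenerate:
  assumes N: "finite N" "N \<noteq> {}"
  shows "distr (PiM N (\<lambda>_. centered_normal \<sigma>)) borel (null_limit N) \<noteq> return borel c"
proof
  interpret centered_normal: prob_space "centered_normal \<sigma>" by (rule prob_space_centered_normal[OF \<sigma>])
  interpret centered_normal: product_sigma_finite "\<lambda>_. centered_normal \<sigma>" by standard
  let ?P = "PiM N (\<lambda>_. centered_normal \<sigma>)"
  have sets: "sets ?P = sets (PiM N (\<lambda>_. borel))" by (intro sets_PiM_cong) auto
  have m [measurable]: "null_limit N \<in> borel_measurable ?P"
    using null_limit_measurable[of N] measurable_cong_sets[OF sets refl] by blast
  assume eq: "distr ?P borel (null_limit N) = return borel c"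
  \<comment> \<open>The value when all squared coordinates equal \<open>t\<close>; 1/4 and 1 are the
    squares of the ends 1/2 and 1 of the two boxes that face each other.\<close>
  define g where "g t = (\<Prod>i\<in>blk ` N. psi_real a (card (bs N i)) (real (card (bs N i)) * t / (2 * \<sigma>\<^sup>2)))" for t
  have card: "0 < card (bs N i)" if "i \<in> blk ` N" for i
    using that N by (auto simp: card_gt_0_iff block_set_def)
  have g: "g (1 / 4) < g 1"
    unfolding g_def
  proof -
    let ?l = "\<lambda>i. psi_real a (card (bs N i)) (real (card (bs N i)) * (1 / 4) / (2 * \<sigma>\<^sup>2))"
    let ?r = "\<lambda>i. psi_real a (card (bs N i)) (real (card (bs N i)) * 1 / (2 * \<sigma>\<^sup>2))"
    have lt: "?l i < ?r i" if "i \<in> blk ` N" for i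
    proof -
      from card[OF that] have "real (card (bs N i)) * (1 / 4) < real (card (bs N i)) * 1" by simp
      then have "real (card (bs N i)) * (1 / 4) / (2 * \<sigma>\<^sup>2) < real (card (bs N i)) * 1 / (2 * \<sigma>\<^sup>2)"
        using \<sigma> by (intro divide_strict_right_mono) auto
      then show ?thesis by (rule psi_real_strict_mono[OF a])
    qed
    have nn: "0 \<le> ?l i" for i by (rule psi_real_nonneg)
    obtain i where i: "i \<in> blk ` N" using N(2) by blast
    show "prod ?l (blk ` N) < prod ?r (blk ` N)"
    proof (rule prod_mono_strict[where f="?l" and g="?r" and i=i])
      show "0 \<le> ?l i \<and> ?l i \<le> ?r i" "0 < ?r i" if "i \<in> blk ` N" for i
        using nn[of i] lt[OF that] by linarith+
    qed (use i lt[OF i] N(1) in auto)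
  qed
  have mono: "psi_real a d s \<le> psi_real a d t" if "s \<le> t" for d s t
    using psi_real_strict_mono[OF a, of s t d] that by (cases "s = t") auto
  have lo: "null_limit N x \<le> g (1 / 4)" if "x \<in> Pi\<^sub>E N (\<lambda>_. {0..1/2})" for x
    unfolding null_limit_def g_def
  proof (intro prod_mono conjI psi_real_nonneg mono divide_right_mono)
    fix i
    have "(x j)\<^sup>2 \<le> 1 / 4" if "j \<in> bs N i" for j
    proof -
      have "0 \<le> x j" "x j \<le> 1 / 2" using that \<open>x \<in> Pi\<^sub>E N (\<lambda>_. {0..1/2})\<close> by (auto simp: block_set_def PiE_iff)
      then have "(x j)\<^sup>2 \<le> (1 / 2)\<^sup>2" by (intro power_mono) auto
      then show ?thesis by (simp add: power2_eq_square)
    qed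
    then show "(\<Sum>j\<in>bs N i. (x j)\<^sup>2) \<le> real (card (bs N i)) * (1 / 4)"
      using sum_bounded_above[of "bs N i" "\<lambda>j. (x j)\<^sup>2" "1 / 4"] by simp
  qed simp
  have hi: "g 1 \<le> null_limit N x" if "x \<in> Pi\<^sub>E N (\<lambda>_. {1..2})" for x
    unfolding null_limit_def g_def
  proof (intro prod_mono conjI psi_real_nonneg mono divide_right_mono)
    fix i
    have "1 \<le> (x j)\<^sup>2" if "j \<in> bs N i" for j
    proof -
      have "1 \<le> x j" using that \<open>x \<in> Pi\<^sub>E N (\<lambda>_. {1..2})\<close> by (auto simp: block_set_def PiE_iff)
      then show ?thesis by simp
    qed
    then show "real (card (bs N i)) * 1 \<le> (\<Sum>j\<in>bs N i. (x j)\<^sup>2)"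
      using sum_bounded_below[of "bs N i" 1 "\<lambda>j. (x j)\<^sup>2"] by simp
  qed simp
  have pos: "0 < emeasure ?P (Pi\<^sub>E N (\<lambda>_. {s..t}))" if "s < t" for s t
  proof -
    have "emeasure ?P (Pi\<^sub>E N (\<lambda>_. {s..t})) = (\<Prod>i\<in>N. emeasure (centered_normal \<sigma>) {s..t})"
      by (intro centered_normal.emeasure_PiM N) auto
    also have "\<dots> \<noteq> 0" using centered_normal_interval_pos[OF \<sigma> that] N by auto
    finally show ?thesis by (simp add: zero_less_iff_neq_zero)
  qed
  have c: "c \<in> A" if A: "A \<in> sets borel" and st: "s < t" and sub: "\<And>x. x \<in> Pi\<^sub>E N (\<lambda>_. {s..t}) \<Longrightarrow> null_limit N x \<in> A" for A s t
  proof -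
    have "0 < emeasure ?P (Pi\<^sub>E N (\<lambda>_. {s..t}))" by (rule pos[OF st])
    also have "\<dots> \<le> emeasure ?P (null_limit N -` A \<inter> space ?P)"
      using sub A by (intro emeasure_mono measurable_sets[OF m]) (auto simp: space_PiM PiE_iff)
    also have "\<dots> = emeasure (distr ?P borel (null_limit N)) A" by (rule emeasure_distr[symmetric, OF m A])
    also have "\<dots> = indicator A c" unfolding eq using A by simp
    finally show ?thesis by (cases "c \<in> A") simp_all
  qed
  have "c \<in> {..g (1 / 4)}" by (rule c[of _ 0 "1/2"]) (use lo in auto)
  moreover have "c \<in> {g 1..}" by (rule c[of _ 1 2]) (use hi in auto)
  ultimately show False using g by simp
qed

lemma bayes_factor_null_blocks:
  assumes \<gamma>: "\<gamma> \<subseteq> {..<p}" "T \<subset> \<gamma>" and null: "\<And>j. j \<in> \<gamma> - T \<Longrightarrow> blk j \<notin> blk ` T"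
  shows "\<exists>\<mu>. real_distribution \<mu> \<and> (\<forall>c. \<mu> \<noteq> return borel c) \<and>
    weak_conv_m (\<lambda>n. distr M borel (\<lambda>\<omega>. bayes_factor a X blk n \<gamma> T (y n \<omega>))) \<mu>"
proof -
  define N where "N = \<gamma> - T"
  have N: "finite N" "N \<noteq> {}" "N \<subseteq> {..<p}" using \<gamma> fin[OF \<gamma>(1)] by (auto simp: N_def)
  let ?P = "PiM N (\<lambda>_. centered_normal \<sigma>)"
  interpret P: prob_space ?P by (intro prob_space_PiM prob_space_centered_normal \<sigma>)
  have sets: "sets ?P = sets (PiM N (\<lambda>_. borel))" by (intro sets_PiM_cong) auto
  have m [measurable]: "null_limit N \<in> borel_measurable ?P"
    using null_limit_measurable[of N] measurable_cong_sets[OF sets refl] by blast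
  define \<mu> where "\<mu> = distr ?P borel (null_limit N)"
  define W where "W n w = (\<Prod>i\<in>blk ` N. psi_real a (card (bs N i)) (inv_quad (bs N i) (gram X n) w / (2 * \<sigma>\<^sup>2)))" for n w
  have \<mu>: "real_distribution \<mu>" unfolding \<mu>_def by (rule P.real_distribution_distr[OF m])
  \<comment> \<open>The orthonormal vectors change with n, but the law of the coordinates does not,
    so the comparison variable has exactly the law \<mu> at every regular n.\<close>
  have law: "\<forall>\<^sub>F n in sequentially. (\<lambda>\<omega>. W n (noise_xty n \<omega>)) \<in> borel_measurable M \<and> distr M borel (\<lambda>\<omega>. W n (noise_xty n \<omega>)) = \<mu>"
    using eventually_regular[OF N(3)]
  proof eventually_elim
    case (elim n)
    have "\<exists>e. (\<forall>i\<in>N. \<forall>j\<in>N. inner_upto n (e i) (e j) = (if i = j then 1 else 0)) \<and>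
      (\<forall>y. \<forall>i\<in>blk ` N. inv_quad (bs N i) (gram X n) (xty X n y) = (\<Sum>j\<in>bs N i. (inner_upto n (e j) y)\<^sup>2))"
      using elim N(3) by (intro block_orthonormal N(1) orth) (auto simp: regular_def)
    then obtain e where e1: "\<And>i j. i \<in> N \<Longrightarrow> j \<in> N \<Longrightarrow> inner_upto n (e i) (e j) = (if i = j then 1 else 0)"
      and e2: "\<And>y i. i \<in> blk ` N \<Longrightarrow> inv_quad (bs N i) (gram X n) (xty X n y) = (\<Sum>j\<in>bs N i. (inner_upto n (e j) y)\<^sup>2)" by blast
    let ?\<eta> = "\<lambda>\<omega>. \<lambda>j\<in>N. inner_upto n (e j) (\<epsilon> n \<omega>)"
    have \<eta>: "?\<eta> \<in> measurable M (PiM N (\<lambda>_. borel))" "distr M (PiM N (\<lambda>_. borel)) ?\<eta> = ?P"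
      by (intro noise_coordinates_law N(1) e1; assumption)+
    have W: "W n (noise_xty n \<omega>) = null_limit N (?\<eta> \<omega>)" for \<omega>
      unfolding W_def null_limit_def noise_xty_def
    proof (intro prod.cong refl arg_cong2[where f="\<lambda>d x. psi_real a d (x / (2 * \<sigma>\<^sup>2))"])
      fix i assume i: "i \<in> blk ` N"
      show "inv_quad (bs N i) (gram X n) (xty X n (\<epsilon> n \<omega>)) = (\<Sum>j\<in>bs N i. (?\<eta> \<omega> j)\<^sup>2)"
        unfolding e2[OF i] by (intro sum.cong refl) (auto simp: block_set_def)
    qed
    have "(\<lambda>\<omega>. null_limit N (?\<eta> \<omega>)) \<in> borel_measurable M"
      by (rule measurable_compose[OF \<eta>(1) null_limit_measurable])
    moreover have "distr M borel (\<lambda>\<omega>. null_limit N (?\<eta> \<omega>)) = \<mu>"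
      using distr_distr[OF null_limit_measurable \<eta>(1)] unfolding \<eta>(2) \<mu>_def by (simp add: comp_def)
    ultimately show ?case unfolding W by blast
  qed
  have conv: "conv_prob_zero M (\<lambda>n \<omega>. bayes_factor a X blk n \<gamma> T (y n \<omega>) - W n (noise_xty n \<omega>))"
  proof (rule conv_prob_zero_typical[where \<Phi>="\<lambda>n w V s. bf_of n \<gamma> w V s - W n w"])
    fix K :: real and w :: "nat \<Rightarrow> nat \<Rightarrow> real" and V s :: "nat \<Rightarrow> real"
    assume w: "\<And>n j. j < p \<Longrightarrow> \<bar>w n j\<bar> \<le> K * sqrt (real n)" and V: "V \<longlonglongrightarrow> \<sigma>\<^sup>2" and s: "s \<longlonglongrightarrow> 0"
    have "T \<subseteq> \<gamma>" using \<gamma>(2) by blast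
    from bf_of_null_blocks[where w=w and V=V and e=s and K=K, OF w V s \<gamma>(1) this null]
    show "(\<lambda>n. bf_of n \<gamma> (w n) (V n) (s n) - W n (w n)) \<longlonglongrightarrow> 0" unfolding W_def N_def .
  next
    fix K :: real assume "0 < K"
    from bayes_factor_eq[OF \<gamma>(1) this]
    show "\<forall>\<^sub>F n in sequentially. \<forall>\<omega>\<in>space M. (noise_xty n \<omega>, noise_ms n \<omega>, noise_mean n \<omega>) \<in> typical K n \<longrightarrow>
      bayes_factor a X blk n \<gamma> T (y n \<omega>) - W n (noise_xty n \<omega>) = bf_of n \<gamma> (noise_xty n \<omega>) (noise_ms n \<omega>) (noise_mean n \<omega>) - W n (noise_xty n \<omega>)"
      by eventually_elim auto
  qed
  have "weak_conv_m (\<lambda>n. distr M borel (\<lambda>\<omega>. bayes_factor a X blk n \<gamma> T (y n \<omega>))) \<mu>"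
    by (rule weak_conv_m_slutsky[OF prob_space_axioms \<mu> bayes_factor_measurable[OF \<gamma>(1)] law conv])
  moreover have "\<mu> \<noteq> return borel c" for c unfolding \<mu>_def by (rule null_limit_nondegenerate[OF N(1,2)])
  ultimately show ?thesis using \<mu> by blast
qed

end

text \<open>Any candidate for the projection differs from \<open>v\<close> by a vector that lies in
  the column space and is orthogonal to it, hence has length 0.\<close>

lemma proj_col_fixed:
  assumes "finite \<gamma>" and v: "\<And>r. r < n \<Longrightarrow> v r = (\<Sum>j\<in>\<gamma>. X n r j * b j)" "\<And>r. n \<le> r \<Longrightarrow> v r = 0"
  shows "proj_col X n \<gamma> v = v"
  unfolding proj_col_def
proof (rule the_equality)
  show "(\<exists>b. \<forall>r<n. v r = (\<Sum>j\<in>\<gamma>. X n r j * b j)) \<and> (\<forall>r. n \<le> r \<longrightarrow> v r = 0) \<and> (\<forall>j\<in>\<gamma>. (\<Sum>r<n. (v r - v r) * X n r j) = 0)"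
    using v by auto
  fix u assume u: "(\<exists>b. \<forall>r<n. u r = (\<Sum>j\<in>\<gamma>. X n r j * b j)) \<and> (\<forall>r. n \<le> r \<longrightarrow> u r = 0) \<and> (\<forall>j\<in>\<gamma>. (\<Sum>r<n. (v r - u r) * X n r j) = 0)"
  then obtain b' where b': "\<And>r. r < n \<Longrightarrow> u r = (\<Sum>j\<in>\<gamma>. X n r j * b' j)" by blast
  have "(\<Sum>r<n. (v r - u r)\<^sup>2) = (\<Sum>r<n. \<Sum>j\<in>\<gamma>. (v r - u r) * X n r j * (b j - b' j))"
  proof (intro sum.cong refl)
    fix r assume "r \<in> {..<n}"
    then have "v r - u r = (\<Sum>j\<in>\<gamma>. X n r j * (b j - b' j))"
      using v(1) b' by (simp add: right_diff_distrib sum_subtractf)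
    then have "(v r - u r)\<^sup>2 = (v r - u r) * (\<Sum>j\<in>\<gamma>. X n r j * (b j - b' j))" by (simp add: power2_eq_square)
    then show "(v r - u r)\<^sup>2 = (\<Sum>j\<in>\<gamma>. (v r - u r) * X n r j * (b j - b' j))" by (simp add: sum_distrib_left mult.assoc)
  qed
  also have "\<dots> = (\<Sum>j\<in>\<gamma>. (\<Sum>r<n. (v r - u r) * X n r j) * (b j - b' j))"
    by (subst sum.swap) (simp add: sum_distrib_right)
  also have "\<dots> = 0" using u by simp
  finally have "\<forall>r\<in>{..<n}. (v r - u r)\<^sup>2 = 0" by (subst (asm) sum_nonneg_eq_0_iff) auto
  then have "u r = v r" for r using u v(2)[of r] by (cases "r < n") auto
  then show "u = v" by blast
qed

text \<open>With a zero coefficient at \<open>j\<close> the signal already lies in the span of the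
  other columns; its residual would vanish for every n, against the positive limit.\<close>

lemma coefficients_nonzero:
  assumes T: "finite T" and j: "j \<in> T" and L: "(\<lambda>n. resid_quad X n (T - {j}) T \<beta> / real n) \<longlonglongrightarrow> L" "L > 0"
  shows "\<beta> j \<noteq> 0"
proof
  assume "\<beta> j = 0"
  have "resid_quad X n (T - {j}) T \<beta> = 0" for n
  proof -
    let ?v = "\<lambda>r. if r < n then (\<Sum>j\<in>T. X n r j * \<beta> j) else 0"
    have "proj_col X n (T - {j}) ?v = ?v"
      using T j \<open>\<beta> j = 0\<close> by (intro proj_col_fixed[where b=\<beta>]) (auto simp: sum.remove[OF T j])
    then show ?thesis by (simp add: resid_quad_def)
  qed
  then show False using L by (simp add: LIMSEQ_const_iff)
qed

theorem theorem5p2: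
  fixes M :: "'w measure" and X :: "nat \<Rightarrow> nat \<Rightarrow> nat \<Rightarrow> real" and blk :: "nat \<Rightarrow> nat"
    and p k :: nat and D :: "nat \<Rightarrow> nat \<Rightarrow> real" and a \<sigma> \<alpha>T :: real
    and T :: "nat set" and \<beta>T :: "nat \<Rightarrow> real" and \<epsilon> :: "nat \<Rightarrow> 'w \<Rightarrow> nat \<Rightarrow> real"
  assumes blocks: "\<forall>j<p. blk j < k"
    and centered: "\<forall>n. \<forall>j<p. (\<Sum>r<n. X n r j) = 0"
    and block_orth: "\<forall>n. \<forall>j<p. \<forall>j'<p. blk j \<noteq> blk j' \<longrightarrow> (\<Sum>r<n. X n r j * X n r j') = 0"
    and limD: "\<forall>i<p. \<forall>j<p. (\<lambda>n. (\<Sum>r<n. X n r i * X n r j) / real n) \<longlonglongrightarrow> D i j"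
    and D_posdef: "\<forall>v. (\<exists>i<p. v i \<noteq> 0) \<longrightarrow> 0 < (\<Sum>i<p. \<Sum>j<p. v i * D i j * v j)"
    and a_gt: "2 < a" and a_le: "a \<le> 4"
    and T_sub: "T \<subseteq> {..<p}"
    and \<sigma>_pos: "0 < \<sigma>"
    and P: "prob_space M"
    and noise_indep: "\<forall>n. prob_space.indep_vars M (\<lambda>_. borel) (\<lambda>r \<omega>. \<epsilon> n \<omega> r) {..<n}"
    and noise_normal: "\<forall>n. \<forall>r<n. distributed M lborel (\<lambda>\<omega>. \<epsilon> n \<omega> r) (normal_density 0 \<sigma>)"
    and identif: "\<forall>\<gamma>. \<gamma> \<subseteq> {..<p} \<and> \<not> T \<subseteq> \<gamma> \<longrightarrow>
                    (\<exists>L>0. (\<lambda>n. resid_quad X n \<gamma> T \<beta>T / real n) \<longlonglongrightarrow> L)"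
  shows "(\<forall>\<gamma>. \<gamma> \<subseteq> {..<p} \<and> T \<subset> \<gamma>
               \<and> (\<forall>j\<in>\<gamma> - T. blk j \<notin> {blk i | i. i \<in> T \<and> \<beta>T i \<noteq> 0}) \<longrightarrow>
             (\<exists>\<mu>. real_distribution \<mu> \<and> (\<forall>c. \<mu> \<noteq> return borel c) \<and>
                  weak_conv_m (\<lambda>n. distr M borel
                     (\<lambda>\<omega>. bayes_factor a X blk n \<gamma> T (response X T \<alpha>T \<beta>T \<epsilon> n \<omega>))) \<mu>))
       \<and> (\<forall>\<gamma>. \<gamma> \<subseteq> {..<p} \<and> \<gamma> \<noteq> T
               \<and> \<not> (T \<subset> \<gamma> \<and> (\<forall>j\<in>\<gamma> - T. blk j \<notin> {blk i | i. i \<in> T \<and> \<beta>T i \<noteq> 0})) \<longrightarrow>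
             conv_prob_zero M (\<lambda>n \<omega>. bayes_factor a X blk n \<gamma> T (response X T \<alpha>T \<beta>T \<epsilon> n \<omega>)))"
proof -
  interpret prob_space M by (rule P)
  \<comment> \<open>Identifiability is applied to the true model with one predictor removed.\<close>
  have nz: "\<beta>T j \<noteq> 0" if j: "j \<in> T" for j
  proof -
    have "T - {j} \<subseteq> {..<p} \<and> \<not> T \<subseteq> T - {j}" using T_sub j by blast
    then obtain L where "L > 0" "(\<lambda>n. resid_quad X n (T - {j}) T \<beta>T / real n) \<longlonglongrightarrow> L" using identif by blast
    then show ?thesis using finite_subset[OF T_sub] j by (intro coefficients_nonzero[of T j X \<beta>T L]) auto
  qed
  interpret noisy_regression X blk p D a \<sigma> T \<beta>T M \<epsilon> \<alpha>T
  proof unfold_locales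
    show "(\<Sum>r<n. X n r j) = 0" if "j < p" for n j using centered that by blast
    show "gram X n j j' = 0" if "j < p" "j' < p" "blk j \<noteq> blk j'" for n j j'
      using block_orth that unfolding gram_def by blast
    show "(\<lambda>n. gram X n i j / real n) \<longlonglongrightarrow> D i j" if "i < p" "j < p" for i j
      using limD that unfolding gram_def by blast
    show "0 < (\<Sum>i<p. \<Sum>j<p. v i * D i j * v j)" if "\<exists>i<p. v i \<noteq> 0" for v using D_posdef that by blast
  qed (use a_gt T_sub \<sigma>_pos nz noise_indep noise_normal in auto)
  have B: "{blk i | i. i \<in> T \<and> \<beta>T i \<noteq> 0} = blk ` T" using nz by auto
  show ?thesis unfolding B
  proof (intro conjI allI impI)
    fix \<gamma> assume "\<gamma> \<subseteq> {..<p} \<and> T \<subset> \<gamma> \<and> (\<forall>j\<in>\<gamma> - T. blk j \<notin> blk ` T)"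
    then show "\<exists>\<mu>. real_distribution \<mu> \<and> (\<forall>c. \<mu> \<noteq> return borel c) \<and>
       weak_conv_m (\<lambda>n. distr M borel (\<lambda>\<omega>. bayes_factor a X blk n \<gamma> T (response X T \<alpha>T \<beta>T \<epsilon> n \<omega>))) \<mu>"
      by (intro bayes_factor_null_blocks) auto
  next
    fix \<gamma> assume \<gamma>: "\<gamma> \<subseteq> {..<p} \<and> \<gamma> \<noteq> T \<and> \<not> (T \<subset> \<gamma> \<and> (\<forall>j\<in>\<gamma> - T. blk j \<notin> blk ` T))"
    show "conv_prob_zero M (\<lambda>n \<omega>. bayes_factor a X blk n \<gamma> T (response X T \<alpha>T \<beta>T \<epsilon> n \<omega>))"
    proof (cases "T \<subseteq> \<gamma>")
      case True
      then obtain j0 where "j0 \<in> \<gamma> - T" "blk j0 \<in> blk ` T" using \<gamma> by blast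
      then show ?thesis using \<gamma> True by (intro bayes_factor_growing_block) auto
    next
      case False
      then show ?thesis using \<gamma> by (intro bayes_factor_missing) auto
    qed
  qed
qed

end
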